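(* Let $T$ and $\check{T}$ be Langlands dual split tori of rank $r$ over $\mathbf{Z}$, let $X=\operatorname{Spec}\mathbf{Z}[\check{\sigma}\cap X^*(T)]$ and $\check{X}=\operatorname{Spec}\mathbf{Z}[\sigma\cap X^*(\check{T})]$ be toric dual varieties (for a full-dimensional rational strongly convex polyhedral cone $\sigma\subset X_*(T)_{\mathbf{R}}$ with dual cone $\check{\sigma}$), and equip them with dual gradings $(\check{\rho}_1,\check{\rho}_2)$ of $\mathbf{G}_{\mathrm{gr}}$-weight $\varepsilon=\langle\check{\rho}_1,\check{\rho}_2\rangle$. Then $(T,X)$ and $(\check{T},\check{X})$ are weakly numerically dual with discrepancy $r-\varepsilon$; that is, for every finite field $\mathbf{F}_q$ and every curve $\Sigma$ over $\mathbf{F}_q$ with discriminant $\Delta$: (i) for every everywhere unramified unitary character $\chi$ of $[T]$ with $L$-parameter $\varphi_\chi:\Gamma_F\to\check{T}(\mathsf{k})$ whose fixed locus on $\check{X}$ is discrete, $\mathring{P}_X(\chi)=\Delta^{(r-\varepsilon)/4}L_{\check{X}}(\varphi_\chi)$; (ii) for every everywhere unramified unitary character $\mu$ of $[\check{T}]$ with $L$-parameter $\varphi_\mu:\Gamma_F\to T(\mathsf{k})$ whose fixed locus on $X$ is discrete, $\mathring{P}_{\check{X}}(\mu)=\Delta^{(r-\varepsilon)/4}L_X(\varphi_\mu)$.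
   Context: Tori and toric duality. $T,\check{T}$ are split tori over $\mathbf{Z}$ with $X^*(T)=X_*(\check{T})$ and $X_*(T)=X^*(\check{T})$. For a full-dimensional rational strongly convex polyhedral cone $\sigma\subset X_*(T)_{\mathbf{R}}$ let $\check{\sigma}=\{m\in X^*(T)_{\mathbf{R}}:\langle\sigma,m\rangle\ge 0\}$. The $T$-toric variety $X=\operatorname{Spec}\mathbf{Z}[\check{\sigma}\cap X^*(T)]$ and the $\check{T}$-toric variety $\check{X}=\operatorname{Spec}\mathbf{Z}[\sigma\cap X^*(\check{T})]$ (with $\sigma$ viewed in $X^*(\check{T})_{\mathbf{R}}$) are called toric dual. Each has a dense orbit identified with its torus ($\mathring{X}=T$, $\mathring{\check X}=\check T$) and a unique torus-fixed point. Conical: an affine variety $Z$ over a field $k$ with $\mathbf{G}_m$-action is conical if $k[Z]$ has only nonnegative weights and its weight-$0$ part is $k$. Dual gradings: cocharacters $\check{\rho}_1:\mathbf{G}_{\mathrm{gr}}\to T$ and $\check{\rho}_2:\mathbf{G}_{\mathrm{gr}}\to\check{T}$ ($\mathbf{G}_{\mathrm{gr}}=\mathbf{G}_m$) such that $\check\rho_1$ makes $X$ conical and $\check\rho_2$ makes $\check X$ conical. Then $X$ is a $T\times\mathbf{G}_{\mathrm{gr}}$-variety with $\mathbf{G}_{\mathrm{gr}}$ acting through $\check{\rho}_1$, and carries the $T$-eigenvolume form (monomial times invariant form on the dense torus) with eigencharacter $\eta_X:=\check{\rho}_2\in X_*(\check T)=X^*(T)$; symmetrically $\check X$ has $\mathbf{G}_{\mathrm{gr}}$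 acting through $\check\rho_2$ and eigencharacter $\eta_{\check X}:=\check\rho_1\in X^*(\check T)$. $\varepsilon=\langle\check\rho_1,\check\rho_2\rangle$. Global setup. $\mathbf{F}_q$ finite field, $\Sigma$ a smooth projective geometrically connected curve of genus $g$ over $\mathbf{F}_q$ with function field $F$, $\Delta=q^{2g-2}$; $\mathbb{A}$ adeles, $\mathcal{O}=\prod_v\mathcal{O}_v$; $\varpi_v$ uniformizer, $q_v$ residue field size, $|\cdot|$ normalized absolute values. Fix a rational section of an $\mathbf{F}_q$-rational spin structure $K^{1/2}$ of $\Sigma$, with square a rational 1-form of order $2m_v$ at $v$; put $\partial^{1/2}=(\varpi_v^{m_v})_v\in\mathbb{A}^\times$ (so $|\partial|=\Delta^{-1}$). For a split torus $H$, $[H]=H(F)\backslash H(\mathbb{A})/H(\mathcal{O})$, with Haar measure on $H(\mathbb{A})$ giving $H(\mathcal{O})$ volume 1. $\mathsf{k}\cong\mathbf{C}$ algebraically closed of characteristic 0; $\Gamma_F$ the unramified Weil group; class field theory normalized so uniformizers correspond to geometric Frobenius $\mathrm{Fr}_v$. An unramified unitary character $\chi$ of $[T]$ has $L$-parameter $\varphi_\chi:\Gamma_F\to\check T(\mathsf k)$ with $\lambda(\varphi_\chi(\mathrm{Fr}_v))=\chi(\lambda(\varpi_v))$ for $\lambda\in X_*(T)=X^*(\check T)$ (and symmetrically for $\check T$). Regularized automorphic period: with $\Phi=\otimes_v\mathbf{1}_{X(\mathcal{O}_v)}$ and $\eta=\eta_X$, $\mathring{P}_X(\chi)=\int_{[T]}\chi(t)\sum_{x\in\mathring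 X(F)}|\eta(t\,\check\rho_1(\partial^{1/2}))|^{1/2}\,\Phi(x\cdot t\,\check\rho_1(\partial^{1/2}))\,dt$; $\mathring P_{\check X}$ is defined symmetrically (with $\check\rho_2$, $\eta_{\check X}$, $\check T$). Spectral period: for $\varphi:\Gamma_F\to\check T(\mathsf k)$, $\Gamma_F$ acts on $\check X(\mathsf k)$ through $\varphi$; when the fixed locus is discrete it is the single $\check T$-fixed point $x_0$, and $L_{\check X}(\varphi)=\mathfrak z\,\Delta^{(\varepsilon-\dim\check X)/4}\prod_v\mathrm{gtr}(\varphi(\mathrm{Fr}_v)\times q_v^{-1/2}\mid\widehat{\mathcal O}_{\check X,x_0})$, where for a graded ring $R=\bigoplus_n R_n$ (grading from the $\mathbf{G}_{\mathrm{gr}}$-action) $\mathrm{gtr}(g\times t\mid R)=\sum_n\mathrm{tr}(g\mid R_n)t^n$, and $\mathfrak z=\chi(\eta_{\check X}(\partial^{-1/2}))$ with $\chi$ the character of $[T]$ with parameter $\varphi$ and $\eta_{\check X}$ viewed as a cocharacter of $T$. $L_X$ is defined symmetrically. *)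

theory Defs
  imports
    "HOL-Algebra.Algebra"
    "HOL-Algebra.Algebraic_Closure_Type"
    "HOL-Library.Poly_Mapping"
    "HOL-Library.Function_Algebras"
    "HOL-Complex_Analysis.Complex_Analysis"
begin

section \<open>Cones and their lattice points\<close>

text \<open>
  A split torus of rank \<open>r\<close> is taken to be \<open>G\<^sub>m^r\<close>.  Then \<open>X\<^sub>*(T) = X\<^sup>*(T\<^sup>\<or>)\<close> and
  \<open>X\<^sup>*(T) = X\<^sub>*(T\<^sup>\<or>)\<close> are both \<open>\<int>^r\<close>, paired by the dot product.  Vectors of length \<open>r\<close> are
  functions on \<open>nat\<close> vanishing from \<open>r\<close> on, so that \<open>r = 0\<close> is included.
\<close>

definition lattice_vecs :: "nat \<Rightarrow> (nat \<Rightarrow> int) set" where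
  "lattice_vecs r = {m. \<forall>i\<ge>r. m i = 0}"

definition real_vecs :: "nat \<Rightarrow> (nat \<Rightarrow> real) set" where
  "real_vecs r = {x. \<forall>i\<ge>r. x i = 0}"

definition lattice_pairing :: "nat \<Rightarrow> (nat \<Rightarrow> int) \<Rightarrow> (nat \<Rightarrow> int) \<Rightarrow> int" where
  "lattice_pairing r l m = (\<Sum>i<r. l i * m i)"

definition rational_polyhedral_cone :: "nat \<Rightarrow> (nat \<Rightarrow> real) set \<Rightarrow> bool" where
  "rational_polyhedral_cone r \<sigma> \<longleftrightarrow>
     (\<exists>S. finite S \<and> S \<subseteq> lattice_vecs r \<and>
        \<sigma> = {x. \<exists>c. (\<forall>u\<in>S. 0 \<le> c u) \<and> x = (\<lambda>i. \<Sum>u\<in>S. c u * real_of_int (u i))})"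

definition strongly_convex :: "(nat \<Rightarrow> real) set \<Rightarrow> bool" where
  "strongly_convex \<sigma> \<longleftrightarrow> (\<forall>x. x \<in> \<sigma> \<and> - x \<in> \<sigma> \<longrightarrow> x = 0)"

text \<open>The linear span of a convex cone is the set of differences of its elements.\<close>

definition full_dimensional :: "nat \<Rightarrow> (nat \<Rightarrow> real) set \<Rightarrow> bool" where
  "full_dimensional r \<sigma> \<longleftrightarrow> (\<forall>x\<in>real_vecs r. \<exists>a\<in>\<sigma>. \<exists>b\<in>\<sigma>. x = a - b)"

definition dual_cone :: "nat \<Rightarrow> (nat \<Rightarrow> real) set \<Rightarrow> (nat \<Rightarrow> real) set" where
  "dual_cone r \<sigma> = {y \<in> real_vecs r. \<forall>x\<in>\<sigma>. 0 \<le> (\<Sum>i<r. x i * y i)}"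

definition lattice_points :: "nat \<Rightarrow> (nat \<Rightarrow> real) set \<Rightarrow> (nat \<Rightarrow> int) set" where
  "lattice_points r \<sigma> = {m \<in> lattice_vecs r. (\<lambda>i. real_of_int (m i)) \<in> \<sigma>}"


section \<open>Split tori and affine toric varieties\<close>

abbreviation complex_ring :: "complex ring" where
  "complex_ring \<equiv> ring_of_type_algebra"

definition torus :: "nat \<Rightarrow> 'a ring \<Rightarrow> (nat \<Rightarrow> 'a) monoid" where
  "torus r R = product_group {..<r} (\<lambda>_. units_of R)"

definition torus_char :: "nat \<Rightarrow> 'a ring \<Rightarrow> (nat \<Rightarrow> int) \<Rightarrow> (nat \<Rightarrow> 'a) \<Rightarrow> 'a" where
  "torus_char r R m t =
     finprod (units_of R) (\<lambda>i. t i [^]\<^bsub>units_of R\<^esub> m i) {..<r}"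

definition torus_cochar :: "nat \<Rightarrow> 'a ring \<Rightarrow> (nat \<Rightarrow> int) \<Rightarrow> 'a \<Rightarrow> (nat \<Rightarrow> 'a)" where
  "torus_cochar r R l u = (\<lambda>i\<in>{..<r}. u [^]\<^bsub>units_of R\<^esub> l i)"

definition torus_map :: "nat \<Rightarrow> ('a \<Rightarrow> 'b) \<Rightarrow> (nat \<Rightarrow> 'a) \<Rightarrow> (nat \<Rightarrow> 'b)" where
  "torus_map r f t = (\<lambda>i\<in>{..<r}. f (t i))"

text \<open>The monoid algebra of a submonoid \<open>M\<close> of \<open>\<int>^r\<close>; the product of finitely supported
  functions is convolution, and the monomial \<open>e^m\<close> is \<open>Poly_Mapping.single m 1\<close>.\<close>

definition monoid_algebra ::
    "(nat \<Rightarrow> int) set \<Rightarrow> ((nat \<Rightarrow> int) \<Rightarrow>\<^sub>0 'a::comm_ring_1) ring" where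
  "monoid_algebra M = ring_of_type_algebra\<lparr>carrier := {p. Poly_Mapping.keys p \<subseteq> M}\<rparr>"

abbreviation int_monoid_algebra ::
    "(nat \<Rightarrow> int) set \<Rightarrow> ((nat \<Rightarrow> int) \<Rightarrow>\<^sub>0 int) ring" where
  "int_monoid_algebra M \<equiv> monoid_algebra M"

abbreviation cpx_monoid_algebra ::
    "(nat \<Rightarrow> int) set \<Rightarrow> ((nat \<Rightarrow> int) \<Rightarrow>\<^sub>0 complex) ring" where
  "cpx_monoid_algebra M \<equiv> monoid_algebra M"

text \<open>\<open>R\<close>-points of \<open>Spec \<int>[M]\<close>, the action \<open>x\<cdot>t\<close> of \<open>T(R)\<close>, given by
  \<open>e^m(x\<cdot>t) = e^m(x) m(t)\<close>, and the base point of the open orbit, where all \<open>e^m\<close> equal 1;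
  the open orbit is identified with \<open>T\<close> by \<open>t \<mapsto> 1\<cdot>t\<close>.\<close>

definition toric_points ::
    "(nat \<Rightarrow> int) set \<Rightarrow> 'a ring \<Rightarrow> (((nat \<Rightarrow> int) \<Rightarrow>\<^sub>0 int) \<Rightarrow> 'a) set" where
  "toric_points M R =
     ring_hom (int_monoid_algebra M) R \<inter> extensional (carrier (int_monoid_algebra M))"

definition toric_base ::
    "(nat \<Rightarrow> int) set \<Rightarrow> 'a ring \<Rightarrow> ((nat \<Rightarrow> int) \<Rightarrow>\<^sub>0 int) \<Rightarrow> 'a" where
  "toric_base M R =
     (\<lambda>p\<in>carrier (int_monoid_algebra M).
        finsum R (\<lambda>m. add_pow R (Poly_Mapping.lookup p m) \<one>\<^bsub>R\<^esub>) (Poly_Mapping.keys p))"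

definition toric_act ::
    "nat \<Rightarrow> (nat \<Rightarrow> int) set \<Rightarrow> 'a ring \<Rightarrow> (((nat \<Rightarrow> int) \<Rightarrow>\<^sub>0 int) \<Rightarrow> 'a) \<Rightarrow> (nat \<Rightarrow> 'a)
       \<Rightarrow> ((nat \<Rightarrow> int) \<Rightarrow>\<^sub>0 int) \<Rightarrow> 'a" where
  "toric_act r M R x t =
     (\<lambda>p\<in>carrier (int_monoid_algebra M).
        finsum R (\<lambda>m. add_pow R (Poly_Mapping.lookup p m)
                        (x (Poly_Mapping.single m 1) \<otimes>\<^bsub>R\<^esub> torus_char r R m t))
          (Poly_Mapping.keys p))"

text \<open>The action on functions, \<open>(t\<cdot>f)(x) = f(x\<cdot>t)\<close>, over the complex numbers.\<close>

definition fun_act ::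
    "nat \<Rightarrow> (nat \<Rightarrow> complex) \<Rightarrow> ((nat \<Rightarrow> int) \<Rightarrow>\<^sub>0 complex) \<Rightarrow> ((nat \<Rightarrow> int) \<Rightarrow>\<^sub>0 complex)" where
  "fun_act r t f =
     (\<Sum>m\<in>Poly_Mapping.keys f.
        Poly_Mapping.single m (torus_char r complex_ring m t * Poly_Mapping.lookup f m))"

definition weight_part ::
    "nat \<Rightarrow> (nat \<Rightarrow> int) set \<Rightarrow> (nat \<Rightarrow> int) \<Rightarrow> int \<Rightarrow> ((nat \<Rightarrow> int) \<Rightarrow>\<^sub>0 complex) set" where
  "weight_part r M \<rho> n =
     {f \<in> carrier (cpx_monoid_algebra M).
        \<forall>z. z \<noteq> 0 \<longrightarrow>
          fun_act r (torus_cochar r complex_ring \<rho> z) f = Poly_Mapping.single 0 (z powi n) * f}"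

text \<open>Weights of monomials do not depend on the ground field, so being conical is tested over the
  complex numbers.\<close>

definition conical :: "nat \<Rightarrow> (nat \<Rightarrow> int) set \<Rightarrow> (nat \<Rightarrow> int) \<Rightarrow> bool" where
  "conical r M \<rho> \<longleftrightarrow>
     (\<forall>n<0. weight_part r M \<rho> n = {0}) \<and> weight_part r M \<rho> 0 = range (Poly_Mapping.single 0)"

definition dual_gradings ::
    "nat \<Rightarrow> (nat \<Rightarrow> real) set \<Rightarrow> (nat \<Rightarrow> int) \<Rightarrow> (nat \<Rightarrow> int) \<Rightarrow> bool" where
  "dual_gradings r \<sigma> \<rho>\<^sub>1 \<rho>\<^sub>2 \<longleftrightarrow>
     \<rho>\<^sub>1 \<in> lattice_vecs r \<and> \<rho>\<^sub>2 \<in> lattice_vecs r \<and>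
     conical r (lattice_points r (dual_cone r \<sigma>)) \<rho>\<^sub>1 \<and> conical r (lattice_points r \<sigma>) \<rho>\<^sub>2"


section \<open>The completed local ring at the fixed point and its graded trace\<close>

definition torus_fixed_point ::
    "nat \<Rightarrow> (nat \<Rightarrow> int) set \<Rightarrow> ((nat \<Rightarrow> int) \<Rightarrow>\<^sub>0 int) \<Rightarrow> complex" where
  "torus_fixed_point r M =
     (THE x. x \<in> toric_points M complex_ring \<and>
             (\<forall>t\<in>carrier (torus r complex_ring). toric_act r M complex_ring x t = x))"

definition maximal_ideal_at ::
    "(nat \<Rightarrow> int) set \<Rightarrow> (((nat \<Rightarrow> int) \<Rightarrow>\<^sub>0 int) \<Rightarrow> complex) \<Rightarrow> ((nat \<Rightarrow> int) \<Rightarrow>\<^sub>0 complex) set" where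
  "maximal_ideal_at M x =
     {f \<in> carrier (cpx_monoid_algebra M).
        (\<Sum>m\<in>Poly_Mapping.keys f. Poly_Mapping.lookup f m * x (Poly_Mapping.single m 1)) = 0}"

primrec ideal_power :: "'a ring \<Rightarrow> 'a set \<Rightarrow> nat \<Rightarrow> 'a set" where
  "ideal_power R I 0 = carrier R"
| "ideal_power R I (Suc n) = ideal_prod R (ideal_power R I n) I"

text \<open>
  The completion \<open>lim k[M]/I^n\<close> for \<open>I\<close> the maximal ideal of a point, i.e. the completed local
  ring at that point, with its structure of \<open>k\<close>-module.  A compatible family of residue classes is
  the same as a decreasing sequence of cosets.
\<close>

definition completed_ring ::
    "(nat \<Rightarrow> int) set \<Rightarrow> ((nat \<Rightarrow> int) \<Rightarrow>\<^sub>0 complex) set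
       \<Rightarrow> (complex, nat \<Rightarrow> ((nat \<Rightarrow> int) \<Rightarrow>\<^sub>0 complex) set) module" where
  "completed_ring M I =
     (let A = cpx_monoid_algebra M; Q = (\<lambda>n. A Quot (ideal_power A I n)) in
      \<lparr>carrier = {a. \<forall>n. a n \<in> carrier (Q n) \<and> a (Suc n) \<subseteq> a n},
       monoid.mult = (\<lambda>a b n. a n \<otimes>\<^bsub>Q n\<^esub> b n),
       one = (\<lambda>n. \<one>\<^bsub>Q n\<^esub>),
       ring.zero = (\<lambda>n. \<zero>\<^bsub>Q n\<^esub>),
       add = (\<lambda>a b n. a n \<oplus>\<^bsub>Q n\<^esub> b n),
       module.smult = (\<lambda>c a n. (a_r_coset A (ideal_power A I n) (Poly_Mapping.single 0 c)) \<otimes>\<^bsub>Q n\<^esub> a n)\<rparr>)"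

abbreviation completed_local_ring ::
    "nat \<Rightarrow> (nat \<Rightarrow> int) set \<Rightarrow> (complex, nat \<Rightarrow> ((nat \<Rightarrow> int) \<Rightarrow>\<^sub>0 complex) set) module" where
  "completed_local_ring r M \<equiv> completed_ring M (maximal_ideal_at M (torus_fixed_point r M))"

definition completed_act ::
    "nat \<Rightarrow> (nat \<Rightarrow> complex) \<Rightarrow> (nat \<Rightarrow> ((nat \<Rightarrow> int) \<Rightarrow>\<^sub>0 complex) set)
       \<Rightarrow> (nat \<Rightarrow> ((nat \<Rightarrow> int) \<Rightarrow>\<^sub>0 complex) set)" where
  "completed_act r t a = (\<lambda>n. fun_act r t ` a n)"

definition graded_piece ::
    "nat \<Rightarrow> (nat \<Rightarrow> int) set \<Rightarrow> (nat \<Rightarrow> int) \<Rightarrow> int \<Rightarrow> (nat \<Rightarrow> ((nat \<Rightarrow> int) \<Rightarrow>\<^sub>0 complex) set) set" where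
  "graded_piece r M \<rho> n =
     {a \<in> carrier (completed_local_ring r M).
        \<forall>z. z \<noteq> 0 \<longrightarrow> completed_act r (torus_cochar r complex_ring \<rho> z) a
                          = (z powi n) \<odot>\<^bsub>completed_local_ring r M\<^esub> a}"

definition has_coords :: "(complex, 'b) module \<Rightarrow> 'b set \<Rightarrow> 'b \<Rightarrow> ('b \<Rightarrow> complex) \<Rightarrow> bool" where
  "has_coords N B x c \<longleftrightarrow> c \<in> extensional B \<and> x = finsum N (\<lambda>b. c b \<odot>\<^bsub>N\<^esub> b) B"

definition is_basis :: "(complex, 'b) module \<Rightarrow> 'b set \<Rightarrow> 'b set \<Rightarrow> bool" where
  "is_basis N V B \<longleftrightarrow> finite B \<and> B \<subseteq> V \<and> (\<forall>x\<in>V. \<exists>!c. has_coords N B x c)"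

text \<open>The trace does not depend on the basis chosen; \<open>V\<close> is a finite-dimensional subspace.\<close>

definition trace_on :: "(complex, 'b) module \<Rightarrow> 'b set \<Rightarrow> ('b \<Rightarrow> 'b) \<Rightarrow> complex" where
  "trace_on N V f =
     (let B = (SOME B. is_basis N V B) in \<Sum>b\<in>B. (THE c. has_coords N B (f b) c) b)"

definition graded_trace ::
    "nat \<Rightarrow> (nat \<Rightarrow> int) set \<Rightarrow> (nat \<Rightarrow> int) \<Rightarrow> (nat \<Rightarrow> complex) \<Rightarrow> complex \<Rightarrow> complex" where
  "graded_trace r M \<rho> g t =
     (\<Sum>\<^sub>\<infinity>n\<in>(UNIV::int set).
        trace_on (completed_local_ring r M) (graded_piece r M \<rho> n) (completed_act r g) * t powi n)"


section \<open>Curves over finite fields\<close>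

text \<open>
  A smooth projective geometrically connected curve over a finite field \<open>k\<close> is given by its
  function field: a finitely generated extension of \<open>k\<close> of transcendence degree 1 in which \<open>k\<close> is
  algebraically closed.  Its closed points are the normalized discrete valuations of the function
  field (a valuation is automatically trivial on the finite field \<open>k\<close>).
\<close>

definition function_field :: "'f::field set \<Rightarrow> bool" where
  "function_field k \<longleftrightarrow>
     finite k \<and> subfield k (ring_of_type_algebra :: 'f ring) \<and>
     (\<exists>t. ring.transcendental (ring_of_type_algebra :: 'f ring) k t \<and>
          ring.finite_dimension (ring_of_type_algebra :: 'f ring)
            (generate_field ring_of_type_algebra (insert t k)) UNIV) \<and>
     (\<forall>x. \<not> ring.transcendental (ring_of_type_algebra :: 'f ring) k x \<longrightarrow> x \<in> k)"

text \<open>Normalized discrete valuations of a subfield \<open>K\<close>; the value at 0 and outside \<open>K\<close> is set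
  to 0, so conditions such as \<open>v x \<ge> n\<close> need care at \<open>x = 0\<close>.\<close>

definition discrete_valuation :: "'a::field set \<Rightarrow> ('a \<Rightarrow> int) \<Rightarrow> bool" where
  "discrete_valuation K v \<longleftrightarrow>
     (\<forall>x. x \<notin> K \<or> x = 0 \<longrightarrow> v x = 0) \<and>
     (\<forall>x\<in>K - {0}. \<forall>y\<in>K - {0}.
        v (x * y) = v x + v y \<and> (x + y \<noteq> 0 \<longrightarrow> min (v x) (v y) \<le> v (x + y))) \<and>
     (\<exists>x\<in>K. v x = 1)"

definition places :: "('f::field \<Rightarrow> int) set" where
  "places = {v. discrete_valuation UNIV v}"

definition val_ge :: "('a::field \<Rightarrow> int) \<Rightarrow> int \<Rightarrow> 'a \<Rightarrow> bool" where
  "val_ge v n x \<longleftrightarrow> x = 0 \<or> n \<le> v x"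

definition residue_size :: "('f::field \<Rightarrow> int) \<Rightarrow> nat" where
  "residue_size v =
     card (carrier ((ring_of_type_algebra\<lparr>carrier := {x. val_ge v 0 x}\<rparr>) Quot {x. val_ge v 1 x}))"

text \<open>
  Rational 1-forms: \<open>\<Omega>\<close> of \<open>F/k\<close> is one-dimensional over \<open>F\<close>, hence is the dual of the space of
  derivations of \<open>F\<close> (which are \<open>k\<close>-linear because \<open>k\<close> is finite), \<open>f dg\<close> being \<open>D \<mapsto> f D(g)\<close>.
  If \<open>\<pi>\<close> is a uniformizer at \<open>v\<close> and \<open>D \<pi> = 1\<close> then \<open>\<omega> = \<omega>(D) d\<pi>\<close>, and \<open>d\<pi>\<close> generates the
  1-forms regular at \<open>v\<close>; so the order of \<open>\<omega>\<close> at \<open>v\<close> is \<open>v (\<omega> D)\<close>.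
\<close>

definition derivation :: "('f::field \<Rightarrow> 'f) \<Rightarrow> bool" where
  "derivation D \<longleftrightarrow> (\<forall>x y. D (x + y) = D x + D y) \<and> (\<forall>x y. D (x * y) = x * D y + y * D x)"

definition rational_form :: "(('f::field \<Rightarrow> 'f) \<Rightarrow> 'f) \<Rightarrow> bool" where
  "rational_form \<omega> \<longleftrightarrow>
     \<omega> \<in> extensional {D. derivation D} \<and>
     (\<forall>D E. derivation D \<and> derivation E \<longrightarrow> \<omega> (\<lambda>x. D x + E x) = \<omega> D + \<omega> E) \<and>
     (\<forall>a D. derivation D \<longrightarrow> \<omega> (\<lambda>x. a * D x) = a * \<omega> D)"

definition nonzero_form :: "(('f::field \<Rightarrow> 'f) \<Rightarrow> 'f) \<Rightarrow> bool" where
  "nonzero_form \<omega> \<longleftrightarrow> rational_form \<omega> \<and> (\<exists>D. derivation D \<and> \<omega> D \<noteq> 0)"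

definition form_order :: "('f::field \<Rightarrow> int) \<Rightarrow> (('f \<Rightarrow> 'f) \<Rightarrow> 'f) \<Rightarrow> int \<Rightarrow> bool" where
  "form_order v \<omega> n \<longleftrightarrow>
     (\<exists>\<pi> D. v \<pi> = 1 \<and> derivation D \<and> D \<pi> = 1 \<and> \<omega> D \<noteq> 0 \<and> v (\<omega> D) = n)"

text \<open>The genus is \<open>dim\<^sub>k H\<^sup>0(\<Omega>)\<close>; a vector space of dimension \<open>g\<close> over \<open>k\<close> has \<open>(card k)^g\<close>
  elements.\<close>

definition regular_forms :: "(('f::field \<Rightarrow> 'f) \<Rightarrow> 'f) set" where
  "regular_forms =
     {\<omega>. rational_form \<omega> \<and> (nonzero_form \<omega> \<longrightarrow> (\<forall>v\<in>places. \<exists>n\<ge>0. form_order v \<omega> n))}"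

definition genus :: "'f::field set \<Rightarrow> nat" where
  "genus k = (THE g. card (regular_forms :: (('f \<Rightarrow> 'f) \<Rightarrow> 'f) set) = card k ^ g)"

definition discriminant :: "'f::field set \<Rightarrow> real" where
  "discriminant k = real (card k) powr (2 * real (genus k) - 2)"

text \<open>
  A spin structure with a nonzero rational section whose square is \<open>\<omega>\<close> amounts to a nonzero rational
  1-form \<open>\<omega>\<close> with even divisor: the section has divisor \<open>\<Sum> m\<^sub>v v\<close> and \<open>K^{1/2}\<close> is the line bundle of
  this divisor.
\<close>

definition spin_section :: "(('f::field \<Rightarrow> 'f) \<Rightarrow> 'f) \<Rightarrow> (('f \<Rightarrow> int) \<Rightarrow> int) \<Rightarrow> bool" where
  "spin_section \<omega> m \<longleftrightarrow>
     nonzero_form \<omega> \<and> finite {v \<in> places. m v \<noteq> 0} \<and> (\<forall>v\<in>places. form_order v \<omega> (2 * m v))"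


section \<open>Completions and adeles\<close>

text \<open>The completion \<open>F\<^sub>v\<close>: Cauchy sequences modulo null sequences.\<close>

definition cauchy_ring :: "('f::field \<Rightarrow> int) \<Rightarrow> (nat \<Rightarrow> 'f) ring" where
  "cauchy_ring v =
     \<lparr>carrier = {x. \<forall>N. \<exists>n0. \<forall>m\<ge>n0. \<forall>n\<ge>n0. val_ge v N (x m - x n)},
      monoid.mult = (\<lambda>x y n. x n * y n), one = (\<lambda>_. 1),
      ring.zero = (\<lambda>_. 0), add = (\<lambda>x y n. x n + y n)\<rparr>"

definition null_seqs :: "('f::field \<Rightarrow> int) \<Rightarrow> (nat \<Rightarrow> 'f) set" where
  "null_seqs v = {x. \<forall>N. \<exists>n0. \<forall>n\<ge>n0. val_ge v N (x n)}"

definition completion :: "('f::field \<Rightarrow> int) \<Rightarrow> (nat \<Rightarrow> 'f) set ring" where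
  "completion v = cauchy_ring v Quot null_seqs v"

definition to_completion :: "('f::field \<Rightarrow> int) \<Rightarrow> 'f \<Rightarrow> (nat \<Rightarrow> 'f) set" where
  "to_completion v a = a_r_coset (cauchy_ring v) (null_seqs v) (\<lambda>_. a)"

definition completion_integers :: "('f::field \<Rightarrow> int) \<Rightarrow> (nat \<Rightarrow> 'f) set set" where
  "completion_integers v = {C \<in> carrier (completion v). \<exists>x\<in>C. \<forall>n. val_ge v 0 (x n)}"

text \<open>The extension of \<open>v\<close> to \<open>F\<^sub>v\<close>, meaningful on nonzero elements only.\<close>

definition completion_val :: "('f::field \<Rightarrow> int) \<Rightarrow> (nat \<Rightarrow> 'f) set \<Rightarrow> int" where
  "completion_val v C = (THE j. \<exists>x\<in>C. \<exists>n0. \<forall>n\<ge>n0. x n \<noteq> 0 \<and> v (x n) = j)"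

type_synonym 'f adele = "('f \<Rightarrow> int) \<Rightarrow> (nat \<Rightarrow> 'f) set"

definition adele_ring :: "'f::field adele ring" where
  "adele_ring =
     \<lparr>carrier = {a \<in> (\<Pi>\<^sub>E v\<in>places. carrier (completion v)).
                   finite {v \<in> places. a v \<notin> completion_integers v}},
      monoid.mult = (\<lambda>a b. \<lambda>v\<in>places. a v \<otimes>\<^bsub>completion v\<^esub> b v),
      one = (\<lambda>v\<in>places. \<one>\<^bsub>completion v\<^esub>),
      ring.zero = (\<lambda>v\<in>places. \<zero>\<^bsub>completion v\<^esub>),
      add = (\<lambda>a b. \<lambda>v\<in>places. a v \<oplus>\<^bsub>completion v\<^esub> b v)\<rparr>"

definition integral_adeles :: "'f::field adele ring" where
  "integral_adeles = adele_ring\<lparr>carrier := (\<Pi>\<^sub>E v\<in>places. completion_integers v)\<rparr>"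

definition diagonal :: "'f::field \<Rightarrow> 'f adele" where
  "diagonal x = (\<lambda>v\<in>places. to_completion v x)"

definition idele_abs :: "'f::field adele \<Rightarrow> real" where
  "idele_abs a =
     (\<Prod>v | v \<in> places \<and> completion_val v (a v) \<noteq> 0.
        real (residue_size v) powi (- completion_val v (a v)))"

definition uniformizers :: "'f::field adele \<Rightarrow> bool" where
  "uniformizers \<pi> \<longleftrightarrow>
     (\<forall>v\<in>places. \<pi> v \<in> Units (completion v) \<and> completion_val v (\<pi> v) = 1)"

definition local_uniformizer :: "'f::field adele \<Rightarrow> ('f \<Rightarrow> int) \<Rightarrow> 'f adele" where
  "local_uniformizer \<pi> v = (\<lambda>w\<in>places. if w = v then \<pi> w else \<one>\<^bsub>completion w\<^esub>)"

text \<open>The idele \<open>\<partial>^{1/2}\<close>.\<close>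

definition half_different :: "'f::field adele \<Rightarrow> (('f \<Rightarrow> int) \<Rightarrow> int) \<Rightarrow> 'f adele" where
  "half_different \<pi> m = (\<lambda>v\<in>places. \<pi> v [^]\<^bsub>units_of (completion v)\<^esub> m v)"


section \<open>Automorphic periods\<close>

abbreviation field_ring :: "'f::field ring" where
  "field_ring \<equiv> ring_of_type_algebra"

definition rational_torus :: "nat \<Rightarrow> (nat \<Rightarrow> 'f::field adele) set" where
  "rational_torus r = torus_map r diagonal ` carrier (torus r field_ring)"

definition integral_torus :: "nat \<Rightarrow> (nat \<Rightarrow> 'f::field adele) set" where
  "integral_torus r = carrier (torus r integral_adeles)"

definition torus_quotient :: "nat \<Rightarrow> (nat \<Rightarrow> 'f::field adele) set monoid" where
  "torus_quotient r =
     torus r adele_ring Mod (rational_torus r <#>\<^bsub>torus r adele_ring\<^esub> integral_torus r)"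

text \<open>
  The measure on \<open>[T] = T(F)\T(\<bbbA>)/T(\<O>)\<close> induced by the Haar measure of \<open>T(\<bbbA>)\<close> giving the compact
  open subgroup \<open>T(\<O>)\<close> volume 1 and the counting measure of \<open>T(F)\<close>.  The space is discrete, and the
  image of \<open>t T(\<O>)\<close> in \<open>T(F)\T(\<bbbA>)\<close> is the quotient of \<open>t T(\<O>)\<close> by the free action of the finite group
  \<open>T(F) \<inter> T(\<O>)\<close>, so every point has mass \<open>1 / card (T(F) \<inter> T(\<O>))\<close>.
\<close>

definition torus_quotient_measure :: "nat \<Rightarrow> (nat \<Rightarrow> 'f::field adele) set measure" where
  "torus_quotient_measure r =
     scale_measure
       (ennreal (1 / real (card {x \<in> carrier (torus r (field_ring :: 'f ring)).
                                  torus_map r diagonal x \<in> integral_torus r})))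
       (count_space (carrier (torus_quotient r)))"

text \<open>Everywhere unramified characters of \<open>[T]\<close>, as functions on \<open>T(\<bbbA>)\<close>.\<close>

definition unramified_character :: "nat \<Rightarrow> ((nat \<Rightarrow> 'f::field adele) \<Rightarrow> complex) \<Rightarrow> bool" where
  "unramified_character r \<psi> \<longleftrightarrow>
     \<psi> \<in> hom (torus r adele_ring) (units_of complex_ring) \<and>
     \<psi> \<in> extensional (carrier (torus r adele_ring)) \<and>
     (\<forall>t\<in>rational_torus r. \<psi> t = 1) \<and> (\<forall>t\<in>integral_torus r. \<psi> t = 1)"

definition unitary_character :: "nat \<Rightarrow> ((nat \<Rightarrow> 'f::field adele) \<Rightarrow> complex) \<Rightarrow> bool" where
  "unitary_character r \<psi> \<longleftrightarrow>
     unramified_character r \<psi> \<and> (\<forall>t\<in>carrier (torus r adele_ring). cmod (\<psi> t) = 1)"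

text \<open>\<open>\<Phi>\<close>, the product over \<open>v\<close> of the indicator functions of \<open>X(\<O>\<^sub>v)\<close>, on \<open>X(\<bbbA>)\<close>.\<close>

definition basic_function ::
    "(nat \<Rightarrow> int) set \<Rightarrow> (((nat \<Rightarrow> int) \<Rightarrow>\<^sub>0 int) \<Rightarrow> 'f::field adele) \<Rightarrow> complex" where
  "basic_function M y =
     (if \<forall>v\<in>places. (\<lambda>p\<in>carrier (int_monoid_algebra M). y p v)
                       \<in> toric_points M (completion v\<lparr>carrier := completion_integers v\<rparr>)
      then 1 else 0)"

text \<open>
  The term of the period attached to \<open>t \<in> T(\<bbbA>)\<close> and \<open>x \<in> T(F)\<close>, for \<open>X = Spec \<int>[M]\<close> graded by
  \<open>\<rho>\<close> with eigencharacter \<open>\<eta>\<close>, where \<open>dh\<close> is \<open>\<partial>^{1/2}\<close>.  The exponent \<open>1/2\<close> of \<open>|\<eta>|\<close> is replaced by a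
  complex number \<open>w\<close>.
\<close>

definition period_term ::
    "nat \<Rightarrow> (nat \<Rightarrow> int) set \<Rightarrow> (nat \<Rightarrow> int) \<Rightarrow> (nat \<Rightarrow> int) \<Rightarrow> 'f::field adele \<Rightarrow> complex
       \<Rightarrow> (nat \<Rightarrow> 'f adele) \<Rightarrow> (nat \<Rightarrow> 'f) \<Rightarrow> complex" where
  "period_term r M \<rho> \<eta> dh w t x =
     (let s = t \<otimes>\<^bsub>torus r adele_ring\<^esub> torus_cochar r adele_ring \<rho> dh;
          y = toric_act r M adele_ring (toric_base M adele_ring) (torus_map r diagonal x)
      in complex_of_real (idele_abs (torus_char r adele_ring \<eta> s)) powr w
           * basic_function M (toric_act r M adele_ring y s))"

definition period_integrand ::
    "nat \<Rightarrow> (nat \<Rightarrow> int) set \<Rightarrow> (nat \<Rightarrow> int) \<Rightarrow> (nat \<Rightarrow> int) \<Rightarrow> 'f::field adele \<Rightarrow> complex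
       \<Rightarrow> ((nat \<Rightarrow> 'f adele) \<Rightarrow> complex) \<Rightarrow> (nat \<Rightarrow> 'f adele) \<Rightarrow> complex" where
  "period_integrand r M \<rho> \<eta> dh w \<psi> t =
     \<psi> t * (\<Sum>\<^sub>\<infinity>x\<in>carrier (torus r field_ring). period_term r M \<rho> \<eta> dh w t x)"

text \<open>The integrand is constant on the classes \<open>c \<in> [T]\<close>; \<open>the_elem\<close> picks its value.\<close>

definition automorphic_period ::
    "nat \<Rightarrow> (nat \<Rightarrow> int) set \<Rightarrow> (nat \<Rightarrow> int) \<Rightarrow> (nat \<Rightarrow> int) \<Rightarrow> 'f::field adele
       \<Rightarrow> ((nat \<Rightarrow> 'f adele) \<Rightarrow> complex) \<Rightarrow> complex \<Rightarrow> complex" where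
  "automorphic_period r M \<rho> \<eta> dh \<psi> w =
     (\<integral>c. the_elem (period_integrand r M \<rho> \<eta> dh w \<psi> ` c) \<partial>torus_quotient_measure r)"

definition period_converges ::
    "nat \<Rightarrow> (nat \<Rightarrow> int) set \<Rightarrow> (nat \<Rightarrow> int) \<Rightarrow> (nat \<Rightarrow> int) \<Rightarrow> 'f::field adele
       \<Rightarrow> ((nat \<Rightarrow> 'f adele) \<Rightarrow> complex) \<Rightarrow> complex \<Rightarrow> bool" where
  "period_converges r M \<rho> \<eta> dh \<psi> w \<longleftrightarrow>
     (\<forall>t\<in>carrier (torus r adele_ring).
        period_term r M \<rho> \<eta> dh w t summable_on carrier (torus r field_ring)) \<and>
     integrable (torus_quotient_measure r) (\<lambda>c. the_elem (period_integrand r M \<rho> \<eta> dh w \<psi> ` c))"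


section \<open>The unramified Weil group and spectral periods\<close>

text \<open>Finite separable extensions of \<open>F\<close>, inside a fixed algebraic closure, unramified at all
  places: every normalized discrete valuation restricts to a normalized one on \<open>F\<close>.\<close>

definition unramified_extension :: "'f::field alg_closure set \<Rightarrow> bool" where
  "unramified_extension L \<longleftrightarrow>
     subfield L (ring_of_type_algebra :: 'f alg_closure ring) \<and> range to_ac \<subseteq> L \<and>
     ring.finite_dimension (ring_of_type_algebra :: 'f alg_closure ring) (range to_ac) L \<and>
     (\<forall>x\<in>L. \<exists>p::'f poly. coprime p (pderiv p) \<and> poly (map_poly to_ac p) x = 0) \<and>
     (\<forall>w. discrete_valuation L w \<longrightarrow> (\<exists>x. w (to_ac x) = 1))"

definition max_unramified :: "'f::field alg_closure set" where
  "max_unramified = \<Union>{L. unramified_extension L}"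

text \<open>The algebraic closure of the finite field \<open>k\<close>: the roots of unity and 0.\<close>

definition constants_closure :: "'f::field set \<Rightarrow> 'f alg_closure set" where
  "constants_closure k = {x. \<exists>n>0. x ^ (card k ^ n) = x}"

text \<open>The last condition says that \<open>g\<close> acts on constants by an integral, possibly negative, power of
  the Frobenius.\<close>

definition weil_group :: "'f::field set \<Rightarrow> ('f alg_closure \<Rightarrow> 'f alg_closure) monoid" where
  "weil_group k =
     \<lparr>carrier =
        {g \<in> ring_iso (ring_of_type_algebra\<lparr>carrier := max_unramified\<rparr>)
                     (ring_of_type_algebra\<lparr>carrier := max_unramified\<rparr>).
           g \<in> extensional max_unramified \<and> (\<forall>x. g (to_ac x) = to_ac x) \<and>
           (\<exists>n. (\<forall>x\<in>constants_closure k. g x = x ^ (card k ^ n)) \<or>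
                (\<forall>x\<in>constants_closure k. (g x) ^ (card k ^ n) = x))},
      monoid.mult = (\<lambda>g h. compose max_unramified g h),
      one = (\<lambda>x\<in>max_unramified. x)\<rparr>"

text \<open>Geometric Frobenius elements at \<open>v\<close>: for a place \<open>w\<close> of the maximal unramified extension above
  \<open>v\<close>, the inverse of \<open>g\<close> induces the \<open>q\<^sub>v\<close>-power map on the residue field of \<open>w\<close>.\<close>

definition geometric_frobenius ::
    "'f::field set \<Rightarrow> ('f \<Rightarrow> int) \<Rightarrow> ('f alg_closure \<Rightarrow> 'f alg_closure) \<Rightarrow> bool" where
  "geometric_frobenius k v g \<longleftrightarrow>
     g \<in> carrier (weil_group k) \<and>
     (\<exists>w. discrete_valuation max_unramified w \<and> (\<forall>x. w (to_ac x) = v x) \<and>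
          (\<forall>x\<in>max_unramified. w (g x) = w x) \<and>
          (\<forall>x\<in>max_unramified. val_ge w 0 x \<longrightarrow> val_ge w 1 ((g x) ^ residue_size v - x)))"

text \<open>Continuous homomorphisms from the Weil group to \<open>T\<^sup>\<or>(\<complex>)\<close>: those trivial on an open subgroup of
  the geometric (inertial) subgroup.\<close>

definition continuous_parameter ::
    "'f::field set \<Rightarrow> nat \<Rightarrow> (('f alg_closure \<Rightarrow> 'f alg_closure) \<Rightarrow> nat \<Rightarrow> complex) \<Rightarrow> bool" where
  "continuous_parameter k r \<phi> \<longleftrightarrow>
     \<phi> \<in> hom (weil_group k) (torus r complex_ring) \<and>
     (\<exists>L. unramified_extension L \<and>
        (\<forall>g\<in>carrier (weil_group k).
           (\<forall>x\<in>L. g x = x) \<and> (\<forall>x\<in>constants_closure k. g x = x)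
             \<longrightarrow> \<phi> g = \<one>\<^bsub>torus r complex_ring\<^esub>))"

definition L_parameter ::
    "'f::field set \<Rightarrow> nat \<Rightarrow> 'f adele \<Rightarrow> (('f \<Rightarrow> int) \<Rightarrow> 'f alg_closure \<Rightarrow> 'f alg_closure)
       \<Rightarrow> ((nat \<Rightarrow> 'f adele) \<Rightarrow> complex)
       \<Rightarrow> (('f alg_closure \<Rightarrow> 'f alg_closure) \<Rightarrow> nat \<Rightarrow> complex) \<Rightarrow> bool" where
  "L_parameter k r \<pi> Fr \<psi> \<phi> \<longleftrightarrow>
     continuous_parameter k r \<phi> \<and>
     (\<forall>v\<in>places. \<forall>l\<in>lattice_vecs r.
        torus_char r complex_ring l (\<phi> (Fr v))
          = \<psi> (torus_cochar r adele_ring l (local_uniformizer \<pi> v)))"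

definition fixed_locus ::
    "'f::field set \<Rightarrow> nat \<Rightarrow> (nat \<Rightarrow> int) set
       \<Rightarrow> (('f alg_closure \<Rightarrow> 'f alg_closure) \<Rightarrow> nat \<Rightarrow> complex)
       \<Rightarrow> (((nat \<Rightarrow> int) \<Rightarrow>\<^sub>0 int) \<Rightarrow> complex) set" where
  "fixed_locus k r M \<phi> =
     {x \<in> toric_points M complex_ring.
        \<forall>g\<in>carrier (weil_group k). toric_act r M complex_ring x (\<phi> g) = x}"

text \<open>The product over all places is the unordered limit of finite products.\<close>

definition euler_product ::
    "nat \<Rightarrow> (nat \<Rightarrow> int) set \<Rightarrow> (nat \<Rightarrow> int)
       \<Rightarrow> (('f::field \<Rightarrow> int) \<Rightarrow> 'f alg_closure \<Rightarrow> 'f alg_closure)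
       \<Rightarrow> (('f alg_closure \<Rightarrow> 'f alg_closure) \<Rightarrow> nat \<Rightarrow> complex) \<Rightarrow> complex \<Rightarrow> complex" where
  "euler_product r M \<rho> Fr \<phi> w =
     Lim (finite_subsets_at_top places)
       (\<lambda>S. \<Prod>v\<in>S. graded_trace r M \<rho> (\<phi> (Fr v)) (of_nat (residue_size v) powr (- w)))"

text \<open>
  The spectral period of \<open>Y = Spec \<int>[M]\<close>, a toric variety of dimension \<open>r\<close> graded by \<open>\<rho>\<close> with
  eigencharacter \<open>\<eta>\<close>, at the parameter \<open>\<phi>\<close>; the exponent \<open>1/2\<close> of \<open>1/q\<^sub>v\<close> is replaced by \<open>w\<close>.
  The pairing of \<open>\<eta>\<close> and \<open>\<rho>\<close> is \<open>\<epsilon>\<close>.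
\<close>

definition spectral_period ::
    "'f::field set \<Rightarrow> nat \<Rightarrow> (nat \<Rightarrow> int) set \<Rightarrow> (nat \<Rightarrow> int) \<Rightarrow> (nat \<Rightarrow> int) \<Rightarrow> 'f adele \<Rightarrow> 'f adele
       \<Rightarrow> (('f \<Rightarrow> int) \<Rightarrow> 'f alg_closure \<Rightarrow> 'f alg_closure)
       \<Rightarrow> (('f alg_closure \<Rightarrow> 'f alg_closure) \<Rightarrow> nat \<Rightarrow> complex) \<Rightarrow> complex \<Rightarrow> complex" where
  "spectral_period k r M \<rho> \<eta> \<pi> dh Fr \<phi> w =
     (let \<psi> = (THE \<psi>. unramified_character r \<psi> \<and> L_parameter k r \<pi> Fr \<psi> \<phi>);
          \<zz> = \<psi> (torus_cochar r adele_ring \<eta> (inv\<^bsub>adele_ring\<^esub> dh))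
      in \<zz> * complex_of_real
               (discriminant k powr ((real_of_int (lattice_pairing r \<eta> \<rho>) - real r) / 4))
           * euler_product r M \<rho> Fr \<phi> w)"


section \<open>Regularization\<close>

text \<open>
  The integrals and Euler products converge for \<open>Re w\<close> large, but in general not at the point
  \<open>w = 1/2\<close> of interest, where they are understood by meromorphic continuation along the closed
  half-plane \<open>Re w \<ge> 1/2\<close>.  The value 0 is used when there is no such continuation regular at \<open>1/2\<close>.
\<close>

definition has_regularized_value :: "(complex \<Rightarrow> complex) \<Rightarrow> complex \<Rightarrow> bool" where
  "has_regularized_value f z \<longleftrightarrow>
     (\<exists>G c. G meromorphic_on {w. 1/2 \<le> Re w} \<and> G analytic_on {1/2} \<and>
            (\<forall>w. c < Re w \<longrightarrow> G w = f w) \<and> G (1/2) = z)"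

definition regularized_value :: "(complex \<Rightarrow> complex) \<Rightarrow> complex" where
  "regularized_value f =
     (if \<exists>z. has_regularized_value f z then THE z. has_regularized_value f z else 0)"

end

theory Submission
  imports Defs
begin

text \<open>
  An adelic point \<open>t\<close> of the torus has a divisor, the lattice-valued function \<open>v \<mapsto> v(t)\<close>.  Unfolding the sum over
  \<open>T(F)\<close> against the integral over \<open>[T]\<close> turns the period into a sum over the divisors with values in the
  monoid \<open>N\<close> dual to \<open>M\<close>: the basic function is the indicator of those divisors, and the finite group
  \<open>T(F) \<inter> T(\<O>)\<close>, which measures the failure of the map to divisors to be injective, cancels against the
  mass of a point of \<open>[T]\<close>.  The shift by \<open>\<partial>^{1/2}\<close> contributes the factor \<open>\<zz>\<close>, and the sum is the
  product over \<open>v\<close> of sums over \<open>N\<close>, which are the graded traces, since the monomials of degree \<open>n\<close> form a basis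
  of the degree \<open>n\<close> part of the completed local ring.  The powers of the discriminant cancel identically.

  Convergence for large real part needs a bound for the number of places of given residue size, and invariance
  under \<open>T(F)\<close> needs the product formula.  Both are obtained by counting: since \<open>k\<close> is finite, dimensions
  are compared through cardinalities, and the number of zeros of a function is squeezed between the growth
  rate of the space of its powers and the size of a space \<open>L(D)\<close>.
\<close>

section \<open>Growth of spaces of functions over a finite constant field\<close>

text \<open>The equality is claimed at every \<open>w\<close> at which the period converges as an
  iterated sum and integral, so iterated convergence has to imply absolute convergence of the
  unfolded double sum. It does, because for fixed \<open>t\<close> all terms over T(F) share one
  phase and nothing can cancel in an inner sum.

  Each counting estimate loses a factor independent of the exponent \<open>l\<close>. Comparing
  exponential rates as \<open>l\<close> grows (\<open>power_growth_le\<close>) removes it, so crude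
  choices of denominators and generators cost nothing. The product formula comes out exact because a
  single integer, the degree over k(x) = k(1/x), is both a growth rate, bounding zeros from above,
  and the size of an independent family, bounding poles from below.

  Convergence is proved for Re w > 3 + A r. The 3 makes the sum over places converge, there being at
  most a constant times Q places of residue size Q. The A r makes the sum over the dual monoid at
  each place converge, where \<open>A\<close> bounds the coordinates of a point by its
  degree.\<close>

lemma power_growth_le:
  fixes a b K :: real
  assumes "0 < b" "\<And>l. a ^ l \<le> K * b ^ l"
  shows "a \<le> b"
proof (rule ccontr)
  assume "\<not> a \<le> b"
  then have "1 < a / b" using assms(1) by simp
  then obtain l where l: "K < (a / b) ^ l" using real_arch_pow by blast
  have "(a / b) ^ l * b ^ l = a ^ l" using assms(1) by (simp add: power_divide)
  moreover have "K * b ^ l < (a / b) ^ l * b ^ l" using l assms(1) by simp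
  ultimately show False using assms(2)[of l] by linarith
qed

locale constant_field =
  fixes k :: "'f::field set"
  assumes finite_k: "finite k"
    and one_k: "1 \<in> k"
    and add_k: "\<And>a b. a \<in> k \<Longrightarrow> b \<in> k \<Longrightarrow> a + b \<in> k"
    and mult_k: "\<And>a b. a \<in> k \<Longrightarrow> b \<in> k \<Longrightarrow> a * b \<in> k"
    and uminus_k: "\<And>a. a \<in> k \<Longrightarrow> - a \<in> k"
    and inverse_k: "\<And>a. a \<in> k \<Longrightarrow> inverse a \<in> k"
begin

lemma zero_k: "0 \<in> k"
  using add_k[OF one_k uminus_k[OF one_k]] by simp

lemma sum_k: "(\<And>i. i \<in> A \<Longrightarrow> f i \<in> k) \<Longrightarrow> sum f A \<in> k"
  by (induction A rule: infinite_finite_induct) (auto intro: zero_k add_k)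

definition q :: nat where "q = card k"

lemma q_ge_2: "2 \<le> q"
proof -
  have "card {0, 1::'f} \<le> card k" using finite_k zero_k one_k by (intro card_mono) auto
  then show ?thesis by (simp add: q_def)
qed

section \<open>Polynomials with constant coefficients\<close>

definition kpol :: "'f poly set" where "kpol = {p. \<forall>i. coeff p i \<in> k}"

lemma kpol_0: "0 \<in> kpol" and kpol_1: "1 \<in> kpol"
  by (auto simp: kpol_def zero_k one_k coeff_pCons split: nat.split)

lemma kpol_add: "p \<in> kpol \<Longrightarrow> p' \<in> kpol \<Longrightarrow> p + p' \<in> kpol"
  by (auto simp: kpol_def add_k)

lemma kpol_uminus: "p \<in> kpol \<Longrightarrow> - p \<in> kpol"
  by (auto simp: kpol_def uminus_k)

lemma kpol_diff: "p \<in> kpol \<Longrightarrow> p' \<in> kpol \<Longrightarrow> p - p' \<in> kpol"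
  using kpol_add[of p "- p'"] kpol_uminus[of p'] by simp

lemma kpol_mult: "p \<in> kpol \<Longrightarrow> p' \<in> kpol \<Longrightarrow> p * p' \<in> kpol"
  by (auto simp: kpol_def coeff_mult intro!: sum_k mult_k)

lemma kpol_monom: "c \<in> k \<Longrightarrow> monom c n \<in> kpol"
  by (auto simp: kpol_def zero_k)

lemma kpol_const: "c \<in> k \<Longrightarrow> [:c:] \<in> kpol"
  using kpol_monom[of c 0] by (simp add: monom_0)

lemma kpol_sum: "(\<And>i. i \<in> A \<Longrightarrow> f i \<in> kpol) \<Longrightarrow> sum f A \<in> kpol"
  by (induction A rule: infinite_finite_induct) (auto intro: kpol_0 kpol_add)

lemma kpol_power: "p \<in> kpol \<Longrightarrow> p ^ n \<in> kpol"
  by (induction n) (auto intro: kpol_1 kpol_mult)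

definition kpl :: "nat \<Rightarrow> 'f poly set" where "kpl l = {p \<in> kpol. degree p \<le> l}"

lemma kpl_0: "0 \<in> kpl l"
  by (simp add: kpl_def kpol_0)

lemma kpl_bij: "bij_betw (\<lambda>c. \<Sum>i\<le>l. monom (c i) i) ({..l} \<rightarrow>\<^sub>E k) (kpl l)"
proof (rule bij_betw_byWitness[where f' = "\<lambda>p. restrict (coeff p) {..l}"])
  show "\<forall>c\<in>{..l} \<rightarrow>\<^sub>E k. restrict (coeff (\<Sum>i\<le>l. monom (c i) i)) {..l} = c"
  proof
    fix c assume c: "c \<in> {..l} \<rightarrow>\<^sub>E k"
    show "restrict (coeff (\<Sum>i\<le>l. monom (c i) i)) {..l} = c"
    proof
      fix j show "restrict (coeff (\<Sum>i\<le>l. monom (c i) i)) {..l} j = c j"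
        using c by (auto simp: coeff_sum PiE_def extensional_def if_distrib cong: if_cong)
    qed
  qed
  show "\<forall>p\<in>kpl l. (\<Sum>i\<le>l. monom (restrict (coeff p) {..l} i) i) = p"
    by (auto simp: kpl_def poly_as_sum_of_monoms')
  show "(\<lambda>c. \<Sum>i\<le>l. monom (c i) i) ` ({..l} \<rightarrow>\<^sub>E k) \<subseteq> kpl l"
    unfolding kpl_def
    by (force intro!: kpol_sum kpol_monom degree_sum_le intro: order.trans[OF degree_monom_le])
  show "(\<lambda>p. restrict (coeff p) {..l}) ` kpl l \<subseteq> {..l} \<rightarrow>\<^sub>E k"
    by (rule image_subsetI, subst restrict_PiE_iff) (auto simp: kpl_def kpol_def)
qed

lemma card_kpl: "card (kpl l) = q ^ (l + 1)"
  using bij_betw_same_card[OF kpl_bij[of l]] by (simp add: card_PiE q_def)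

lemma finite_kpl: "finite (kpl l)"
  using bij_betw_finite[OF kpl_bij[of l]] finite_PiE[of "{..l}" "\<lambda>_. k"] finite_k by simp

section \<open>Generation over k(t) with explicit denominators\<close>

definition transc :: "'f \<Rightarrow> bool" where
  "transc x \<longleftrightarrow> (\<forall>p\<in>kpol. poly p x = 0 \<longrightarrow> p = 0)"

text \<open>The denominator \<open>g\<close> is fixed, so this is a finite vector space over
  \<open>k\<close>, and its cardinality can stand for its dimension.\<close>

definition ratspan :: "'f \<Rightarrow> nat \<Rightarrow> (nat \<Rightarrow> 'f) \<Rightarrow> 'f \<Rightarrow> nat \<Rightarrow> 'f set" where
  "ratspan t n w g l = {f. \<exists>p. (\<forall>i<n. p i \<in> kpl l) \<and> g * f = (\<Sum>i<n. poly (p i) t * w i)}"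

lemma ratspan_finite_card:
  assumes "g \<noteq> 0"
  shows "finite (ratspan t n w g l) \<and> card (ratspan t n w g l) \<le> q ^ (n * (l + 1))"
proof -
  let ?F = "\<lambda>p. (\<Sum>i<n. poly (p i) t * w i) / g"
  have sub: "ratspan t n w g l \<subseteq> ?F ` ({..<n} \<rightarrow>\<^sub>E kpl l)"
  proof
    fix f assume "f \<in> ratspan t n w g l"
    then obtain p where p: "\<forall>i<n. p i \<in> kpl l" "g * f = (\<Sum>i<n. poly (p i) t * w i)"
      by (auto simp: ratspan_def)
    have "f = ?F (restrict p {..<n})" using p(2) assms by (simp add: field_simps)
    moreover have "restrict p {..<n} \<in> {..<n} \<rightarrow>\<^sub>E kpl l" using p(1) by auto
    ultimately show "f \<in> ?F ` ({..<n} \<rightarrow>\<^sub>E kpl l)" by blast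
  qed
  have fin: "finite ({..<n} \<rightarrow>\<^sub>E kpl l)" by (intro finite_PiE) (auto simp: finite_kpl)
  have "card (ratspan t n w g l) \<le> card ({..<n} \<rightarrow>\<^sub>E kpl l)"
    using card_mono[OF finite_imageI[OF fin] sub] card_image_le[OF fin, of ?F] by linarith
  also have "\<dots> = (q ^ (l + 1)) ^ n" by (simp add: card_PiE card_kpl)
  also have "\<dots> = q ^ (n * (l + 1))" by (metis power_mult mult.commute)
  finally show ?thesis using finite_subset[OF sub finite_imageI[OF fin]] by simp
qed

lemma ratspan_0: "0 \<in> ratspan t n w g l"
  unfolding ratspan_def by (rule CollectI, rule exI[of _ "\<lambda>_. 0"]) (simp add: kpl_0)

lemma ratspan_add: "a \<in> ratspan t n w g l \<Longrightarrow> b \<in> ratspan t n w g l \<Longrightarrow> a + b \<in> ratspan t n w g l"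
proof -
  assume "a \<in> ratspan t n w g l" "b \<in> ratspan t n w g l"
  then obtain p p' where "\<forall>i<n. p i \<in> kpl l" "g * a = (\<Sum>i<n. poly (p i) t * w i)"
     "\<forall>i<n. p' i \<in> kpl l" "g * b = (\<Sum>i<n. poly (p' i) t * w i)"
    by (auto simp: ratspan_def)
  then show ?thesis unfolding ratspan_def
    by (auto intro!: exI[of _ "\<lambda>i. p i + p' i"] kpol_add degree_add_le
             simp: kpl_def algebra_simps sum.distrib)
qed

text \<open>A single rule for changing denominators: taking \<open>b = a\<close> and
  \<open>p\<close> the new factor enlarges the denominator, while taking \<open>h = g\<close>
  multiplies by a polynomial in \<open>t\<close>. Only the degree bound moves.\<close>

lemma ratspan_mult:
  assumes "a \<in> ratspan t n w g l" "p \<in> kpl d" "h * b = poly p t * (g * a)" "l + d \<le> l'"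
  shows "b \<in> ratspan t n w h l'"
proof -
  obtain r where r: "\<forall>i<n. r i \<in> kpl l" "g * a = (\<Sum>i<n. poly (r i) t * w i)"
    using assms(1) by (auto simp: ratspan_def)
  have "\<forall>i<n. p * r i \<in> kpl l'"
  proof (intro allI impI)
    fix i assume "i < n"
    then have "r i \<in> kpol" "degree (r i) \<le> l" using r(1) by (auto simp: kpl_def)
    then show "p * r i \<in> kpl l'"
      using assms(2,4) degree_mult_le[of p "r i"] by (auto simp: kpl_def intro: kpol_mult)
  qed
  moreover have "h * b = (\<Sum>i<n. poly (p * r i) t * w i)"
    by (simp add: assms(3) r(2) sum_distrib_left mult.assoc)
  ultimately show ?thesis unfolding ratspan_def
    by (intro CollectI exI[of _ "\<lambda>i. p * r i"] conjI)
qed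

lemma ratspan_smult: "c \<in> k \<Longrightarrow> a \<in> ratspan t n w g l \<Longrightarrow> c * a \<in> ratspan t n w g l"
  by (rule ratspan_mult[where p = "[:c:]" and d = 0 and g = g])
    (auto simp: kpl_def kpol_const)

text \<open>The \<open>w i\<close> generate the field over k(t). Clearing denominators states this
  inside k[t], so the subfield k(t) never has to be named.\<close>

definition spanning :: "'f \<Rightarrow> nat \<Rightarrow> (nat \<Rightarrow> 'f) \<Rightarrow> bool" where
  "spanning t n w \<longleftrightarrow> transc t \<and> (\<forall>f. \<exists>g\<in>kpol. g \<noteq> 0 \<and> (\<exists>l. f \<in> ratspan t n w (poly g t) l))"

lemma common_denominator:
  assumes "spanning t n w" "finite U"
  shows "\<exists>g\<in>kpol. g \<noteq> 0 \<and> (\<exists>l. \<forall>u\<in>U. u \<in> ratspan t n w (poly g t) l)"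
  using assms(2)
proof (induction U)
  case empty
  show ?case using kpol_1 by (intro bexI[of _ 1]) auto
next
  case (insert u U)
  obtain g l where g: "g \<in> kpol" "g \<noteq> 0" "\<forall>u\<in>U. u \<in> ratspan t n w (poly g t) l"
    using insert by blast
  obtain g' l' where g': "g' \<in> kpol" "g' \<noteq> 0" "u \<in> ratspan t n w (poly g' t) l'"
    using assms(1) unfolding spanning_def by blast
  have "\<forall>a\<in>insert u U. a \<in> ratspan t n w (poly (g * g') t) (l + l' + degree g + degree g')"
  proof
    fix a assume "a \<in> insert u U"
    then show "a \<in> ratspan t n w (poly (g * g') t) (l + l' + degree g + degree g')"
    proof
      assume [simp]: "a = u"
      show ?thesis unfolding \<open>a = u\<close>
        by (rule ratspan_mult[OF g'(3), where p = g and d = "degree g"]) (auto simp: kpl_def g)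
    next
      assume "a \<in> U"
      then have a: "a \<in> ratspan t n w (poly g t) l" using g(3) by blast
      show ?thesis
        by (rule ratspan_mult[OF a, where p = g' and d = "degree g'"]) (auto simp: kpl_def g')
    qed
  qed
  then show ?case using kpol_mult[OF g(1) g'(1)] g(2) g'(2) by (metis no_zero_divisors)
qed

definition subspace_k :: "'f set \<Rightarrow> bool" where
  "subspace_k S \<longleftrightarrow> 0 \<in> S \<and> (\<forall>a\<in>S. \<forall>b\<in>S. a + b \<in> S) \<and> (\<forall>c\<in>k. \<forall>a\<in>S. c * a \<in> S)"

text \<open>For transcendental \<open>y\<close>, the least \<open>E\<close> with \<open>growth y E\<close> is the degree of the field over \<open>k(y)\<close>; stating it by cardinalities avoids
  dimensions over \<open>k(y)\<close>.\<close>

definition growth :: "'f \<Rightarrow> nat \<Rightarrow> bool" where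
  "growth y E \<longleftrightarrow> (\<forall>U. finite U \<longrightarrow> (\<exists>C. \<forall>l. \<exists>S. finite S \<and> card S \<le> q ^ (E * l + C) \<and> subspace_k S \<and>
     (\<forall>u\<in>U. \<forall>j\<le>l. y ^ j * u \<in> S)))"

lemma growthI:
  assumes "transc t" and "\<And>U. finite U \<Longrightarrow> \<exists>C. \<forall>l. \<exists>g\<in>kpol. g \<noteq> 0 \<and> (\<forall>u\<in>U. \<forall>j\<le>l. y ^ j * u \<in> ratspan t n w (poly g t) (D * l + C))"
  shows "growth y (n * D)"
  unfolding growth_def
proof (intro allI impI)
  fix U :: "'f set" assume "finite U"
  then obtain C where C: "\<forall>l. \<exists>g\<in>kpol. g \<noteq> 0 \<and> (\<forall>u\<in>U. \<forall>j\<le>l. y ^ j * u \<in> ratspan t n w (poly g t) (D * l + C))"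
    using assms(2)[OF \<open>finite U\<close>] by (elim exE)
  show "\<exists>C. \<forall>l. \<exists>S. finite S \<and> card S \<le> q ^ (n * D * l + C) \<and> subspace_k S \<and>
     (\<forall>u\<in>U. \<forall>j\<le>l. y ^ j * u \<in> S)"
  \<comment> \<open>A degree bound \<open>D * l + C\<close> leaves \<open>D * l + C + 1\<close>
    coefficients for each of the \<open>n\<close> generators.\<close>
  proof (intro exI[of _ "n * (C + 1)"] allI)
    fix l
    obtain g where g: "g \<in> kpol" "g \<noteq> 0" "\<forall>u\<in>U. \<forall>j\<le>l. y ^ j * u \<in> ratspan t n w (poly g t) (D * l + C)"
      using spec[OF C, of l] by (elim bexE conjE)
    have g0: "poly g t \<noteq> 0" using g assms(1) by (auto simp: transc_def)
    let ?S = "ratspan t n w (poly g t) (D * l + C)"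
    have "finite ?S \<and> card ?S \<le> q ^ (n * D * l + n * (C + 1))"
      using ratspan_finite_card[OF g0, of t n w "D * l + C"] by (simp add: algebra_simps)
    then show "\<exists>S. finite S \<and> card S \<le> q ^ (n * D * l + n * (C + 1)) \<and> subspace_k S \<and>
     (\<forall>u\<in>U. \<forall>j\<le>l. y ^ j * u \<in> S)"
      using g(3) by (intro exI[of _ ?S]) (simp add: subspace_k_def ratspan_0 ratspan_add ratspan_smult)
  qed
qed

text \<open>Multiplying by powers of Y(t) only raises degrees and needs no new denominator. The rate
  is linear in \<open>degree Y\<close>, which is what makes the count of places in
  \<open>count_places\<close> linear in \<open>Q\<close>.\<close>

lemma growth_poly:
  assumes "spanning t n w" "Y \<in> kpol"
  shows "growth (poly Y t) (n * degree Y)"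
proof (rule growthI)
  show "transc t" using assms(1) by (simp add: spanning_def)
  fix U :: "'f set" assume "finite U"
  then obtain g l0 where g: "g \<in> kpol" "g \<noteq> 0" "\<forall>u\<in>U. u \<in> ratspan t n w (poly g t) l0"
    using common_denominator[OF assms(1)] by blast
  have "poly Y t ^ j * u \<in> ratspan t n w (poly g t) (degree Y * l + l0)" if "u \<in> U" "j \<le> l" for u j l
  proof (rule ratspan_mult[where p = "Y ^ j" and g = "poly g t"])
    show "u \<in> ratspan t n w (poly g t) l0" using g(3) that by blast
    show "Y ^ j \<in> kpl (degree (Y ^ j))" by (simp add: kpl_def kpol_power assms(2))
    have "degree (Y ^ j) \<le> degree Y * j" by (rule degree_power_le)
    also have "\<dots> \<le> degree Y * l" using that by simp
    finally show "l0 + degree (Y ^ j) \<le> degree Y * l + l0" by simp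
  qed simp
  then show "\<exists>C. \<forall>l. \<exists>g\<in>kpol. g \<noteq> 0 \<and> (\<forall>u\<in>U. \<forall>j\<le>l. poly Y t ^ j * u \<in> ratspan t n w (poly g t) (degree Y * l + C))"
    using g(1,2) by blast
qed

text \<open>If \<open>g\<close> clears the denominators of all \<open>y * w i\<close>, then each
  multiplication by \<open>y\<close> costs one factor g(t) in the denominator and \<open>l0\<close>
  in the degree. Powers up to \<open>l\<close> are brought to the common denominator
  \<open>g ^ l\<close>, which adds \<open>degree g\<close> per step; hence
  \<open>D = l0 + degree g\<close>.\<close>

lemma growth_exists:
  assumes "spanning t n w"
  shows "\<exists>E. growth y E"
proof -
  obtain g l0 where g: "g \<in> kpol" "g \<noteq> 0" "\<forall>u\<in>(\<lambda>i. y * w i) ` {..<n}. u \<in> ratspan t n w (poly g t) l0"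
    using common_denominator[OF assms, of "(\<lambda>i. y * w i) ` {..<n}"] by blast
  have tr: "transc t" using assms by (simp add: spanning_def)
  define D where "D = l0 + degree g"
  have step: "y * a \<in> ratspan t n w (h * poly g t) (l + l0)" if a: "a \<in> ratspan t n w h l" for a h l
  proof -
    obtain p where p: "\<forall>i<n. p i \<in> kpl l" "h * a = (\<Sum>i<n. poly (p i) t * w i)"
      using a by (auto simp: ratspan_def)
    have "\<forall>i<n. \<exists>r. (\<forall>j<n. r j \<in> kpl l0) \<and> poly g t * (y * w i) = (\<Sum>j<n. poly (r j) t * w j)"
      using g(3) unfolding ratspan_def by blast
    then obtain r where r: "\<And>i j. i < n \<Longrightarrow> j < n \<Longrightarrow> r i j \<in> kpl l0"
        "\<And>i. i < n \<Longrightarrow> poly g t * (y * w i) = (\<Sum>j<n. poly (r i j) t * w j)" by metis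
    have "h * poly g t * (y * a) = (\<Sum>i<n. poly (p i) t * (poly g t * (y * w i)))"
    proof -
      have "h * poly g t * (y * a) = (h * a) * (poly g t * y)" by (simp only: ac_simps)
      also have "\<dots> = (\<Sum>i<n. poly (p i) t * (poly g t * (y * w i)))"
        unfolding p(2) sum_distrib_right by (simp only: ac_simps)
      finally show ?thesis .
    qed
    also have "\<dots> = (\<Sum>i<n. \<Sum>j<n. poly (p i * r i j) t * w j)"
      by (intro sum.cong) (simp_all add: r(2) sum_distrib_left mult.assoc)
    also have "\<dots> = (\<Sum>j<n. \<Sum>i<n. poly (p i * r i j) t * w j)" by (rule sum.swap)
    also have "\<dots> = (\<Sum>j<n. poly (\<Sum>i<n. p i * r i j) t * w j)"
      by (simp add: poly_sum sum_distrib_right)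
    finally have eq: "h * poly g t * (y * a) = (\<Sum>j<n. poly (\<Sum>i<n. p i * r i j) t * w j)" .
    have coeffs: "(\<Sum>i<n. p i * r i j) \<in> kpl (l + l0)" if "j < n" for j
      unfolding kpl_def
    proof (safe intro!: kpol_sum kpol_mult degree_sum_le)
      fix i assume i: "i < n"
      show "p i \<in> kpol" "r i j \<in> kpol" using p(1) r(1)[OF i that] i by (auto simp: kpl_def)
      have "degree (p i * r i j) \<le> degree (p i) + degree (r i j)" by (rule degree_mult_le)
      also have "\<dots> \<le> l + l0" using p(1) r(1)[OF i that] i by (auto simp: kpl_def add_mono)
      finally show "degree (p i * r i j) \<le> l + l0" .
    qed
    show ?thesis unfolding ratspan_def
      by (rule CollectI, rule exI[of _ "\<lambda>j. \<Sum>i<n. p i * r i j"]) (simp add: coeffs eq)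
  qed
  have "growth y (n * D)"
  proof (rule growthI[OF tr])
    fix U :: "'f set" assume "finite U"
    then obtain gU l1 where gU: "gU \<in> kpol" "gU \<noteq> 0" "\<forall>u\<in>U. u \<in> ratspan t n w (poly gU t) l1"
      using common_denominator[OF assms] by blast
    have pw: "y ^ j * u \<in> ratspan t n w (poly (g ^ j * gU) t) (j * l0 + l1)" if "u \<in> U" for u j
    proof (induction j)
      case 0 then show ?case using gU(3) that by simp
    next
      case (Suc j)
      show ?case using step[OF Suc] by (simp add: algebra_simps)
    qed
    show "\<exists>C. \<forall>l. \<exists>g\<in>kpol. g \<noteq> 0 \<and> (\<forall>u\<in>U. \<forall>j\<le>l. y ^ j * u \<in> ratspan t n w (poly g t) (D * l + C))"
    proof (intro exI[of _ l1] allI bexI[of _ "g ^ l * gU" for l] conjI ballI impI)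
      fix l show "g ^ l * gU \<in> kpol" by (intro kpol_mult kpol_power g gU)
      show "g ^ l * gU \<noteq> 0" using g gU by simp
      fix u j assume uj: "u \<in> U" "j \<le> l"
      show "y ^ j * u \<in> ratspan t n w (poly (g ^ l * gU) t) (D * l + l1)"
      proof (rule ratspan_mult[OF pw[OF uj(1), of j], where p = "g ^ (l - j)"])
        show "g ^ (l - j) \<in> kpl (degree g * (l - j))"
          by (simp add: kpl_def kpol_power g degree_power_le)
        show "poly (g ^ l * gU) t * (y ^ j * u) = poly (g ^ (l - j)) t * (poly (g ^ j * gU) t * (y ^ j * u))"
          using uj(2) by (simp add: power_add[symmetric] mult.assoc[symmetric])
        have "j * l0 + degree g * (l - j) \<le> l * l0 + degree g * l"
          using uj(2) by (intro add_mono) auto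
        then show "j * l0 + l1 + degree g * (l - j) \<le> D * l + l1"
          by (simp add: D_def algebra_simps)
      qed
    qed
  qed
  then show ?thesis by blast
qed

section \<open>Independence over k[x] and the degree over k(x)\<close>

definition indep :: "'f \<Rightarrow> nat \<Rightarrow> (nat \<Rightarrow> 'f) \<Rightarrow> bool" where
  "indep x m u \<longleftrightarrow> (\<forall>p. (\<forall>i<m. p i \<in> kpol) \<longrightarrow> (\<Sum>i<m. poly (p i) x * u i) = 0 \<longrightarrow> (\<forall>i<m. p i = 0))"

lemma indep_inj:
  assumes "indep x m u"
  shows "inj_on (\<lambda>p. \<Sum>i<m. poly (p i) x * u i) ({..<m} \<rightarrow>\<^sub>E kpl l)"
proof (rule inj_onI)
  fix p p' assume p: "p \<in> {..<m} \<rightarrow>\<^sub>E kpl l" "p' \<in> {..<m} \<rightarrow>\<^sub>E kpl l"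
    and eq: "(\<Sum>i<m. poly (p i) x * u i) = (\<Sum>i<m. poly (p' i) x * u i)"
  have "(\<Sum>i<m. poly (p i - p' i) x * u i) = 0"
    using eq by (simp add: algebra_simps sum_subtractf)
  moreover have "\<forall>i<m. p i - p' i \<in> kpol" using p by (auto simp: PiE_iff kpl_def intro!: kpol_diff)
  ultimately have "\<forall>i<m. p i - p' i = 0" using assms unfolding indep_def by meson
  then show "p = p'" using p by (intro ext) (metis PiE_E eq_iff_diff_eq_0 lessThan_iff)
qed

text \<open>The \<open>q^{m(l+1)}\<close> combinations of the \<open>x^j u_i\<close>, \<open>j \<le> l\<close>, are distinct; compare with \<open>q^{El+C}\<close> as \<open>l\<close> grows.\<close>

lemma indep_le_growth:
  assumes "indep x m u" "growth x E"
  shows "m \<le> E"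
proof -
  obtain C where C: "\<forall>l. \<exists>S. finite S \<and> card S \<le> q ^ (E * l + C) \<and> subspace_k S \<and>
     (\<forall>w\<in>u ` {..<m}. \<forall>j\<le>l. x ^ j * w \<in> S)"
    using assms(2) unfolding growth_def by (metis finite_imageI finite_lessThan)
  have "(real q ^ m) ^ l \<le> real q ^ C * (real q ^ E) ^ l" for l
  proof -
    obtain S where S: "finite S" "card S \<le> q ^ (E * l + C)" "subspace_k S" "\<forall>w\<in>u ` {..<m}. \<forall>j\<le>l. x ^ j * w \<in> S"
      using spec[OF C, of l] by (elim exE conjE) blast
    have sumS: "sum f A \<in> S" if "\<And>i. i \<in> A \<Longrightarrow> f i \<in> S" for f :: "nat \<Rightarrow> 'f" and A
      using that by (induction A rule: infinite_finite_induct) (use S(3) in \<open>auto simp: subspace_k_def\<close>)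
    have "(\<lambda>p. \<Sum>i<m. poly (p i) x * u i) ` ({..<m} \<rightarrow>\<^sub>E kpl l) \<subseteq> S"
    proof (safe intro!: sumS)
      fix p i assume p: "p \<in> {..<m} \<rightarrow>\<^sub>E kpl l" and i: "i < m"
      have pi: "p i \<in> kpol" "degree (p i) \<le> l" using p i by (auto simp: kpl_def)
      have "poly (p i) x * u i = (\<Sum>j\<le>degree (p i). coeff (p i) j * (x ^ j * u i))"
        by (simp add: poly_altdef sum_distrib_right mult.assoc)
      also have "\<dots> \<in> S" using pi S(3,4) i by (intro sumS) (auto simp: kpol_def subspace_k_def)
      finally show "poly (p i) x * u i \<in> S" .
    qed
    then have "card ((\<lambda>p. \<Sum>i<m. poly (p i) x * u i) ` ({..<m} \<rightarrow>\<^sub>E kpl l)) \<le> card S"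
      by (rule card_mono[OF S(1)])
    then have "card ({..<m} \<rightarrow>\<^sub>E kpl l) \<le> card S"
      by (simp only: card_image[OF indep_inj[OF assms(1)]])
    moreover have "card ({..<m} \<rightarrow>\<^sub>E kpl l) = (q ^ (l + 1)) ^ m"
      by (simp only: card_PiE[OF finite_lessThan] card_kpl prod_constant card_lessThan)
    ultimately have "(q ^ (l + 1)) ^ m \<le> q ^ (E * l + C)"
      using S(2) by linarith
    moreover have "(q ^ m) ^ l \<le> (q ^ (l + 1)) ^ m"
      using q_ge_2 by (simp add: power_mult[symmetric] algebra_simps)
    ultimately have "(q ^ m) ^ l \<le> q ^ C * (q ^ E) ^ l"
      by (simp add: power_mult[symmetric] power_add mult.commute)
    then have "real ((q ^ m) ^ l) \<le> real (q ^ C * (q ^ E) ^ l)" by (rule of_nat_mono)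
    then show ?thesis by simp
  qed
  then have "real q ^ m \<le> real q ^ E" using q_ge_2 by - (rule power_growth_le[where K = "real q ^ C"], simp_all)
  then show ?thesis using q_ge_2 by (simp add: power_increasing_iff)
qed

text \<open>A maximal family independent over k[x] also spans: adjoining any \<open>f\<close>
  produces a relation in which the coefficient of \<open>f\<close> cannot vanish, and that
  coefficient is a denominator for \<open>f\<close>. Maximal families exist because every growth
  rate bounds their size, and \<open>growth_poly\<close> for the variable itself turns the size into
  a growth rate.\<close>

lemma exists_basis:
  assumes "spanning t n w" "transc x"
  shows "\<exists>m u. indep x m u \<and> growth x m"
proof -
  obtain E where E: "growth x E" using growth_exists[OF assms(1)] by blast
  have i0: "\<exists>u. indep x 0 u" by (auto simp: indep_def)
  have bd: "\<forall>m. (\<exists>u. indep x m u) \<longrightarrow> m \<le> E" using indep_le_growth E by blast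
  obtain m where m: "\<exists>u. indep x m u" "\<forall>m'. (\<exists>u. indep x m' u) \<longrightarrow> m' \<le> m"
    using ex_has_greatest_nat[of "\<lambda>m. \<exists>u. indep x m u" 0 id "Suc E"] i0 bd by (force simp: less_Suc_eq_le)
  then obtain u where u: "indep x m u" by blast
  have "spanning x m u"
    unfolding spanning_def
  proof (intro conjI allI assms(2))
    fix f
    define u' where "u' = u(m := f)"
    have "\<not> indep x (Suc m) u'" using m(2) by auto
    then obtain p where p: "\<forall>i<Suc m. p i \<in> kpol" "(\<Sum>i<Suc m. poly (p i) x * u' i) = 0" "\<exists>i<Suc m. p i \<noteq> 0"
      unfolding indep_def by blast
    have eq: "(\<Sum>i<m. poly (p i) x * u i) + poly (p m) x * f = 0"
      using p(2) by (simp add: u'_def)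
    have pm: "p m \<noteq> 0"
    proof
      assume "p m = 0"
      then have "(\<Sum>i<m. poly (p i) x * u i) = 0" using eq by simp
      then have "\<forall>i<m. p i = 0" using u p(1) unfolding indep_def by (meson less_Suc_eq)
      then show False using p(3) \<open>p m = 0\<close> less_Suc_eq by auto
    qed
    have "f \<in> ratspan x m u (poly (p m) x) (\<Sum>i<m. degree (p i))"
      unfolding ratspan_def
    proof (intro CollectI exI[of _ "\<lambda>i. - p i"] conjI allI impI)
      show "poly (p m) x * f = (\<Sum>i<m. poly (- p i) x * u i)"
        using eq by (simp add: sum_negf eq_neg_iff_add_eq_0 add.commute)
      fix i assume i: "i < m"
      have "degree (p i) \<le> (\<Sum>i<m. degree (p i))" using i by (intro member_le_sum) auto
      then show "- p i \<in> kpl (\<Sum>i<m. degree (p i))" using p(1) i by (simp add: kpl_def kpol_uminus)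
    qed
    then show "\<exists>g\<in>kpol. g \<noteq> 0 \<and> (\<exists>l. f \<in> ratspan x m u (poly g x) l)"
      using pm p(1) by blast
  qed
  then have "growth (poly (monom 1 1) x) (m * degree (monom (1::'f) 1))"
    by (intro growth_poly kpol_monom one_k)
  then have "growth x m" by (simp add: degree_monom_eq poly_monom)
  then show ?thesis using u by blast
qed

text \<open>The coefficients are reversed with respect to a given length \<open>L\<close> instead of
  the degree, so that a whole relation can be multiplied by one power x^L.\<close>

lemma reverse_poly:
  assumes "p \<in> kpol" "x \<noteq> 0" "degree p \<le> L"
  shows "\<exists>p'\<in>kpol. poly p' x = x ^ L * poly p (inverse x) \<and> (p' = 0 \<longrightarrow> p = 0)"
proof (intro bexI conjI impI)
  let ?p' = "\<Sum>j\<le>L. monom (coeff p j) (L - j)"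
  show "?p' \<in> kpol" using assms(1) by (intro kpol_sum kpol_monom) (simp add: kpol_def)
  have "poly ?p' x = (\<Sum>j\<le>L. coeff p j * x ^ (L - j))" by (simp add: poly_sum poly_monom)
  also have "\<dots> = (\<Sum>j\<le>L. x ^ L * (coeff p j * inverse x ^ j))"
    using assms(2) by (intro sum.cong) (auto simp: power_diff field_simps)
  also have "\<dots> = x ^ L * poly p (inverse x)"
  proof -
    have "poly p (inverse x) = (\<Sum>j\<le>L. coeff p j * inverse x ^ j)"
      unfolding poly_altdef using assms(3)
      by (intro sum.mono_neutral_left) (auto simp: coeff_eq_0)
    then show ?thesis by (simp add: sum_distrib_left)
  qed
  finally show "poly ?p' x = x ^ L * poly p (inverse x)" .
  assume 0: "?p' = 0"
  show "p = 0"
  proof (rule poly_eqI)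
    fix j
    show "coeff p j = coeff 0 j"
    proof (cases "j \<le> L")
      case True
      have "coeff ?p' (L - j) = (\<Sum>i\<le>L. if i = j then coeff p i else 0)"
        unfolding coeff_sum using True by (intro sum.cong) (auto simp: eq_diff_iff)
      then show ?thesis using 0 True by simp
    next
      case False then show ?thesis using assms(3) by (simp add: coeff_eq_0)
    qed
  qed
qed

lemma indep_inverse:
  assumes "indep x m u" "x \<noteq> 0"
  shows "indep (inverse x) m u"
  unfolding indep_def
proof (intro allI impI)
  fix p i assume p: "\<forall>i<m. p i \<in> kpol" "(\<Sum>i<m. poly (p i) (inverse x) * u i) = 0" and i: "i < m"
  define L where "L = (\<Sum>i<m. degree (p i))"
  have "\<forall>i<m. \<exists>p'\<in>kpol. poly p' x = x ^ L * poly (p i) (inverse x) \<and> (p' = 0 \<longrightarrow> p i = 0)"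
  proof (intro allI impI)
    fix i assume i: "i < m"
    have L: "degree (p i) \<le> L" unfolding L_def by (rule member_le_sum) (use i in auto)
    have "p i \<in> kpol" using p(1) i by blast
    from reverse_poly[OF this assms(2) L] show "\<exists>p'\<in>kpol. poly p' x = x ^ L * poly (p i) (inverse x) \<and> (p' = 0 \<longrightarrow> p i = 0)" .
  qed
  then obtain p' where p': "\<And>i. i < m \<Longrightarrow> p' i \<in> kpol" "\<And>i. i < m \<Longrightarrow> poly (p' i) x = x ^ L * poly (p i) (inverse x)"
      "\<And>i. i < m \<Longrightarrow> p' i = 0 \<Longrightarrow> p i = 0" by metis
  have "(\<Sum>i<m. poly (p' i) x * u i) = x ^ L * (\<Sum>i<m. poly (p i) (inverse x) * u i)"
    by (simp add: p'(2) sum_distrib_left mult.assoc)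
  then have "(\<Sum>i<m. poly (p' i) x * u i) = 0" using p(2) by simp
  then show "p i = 0" using assms(1) p'(1,3) i unfolding indep_def by meson
qed

lemma transc_nonzero:
  assumes "transc x" shows "x \<noteq> 0"
proof
  assume "x = 0"
  then have "poly (monom 1 1) x = 0" by (simp add: poly_monom)
  then have "monom (1::'f) 1 = 0" using assms kpol_monom[OF one_k] unfolding transc_def by blast
  then show False by (simp add: monom_eq_0_iff)
qed

lemma transc_inverse:
  assumes "transc x" shows "transc (inverse x)"
  unfolding transc_def
proof (intro ballI impI)
  fix p assume p: "p \<in> kpol" "poly p (inverse x) = 0"
  obtain p' where "p' \<in> kpol" "poly p' x = x ^ degree p * poly p (inverse x)" "p' = 0 \<longrightarrow> p = 0"
    using reverse_poly[OF p(1) transc_nonzero[OF assms], of "degree p"] by blast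
  then show "p = 0" using assms p(2) unfolding transc_def by simp
qed

text \<open>\<open>m\<close> is the degree of the field over k(x) = k(1/x). Independence passes
  between \<open>x\<close> and its inverse, and each independent family is bounded by the growth
  rate of the other, so the two sizes agree.\<close>

lemma exists_degree:
  assumes "spanning t n w" "transc x"
  shows "\<exists>m u. indep x m u \<and> growth x m \<and> growth (inverse x) m"
proof -
  obtain m u where m: "indep x m u" "growth x m" using exists_basis[OF assms] by blast
  obtain m' u' where m': "indep (inverse x) m' u'" "growth (inverse x) m'"
    using exists_basis[OF assms(1) transc_inverse[OF assms(2)]] by blast
  have x0: "x \<noteq> 0" using transc_nonzero assms by blast
  have "m \<le> m'" using indep_le_growth[OF indep_inverse[OF m(1) x0] m'(2)] .
  moreover have "m' \<le> m" using indep_le_growth[OF indep_inverse[OF m'(1)] , of m] m(2) x0 by simp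
  ultimately show ?thesis using m m' by auto
qed

end

section \<open>Independence of places\<close>

lemma place_mult: "v \<in> places \<Longrightarrow> x \<noteq> 0 \<Longrightarrow> y \<noteq> 0 \<Longrightarrow> v (x * y) = v x + v y"
  by (auto simp: places_def discrete_valuation_def)

lemma place_0: "v \<in> places \<Longrightarrow> v 0 = 0"
  by (auto simp: places_def discrete_valuation_def)

lemma place_add: "v \<in> places \<Longrightarrow> x \<noteq> 0 \<Longrightarrow> y \<noteq> 0 \<Longrightarrow> x + y \<noteq> 0 \<Longrightarrow> min (v x) (v y) \<le> v (x + y)"
  by (auto simp: places_def discrete_valuation_def)

lemma place_uniformizer:
  assumes "v \<in> places" shows "\<exists>p. p \<noteq> 0 \<and> v p = 1"
proof -
  obtain p where "v p = 1" using assms by (auto simp: places_def discrete_valuation_def)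
  moreover have "p \<noteq> 0" using calculation place_0[OF assms] by auto
  ultimately show ?thesis by blast
qed

lemma place_1: "v \<in> places \<Longrightarrow> v 1 = 0"
  using place_mult[of v 1 1] by simp

lemma place_inverse:
  assumes "v \<in> places" shows "v (inverse x) = - v x"
proof (cases "x = 0")
  case False
  then show ?thesis using place_mult[OF assms, of x "inverse x"] place_1[OF assms] by simp
qed (simp add: place_0 assms)

lemma place_uminus:
  assumes "v \<in> places" shows "v (- x) = v x"
proof (cases "x = 0")
  case False
  have "2 * v (- 1) = 0" using place_mult[OF assms, of "-1" "-1"] place_1[OF assms] by simp
  then show ?thesis using place_mult[OF assms, of "-1" x] False by simp
qed simp

lemma place_power: "v \<in> places \<Longrightarrow> x \<noteq> 0 \<Longrightarrow> v (x ^ n) = int n * v x"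
  by (induction n) (auto simp: place_1 place_mult algebra_simps)

lemma place_prod:
  "v \<in> places \<Longrightarrow> (\<And>i. i \<in> A \<Longrightarrow> f i \<noteq> 0) \<Longrightarrow> v (prod f A) = (\<Sum>i\<in>A. v (f i))"
  by (induction A rule: infinite_finite_induct) (auto simp: place_1 place_mult)

lemma val_ge_0 [simp]: "val_ge v n 0"
  by (simp add: val_ge_def)

lemma val_ge_add:
  assumes "v \<in> places" "val_ge v n x" "val_ge v n y"
  shows "val_ge v n (x + y)"
proof (cases "x = 0 \<or> y = 0 \<or> x + y = 0")
  case False
  then have "min (v x) (v y) \<le> v (x + y)" using place_add[OF assms(1)] by blast
  moreover have "n \<le> v x" "n \<le> v y" using assms False by (auto simp: val_ge_def)
  ultimately show ?thesis unfolding val_ge_def by linarith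
next
  case True
  then show ?thesis using assms by (elim disjE) (simp_all add: val_ge_def)
qed

lemma val_ge_uminus: "v \<in> places \<Longrightarrow> val_ge v n (- x) \<longleftrightarrow> val_ge v n x"
  by (simp add: val_ge_def place_uminus)

lemma val_ge_diff: "v \<in> places \<Longrightarrow> val_ge v n x \<Longrightarrow> val_ge v n y \<Longrightarrow> val_ge v n (x - y)"
  using val_ge_add[of v n x "- y"] val_ge_uminus[of v n y] by simp

lemma val_ge_sum: "v \<in> places \<Longrightarrow> (\<And>i. i \<in> A \<Longrightarrow> val_ge v n (f i)) \<Longrightarrow> val_ge v n (sum f A)"
  by (induction A rule: infinite_finite_induct) (auto intro: val_ge_add)

lemma val_ge_mult: "v \<in> places \<Longrightarrow> val_ge v n x \<Longrightarrow> val_ge v m y \<Longrightarrow> val_ge v (n + m) (x * y)"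
  by (auto simp: val_ge_def place_mult)

lemma val_ge_mult_0: "v \<in> places \<Longrightarrow> val_ge v n x \<Longrightarrow> val_ge v 0 y \<Longrightarrow> val_ge v n (x * y)"
  using val_ge_mult[of v n x 0 y] by simp

lemma val_ge_mult_iff: "v \<in> places \<Longrightarrow> y \<noteq> 0 \<Longrightarrow> val_ge v n (x * y) \<longleftrightarrow> val_ge v (n - v y) x"
  by (auto simp: val_ge_def place_mult)

lemma val_ge_mono: "val_ge v n x \<Longrightarrow> m \<le> n \<Longrightarrow> val_ge v m x"
  by (auto simp: val_ge_def)

lemma val_ge_1: "v \<in> places \<Longrightarrow> val_ge v 0 1"
  by (simp add: val_ge_def place_1)

lemma val_ge_power: "v \<in> places \<Longrightarrow> val_ge v 0 x \<Longrightarrow> val_ge v 0 (x ^ n)"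
  by (induction n) (auto simp: val_ge_1 intro: val_ge_mult_0)

text \<open>The sharp form of the ultrametric inequality. The case \<open>y = 0\<close> is listed
  separately because \<open>v 0\<close> is the default value 0 and not infinity.\<close>

lemma place_add_strict:
  assumes "v \<in> places" "x \<noteq> 0" "y = 0 \<or> v x < v y"
  shows "x + y \<noteq> 0 \<and> v (x + y) = v x"
proof (cases "y = 0")
  case False
  then have lt: "v x < v y" using assms(3) by simp
  have ne: "x + y \<noteq> 0"
  proof
    assume "x + y = 0"
    then have "x = - y" by (simp add: eq_neg_iff_add_eq_0)
    then show False using lt place_uminus[OF assms(1)] by simp
  qed
  have "v x \<le> v (x + y)" using place_add[OF assms(1,2) False ne] lt by simp
  moreover have "min (v (x + y)) (v (- y)) \<le> v (x + y + - y)"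
    by (rule place_add[OF assms(1) ne]) (use False assms(2) in auto)
  ultimately show ?thesis using ne lt by (simp add: place_uminus assms(1))
qed (use assms in simp)

section \<open>Separation of places and weak approximation\<close>

lemma places_incomparable:
  assumes v: "v \<in> places" and w: "w \<in> places" and ne: "v \<noteq> w"
  shows "\<exists>a. a \<noteq> 0 \<and> 0 \<le> v a \<and> w a < 0"
proof (rule ccontr)
  assume "\<not> ?thesis"
  then have le: "\<And>a. a \<noteq> 0 \<Longrightarrow> 0 \<le> v a \<Longrightarrow> 0 \<le> w a" by force
  have unit: "w a = 0" if "a \<noteq> 0" "v a = 0" for a
    using le[of a] le[of "inverse a"] that by (simp add: place_inverse v w)
  obtain p where p: "p \<noteq> 0" "v p = 1" using place_uniformizer[OF v] by blast
  \<comment> \<open>Since units at \<open>v\<close> are units at \<open>w\<close>, dividing out a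
    power of the uniformizer \<open>p\<close> makes \<open>w\<close> proportional to
    \<open>v\<close> with factor \<open>w p\<close>. Both valuations take the value 1, which forces
    this factor to be 1.\<close>
  have wn: "w a = v a * w p" if "a \<noteq> 0" "0 \<le> v a" for a
  proof -
    have "v (a * inverse p ^ nat (v a)) = 0"
      using that p by (simp add: place_mult place_power place_inverse v)
    then have "w (a * inverse p ^ nat (v a)) = 0" using unit that p by simp
    then show ?thesis using that p by (simp add: place_mult place_power place_inverse w)
  qed
  have wa: "w a = v a * w p" if "a \<noteq> 0" for a
    using wn[of a] wn[of "inverse a"] that by (cases "0 \<le> v a") (auto simp: place_inverse v w)
  obtain p' where p': "p' \<noteq> 0" "w p' = 1" using place_uniformizer[OF w] by blast
  have "w p dvd 1" using wa[OF p'(1)] p'(2) by (metis dvd_triv_right)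
  moreover have "0 \<le> w p" using le[OF p(1)] p(2) by simp
  ultimately have "w p = 1" by auto
  then have "v a = w a" for a using wa[of a] by (cases "a = 0") (auto simp: place_0 v w)
  then show False using ne by auto
qed

lemma places_separate:
  assumes "v \<in> places" "w \<in> places" "v \<noteq> w"
  shows "\<exists>x. x \<noteq> 0 \<and> 0 < v x \<and> w x < 0"
proof -
  obtain a b where a: "a \<noteq> 0" "0 \<le> v a" "w a < 0" and b: "b \<noteq> 0" "0 \<le> w b" "v b < 0"
    using places_incomparable[OF assms] places_incomparable[OF assms(2,1)] assms(3) by auto
  have "v (a * inverse b) > 0 \<and> w (a * inverse b) < 0"
    using a b assms by (simp add: place_mult place_inverse)
  then show ?thesis using a b by (intro exI[of _ "a * inverse b"]) simp
qed

lemma places_separate_finite: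
  assumes "finite V" "V \<subseteq> places" "v \<in> places" "v \<notin> V"
  shows "\<exists>x. x \<noteq> 0 \<and> 0 < v x \<and> (\<forall>w\<in>V. w x < 0)"
  using assms(1,2,4)
proof (induction V)
  case empty
  then show ?case using place_uniformizer[OF assms(3)] by auto
next
  case (insert w V)
  obtain x where x: "x \<noteq> 0" "0 < v x" "\<forall>u\<in>V. u x < 0" using insert by auto
  have w: "w \<in> places" using insert by blast
  obtain y where y: "y \<noteq> 0" "0 < v y" "w y < 0"
    using places_separate[OF assms(3) w] insert by auto
  show ?case
  proof (cases "w x < 0")
    case True then show ?thesis using x by blast
  next
    case False
    \<comment> \<open>\<open>r\<close> exceeds all |u y|, so at each \<open>u\<close> in
      \<open>V\<close> the term \<open>x ^ r\<close> has the smaller valuation and decides the sum,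
      whereas at \<open>w\<close> the term \<open>y\<close> does: there \<open>w x\<close> is
      nonnegative.\<close>
    define r where "r = Suc (\<Sum>u\<in>V. nat \<bar>u y\<bar>)"
    have ur: "int r * u x < u y \<and> int r * u x < 0" if u: "u \<in> V" for u
    proof -
      have "nat \<bar>u y\<bar> \<le> (\<Sum>u\<in>V. nat \<bar>u y\<bar>)" by (rule member_le_sum) (use u insert in auto)
      then have "int r > \<bar>u y\<bar>" unfolding r_def by linarith
      moreover have "int r * u x \<le> int r * (-1)" using x(3) u by (intro mult_left_mono) auto
      ultimately show ?thesis by linarith
    qed
    let ?z = "y + x ^ r"
    have z: "?z \<noteq> 0 \<and> w ?z = w y"
      by (rule place_add_strict[OF w y(1)])
        (use x y False w in \<open>simp add: place_power\<close>, use y(3) in \<open>meson not_less mult_nonneg_nonneg of_nat_0_le_iff le_less_trans less_le_trans\<close>)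
    have "val_ge v 1 ?z"
    proof (rule val_ge_add[OF assms(3)])
      show "val_ge v 1 y" using y by (simp add: val_ge_def)
      have "int r * v x \<ge> 1 * 1" using x(2) by (intro mult_mono) (auto simp: r_def)
      then show "val_ge v 1 (x ^ r)" using x assms(3) by (simp add: val_ge_def place_power)
    qed
    then have "0 < v ?z" using z by (simp add: val_ge_def)
    moreover have "u ?z < 0" if u: "u \<in> V" for u
    proof -
      have up: "u \<in> places" using u insert by blast
      have "u (x ^ r + y) = u (x ^ r)"
        using place_add_strict[OF up, of "x ^ r" y] x(1) ur[OF u] by (simp add: place_power up)
      then show ?thesis using ur[OF u] x(1) by (simp add: place_power up add.commute)
    qed
    ultimately show ?thesis using z y(3) by auto
  qed
qed

text \<open>With \<open>x\<close> having a zero at \<open>v\<close> and poles at the other places, 1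
  / (1 + x^M) is close to 1 at \<open>v\<close> and close to 0 at the others.\<close>

lemma approx_idempotent:
  assumes "finite V" "V \<subseteq> places" "v \<in> V"
  shows "\<exists>e. val_ge v (int N) (e - 1) \<and> (\<forall>w\<in>V - {v}. val_ge w (int N) e)"
proof -
  have v: "v \<in> places" using assms by blast
  have V: "finite (V - {v})" "V - {v} \<subseteq> places" "v \<notin> V - {v}" using assms by auto
  obtain x where x: "x \<noteq> 0" "0 < v x" "\<forall>w\<in>V - {v}. w x < 0"
    using places_separate_finite[OF V(1,2) v V(3)] by blast
  define M where "M = Suc N"
  have v1: "1 + x ^ M \<noteq> 0 \<and> v (1 + x ^ M) = v 1"
    by (rule place_add_strict[OF v]) (use x v in \<open>auto simp: place_1 place_power M_def simp del: power_Suc\<close>)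
  let ?e = "inverse (1 + x ^ M)"
  have "(1 + x ^ M) * ?e = 1" using v1 by simp
  then have "?e - 1 = - (x ^ M * ?e)" by (simp add: algebra_simps)
  moreover have "val_ge v (int N) (x ^ M * ?e)"
  proof -
    have "int M * v x \<ge> int M * 1" using x(2) by (intro mult_left_mono) auto
    moreover have "v (x ^ M * ?e) = int M * v x"
      using x v1 v by (simp add: place_mult place_power place_inverse place_1)
    moreover have "int N \<le> int M" by (simp add: M_def)
    ultimately show ?thesis unfolding val_ge_def by linarith
  qed
  ultimately have "val_ge v (int N) (?e - 1)" by (simp only: val_ge_uminus[OF v])
  moreover have "val_ge w (int N) ?e" if w: "w \<in> V - {v}" for w
  proof -
    have wp: "w \<in> places" using w assms by blast
    have "w x < 0" using x(3) w by blast
    then have "int M * w x \<le> int M * (-1)" by (intro mult_left_mono) auto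
    then have le: "int M * w x \<le> - int M" by simp
    moreover have "int M > 0" by (simp add: M_def)
    ultimately have "w (x ^ M) < w 1" using x(1) by (simp add: place_power place_1 wp)
    then have "w (x ^ M + 1) = w (x ^ M)"
      using place_add_strict[OF wp, of "x ^ M" 1] x(1) by simp
    moreover have "w (x ^ M) = int M * w x" using x(1) by (simp add: place_power wp)
    ultimately have "w ?e = - (int M * w x)" by (simp add: place_inverse wp add.commute)
    moreover have "int N \<le> int M" by (simp add: M_def)
    ultimately show ?thesis using le unfolding val_ge_def by linarith
  qed
  ultimately show ?thesis by blast
qed

lemma weak_approximation:
  assumes "finite V" "V \<subseteq> places"
  shows "\<exists>f. \<forall>v\<in>V. val_ge v n (f - a v)"
proof -
  \<comment> \<open>\<open>N\<close> absorbs the worst pole of any \<open>a u\<close> at any place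
    of \<open>V\<close>, so that multiplying \<open>a u\<close> by an element of valuation at least
    \<open>N\<close> leaves valuation at least \<open>n\<close>.\<close>
  define N where "N = nat \<bar>n\<bar> + (\<Sum>w\<in>V. \<Sum>u\<in>V. nat \<bar>w (a u)\<bar>)"
  have N: "n \<le> int N + w (a u)" if "w \<in> V" "u \<in> V" for w u
  proof -
    have "nat \<bar>w (a u)\<bar> \<le> (\<Sum>u\<in>V. nat \<bar>w (a u)\<bar>)" by (rule member_le_sum) (use that assms in auto)
    also have "\<dots> \<le> (\<Sum>w\<in>V. \<Sum>u\<in>V. nat \<bar>w (a u)\<bar>)"
      by (rule member_le_sum[of w V "\<lambda>w. \<Sum>u\<in>V. nat \<bar>w (a u)\<bar>"]) (use that assms in auto)
    finally show ?thesis unfolding N_def by linarith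
  qed
  obtain e where e: "\<And>v. v \<in> V \<Longrightarrow> val_ge v (int N) (e v - 1) \<and> (\<forall>w\<in>V - {v}. val_ge w (int N) (e v))"
    using approx_idempotent[OF assms, of _ N] by metis
  have small: "val_ge w n (b * a u)" if "w \<in> V" "u \<in> V" "val_ge w (int N) b" for w u b
  proof (cases "a u = 0")
    case False
    have wp: "w \<in> places" using that assms by blast
    show ?thesis using val_ge_mono[OF that(3), of "n - w (a u)"] N[OF that(1,2)] False
      by (simp add: val_ge_mult_iff wp)
  qed simp
  have "val_ge w n ((\<Sum>u\<in>V. e u * a u) - a w)" if w: "w \<in> V" for w
  proof -
    have wp: "w \<in> places" using w assms by blast
    have "(\<Sum>u\<in>V. e u * a u) - a w = (e w - 1) * a w + (\<Sum>u\<in>V - {w}. e u * a u)"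
      using sum.remove[OF assms(1) w, of "\<lambda>u. e u * a u"] by (simp add: algebra_simps)
    moreover have "val_ge w n ((e w - 1) * a w + (\<Sum>u\<in>V - {w}. e u * a u))"
      using e w by (intro val_ge_add val_ge_sum wp small) auto
    ultimately show ?thesis by simp
  qed
  then show ?thesis by blast
qed

text \<open>Each digit is 0 or a unit, so the first nonzero digit determines the valuation of the
  sum and would make it less than \<open>n\<close>.\<close>

lemma digits_zero:
  assumes v: "v \<in> places" "p \<noteq> 0" "v p = 1"
    and d: "\<And>i. i < n \<Longrightarrow> d i \<noteq> 0 \<Longrightarrow> v (d i) = 0"
    and ge: "val_ge v (int n) (\<Sum>i<n. d i * p ^ i)"
  shows "\<forall>i<n. d i = 0"
proof (rule ccontr)
  assume "\<not> (\<forall>i<n. d i = 0)"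
  then obtain i0 where i0: "i0 < n" "d i0 \<noteq> 0" "\<And>i. i < i0 \<Longrightarrow> \<not> (i < n \<and> d i \<noteq> 0)"
    using exists_least_iff[of "\<lambda>i. i < n \<and> d i \<noteq> 0"] by blast
  have tm: "val_ge v (int i) (d i * p ^ i)" if "i < n" for i
    using d[OF that] v by (cases "d i = 0") (auto simp: val_ge_def place_mult place_power)
  have rest: "val_ge v (int i0 + 1) (\<Sum>i\<in>{..<n} - {i0}. d i * p ^ i)"
  proof (rule val_ge_sum[OF v(1)])
    fix i assume i: "i \<in> {..<n} - {i0}"
    show "val_ge v (int i0 + 1) (d i * p ^ i)"
    proof (cases "i < i0")
      case True then show ?thesis using i0(3)[OF True] i by simp
    next
      case False then show ?thesis using val_ge_mono[OF tm[of i]] i by simp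
    qed
  qed
  have "(\<Sum>i<n. d i * p ^ i) = d i0 * p ^ i0 + (\<Sum>i\<in>{..<n} - {i0}. d i * p ^ i)"
    using i0(1) by (intro sum.remove) auto
  then have "d i0 * p ^ i0 = (\<Sum>i<n. d i * p ^ i) - (\<Sum>i\<in>{..<n} - {i0}. d i * p ^ i)" by simp
  moreover have "val_ge v (int i0 + 1) \<dots>"
    by (rule val_ge_diff[OF v(1) val_ge_mono[OF ge] rest]) (use i0 in simp)
  ultimately have "val_ge v (int i0 + 1) (d i0 * p ^ i0)" by simp
  then show False using i0 d v by (simp add: val_ge_def place_mult place_power)
qed

section \<open>Residue fields\<close>

lemma residue_cosets:
  assumes "v \<in> places"
  shows "carrier ((ring_of_type_algebra\<lparr>carrier := {x. val_ge v 0 x}\<rparr>) Quot {x. val_ge v 1 x})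
    = (\<lambda>a. {b. val_ge v 1 (b - a)}) ` {a. val_ge v 0 a}"
proof -
  have "(\<Union>h\<in>{x. val_ge v 1 x}. {h + a}) = {b. val_ge v 1 (b - a)}" for a
  proof safe
    fix b assume "val_ge v 1 (b - a)"
    then show "b \<in> (\<Union>h\<in>{x. val_ge v 1 x}. {h + a})" by (intro UN_I[of "b - a"]) auto
  qed simp
  then show ?thesis
    by (auto simp: FactRing_def A_RCOSETS_def RCOSETS_def r_coset_def ring_of_type_algebra_def)
qed

lemma coset_eq_iff:
  assumes "v \<in> places"
  shows "{b. val_ge v 1 (b - a)} = {b. val_ge v 1 (b - a')} \<longleftrightarrow> val_ge v 1 (a - a')"
proof
  assume "{b. val_ge v 1 (b - a)} = {b. val_ge v 1 (b - a')}"
  moreover have "a \<in> {b. val_ge v 1 (b - a)}" by simp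
  ultimately show "val_ge v 1 (a - a')" by blast
next
  assume a: "val_ge v 1 (a - a')"
  have "val_ge v 1 (b - a) \<longleftrightarrow> val_ge v 1 (b - a')" for b
    using val_ge_add[OF assms _ a, of "b - a"] val_ge_diff[OF assms _ a, of "b - a'"] by auto
  then show "{b. val_ge v 1 (b - a)} = {b. val_ge v 1 (b - a')}" by blast
qed

text \<open>Completeness is not demanded: a bound for incomplete systems is what first shows the
  residue field to be finite.\<close>

definition residue_system :: "('f::field \<Rightarrow> int) \<Rightarrow> 'f set \<Rightarrow> bool" where
  "residue_system v R \<longleftrightarrow> finite R \<and> (\<forall>a\<in>R. val_ge v 0 a) \<and> (\<forall>a\<in>R. \<forall>b\<in>R. a \<noteq> b \<longrightarrow> \<not> val_ge v 1 (a - b))"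

context constant_field
begin

text \<open>Approximation gives an element \<open>f c\<close> integral on \<open>Z\<close> for each choice \<open>c\<close> of expansion digits, pairwise incongruent
  modulo \<open>x\<close>.  The sums of \<open>x^j f c\<^sub>j\<close>, \<open>j \<le> l\<close>, are then distinct; let \<open>l\<close> grow.\<close>

lemma zeros_bound_systems:
  assumes gr: "growth x E" and x0: "x \<noteq> 0" and fin: "finite Z"
    and Z: "Z \<subseteq> places" "\<And>v. v \<in> Z \<Longrightarrow> 0 < v x"
    and R: "\<And>v. v \<in> Z \<Longrightarrow> residue_system v (R v)"
  shows "(\<Prod>v\<in>Z. card (R v) ^ nat (v x)) \<le> q ^ E"
proof -
  define I where "I = Sigma Z (\<lambda>v. {..<nat (v x)})"
  define C where "C = PiE I (\<lambda>i. R (fst i))"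
  have finI: "finite I" using fin by (simp add: I_def)
  have finC: "finite C" unfolding C_def
    by (rule finite_PiE[OF finI]) (use R in \<open>auto simp: I_def residue_system_def\<close>)
  have cardC: "card C = (\<Prod>v\<in>Z. card (R v) ^ nat (v x))"
  proof -
    have "card C = (\<Prod>i\<in>I. card (R (fst i)))" unfolding C_def by (rule card_PiE[OF finI])
    also have "\<dots> = (\<Prod>(v, i)\<in>I. card (R v))" by (simp add: case_prod_unfold)
    also have "\<dots> = (\<Prod>v\<in>Z. \<Prod>i<nat (v x). card (R v))"
      unfolding I_def by (rule prod.Sigma[symmetric]) (use fin in auto)
    finally show ?thesis by simp
  qed
  have "\<forall>v\<in>Z. \<exists>p. p \<noteq> 0 \<and> v p = 1" using place_uniformizer Z by blast
  then obtain p where p: "\<And>v. v \<in> Z \<Longrightarrow> p v \<noteq> 0 \<and> v (p v) = 1" by metis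
  define a where "a c v = (\<Sum>i<nat (v x). c (v, i) * p v ^ i)" for c v
  define n where "n = (\<Sum>v\<in>Z. \<bar>v x\<bar>)"
  have n: "v x \<le> n" if "v \<in> Z" for v
  proof -
    have "\<bar>v x\<bar> \<le> n" unfolding n_def by (rule member_le_sum) (use that fin in auto)
    then show ?thesis by simp
  qed
  have "\<forall>c. \<exists>f. \<forall>v\<in>Z. val_ge v n (f - a c v)" using weak_approximation[OF fin Z(1)] by blast
  then obtain f where f: "\<And>c v. v \<in> Z \<Longrightarrow> val_ge v n (f c - a c v)" by metis
  have f': "val_ge v (v x) (f c - a c v)" if "v \<in> Z" for c v using val_ge_mono[OF f[OF that] n[OF that]] .
  define A where "A = {y. \<forall>v\<in>Z. val_ge v 0 y}"
  have Rc: "val_ge v 0 (c (v, i))" if "c \<in> C" "v \<in> Z" "i < nat (v x)" for c v i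
    using that R unfolding C_def I_def residue_system_def by (auto dest!: PiE_mem[where x = "(v, i)"])
  have fA: "f c \<in> A" if c: "c \<in> C" for c
    unfolding A_def
  proof safe
    fix v assume v: "v \<in> Z"
    have vp: "v \<in> places" using v Z by blast
    have "val_ge v 0 (a c v)"
      unfolding a_def using p[OF v] by (intro val_ge_sum val_ge_mult_0 val_ge_power vp Rc[OF c v]) (auto simp: val_ge_def)
    moreover have "val_ge v 0 (f c - a c v)"
      by (rule val_ge_mono[OF f'[OF v]]) (use Z(2)[OF v] in simp)
    ultimately show "val_ge v 0 (f c)" using val_ge_add[OF vp, of 0 "f c - a c v" "a c v"] by simp
  qed
  \<comment> \<open>The difference of the two expansions is divisible by \<open>x\<close> at each
    \<open>v\<close> in \<open>Z\<close>, hence by the power v x of the uniformizer;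
    \<open>digits_zero\<close> then equates all digits.\<close>
  have inj: "c = c'" if c: "c \<in> C" "c' \<in> C" and y: "y \<in> A" "f c - f c' = x * y" for c c' y
  proof -
    have eq: "c (v, i) = c' (v, i)" if v: "v \<in> Z" and i: "i < nat (v x)" for v i
    proof -
      have vp: "v \<in> places" using v Z by blast
      note x0 = x0 Z(2)[OF v]
      have vy: "val_ge v (v x) (f c - f c')"
        using y v x0 by (auto simp: A_def mult.commute[of x] val_ge_mult_iff vp)
      have "val_ge v (v x) (f c - f c' - (f c - a c v) + (f c' - a c' v))"
        by (intro val_ge_add val_ge_diff vp vy f'[OF v])
      then have "val_ge v (v x) (a c v - a c' v)" by simp
      moreover have "a c v - a c' v = (\<Sum>i<nat (v x). (c (v, i) - c' (v, i)) * p v ^ i)"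
        by (simp add: a_def sum_subtractf algebra_simps)
      ultimately have "val_ge v (int (nat (v x))) (\<Sum>i<nat (v x). (c (v, i) - c' (v, i)) * p v ^ i)"
        using x0 by simp
      moreover have "v (c (v, i) - c' (v, i)) = 0" if "i < nat (v x)" "c (v, i) - c' (v, i) \<noteq> 0" for i
      proof -
        have "c (v, i) \<in> R v" "c' (v, i) \<in> R v"
          using c that v unfolding C_def I_def by (auto dest!: PiE_mem[where x = "(v, i)"])
        then have "\<not> val_ge v 1 (c (v, i) - c' (v, i))" "val_ge v 0 (c (v, i) - c' (v, i))"
          using R[OF v] that unfolding residue_system_def by (auto intro!: val_ge_diff vp)
        then show ?thesis using that(2) by (auto simp: val_ge_def)
      qed
      ultimately have "\<forall>i<nat (v x). c (v, i) - c' (v, i) = 0"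
        using p[OF v] by (intro digits_zero[OF vp, of "p v"]) auto
      then show ?thesis using i by simp
    qed
    show ?thesis
      by (rule PiE_ext[OF c[unfolded C_def]]) (auto simp: I_def eq)
  qed
  have A_add: "a + b \<in> A" if "a \<in> A" "b \<in> A" for a b using that Z unfolding A_def by (auto intro!: val_ge_add)
  have A_diff: "a - b \<in> A" if "a \<in> A" "b \<in> A" for a b using that Z unfolding A_def by (auto intro!: val_ge_diff)
  have A_mult: "x * b \<in> A" if "b \<in> A" for b
  proof -
    have "val_ge v 0 (x * b)" if v: "v \<in> Z" for v
    proof -
      have "val_ge v 0 b" "v \<in> places" "val_ge v 0 x"
        using \<open>b \<in> A\<close> v Z(1) Z(2)[OF v] by (auto simp: A_def val_ge_def)
      then show ?thesis by (simp add: val_ge_mult_0)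
    qed
    then show ?thesis by (simp add: A_def)
  qed
  \<comment> \<open>Sums of x^j f(c_j) in Horner form, so that injectivity follows by peeling off
    one \<open>f c\<close> modulo \<open>x\<close> at each level.\<close>
  define T where "T = rec_nat (f ` C) (\<lambda>_ S. (\<lambda>(u, s). u + x * s) ` (f ` C \<times> S))"
  have T0: "T 0 = f ` C" and TS: "T (Suc l) = (\<lambda>(u, s). u + x * s) ` (f ` C \<times> T l)" for l
    by (simp_all add: T_def)
  have "0 \<in> A" by (simp add: A_def)
  have injf: "inj_on f C" by (intro inj_onI) (use inj[OF _ _ \<open>0 \<in> A\<close>] in simp)
  have T: "finite (T l) \<and> T l \<subseteq> A \<and> card (T l) = card C ^ (l + 1)" for l
  proof (induction l)
    case 0
    then show ?case using fA finC card_image[OF injf] by (auto simp: T0)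
  next
    case (Suc l)
    have "inj_on (\<lambda>(u, s). u + x * s) (f ` C \<times> T l)"
    proof (rule inj_onI, clarify)
      fix c s c' s' assume c: "c \<in> C" "c' \<in> C" and s: "s \<in> T l" "s' \<in> T l" and eq: "f c + x * s = f c' + x * s'"
      have "f c - f c' = x * (s' - s)" using eq by (simp add: algebra_simps)
      then have cc: "c = c'" using inj[OF c] A_diff Suc s by blast
      show "f c = f c' \<and> s = s'" using cc eq x0 by simp
    qed
    then have "card (T (Suc l)) = card (f ` C) * card (T l)"
      by (simp add: TS card_image card_cartesian_product)
    moreover have "T (Suc l) \<subseteq> A" using Suc fA A_add A_mult by (auto simp: TS)
    ultimately show ?case using Suc finC by (simp add: TS card_image[OF injf])
  qed
  obtain K where K: "\<forall>l. \<exists>S. finite S \<and> card S \<le> q ^ (E * l + K) \<and> subspace_k S \<and>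
     (\<forall>u\<in>f ` C. \<forall>j\<le>l. x ^ j * u \<in> S)"
    using gr finC unfolding growth_def by (elim allE[of _ "f ` C"]) auto
  have "real (card C) ^ l \<le> real q ^ K * (real q ^ E) ^ l" for l
  proof -
    obtain S where S: "finite S" "card S \<le> q ^ (E * l + K)" "subspace_k S" "\<forall>u\<in>f ` C. \<forall>j\<le>l. x ^ j * u \<in> S"
      using spec[OF K, of l] by (elim exE conjE)
    have TS': "i + j \<le> l \<Longrightarrow> s \<in> T j \<Longrightarrow> x ^ i * s \<in> S" for i j s
    proof (induction j arbitrary: i s)
      case 0 then show ?case using S(4) by (auto simp: T0)
    next
      case (Suc j)
      obtain u s' where us: "u \<in> f ` C" "s' \<in> T j" "s = u + x * s'" using Suc.prems(2) by (auto simp: TS)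
      have "x ^ Suc i * s' \<in> S" by (rule Suc.IH) (use Suc.prems us in auto)
      moreover have "x ^ i * u \<in> S" using S(4) us Suc.prems by auto
      moreover have "x ^ i * s = x ^ i * u + x ^ Suc i * s'" by (simp add: us algebra_simps)
      ultimately show ?case using S(3) by (simp only: subspace_k_def)
    qed
    have "T l \<subseteq> S" using TS'[of 0 l] by auto
    then have "card (T l) \<le> card S" by (rule card_mono[OF S(1)])
    then have "card C ^ (l + 1) \<le> q ^ (E * l + K)" using T[of l] S(2) by linarith
    then have "card C ^ l \<le> q ^ K * (q ^ E) ^ l"
    proof (cases "card C = 0")
      case True then show ?thesis using q_ge_2 by (cases l) auto
    next
      case False
      then have "card C ^ l \<le> card C ^ (l + 1)" by simp
      also have "\<dots> \<le> q ^ (E * l + K)" by fact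
      finally show ?thesis by (simp add: power_add power_mult mult.commute)
    qed
    then have "real (card C ^ l) \<le> real (q ^ K * (q ^ E) ^ l)" by (rule of_nat_mono)
    then show ?thesis by simp
  qed
  then have "real (card C) \<le> real q ^ E"
    by - (rule power_growth_le[where K = "real q ^ K"], use q_ge_2 in simp_all)
  then have "card C \<le> q ^ E" by (simp flip: of_nat_power)
  then show ?thesis by (simp add: cardC)
qed

end

section \<open>Places of a global function field\<close>

locale global_function_field = constant_field k for k :: "'f::field set" +
  assumes spanning_exists: "\<exists>t n w. spanning t n w"
    and algebraic_constants: "\<And>x. \<not> transc x \<Longrightarrow> x \<in> k"
begin

lemma growth_ex: "\<exists>E. growth y E"
  using spanning_exists growth_exists by blast

text \<open>A nonzero constant has only finitely many distinct powers, so two different multiples of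
  its valuation agree.\<close>

lemma place_const:
  assumes v: "v \<in> places" and c: "c \<in> k"
  shows "v c = 0"
proof (cases "c = 0")
  case False
  have "\<not> inj_on (\<lambda>n::nat. c ^ n) UNIV"
  proof
    assume "inj_on (\<lambda>n::nat. c ^ n) UNIV"
    moreover have "range (\<lambda>n::nat. c ^ n) \<subseteq> k"
    proof safe
      fix n show "c ^ n \<in> k" by (induction n) (auto simp: one_k c mult_k)
    qed
    ultimately show False using finite_k by (meson finite_imageD finite_subset infinite_UNIV_nat)
  qed
  then obtain m n :: nat where mn: "c ^ m = c ^ n" "m \<noteq> n" by (auto simp: inj_on_def)
  then have "int m * v c = int n * v c" using place_power[OF v False] by metis
  then show ?thesis using mn(2) by simp
qed (simp add: place_0 v)

text \<open>A uniformizer at \<open>v\<close> has some growth rate \<open>E\<close>; applied to the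
  single zero \<open>v\<close> of order 1, the bound on zeros becomes a bound on \<open>R\<close>
  itself.\<close>

lemma residue_system_bound:
  fixes v :: "'f \<Rightarrow> int"
  assumes v: "v \<in> places"
  shows "\<exists>B. \<forall>R. residue_system v R \<longrightarrow> card R \<le> B"
proof -
  obtain p where p: "p \<noteq> 0" "v p = 1" using place_uniformizer[OF v] by blast
  obtain E where E: "growth p E" using growth_ex by blast
  have "card R \<le> q ^ E" if "residue_system v R" for R
    using zeros_bound_systems[OF E p(1), of "{v}" "\<lambda>_. R"] v p that by simp
  then show ?thesis by blast
qed

text \<open>Representatives of finitely many residue classes form a residue system, so the uniform
  bound makes the residue field finite; all classes together then give a complete system.\<close>

lemma residue_reps:
  fixes v :: "'f \<Rightarrow> int"
  assumes v: "v \<in> places"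
  shows "\<exists>R. residue_system v R \<and> card R = residue_size v \<and> (\<forall>a. val_ge v 0 a \<longrightarrow> (\<exists>r\<in>R. val_ge v 1 (a - r)))"
proof -
  define f where "f a = {b. val_ge v 1 (b - a)}" for a
  define Q where "Q = f ` {a. val_ge v 0 a}"
  have "\<forall>C\<in>Q. \<exists>a. val_ge v 0 a \<and> C = f a" by (auto simp: Q_def)
  then obtain g where g: "\<And>C. C \<in> Q \<Longrightarrow> val_ge v 0 (g C) \<and> C = f (g C)" by metis
  have injg: "inj_on g Q" by (rule inj_onI) (use g in metis)
  have sys: "residue_system v (g ` S)" if S: "finite S" "S \<subseteq> Q" for S
    unfolding residue_system_def
  proof (intro conjI ballI impI)
    fix a b assume ab: "a \<in> g ` S" "b \<in> g ` S" "a \<noteq> b"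
    then obtain C D where CD: "C \<in> S" "D \<in> S" "a = g C" "b = g D" by blast
    then have "f a \<noteq> f b" using g[of C] g[of D] S ab(3) by (metis subsetD)
    then show "\<not> val_ge v 1 (a - b)" unfolding f_def by (simp add: coset_eq_iff[OF v])
  qed (use S g in auto)
  obtain B where B: "\<And>R. residue_system v R \<Longrightarrow> card R \<le> B" using residue_system_bound[OF v] by blast
  have finQ: "finite Q"
  proof (rule ccontr)
    assume "infinite Q"
    then obtain S where S: "S \<subseteq> Q" "finite S" "card S = Suc B" by (meson infinite_arbitrarily_large)
    have "card (g ` S) = card S" by (rule card_image) (rule inj_on_subset[OF injg S(1)])
    then show False using B[OF sys[OF S(2,1)]] S(3) by simp
  qed
  have "card (g ` Q) = residue_size v"
    unfolding card_image[OF injg] residue_size_def residue_cosets[OF v] by (simp add: Q_def f_def)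
  moreover have "\<exists>r\<in>g ` Q. val_ge v 1 (a - r)" if a: "val_ge v 0 a" for a
  proof -
    have fa: "f a \<in> Q" using a by (simp add: Q_def)
    then have "f a = f (g (f a))" using g by blast
    then have "{b. val_ge v 1 (b - a)} = {b. val_ge v 1 (b - g (f a))}" by (simp only: f_def)
    then have "val_ge v 1 (a - g (f a))" by (simp only: coset_eq_iff[OF v])
    then show ?thesis using fa by blast
  qed
  ultimately show ?thesis using sys[OF finQ] by blast
qed

lemma residue_size_ge_2:
  fixes v :: "'f \<Rightarrow> int"
  assumes v: "v \<in> places" shows "2 \<le> residue_size v"
proof -
  obtain R where R: "residue_system v R" "card R = residue_size v" "\<forall>a. val_ge v 0 a \<longrightarrow> (\<exists>r\<in>R. val_ge v 1 (a - r))"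
    using residue_reps[OF v] by blast
  obtain r0 r1 where r: "r0 \<in> R" "val_ge v 1 (0 - r0)" "r1 \<in> R" "val_ge v 1 (1 - r1)"
    using R(3) val_ge_1[OF v] val_ge_0[of v 0] by meson
  have "r0 \<noteq> r1"
  proof
    assume "r0 = r1"
    then have "val_ge v 1 (1 - r1 - (0 - r0) )" using val_ge_diff[OF v r(4,2)] by simp
    then show False using \<open>r0 = r1\<close> by (simp add: val_ge_def place_1[OF v])
  qed
  then have "card {r0, r1} = 2" by simp
  then show ?thesis using card_mono[of R "{r0, r1}"] r R by (auto simp: residue_system_def)
qed

lemma zeros_bound:
  assumes "growth x E" "x \<noteq> 0" "finite Z" "Z \<subseteq> places" "\<And>v. v \<in> Z \<Longrightarrow> 0 < v x"
  shows "(\<Prod>v\<in>Z. residue_size v ^ nat (v x)) \<le> q ^ E"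
proof -
  have "\<forall>v\<in>Z. \<exists>R. residue_system v R \<and> card R = residue_size v" using residue_reps assms(4) by blast
  then obtain R where R: "\<And>v. v \<in> Z \<Longrightarrow> residue_system v (R v) \<and> card (R v) = residue_size v" by metis
  have "(\<Prod>v\<in>Z. card (R v) ^ nat (v x)) \<le> q ^ E"
    by (rule zeros_bound_systems[OF assms(1-4)]) (use assms(5) R in auto)
  moreover have "(\<Prod>v\<in>Z. card (R v) ^ nat (v x)) = (\<Prod>v\<in>Z. residue_size v ^ nat (v x))"
    by (rule prod.cong) (use R in auto)
  ultimately show ?thesis by simp
qed

lemma card_zeros_bound:
  assumes "growth x E" "x \<noteq> 0" "finite Z" "Z \<subseteq> places" "\<And>v. v \<in> Z \<Longrightarrow> 0 < v x"
  shows "2 ^ card Z \<le> q ^ E"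
proof -
  have "(\<Prod>v\<in>Z. 2::nat) \<le> (\<Prod>v\<in>Z. residue_size v ^ nat (v x))"
  proof (rule prod_mono, safe)
    fix v assume v: "v \<in> Z"
    have "v \<in> places" using v assms(4) by blast
    then have "2 \<le> residue_size v" by (rule residue_size_ge_2)
    moreover have "residue_size v ^ 1 \<le> residue_size v ^ nat (v x)"
      using assms(5)[OF v] calculation by (intro power_increasing) auto
    ultimately show "2 \<le> residue_size v ^ nat (v x)" by simp
  qed
  moreover have "(\<Prod>v\<in>Z. residue_size v ^ nat (v x)) \<le> q ^ E"
    by (rule zeros_bound[OF assms(1-4)]) (rule assms(5))
  ultimately show ?thesis by simp
qed

lemma finite_zeros:
  fixes x :: 'f
  assumes "x \<noteq> 0" shows "finite {v \<in> places. 0 < v x}"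
proof (rule ccontr)
  assume inf: "infinite {v \<in> places. 0 < v x}"
  obtain E where E: "growth x E" using growth_ex by blast
  \<comment> \<open>With \<open>q ^ E\<close> zeros the bound would read 2^N <= N for N =
    q^E.\<close>
  obtain Z where Z: "Z \<subseteq> {v \<in> places. 0 < v x}" "finite Z" "card Z = q ^ E"
    using infinite_arbitrarily_large[OF inf] by blast
  have "2 ^ card Z \<le> q ^ E" by (rule card_zeros_bound[OF E assms Z(2)]) (use Z in auto)
  then show False using Z(3) less_exp[of "q ^ E"] by simp
qed

lemma finite_support:
  fixes x :: 'f
  assumes "x \<noteq> 0" shows "finite {v \<in> places. v x \<noteq> 0}"
proof -
  have "{v \<in> places. v x \<noteq> 0} \<subseteq> {v \<in> places. 0 < v x} \<union> {v \<in> places. 0 < v (inverse x)}"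
    by (auto simp: place_inverse)
  moreover have "finite ({v \<in> places. 0 < v x} \<union> {v \<in> places. 0 < v (inverse x)})"
    using finite_zeros[of x] finite_zeros[of "inverse x"] assms by simp
  ultimately show ?thesis by (rule finite_subset)
qed

text \<open>A maximal subring containing \<open>k\<close> and \<open>x\<close> but not \<open>1/x\<close> is the valuation ring of a place where \<open>x\<close> vanishes.\<close>

definition subalgebras :: "'f \<Rightarrow> 'f set set" where
  "subalgebras x = {R. k \<subseteq> R \<and> x \<in> R \<and> inverse x \<notin> R \<and> (\<forall>a\<in>R. \<forall>b\<in>R. a - b \<in> R \<and> a * b \<in> R)}"

lemma subalgebras_closed:
  assumes "R \<in> subalgebras x"
  shows "0 \<in> R" "1 \<in> R" "a \<in> R \<Longrightarrow> - a \<in> R" "a \<in> R \<Longrightarrow> b \<in> R \<Longrightarrow> a + b \<in> R"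
    "a \<in> R \<Longrightarrow> b \<in> R \<Longrightarrow> a - b \<in> R" "a \<in> R \<Longrightarrow> b \<in> R \<Longrightarrow> a * b \<in> R" "a \<in> R \<Longrightarrow> a ^ n \<in> R"
    "(\<And>i. i \<in> I \<Longrightarrow> g i \<in> R) \<Longrightarrow> sum g I \<in> R"
proof -
  have R: "k \<subseteq> R" "\<And>a b. a \<in> R \<Longrightarrow> b \<in> R \<Longrightarrow> a - b \<in> R \<and> a * b \<in> R"
    using assms by (auto simp: subalgebras_def)
  show 0: "0 \<in> R" and 1: "1 \<in> R" using R zero_k one_k by auto
  show um: "\<And>a. a \<in> R \<Longrightarrow> - a \<in> R" using R(2)[OF 0] by simp
  show add: "\<And>a b. a \<in> R \<Longrightarrow> b \<in> R \<Longrightarrow> a + b \<in> R" using R(2)[OF _ um] by simp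
  show "a \<in> R \<Longrightarrow> b \<in> R \<Longrightarrow> a - b \<in> R" "a \<in> R \<Longrightarrow> b \<in> R \<Longrightarrow> a * b \<in> R" using R(2) by auto
  show "a \<in> R \<Longrightarrow> a ^ n \<in> R" by (induction n) (use 1 R(2) in auto)
  show "(\<And>i. i \<in> I \<Longrightarrow> g i \<in> R) \<Longrightarrow> sum g I \<in> R"
    by (induction I rule: infinite_finite_induct) (use 0 add in auto)
qed

text \<open>k[x] does not contain 1/x: an identity 1/x = p(x) would make X p - 1 the zero
  polynomial, but its value at 0 is -1.\<close>

lemma subalgebras_nonempty:
  assumes "transc x" shows "(\<lambda>p. poly p x) ` kpol \<in> subalgebras x"
  unfolding subalgebras_def
proof (intro CollectI conjI ballI)
  show "k \<subseteq> (\<lambda>p. poly p x) ` kpol"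
  proof
    fix c assume "c \<in> k"
    then show "c \<in> (\<lambda>p. poly p x) ` kpol" by (intro image_eqI[of _ _ "[:c:]"]) (auto simp: kpol_const)
  qed
  show "x \<in> (\<lambda>p. poly p x) ` kpol"
    by (intro image_eqI[of _ _ "monom 1 1"]) (auto simp: poly_monom kpol_monom one_k)
  show "inverse x \<notin> (\<lambda>p. poly p x) ` kpol"
  proof
    assume "inverse x \<in> (\<lambda>p. poly p x) ` kpol"
    then obtain p where p: "p \<in> kpol" "inverse x = poly p x" by blast
    let ?r = "monom 1 1 * p - 1"
    have "poly ?r x = x * inverse x - 1" by (simp add: poly_monom p(2))
    also have "\<dots> = 0" using transc_nonzero[OF assms] by simp
    finally have "?r = 0" using assms p(1) unfolding transc_def
      by (meson kpol_1 kpol_diff kpol_monom kpol_mult one_k)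
    then have "poly ?r 0 = 0" by (simp only: poly_0)
    then show False by (simp add: poly_monom)
  qed
  fix a b assume "a \<in> (\<lambda>p. poly p x) ` kpol" "b \<in> (\<lambda>p. poly p x) ` kpol"
  then obtain p p' where p: "p \<in> kpol" "a = poly p x" "p' \<in> kpol" "b = poly p' x" by blast
  show "a - b \<in> (\<lambda>p. poly p x) ` kpol"
    by (rule image_eqI[of _ _ "p - p'"]) (simp_all add: p kpol_diff)
  show "a * b \<in> (\<lambda>p. poly p x) ` kpol"
    by (rule image_eqI[of _ _ "p * p'"]) (simp_all add: p kpol_mult)
qed

lemma maximal_subalgebra:
  assumes "transc x"
  shows "\<exists>R\<in>subalgebras x. \<forall>S\<in>subalgebras x. R \<subseteq> S \<longrightarrow> S = R"
proof (rule subset_Zorn_nonempty)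
  show "subalgebras x \<noteq> {}" using subalgebras_nonempty[OF assms] by blast
  fix C assume C: "C \<noteq> {}" "subset.chain (subalgebras x) C"
  have sub: "C \<subseteq> subalgebras x" using C(2) by (simp add: subset_chain_def)
  have tot: "A \<subseteq> B \<or> B \<subseteq> A" if "A \<in> C" "B \<in> C" for A B
    using C(2) that by (auto simp: subset_chain_def)
  show "\<Union> C \<in> subalgebras x"
    unfolding subalgebras_def
  proof (intro CollectI conjI)
    obtain A where "A \<in> C" "A \<in> subalgebras x" using C(1) sub by blast
    then show "k \<subseteq> \<Union> C" "x \<in> \<Union> C" by (auto simp: subalgebras_def)
    show "inverse x \<notin> \<Union> C" using sub by (auto simp: subalgebras_def)
    show "\<forall>a\<in>\<Union> C. \<forall>b\<in>\<Union> C. a - b \<in> \<Union> C \<and> a * b \<in> \<Union> C"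
    proof (intro ballI)
      fix a b assume "a \<in> \<Union> C" "b \<in> \<Union> C"
      then obtain A B where AB: "A \<in> C" "B \<in> C" "a \<in> A" "b \<in> B" by blast
      obtain D where D: "D \<in> C" "a \<in> D" "b \<in> D" using tot[OF AB(1,2)] AB by (metis subsetD)
      then have "a - b \<in> D \<and> a * b \<in> D" using sub by (auto simp: subalgebras_def)
      then show "a - b \<in> \<Union> C \<and> a * b \<in> \<Union> C" using D(1) by blast
    qed
  qed
qed

end

locale maximal_subalg = global_function_field k for k :: "'f::field set" +
  fixes x :: 'f and R :: "'f set"
  assumes tr: "transc x" and R: "R \<in> subalgebras x"
    and maximal: "\<And>S. S \<in> subalgebras x \<Longrightarrow> R \<subseteq> S \<Longrightarrow> S = R"
begin

section \<open>A maximal subring is a valuation ring\<close>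

lemmas closed = subalgebras_closed[OF R]

lemma kR: "k \<subseteq> R" and xR: "x \<in> R" and ixR: "inverse x \<notin> R"
  using R by (auto simp: subalgebras_def)

lemma x0: "x \<noteq> 0" using transc_nonzero[OF tr] .

definition Rpol :: "'f poly set" where "Rpol = {p. \<forall>i. coeff p i \<in> R}"

text \<open>R[y] properly contains \<open>R\<close>, so by maximality it is not in
  \<open>subalgebras x\<close>, and the only condition that can fail is the one on 1/x.\<close>

lemma adjoin:
  assumes "y \<notin> R"
  shows "\<exists>p\<in>Rpol. poly p y = inverse x"
proof (rule ccontr)
  assume neg: "\<not> ?thesis"
  let ?S = "(\<lambda>p. poly p y) ` Rpol"
  have c: "c \<in> ?S" if "c \<in> R" for c
    by (rule image_eqI[of _ _ "[:c:]"]) (use that in \<open>auto simp: Rpol_def coeff_pCons closed(1) split: nat.split\<close>)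
  have "?S \<in> subalgebras x"
    unfolding subalgebras_def
  proof (intro CollectI conjI ballI)
    show "k \<subseteq> ?S" "x \<in> ?S" using c kR xR by auto
    show "inverse x \<notin> ?S" using neg by force
    fix a b assume "a \<in> ?S" "b \<in> ?S"
    then obtain p p' where p: "p \<in> Rpol" "a = poly p y" "p' \<in> Rpol" "b = poly p' y" by blast
    show "a - b \<in> ?S"
      by (rule image_eqI[of _ _ "p - p'"]) (use p in \<open>auto simp: Rpol_def closed(5)\<close>)
    show "a * b \<in> ?S"
      by (rule image_eqI[of _ _ "p * p'"]) (use p in \<open>auto simp: Rpol_def coeff_mult intro!: closed(6,8)\<close>)
  qed
  then have "?S = R" using maximal c by blast
  moreover have "y \<in> ?S"
    by (rule image_eqI[of _ _ "[:0, 1:]"]) (auto simp: Rpol_def coeff_pCons closed(1,2) split: nat.split)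
  ultimately show False using assms by blast
qed

text \<open>Informally, \<open>x\<close> lies in the maximal ideal. If u = 1 - a x were not a unit,
  R[1/u] would contain 1/x by \<open>adjoin\<close>; clearing denominators puts u^m / x in
  \<open>R\<close>, and since u^m = 1 - b x, adding \<open>b\<close> puts 1/x itself in
  \<open>R\<close>.\<close>

lemma unit_one_minus:
  assumes a: "a \<in> R"
  shows "1 - a * x \<noteq> 0 \<and> inverse (1 - a * x) \<in> R"
proof (intro conjI)
  let ?u = "1 - a * x"
  show u0: "?u \<noteq> 0"
  proof
    assume "?u = 0"
    then have "inverse x = a" using x0 by (simp add: field_simps)
    then show False using a ixR by simp
  qed
  show "inverse ?u \<in> R"
  proof (rule ccontr)
    assume "inverse ?u \<notin> R"
    then obtain p where p: "p \<in> Rpol" "poly p (inverse ?u) = inverse x" using adjoin by blast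
    let ?m = "degree p"
    have uR: "?u \<in> R" using a xR closed by auto
    have pw: "\<exists>b\<in>R. ?u ^ n = 1 - b * x" for n
    proof (induction n)
      case 0 then show ?case by (intro bexI[of _ 0]) (auto simp: closed)
    next
      case (Suc n)
      then obtain b where b: "b \<in> R" "?u ^ n = 1 - b * x" by blast
      show ?case using a b closed xR by (intro bexI[of _ "a + b - a * b * x"]) (auto simp: b(2) algebra_simps)
    qed
    obtain b where b: "b \<in> R" "?u ^ ?m = 1 - b * x" using pw by blast
    have "?u ^ ?m * inverse x = (\<Sum>i\<le>?m. coeff p i * ?u ^ (?m - i))"
      unfolding p(2)[symmetric] poly_altdef sum_distrib_left using u0
      by (intro sum.cong) (auto simp: power_diff field_simps)
    also have "\<dots> \<in> R" using p(1) uR by (intro closed(8) closed(6) closed(7)) (auto simp: Rpol_def)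
    finally have "(1 - b * x) * inverse x \<in> R" by (simp add: b(2))
    then have "(1 - b * x) * inverse x + b \<in> R" using b(1) closed by blast
    moreover have "(1 - b * x) * inverse x + b = inverse x" using x0 by (simp add: field_simps)
    ultimately show False using ixR by simp
  qed
qed

text \<open>The relation for 1/f, multiplied by \<open>x\<close>, can be solved for 1 because 1
  minus \<open>x\<close> times the constant coefficient of \<open>p'\<close> is a unit. Multiplied
  by the n-th power of \<open>f\<close>, with n the degree of \<open>p\<close>, it expresses that
  power through lower ones, since \<open>p'\<close> has degree at most n. Substituting this for the
  leading power of \<open>p\<close> lowers the degree.\<close>

lemma reduce_degree:
  assumes p: "p \<in> Rpol" "poly p f = inverse x" and p': "p' \<in> Rpol" "poly p' (inverse f) = inverse x"
    and deg: "degree p' \<le> degree p" and f0: "f \<noteq> 0"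
  shows "\<exists>r\<in>Rpol. poly r f = inverse x \<and> degree r < degree p"
proof -
  let ?n = "degree p" let ?m = "degree p'"
  have n: "0 < ?n"
  proof (rule ccontr)
    assume "\<not> 0 < ?n"
    then obtain c where "p = [:c:]" by (metis degree_eq_zeroE gr0I)
    then show False using p ixR by (auto simp: Rpol_def coeff_pCons split: nat.splits)
  qed
  let ?u = "1 - coeff p' 0 * x"
  have u: "?u \<noteq> 0" "inverse ?u \<in> R" using unit_one_minus[of "coeff p' 0"] p'(1) by (auto simp: Rpol_def)
  define b where "b j = coeff p ?n * (inverse ?u * (x * coeff p' j))" for j
  have bR: "b j \<in> R" for j using p p' u xR unfolding b_def Rpol_def by (auto intro!: closed(6))
  let ?r = "(p - monom (coeff p ?n) ?n) + (\<Sum>j\<in>{1..?m}. monom (b j) (?n - j))"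
  have "?r \<in> Rpol" unfolding Rpol_def
  proof (intro CollectI allI)
    fix i
    have "coeff (p - monom (coeff p ?n) ?n) i \<in> R" using p(1) closed by (auto simp: Rpol_def)
    moreover have "coeff (\<Sum>j\<in>{1..?m}. monom (b j) (?n - j)) i \<in> R"
      unfolding coeff_sum by (intro closed(8)) (auto simp: bR closed(1))
    ultimately show "coeff ?r i \<in> R" using closed(4) by simp
  qed
  moreover have "degree ?r < ?n"
  proof (rule degree_lessI)
    show "?r \<noteq> 0 \<or> 0 < ?n" using n by simp
    show "\<forall>i\<ge>?n. coeff ?r i = 0"
    proof (intro allI impI)
      fix i assume i: "?n \<le> i"
      have "coeff (p - monom (coeff p ?n) ?n) i = 0" using i by (auto simp: coeff_eq_0)
      moreover have "coeff (\<Sum>j\<in>{1..?m}. monom (b j) (?n - j)) i = 0"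
        unfolding coeff_sum using i n by (intro sum.neutral) (auto simp: coeff_monom)
      ultimately show "coeff ?r i = 0" by simp
    qed
  qed
  moreover have "poly ?r f = inverse x"
  proof -
    have "1 = x * poly p' (inverse f)" using p' x0 by simp
    also have "poly p' (inverse f) = coeff p' 0 + (\<Sum>j\<in>{1..?m}. coeff p' j * inverse f ^ j)"
    proof -
      have "{..?m} = insert 0 {1..?m}" by auto
      then show ?thesis unfolding poly_altdef by simp
    qed
    finally have uS: "?u = x * (\<Sum>j\<in>{1..?m}. coeff p' j * inverse f ^ j)" by (simp add: algebra_simps)
    have "inverse ?u * (x * (\<Sum>j\<in>{1..?m}. coeff p' j * inverse f ^ j)) = 1"
      using u(1) unfolding uS[symmetric] by simp
    then have "f ^ ?n = inverse ?u * (x * (\<Sum>j\<in>{1..?m}. coeff p' j * inverse f ^ j)) * f ^ ?n"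
      by simp
    also have "\<dots> = (\<Sum>j\<in>{1..?m}. inverse ?u * (x * coeff p' j) * (inverse f ^ j * f ^ ?n))"
      unfolding sum_distrib_left sum_distrib_right by (simp only: mult.assoc)
    also have "\<dots> = (\<Sum>j\<in>{1..?m}. inverse ?u * (x * coeff p' j) * f ^ (?n - j))"
    proof (rule sum.cong[OF refl])
      fix j assume "j \<in> {1..?m}"
      then have "inverse f ^ j * f ^ ?n = f ^ (?n - j)"
        using f0 deg by (simp add: power_diff divide_inverse power_inverse mult.commute)
      then show "inverse ?u * (x * coeff p' j) * (inverse f ^ j * f ^ ?n) = inverse ?u * (x * coeff p' j) * f ^ (?n - j)"
        by simp
    qed
    finally have fn: "f ^ ?n = (\<Sum>j\<in>{1..?m}. inverse ?u * (x * coeff p' j) * f ^ (?n - j))" .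
    have "poly ?r f = poly p f - coeff p ?n * f ^ ?n + (\<Sum>j\<in>{1..?m}. b j * f ^ (?n - j))"
      by (simp add: poly_monom poly_sum)
    also have "(\<Sum>j\<in>{1..?m}. b j * f ^ (?n - j)) = coeff p ?n * f ^ ?n"
      by (subst fn) (simp add: b_def sum_distrib_left mult.assoc)
    finally show ?thesis using p(2) by simp
  qed
  ultimately show ?thesis by blast
qed

text \<open>Otherwise both R[f] and R[1/f] contain 1/x. Take both relations of least degree; the one
  of larger degree can still be shortened by means of the other.\<close>

lemma valuation_ring: "f \<in> R \<or> inverse f \<in> R"
proof (rule ccontr)
  assume neg: "\<not> ?thesis"
  then have f0: "f \<noteq> 0" using closed(1) by auto
  define D where "D f n \<longleftrightarrow> (\<exists>p\<in>Rpol. poly p f = inverse x \<and> degree p = n)" for f n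
  have ex: "\<exists>n. D f n" "\<exists>n. D (inverse f) n"
    using adjoin[of f] adjoin[of "inverse f"] neg by (auto simp: D_def)
  define n where "n = (LEAST n. D f n)"
  define m where "m = (LEAST n. D (inverse f) n)"
  have nm: "D f n" "D (inverse f) m" using ex by (auto simp: n_def m_def intro: LeastI_ex)
  have least: "\<And>j. j < n \<Longrightarrow> \<not> D f j" "\<And>j. j < m \<Longrightarrow> \<not> D (inverse f) j"
    by (auto simp: n_def m_def dest: not_less_Least)
  obtain p where p: "p \<in> Rpol" "poly p f = inverse x" "degree p = n" using nm by (auto simp: D_def)
  obtain p' where p': "p' \<in> Rpol" "poly p' (inverse f) = inverse x" "degree p' = m" using nm by (auto simp: D_def)
  show False
  proof (cases "m \<le> n")
    case True
    then show False using reduce_degree[OF p(1,2) p'(1,2) _ f0] p(3) p'(3) least(1) by (auto simp: D_def)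
  next
    case False
    then show False using reduce_degree[OF p'(1,2), of p] p p'(3) f0 least(2) by (auto simp: D_def)
  qed
qed

text \<open>The nonunits of \<open>R\<close>, its maximal ideal. Zero needs its own clause since
  \<open>inverse 0 = 0\<close> lies in \<open>R\<close>.\<close>

definition P :: "'f set" where "P = {f \<in> R. f = 0 \<or> inverse f \<notin> R}"

lemma PR: "a \<in> P \<Longrightarrow> a \<in> R" by (simp add: P_def)

lemma P0: "0 \<in> P" by (simp add: P_def closed)

lemma P_mult:
  assumes "a \<in> P" "r \<in> R" shows "r * a \<in> P"
proof (cases "r * a = 0")
  case False
  have "inverse (r * a) \<notin> R"
  proof
    assume "inverse (r * a) \<in> R"
    then have "r * inverse (r * a) \<in> R" using closed(6)[OF assms(2)] by blast
    moreover have "r * inverse (r * a) = inverse a" using False by simp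
    ultimately have "inverse a \<in> R" by metis
    then show False using assms(1) False by (simp add: P_def)
  qed
  then show ?thesis using assms closed(6)[of r a] by (auto simp: P_def)
qed (use P0 in auto)

lemma P_add:
  assumes "a \<in> P" "b \<in> P" shows "a + b \<in> P"
proof -
  have *: "a + b \<in> P" if ab: "a \<in> P" "b \<in> P" "a * inverse b \<in> R" "b \<noteq> 0" for a b
  proof -
    have "(a * inverse b + 1) * b \<in> P" using P_mult[OF ab(2)] ab(3) closed by blast
    moreover have "(a * inverse b + 1) * b = a + b" using ab(4) by (simp add: field_simps)
    ultimately show ?thesis by simp
  qed
  show ?thesis
  proof (cases "a = 0 \<or> b = 0")
    case False
    then have "inverse (a * inverse b) = b * inverse a" by simp
    then show ?thesis using *[OF assms] *[OF assms(2,1)] False valuation_ring[of "a * inverse b"]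
      by (auto simp: add.commute mult.commute)
  qed (use assms in auto)
qed

lemma P_uminus: "a \<in> P \<Longrightarrow> - a \<in> P"
  using P_mult[of a "-1"] closed by simp

lemma P_sum: "(\<And>i. i \<in> I \<Longrightarrow> g i \<in> P) \<Longrightarrow> sum g I \<in> P"
  by (induction I rule: infinite_finite_induct) (auto intro: P0 P_add)

lemma P_const: "c \<in> P \<Longrightarrow> c \<in> k \<Longrightarrow> c = 0"
  using kR inverse_k by (auto simp: P_def)

lemma xP: "x \<in> P" using xR ixR by (simp add: P_def)

section \<open>Chains in the maximal ideal and discreteness\<close>

lemma quotient_cases: "a * inverse b \<in> R \<or> b * inverse a \<in> P"
  using valuation_ring[of "a * inverse b"] by (auto simp: P_def mult.commute)

text \<open>Informally, the valuations of the \<open>a i\<close> decrease strictly from that of y =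
  a 0. In a relation, take the last index j whose coefficient has a nonzero constant term and divide
  by \<open>a j\<close>: earlier terms fall into \<open>P\<close> by \<open>quot\<close>, later ones
  because their coefficient supplies a factor y. So the j-th coefficient takes a value in
  \<open>P\<close>, and its constant term is a constant in \<open>P\<close>, that is 0.\<close>

lemma chain_indep:
  assumes a: "\<And>i. i < m \<Longrightarrow> a i \<in> P \<and> a i \<noteq> 0"
    and quot: "\<And>i j. i < j \<Longrightarrow> j < m \<Longrightarrow> a i * inverse (a j) \<in> P" and m: "0 < m"
  shows "indep (a 0) m a"
proof -
  let ?y = "a 0"
  have yP: "?y \<in> P" "?y \<noteq> 0" using a[OF m] by auto
  have polyR: "poly p ?y \<in> R" if "p \<in> kpol" for p
    unfolding poly_altdef using that kR PR[OF yP(1)]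
    by (intro closed(8) closed(6) closed(7)) (auto simp: kpol_def)
  have core: "coeff (p i) 0 = 0"
    if p: "\<forall>i<m. p i \<in> kpol" "(\<Sum>i<m. poly (p i) ?y * a i) = 0" and i: "i < m" for p i
  proof (rule ccontr)
    assume ne: "coeff (p i) 0 \<noteq> 0"
    define j where "j = Max {i. i < m \<and> coeff (p i) 0 \<noteq> 0}"
    have fin: "finite {i. i < m \<and> coeff (p i) 0 \<noteq> 0}" by simp
    have "j \<in> {i. i < m \<and> coeff (p i) 0 \<noteq> 0}" unfolding j_def using ne i by (intro Max_in fin) auto
    then have j: "j < m" "coeff (p j) 0 \<noteq> 0" by auto
    have jmax: "coeff (p l) 0 = 0" if "j < l" "l < m" for l
    proof (rule ccontr)
      assume "coeff (p l) 0 \<noteq> 0"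
      then have "l \<le> j" unfolding j_def using that by (intro Max_ge fin) auto
      then show False using that by simp
    qed
    have aj: "a j \<noteq> 0" using a[OF j(1)] by simp
    have "poly (p j) ?y * a j + (\<Sum>l\<in>{..<m} - {j}. poly (p l) ?y * a l) = 0"
      using p(2) sum.remove[of "{..<m}" j "\<lambda>l. poly (p l) ?y * a l"] j(1) by simp
    then have "poly (p j) ?y * a j = - (\<Sum>l\<in>{..<m} - {j}. poly (p l) ?y * a l)"
      by (simp add: eq_neg_iff_add_eq_0)
    then have "poly (p j) ?y = - (\<Sum>l\<in>{..<m} - {j}. poly (p l) ?y * a l) * inverse (a j)"
      using aj by (metis mult.assoc mult.right_neutral right_inverse)
    also have "\<dots> = - (\<Sum>l\<in>{..<m} - {j}. poly (p l) ?y * a l * inverse (a j))"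
      by (simp add: sum_distrib_right)
    also have "\<dots> \<in> P"
    proof (intro P_uminus P_sum)
      fix l assume l: "l \<in> {..<m} - {j}"
      then have pl: "p l \<in> kpol" using p by auto
      show "poly (p l) ?y * a l * inverse (a j) \<in> P"
      proof (cases "l < j")
        case True
        then show ?thesis using P_mult[OF quot[OF True j(1)] polyR[OF pl]] by (simp add: mult.assoc)
      next
        case False
        then have lj: "j < l" "l < m" using l by auto
        obtain g where g: "p l = pCons 0 g" using jmax[OF lj] by (cases "p l") auto
        have gk: "g \<in> kpol" using pl unfolding g kpol_def by (auto simp: coeff_pCons split: nat.splits dest!: spec[of _ "Suc _"])
        have yaj: "?y * inverse (a j) \<in> R"
        proof (cases "j = 0")
          case True then show ?thesis using aj closed by simp
        next
          case False then show ?thesis using quot[of 0 j] j PR by simp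
        qed
        have "poly g ?y * (?y * inverse (a j)) * a l \<in> P"
          using P_mult a[OF lj(2)] closed(6)[OF polyR[OF gk] yaj] by blast
        then show ?thesis by (simp add: g mult_ac)
      qed
    qed
    finally have pjP: "poly (p j) ?y \<in> P" .
    obtain c g where cg: "p j = pCons c g" by (cases "p j")
    have pj: "p j \<in> kpol" using p j by auto
    have ck: "c \<in> k" using pj unfolding cg kpol_def by (auto dest!: spec[of _ 0])
    have gk: "g \<in> kpol" using pj unfolding cg kpol_def by (auto simp: coeff_pCons split: nat.splits dest!: spec[of _ "Suc _"])
    have "poly (p j) ?y - poly g ?y * ?y \<in> P"
      using P_add[OF pjP P_uminus[OF P_mult[OF yP(1) polyR[OF gk]]]] by simp
    then have "c \<in> P" by (simp add: cg mult.commute)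
    then show False using P_const[OF _ ck] j(2) cg by simp
  qed
  \<comment> \<open>With all constant terms gone, the relation is divisible by \<open>a 0\<close>;
    dividing shifts every coefficient down by one and the induction continues.\<close>
  have all: "\<forall>p. (\<forall>i<m. p i \<in> kpol) \<longrightarrow> (\<Sum>i<m. poly (p i) ?y * a i) = 0 \<longrightarrow> (\<forall>i<m. coeff (p i) n = 0)" for n
  proof (induction n)
    case 0 then show ?case using core by blast
  next
    case (Suc n)
    show ?case
    proof (intro allI impI)
      fix p i assume p: "\<forall>i<m. p i \<in> kpol" "(\<Sum>i<m. poly (p i) ?y * a i) = 0" and i: "i < m"
      have "\<forall>i<m. \<exists>g. p i = pCons 0 g"
      proof (intro allI impI)
        fix i assume "i < m"
        then have "coeff (p i) 0 = 0" using core[OF p] by blast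
        then show "\<exists>g. p i = pCons 0 g" by (cases "p i") auto
      qed
      then obtain g where g: "\<And>i. i < m \<Longrightarrow> p i = pCons 0 (g i)" by metis
      have gk: "g i \<in> kpol" if "i < m" for i
      proof -
        have "p i \<in> kpol" using p that by blast
        then show ?thesis unfolding g[OF that] kpol_def by (auto simp: coeff_pCons split: nat.splits dest!: spec[of _ "Suc _"])
      qed
      have "(\<Sum>i<m. poly (p i) ?y * a i) = ?y * (\<Sum>i<m. poly (g i) ?y * a i)"
        by (simp add: g sum_distrib_left mult.assoc)
      then have "(\<Sum>i<m. poly (g i) ?y * a i) = 0" using p(2) yP by simp
      then have "coeff (g i) n = 0" using Suc gk i by blast
      then show "coeff (p i) (Suc n) = 0" using g[OF i] by simp
    qed
  qed
  show ?thesis unfolding indep_def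
  proof (intro allI impI)
    fix p i assume "\<forall>i<m. p i \<in> kpol" "(\<Sum>i<m. poly (p i) ?y * a i) = 0" "i < m"
    then show "p i = 0" using all by (intro poly_eqI) auto
  qed
qed

end

context maximal_subalg
begin

definition chain_from :: "'f \<Rightarrow> nat \<Rightarrow> (nat \<Rightarrow> 'f) \<Rightarrow> bool" where
  "chain_from z m a \<longleftrightarrow> a 0 = z \<and> 0 < m \<and> (\<forall>i<m. a i \<in> P \<and> a i \<noteq> 0) \<and>
    (\<forall>i j. i < j \<longrightarrow> j < m \<longrightarrow> a i * inverse (a j) \<in> P)"

text \<open>Such chains are independent over \<open>k[z]\<close>, hence bounded in length; this is what makes the valuation discrete.\<close>

lemma chain_length_bound:
  assumes "z \<in> P" "z \<noteq> 0"
  shows "\<exists>E. \<forall>m a. chain_from z m a \<longrightarrow> m \<le> E"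
proof -
  obtain E where E: "growth z E" using growth_ex by blast
  have "m \<le> E" if a: "chain_from z m a" for m a
  proof -
    have "indep (a 0) m a" by (rule chain_indep) (use a in \<open>auto simp: chain_from_def\<close>)
    then show "m \<le> E" using indep_le_growth[OF _ E] a by (simp add: chain_from_def)
  qed
  then show ?thesis by blast
qed

lemma P_quot_trans:
  assumes "a * inverse b \<in> P" "b * inverse c \<in> P" "b \<noteq> 0"
  shows "a * inverse c \<in> P"
proof -
  have "(b * inverse c) * (a * inverse b) \<in> P" using P_mult[OF assms(1) PR[OF assms(2)]] .
  moreover have "(b * inverse c) * (a * inverse b) = a * inverse c" using assms(3) by (simp add: field_simps)
  ultimately show ?thesis by simp
qed

text \<open>If no nonzero element of \<open>P\<close> divided all of \<open>P\<close>, every nonzero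
  \<open>p\<close> in \<open>P\<close> would have a divisor \<open>z\<close> in \<open>P\<close>
  with p / z again in \<open>P\<close>; iterating from \<open>x\<close> gives chains of unbounded
  length.\<close>

lemma generator: "\<exists>p\<in>P. p \<noteq> 0 \<and> (\<forall>z\<in>P. z * inverse p \<in> R)"
proof (rule ccontr)
  assume neg: "\<not> ?thesis"
  have "\<exists>z\<in>P. z \<noteq> 0 \<and> p * inverse z \<in> P" if p: "p \<in> P" "p \<noteq> 0" for p
  proof -
    obtain z where z: "z \<in> P" "z * inverse p \<notin> R" using neg p by blast
    then have "z \<noteq> 0" using closed(1) by auto
    then show ?thesis using quotient_cases[of z p] z by blast
  qed
  then obtain g where g: "\<And>p. p \<in> P \<Longrightarrow> p \<noteq> 0 \<Longrightarrow> g p \<in> P \<and> g p \<noteq> 0 \<and> p * inverse (g p) \<in> P" by metis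
  define a where "a n = (g ^^ n) x" for n
  have aP: "a n \<in> P \<and> a n \<noteq> 0" for n
    by (induction n) (use xP x0 g in \<open>auto simp: a_def\<close>)
  have quot: "i < j \<Longrightarrow> a i * inverse (a j) \<in> P" for i j
  proof (induction j)
    case (Suc j)
    have s: "a j * inverse (a (Suc j)) \<in> P" using g[of "a j"] aP[of j] by (simp add: a_def)
    show ?case
    proof (cases "i = j")
      case False
      then show ?thesis using P_quot_trans[OF _ s] Suc aP[of j] by auto
    qed (use s in simp)
  qed simp
  obtain E where E: "\<And>m a. chain_from x m a \<Longrightarrow> m \<le> E"
    using chain_length_bound[OF xP x0] by blast
  have "chain_from x (Suc E) a" using aP quot by (simp add: chain_from_def a_def)
  then have "Suc E \<le> E" by (rule E)
  then show False by simp
qed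

definition unit :: "'f \<Rightarrow> bool" where "unit u \<longleftrightarrow> u \<noteq> 0 \<and> u \<in> R \<and> inverse u \<in> R"

lemma unit_mult: "unit u \<Longrightarrow> unit u' \<Longrightarrow> unit (u * u')"
  by (auto simp: unit_def intro: closed(6))

lemma unit_inverse: "unit u \<Longrightarrow> unit (inverse u)"
  by (auto simp: unit_def)

context
  fixes p assumes p: "p \<in> P" "p \<noteq> 0" and gen: "\<And>z. z \<in> P \<Longrightarrow> z * inverse p \<in> R"
begin

text \<open>The exponent is the first \<open>n\<close> at which f / p^(n+1) leaves \<open>R\<close>;
  the quotient f / p^n is then not in \<open>P\<close>, hence a unit.\<close>

lemma unit_factor_R:
  assumes f: "f \<in> R" "f \<noteq> 0"
  shows "\<exists>u n. unit u \<and> f = u * p ^ n"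
proof -
  have "\<exists>n. f * inverse p ^ Suc n \<notin> R"
  proof (rule ccontr)
    assume "\<not> ?thesis"
    then have all: "f * inverse p ^ Suc n \<in> R" for n by blast
    have "p * (f * inverse p ^ Suc 0) \<in> P" using P_mult[OF p(1) all[of 0]] by (simp add: mult.commute)
    moreover have "p * (f * inverse p ^ Suc 0) = f"
    proof -
      have "p * (f * inverse p ^ Suc 0) = f * (p * inverse p)" by (simp add: mult.left_commute)
      then show ?thesis using p(2) by simp
    qed
    ultimately have fP: "f \<in> P" by (simp only:)
    obtain E where E: "\<And>m a. chain_from f m a \<Longrightarrow> m \<le> E"
      using chain_length_bound[OF fP f(2)] by blast
    have ppow: "p ^ n \<in> P" if "0 < n" for n
      using that P_mult[OF p(1) closed(7)[OF PR[OF p(1)]], of "n - 1"] by (cases n) (auto simp: mult.commute)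
    \<comment> \<open>If \<open>f\<close> were divisible by all powers of \<open>p\<close>, then f,
      p^E, ..., p would be a chain with E + 1 members, one too many.\<close>
    define a where "a i = (if i = 0 then f else p ^ (Suc E - i))" for i
    have "Suc E \<le> E"
    proof (rule E[of _ a], unfold chain_from_def, intro conjI allI impI)
      fix i assume "i < Suc E" then show "a i \<in> P" "a i \<noteq> 0" using fP f(2) p(2) ppow by (auto simp: a_def)
    next
      fix i j assume ij: "i < j" "j < Suc E"
      show "a i * inverse (a j) \<in> P"
      proof (cases "i = 0")
        case True
        have "p * (f * inverse p ^ Suc (Suc E - j)) \<in> P"
          using P_mult[OF p(1) all[of "Suc E - j"]] by (simp only: mult.commute)
        moreover have "p * (f * inverse p ^ Suc n) = f * inverse (p ^ n)" for n
        proof -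
          have "p * (f * inverse p ^ Suc n) = f * (p * inverse p) * inverse p ^ n" by (simp add: ac_simps)
          then show ?thesis using p(2) by (simp add: power_inverse)
        qed
        ultimately have "f * inverse (p ^ (Suc E - j)) \<in> P" by (simp only:)
        then show ?thesis using True ij by (simp add: a_def)
      next
        case False
        have "p ^ (Suc E - i) = p ^ (Suc E - j) * p ^ (j - i)" using ij by (simp flip: power_add)
        then have "a i * inverse (a j) = p ^ (j - i)" using False ij p(2) by (simp add: a_def)
        then show ?thesis using ppow ij by simp
      qed
    qed (simp_all add: a_def)
    then show False by simp
  qed
  then obtain n where n: "f * inverse p ^ Suc n \<notin> R" "\<And>j. j < n \<Longrightarrow> f * inverse p ^ Suc j \<in> R"
    using exists_least_iff[of "\<lambda>n. f * inverse p ^ Suc n \<notin> R"] by blast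
  let ?u = "f * inverse p ^ n"
  have uR: "?u \<in> R" using n(2)[of "n - 1"] f by (cases n) auto
  have "?u \<notin> P" using gen[of ?u] n(1) by (auto simp: mult_ac)
  moreover have "?u \<noteq> 0" using f p by simp
  ultimately have "unit ?u" using uR by (auto simp: unit_def P_def)
  moreover have "f = ?u * p ^ n" using p(2) by (simp add: power_inverse field_simps)
  ultimately show ?thesis by blast
qed

lemma unit_factor:
  assumes "f \<noteq> 0" shows "\<exists>u j. unit u \<and> f = u * p powi j"
proof (cases "f \<in> R")
  case True
  then obtain u n where "unit u" "f = u * p ^ n" using unit_factor_R assms by blast
  then have "unit u \<and> f = u * p powi int n" by simp
  then show ?thesis by blast
next
  case False
  then have "inverse f \<in> R" using valuation_ring by blast
  then obtain u n where u: "unit u" "inverse f = u * p ^ n" using unit_factor_R assms by (metis inverse_nonzero_iff_nonzero)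
  then have "f = inverse u * p powi (- int n)" by (metis inverse_inverse_eq inverse_mult_distrib power_int_minus power_int_of_nat)
  then show ?thesis using unit_inverse[OF u(1)] by blast
qed

lemma unit_not_P: "unit u \<Longrightarrow> u \<notin> P"
  by (auto simp: unit_def P_def)

lemma unit_factor_unique:
  assumes "unit u" "unit u'" "u * p powi i = u' * p powi j"
  shows "i = j"
proof -
  have *: False if u: "unit u" "unit u'" "u * p powi i = u' * p powi j" and ij: "i < j" for u u' i j
  proof -
    have "p powi (j - i) = p ^ nat (j - i)" using ij by (simp add: power_int_def)
    then have "p powi j = p powi i * p ^ nat (j - i)" using p(2) power_int_add[of p i "j - i"] by simp
    then have "u * p powi i = (u' * p ^ nat (j - i)) * p powi i" using u(3) by (simp add: mult_ac)
    then have "u = u' * p ^ nat (j - i)" using p(2) by simp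
    moreover have "u' * p ^ nat (j - i) \<in> P"
    proof -
      obtain l where l: "nat (j - i) = Suc l" using ij by (metis gr0_conv_Suc zero_less_nat_eq diff_gt_0_iff_gt)
      have "(u' * p ^ l) * p \<in> P" using P_mult[OF p(1)] u(2) PR[OF p(1)] closed by (auto simp: unit_def)
      then show ?thesis by (simp add: l mult_ac)
    qed
    ultimately show False using unit_not_P[OF u(1)] by simp
  qed
  show ?thesis using *[OF assms] *[OF assms(2,1) assms(3)[symmetric]] by force
qed

definition val :: "'f \<Rightarrow> int" where
  "val f = (if f = 0 then 0 else THE j. \<exists>u. unit u \<and> f = u * p powi j)"

lemma val_eq: "unit u \<Longrightarrow> val (u * p powi j) = j"
proof -
  assume u: "unit u"
  then have "u * p powi j \<noteq> 0" using p by (auto simp: unit_def)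
  moreover have "(THE i. \<exists>u'. unit u' \<and> u * p powi j = u' * p powi i) = j"
    by (rule the_equality) (use u unit_factor_unique in blast)+
  ultimately show ?thesis by (simp add: val_def)
qed

lemma val_R: "f \<in> R \<Longrightarrow> f \<noteq> 0 \<Longrightarrow> 0 \<le> val f"
  using unit_factor_R[of f] val_eq by (metis of_nat_0_le_iff power_int_of_nat)

lemma val_place: "val \<in> places"
proof -
  have m: "val (a * b) = val a + val b" if ab: "a \<noteq> 0" "b \<noteq> 0" for a b
  proof -
    obtain u i w j where uw: "unit u" "a = u * p powi i" "unit w" "b = w * p powi j"
      using unit_factor ab by metis
    have "a * b = (u * w) * p powi (i + j)" using p(2) by (simp add: uw power_int_add mult_ac)
    then have "val (a * b) = i + j" by (simp only: val_eq[OF unit_mult[OF uw(1,3)]])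
    moreover have "val a = i" "val b = j" using val_eq[OF uw(1)] val_eq[OF uw(3)] uw by auto
    ultimately show ?thesis by simp
  qed
  have le: "val a \<le> val (a + b)" if ab: "a \<noteq> 0" "b \<noteq> 0" "a + b \<noteq> 0" "val a \<le> val b" for a b
  proof -
    obtain u i w j where uw: "unit u" "a = u * p powi i" "unit w" "b = w * p powi j"
      using unit_factor ab by metis
    have ij: "i \<le> j" using ab(4) by (simp add: uw val_eq)
    have "p powi (j - i) = p ^ nat (j - i)" using ij by (simp add: power_int_def)
    then have "p powi j = p powi i * p ^ nat (j - i)" using p(2) power_int_add[of p i "j - i"] by simp
    then have s: "a + b = (u + w * p ^ nat (j - i)) * p powi i" by (simp add: uw algebra_simps)
    let ?r = "u + w * p ^ nat (j - i)"
    have "?r \<in> R" using uw by (intro closed(4,6,7) PR[OF p(1)]) (simp_all add: unit_def)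
    moreover have r0: "?r \<noteq> 0" using s ab(3) by auto
    ultimately have "0 \<le> val ?r" by (rule val_R)
    moreover have "val (p powi i) = i" using val_eq[of 1 i] closed(2) by (simp add: unit_def)
    moreover have "p powi i \<noteq> 0" using p by simp
    ultimately have "i \<le> val (a + b)" unfolding s using m[OF r0, of "p powi i"] by simp
    then show ?thesis by (simp add: uw val_eq)
  qed
  have "val p = 1" using val_eq[of 1 1] closed(2) by (simp add: unit_def)
  moreover have "min (val a) (val b) \<le> val (a + b)" if "a \<noteq> 0" "b \<noteq> 0" "a + b \<noteq> 0" for a b
    using le[of a b] le[of b a] that by (cases "val a \<le> val b") (auto simp: add.commute)
  moreover have "val 0 = 0" by (simp add: val_def)
  ultimately show ?thesis using m by (auto simp: places_def discrete_valuation_def)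
qed

lemma val_P: "f \<in> P \<Longrightarrow> f \<noteq> 0 \<Longrightarrow> 0 < val f"
proof -
  assume f: "f \<in> P" "f \<noteq> 0"
  have "f * inverse p \<in> R" by (rule gen[OF f(1)])
  then have "0 \<le> val (f * inverse p)" using f p by (intro val_R) auto
  moreover have "val p = 1" using val_eq[of 1 1] closed(2) by (simp add: unit_def)
  ultimately show ?thesis using f p by (simp add: place_mult[OF val_place] place_inverse[OF val_place])
qed

end

lemma place_above: "\<exists>v\<in>places. 0 < v x"
proof -
  obtain p where p: "p \<in> P" "p \<noteq> 0" "\<forall>z\<in>P. z * inverse p \<in> R" using generator by blast
  show ?thesis
    using val_place[OF p(1,2)] val_P[OF p(1,2) _ xP x0] p(3) by blast
qed

end

context global_function_field
begin

lemma zero_exists: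
  assumes "transc x" shows "\<exists>v\<in>places. 0 < v x"
proof -
  obtain R where R: "R \<in> subalgebras x" "\<forall>S\<in>subalgebras x. R \<subseteq> S \<longrightarrow> S = R"
    using maximal_subalgebra[OF assms] by blast
  interpret maximal_subalg k x R
    by unfold_locales (use assms R in blast)+
  show ?thesis by (rule place_above)
qed

text \<open>A nonconstant \<open>f\<close> is transcendental, so 1/f has a zero somewhere, and
  \<open>f\<close> has a pole there.\<close>

lemma integral_const:
  assumes "\<And>v. v \<in> places \<Longrightarrow> val_ge v 0 f" shows "f \<in> k"
proof (rule ccontr)
  assume "f \<notin> k"
  then have tr: "transc f" using algebraic_constants by blast
  obtain v where v: "v \<in> places" "0 < v (inverse f)" using zero_exists[OF transc_inverse[OF tr]] by blast
  then have "v f < 0" by (simp add: place_inverse)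
  then show False using assms[OF v(1)] transc_nonzero[OF tr] by (simp add: val_ge_def)
qed

section \<open>The spaces L(D) and a lower bound for poles\<close>

definition Ldiv :: "(('f \<Rightarrow> int) \<Rightarrow> nat) \<Rightarrow> 'f set" where
  "Ldiv D = {f. \<forall>v\<in>places. val_ge v (- int (D v)) f}"

lemma Ldiv_diff: "f \<in> Ldiv D \<Longrightarrow> g \<in> Ldiv D \<Longrightarrow> f - g \<in> Ldiv D"
  by (auto simp: Ldiv_def intro: val_ge_diff)

lemma card_fibres_le:
  assumes T: "finite T" "h ` S \<subseteq> T" and S': "finite (S' :: 'f set)"
    and d: "\<And>f f'. f \<in> S \<Longrightarrow> f' \<in> S \<Longrightarrow> h f = h f' \<Longrightarrow> f - f' \<in> S'"
  shows "finite S \<and> card S \<le> card T * card S'"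
proof -
  have fib: "finite {f\<in>S. h f = r} \<and> card {f\<in>S. h f = r} \<le> card S'" for r
  proof (cases "{f\<in>S. h f = r} = {}")
    case False
    then obtain f0 where f0: "f0 \<in> S" "h f0 = r" by blast
    have inj: "inj_on (\<lambda>f. f - f0) {f\<in>S. h f = r}" by (auto simp: inj_on_def)
    have im: "(\<lambda>f. f - f0) ` {f\<in>S. h f = r} \<subseteq> S'" using d f0 by auto
    show ?thesis using finite_imageD[OF finite_subset[OF im S'] inj] card_inj_on_le[OF inj im S'] by blast
  next
    case True
    then show ?thesis by (metis card.empty finite.emptyI zero_le)
  qed
  have S: "S = (\<Union>r\<in>T. {f\<in>S. h f = r})" using T(2) by auto
  have "finite S" by (subst S) (use T(1) fib in blast)
  moreover have "card S \<le> (\<Sum>r\<in>T. card {f\<in>S. h f = r})"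
    by (subst S) (rule card_UN_le[OF T(1)])
  moreover have "\<dots> \<le> card T * card S'" using sum_bounded_above[of T _ "card S'"] fib by simp
  ultimately show ?thesis by linarith
qed

text \<open>Lowering \<open>D\<close> by 1 at one place \<open>v\<close> loses at most a factor
  \<open>residue_size v\<close>, because the leading coefficient at \<open>v\<close> has only that
  many values modulo the maximal ideal. At \<open>D = 0\<close> only constants remain, which gives
  the factor \<open>q\<close>.\<close>

lemma card_Ldiv:
  assumes Z: "finite Z" "Z \<subseteq> places"
  shows "(\<forall>v\<in>places - Z. D v = 0) \<Longrightarrow> finite (Ldiv D) \<and> card (Ldiv D) \<le> q * (\<Prod>v\<in>Z. residue_size v ^ D v)"
proof (induction "\<Sum>v\<in>Z. D v" arbitrary: D)
  case 0
  then have "D v = 0" if "v \<in> places" for v using that Z by (cases "v \<in> Z") auto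
  then have sub: "Ldiv D \<subseteq> k" using integral_const by (auto simp: Ldiv_def)
  have "card (Ldiv D) \<le> q * 1" using card_mono[OF finite_k sub] by (simp add: q_def)
  also have "\<dots> \<le> q * (\<Prod>v\<in>Z. residue_size v ^ D v)"
  proof (intro mult_left_mono)
    have "0 < (\<Prod>v\<in>Z. residue_size v ^ D v)"
    proof (rule prod_pos)
      fix v assume "v \<in> Z"
      then have "2 \<le> residue_size v" using Z residue_size_ge_2 by blast
      then show "0 < residue_size v ^ D v" by simp
    qed
    then show "1 \<le> (\<Prod>v\<in>Z. residue_size v ^ D v)" by simp
  qed simp
  finally show ?case using finite_subset[OF sub finite_k] by simp
next
  case (Suc n)
  obtain v where v: "v \<in> Z" "D v \<noteq> 0" using Suc.hyps(2) by (metis sum.neutral nat.distinct(1))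
  have vp: "v \<in> places" using v Z by blast
  define D' where "D' = D(v := D v - 1)"
  have sumD: "(\<Sum>w\<in>Z. D w) = D v + (\<Sum>w\<in>Z - {v}. D w)" "(\<Sum>w\<in>Z. D' w) = D' v + (\<Sum>w\<in>Z - {v}. D' w)"
    by (rule sum.remove[OF Z(1) v(1)])+
  moreover have "(\<Sum>w\<in>Z - {v}. D' w) = (\<Sum>w\<in>Z - {v}. D w)" by (rule sum.cong) (auto simp: D'_def)
  ultimately have "n = (\<Sum>w\<in>Z. D' w)" using Suc.hyps(2) v(2) by (simp add: D'_def)
  moreover have "\<forall>w\<in>places - Z. D' w = 0" using Suc.prems v by (auto simp: D'_def)
  ultimately have IH: "finite (Ldiv D') \<and> card (Ldiv D') \<le> q * (\<Prod>w\<in>Z. residue_size w ^ D' w)"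
    using Suc.hyps(1) by blast
  obtain p where p: "p \<noteq> 0" "v p = 1" using place_uniformizer[OF vp] by blast
  obtain R where R: "residue_system v R" "card R = residue_size v" "\<forall>a. val_ge v 0 a \<longrightarrow> (\<exists>r\<in>R. val_ge v 1 (a - r))"
    using residue_reps[OF vp] by blast
  have "\<forall>f\<in>Ldiv D. \<exists>r\<in>R. val_ge v 1 (f * p ^ D v - r)"
    using R(3) p vp by (auto simp: Ldiv_def val_ge_mult_iff place_power)
  then obtain h where h: "\<And>f. f \<in> Ldiv D \<Longrightarrow> h f \<in> R \<and> val_ge v 1 (f * p ^ D v - h f)" by metis
  have "finite (Ldiv D) \<and> card (Ldiv D) \<le> card R * card (Ldiv D')"
  proof (rule card_fibres_le[where h = h])
    show "finite R" using R(1) by (simp add: residue_system_def)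
    show "h ` Ldiv D \<subseteq> R" using h by blast
    show "finite (Ldiv D')" using IH by simp
    fix f f' assume f: "f \<in> Ldiv D" "f' \<in> Ldiv D" "h f = h f'"
    have "val_ge v 1 ((f * p ^ D v - h f) - (f' * p ^ D v - h f'))"
      using conjunct2[OF h[OF f(1)]] conjunct2[OF h[OF f(2)]] by (rule val_ge_diff[OF vp])
    then have "val_ge v 1 ((f - f') * p ^ D v)" by (simp add: f(3) algebra_simps)
    then have "val_ge v (1 - int (D v)) (f - f')" using p vp by (simp add: val_ge_mult_iff place_power)
    then have "val_ge v (- int (D' v)) (f - f')" using v(2) by (simp add: D'_def of_nat_diff)
    moreover have "f - f' \<in> Ldiv D" using Ldiv_diff f by blast
    ultimately show "f - f' \<in> Ldiv D'" by (auto simp: Ldiv_def D'_def)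
  qed
  moreover have "(\<Prod>w\<in>Z. residue_size w ^ D w) = residue_size v * (\<Prod>w\<in>Z. residue_size w ^ D' w)"
  proof -
    have "(\<Prod>w\<in>Z - {v}. residue_size w ^ D' w) = (\<Prod>w\<in>Z - {v}. residue_size w ^ D w)"
      by (rule prod.cong) (auto simp: D'_def)
    moreover have "residue_size v ^ D v = residue_size v * residue_size v ^ D' v"
      using v(2) by (cases "D v") (auto simp: D'_def)
    ultimately show ?thesis
      using prod.remove[OF Z(1) v(1), of "\<lambda>w. residue_size w ^ D w"] prod.remove[OF Z(1) v(1), of "\<lambda>w. residue_size w ^ D' w"]
      by simp
  qed
  moreover have "card R * card (Ldiv D') \<le> residue_size v * (q * (\<Prod>w\<in>Z. residue_size w ^ D' w))"
    using IH R(2) by simp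
  ultimately show ?case by (simp add: mult.left_commute)
qed

text \<open>Combinations of the \<open>u i\<close> with coefficients in k[x] of degree at most
  \<open>l\<close> have poles bounded by l B + C, where \<open>B\<close> is the divisor of poles of
  \<open>x\<close> and \<open>C\<close> bounds the poles of the \<open>u i\<close>. Counting them
  against \<open>card_Ldiv\<close> and letting \<open>l\<close> grow leaves only \<open>n\<close>
  and \<open>B\<close>.\<close>

lemma poles_lower_bound:
  assumes "indep x n u" "finite Z" "Z \<subseteq> places" "\<And>v. v \<in> places \<Longrightarrow> v x < 0 \<Longrightarrow> v \<in> Z"
  shows "q ^ n \<le> (\<Prod>v\<in>Z. residue_size v ^ nat (- v x))"
proof -
  define C where "C v = (\<Sum>i<n. nat (- v (u i)))" for v
  define Y where "Y = Z \<union> (\<Union>i\<in>{i. i < n \<and> u i \<noteq> 0}. {v \<in> places. v (u i) \<noteq> 0})"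
  have finY: "finite Y" using assms(2) finite_support by (auto simp: Y_def)
  have Yp: "Y \<subseteq> places" using assms(3) by (auto simp: Y_def)
  define B where "B v = nat (- v x)" for v
  have B0: "B v = 0" if "v \<in> places - Z" for v using assms(4)[of v] that by (force simp: B_def)
  have C0: "C v = 0" if "v \<in> places - Y" for v
  proof -
    have "v (u i) = 0" if "i < n" for i
      using \<open>v \<in> places - Y\<close> that by (cases "u i = 0") (auto simp: Y_def place_0)
    then show ?thesis by (simp add: C_def)
  qed
  let ?r = "residue_size :: ('f \<Rightarrow> int) \<Rightarrow> nat"
  let ?QB = "\<Prod>v\<in>Z. ?r v ^ B v" let ?QC = "\<Prod>v\<in>Y. ?r v ^ C v"
  have QBY: "(\<Prod>v\<in>Y. ?r v ^ B v) = ?QB"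
    using finY Yp B0 by (intro prod.mono_neutral_right) (auto simp: Y_def)
  have "q ^ n \<le> ?QB"
  proof -
    have main: "(q ^ n) ^ l \<le> (q * ?QC) * ?QB ^ l" for l
    proof -
      define D where "D v = l * B v + C v" for v
      have "\<forall>v\<in>places - Y. D v = 0" using B0 C0 by (auto simp: D_def Y_def)
      from card_Ldiv[OF finY Yp this]
      have L: "finite (Ldiv D)" "card (Ldiv D) \<le> q * (\<Prod>v\<in>Y. ?r v ^ D v)" by auto
      have D: "(\<Prod>v\<in>Y. ?r v ^ D v) = ?QB ^ l * ?QC"
        unfolding D_def power_add prod.distrib QBY[symmetric] by (simp add: power_mult[symmetric] prod_power_distrib mult.commute)
      have "(\<lambda>p. \<Sum>i<n. poly (p i) x * u i) ` ({..<n} \<rightarrow>\<^sub>E kpl l) \<subseteq> Ldiv D"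
      proof
        fix y assume "y \<in> (\<lambda>p. \<Sum>i<n. poly (p i) x * u i) ` ({..<n} \<rightarrow>\<^sub>E kpl l)"
        then obtain p where p: "p \<in> {..<n} \<rightarrow>\<^sub>E kpl l" "y = (\<Sum>i<n. poly (p i) x * u i)" by blast
        show "y \<in> Ldiv D"
          unfolding Ldiv_def p(2)
        proof (intro CollectI ballI val_ge_sum)
          fix v :: "'f \<Rightarrow> int" and i assume v: "v \<in> places" and i: "i \<in> {..<n}"
          have pi: "p i \<in> kpol" "degree (p i) \<le> l" using p(1) i by (auto simp: kpl_def)
          have "val_ge v (- int (l * B v)) (poly (p i) x)"
            unfolding poly_altdef
          proof (rule val_ge_sum[OF v])
            fix j assume j: "j \<in> {..degree (p i)}"
            show "val_ge v (- int (l * B v)) (coeff (p i) j * x ^ j)"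
            proof (cases "x ^ j = 0 \<or> coeff (p i) j = 0")
              case False
              then have c: "v (coeff (p i) j) = 0" using place_const[OF v] pi(1) by (simp add: kpol_def)
              have xj: "v (x ^ j) = int j * v x" using False by (cases "j = 0") (auto simp: place_power v place_1)
              have "- v x \<le> int (B v)" by (simp add: B_def)
              then have "int j * (- v x) \<le> int j * int (B v)" by (intro mult_left_mono) auto
              also have "\<dots> \<le> int l * int (B v)" using j pi(2) by (intro mult_right_mono) auto
              finally show ?thesis using False by (simp add: val_ge_def place_mult v c xj)
            next
              case True
              then have "coeff (p i) j * x ^ j = 0" by auto
              then show ?thesis by (simp only: val_ge_0)
            qed
          qed
          moreover have "val_ge v (- int (C v)) (u i)"
          proof -
            have "nat (- v (u i)) \<le> C v" unfolding C_def by (rule member_le_sum) (use i in auto)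
            then show ?thesis unfolding val_ge_def by linarith
          qed
          ultimately show "val_ge v (- int (D v)) (poly (p i) x * u i)"
            using val_ge_mult[OF v, of "- int (l * B v)" "poly (p i) x" "- int (C v)" "u i"] by (simp add: D_def add.commute)
        qed
      qed
      then have "card ((\<lambda>p. \<Sum>i<n. poly (p i) x * u i) ` ({..<n} \<rightarrow>\<^sub>E kpl l)) \<le> card (Ldiv D)"
        by (rule card_mono[OF L(1)])
      then have "card ({..<n} \<rightarrow>\<^sub>E kpl l) \<le> card (Ldiv D)"
        by (simp only: card_image[OF indep_inj[OF assms(1)]])
      moreover have "card ({..<n} \<rightarrow>\<^sub>E kpl l) = (q ^ (l + 1)) ^ n"
        by (simp only: card_PiE[OF finite_lessThan] card_kpl prod_constant card_lessThan)
      moreover have "(q ^ n) ^ l \<le> (q ^ (l + 1)) ^ n"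
        using q_ge_2 by (simp add: power_mult[symmetric] algebra_simps)
      ultimately have "(q ^ n) ^ l \<le> q * (?QB ^ l * ?QC)" using L(2)[unfolded D] by linarith
      then show ?thesis by (simp add: mult_ac)
    qed
    have "0 < ?QB"
    proof (rule prod_pos)
      fix v :: "'f \<Rightarrow> int" assume "v \<in> Z"
      then have "2 \<le> ?r v" using assms(3) residue_size_ge_2 by blast
      then show "0 < ?r v ^ B v" by simp
    qed
    then have "0 < real ?QB" by linarith
    moreover have "real (q ^ n) ^ l \<le> real (q * ?QC) * real ?QB ^ l" for l
    proof -
      have "real ((q ^ n) ^ l) \<le> real ((q * ?QC) * ?QB ^ l)" using main[of l] by (rule of_nat_mono)
      then show ?thesis by (simp only: of_nat_mult of_nat_power)
    qed
    ultimately have "real (q ^ n) \<le> real ?QB" by (rule power_growth_le)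
    then show ?thesis by linarith
  qed
  then show ?thesis by (simp add: B_def)
qed

end

section \<open>The product formula and the number of places\<close>

context global_function_field
begin

lemma residue_size_pos: "v \<in> places \<Longrightarrow> 0 < residue_size v"
  for v :: "'f \<Rightarrow> int" using residue_size_ge_2[of v] by linarith

text \<open>One \<open>m\<close> serves both inequalities: as a growth rate of \<open>x\<close> it
  bounds the zeros from above, and as the size of a family independent over k[1/x] it bounds the
  poles of 1/x, which are the same places, from below.\<close>

lemma zeros_degree:
  assumes ind: "indep (inverse x) m u" and gr: "growth x m" and x: "x \<noteq> 0"
  shows "(\<Prod>v | v \<in> places \<and> 0 < v x. residue_size v ^ nat (v x)) = q ^ m"
proof (rule antisym)
  let ?Z = "{v \<in> places. 0 < v x}"
  have fin: "finite ?Z" using finite_zeros[OF x] .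
  show "(\<Prod>v\<in>?Z. residue_size v ^ nat (v x)) \<le> q ^ m"
    by (rule zeros_bound[OF gr x fin]) auto
  have "q ^ m \<le> (\<Prod>v\<in>?Z. residue_size v ^ nat (- v (inverse x)))"
    by (rule poles_lower_bound[OF ind fin]) (auto simp: place_inverse)
  also have "\<dots> = (\<Prod>v\<in>?Z. residue_size v ^ nat (v x))"
    by (rule prod.cong) (auto simp: place_inverse)
  finally show "q ^ m \<le> (\<Prod>v\<in>?Z. residue_size v ^ nat (v x))" .
qed

text \<open>For nonconstant \<open>x\<close> the zeros and the poles both contribute q^m, with the
  same \<open>m\<close> from \<open>exists_degree\<close>; a constant has neither.\<close>

lemma product_formula:
  fixes x :: 'f
  assumes x: "x \<noteq> 0"
  shows "(\<Prod>v | v \<in> places \<and> v x \<noteq> 0. real (residue_size v) powi (- v x)) = 1"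
proof (cases "transc x")
  case False
  then have "x \<in> k" using algebraic_constants by blast
  then have empty: "{v. v \<in> places \<and> v x \<noteq> 0} = {}" using place_const by auto
  show ?thesis unfolding empty by simp
next
  case True
  obtain m u where m: "indep x m u" "growth x m" "growth (inverse x) m"
    using exists_degree True spanning_exists by blast
  let ?r = "residue_size :: ('f \<Rightarrow> int) \<Rightarrow> nat"
  let ?A = "{v \<in> places. 0 < v x}" and ?B = "{v \<in> places. v x < 0}"
  have fin: "finite ?A" "finite ?B"
    by (rule finite_subset[OF _ finite_support[OF x]], force)+
  have A: "(\<Prod>v\<in>?A. ?r v ^ nat (v x)) = q ^ m"
    using zeros_degree[OF indep_inverse[OF m(1) x] m(2) x] by simp
  have "(\<Prod>v | v \<in> places \<and> 0 < v (inverse x). ?r v ^ nat (v (inverse x))) = q ^ m"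
    using x m by (intro zeros_degree) auto
  also have "{v \<in> places. 0 < v (inverse x)} = ?B" by (auto simp: place_inverse)
  also have "(\<Prod>v\<in>?B. ?r v ^ nat (v (inverse x))) = (\<Prod>v\<in>?B. ?r v ^ nat (- v x))"
    by (rule prod.cong) (auto simp: place_inverse)
  finally have B: "(\<Prod>v\<in>?B. ?r v ^ nat (- v x)) = q ^ m" .
  have un: "{v. v \<in> places \<and> v x \<noteq> 0} = ?A \<union> ?B" by auto
  have "(\<Prod>v\<in>?A. real (?r v) powi (- v x)) = (\<Prod>v\<in>?A. inverse (real (?r v ^ nat (v x))))"
    by (rule prod.cong) (auto simp: power_int_def power_inverse)
  also have "\<dots> = inverse (real (\<Prod>v\<in>?A. ?r v ^ nat (v x)))"
    by (simp only: prod_inversef[unfolded comp_def] of_nat_prod)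
  finally have A': "(\<Prod>v\<in>?A. real (?r v) powi (- v x)) = inverse (real (q ^ m))" by (simp only: A)
  have "(\<Prod>v\<in>?B. real (?r v) powi (- v x)) = (\<Prod>v\<in>?B. real (?r v ^ nat (- v x)))"
    by (rule prod.cong) (auto simp: power_int_def)
  also have "\<dots> = real (\<Prod>v\<in>?B. ?r v ^ nat (- v x))" by (simp only: of_nat_prod)
  finally have B': "(\<Prod>v\<in>?B. real (?r v) powi (- v x)) = real (q ^ m)" by (simp only: B)
  have "(\<Prod>v\<in>?A \<union> ?B. real (?r v) powi (- v x))
      = (\<Prod>v\<in>?A. real (?r v) powi (- v x)) * (\<Prod>v\<in>?B. real (?r v) powi (- v x))"
    by (rule prod.union_disjoint[OF fin]) auto
  also have "\<dots> = inverse (real (q ^ m)) * real (q ^ m)" by (simp only: A' B')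
  also have "\<dots> = 1" using q_ge_2 by simp
  finally show ?thesis unfolding un .
qed

text \<open>Let Q be the residue size. Multiplication by a unit \<open>t\<close> permutes the
  nonzero representatives modulo the maximal ideal, so comparing the products of all of them shows
  that t^(Q-1) is congruent to 1.\<close>

lemma residue_fermat:
  fixes v :: "'f \<Rightarrow> int"
  assumes v: "v \<in> places" and t: "val_ge v 0 t"
  shows "val_ge v 1 (t ^ residue_size v - t)"
proof (cases "val_ge v 1 t")
  case True
  have "t ^ residue_size v - t = t * (t ^ (residue_size v - 1) - 1)"
    using residue_size_pos[OF v] by (cases "residue_size v") (auto simp: algebra_simps)
  moreover have "val_ge v 1 \<dots>"
    using True t v by (intro val_ge_mult_0 val_ge_diff val_ge_power val_ge_1)
  ultimately show ?thesis by simp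
next
  case False
  then have t0: "t \<noteq> 0" "v t = 0" using t by (auto simp: val_ge_def)
  obtain R where R: "residue_system v R" "card R = residue_size v" "\<forall>a. val_ge v 0 a \<longrightarrow> (\<exists>r\<in>R. val_ge v 1 (a - r))"
    using residue_reps[OF v] by blast
  have Rf: "finite R" "\<And>r. r \<in> R \<Longrightarrow> val_ge v 0 r" "\<And>r s. r \<in> R \<Longrightarrow> s \<in> R \<Longrightarrow> val_ge v 1 (r - s) \<Longrightarrow> r = s"
    using R(1) by (auto simp: residue_system_def)
  define U where "U = {r \<in> R. \<not> val_ge v 1 r}"
  obtain r0 where r0: "r0 \<in> R" "val_ge v 1 (0 - r0)" using R(3) val_ge_0 by blast
  have r0': "val_ge v 1 r0" using r0(2) val_ge_uminus[OF v] by simp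
  have "U = R - {r0}"
  proof -
    have "r = r0" if "r \<in> R" "val_ge v 1 r" for r
      using Rf(3)[OF that(1) r0(1)] val_ge_diff[OF v that(2) r0'] by blast
    then have "U \<subseteq> R - {r0}" "R - {r0} \<subseteq> U" using r0(1) r0' unfolding U_def by blast+
    then show ?thesis by (rule subset_antisym)
  qed
  then have cardU: "card U = residue_size v - 1" using R(2) Rf(1) r0(1) by simp
  have Uu: "r \<noteq> 0 \<and> v r = 0" if "r \<in> U" for r using that Rf(2)[of r] by (auto simp: U_def val_ge_def)
  have finU: "finite U" using Rf(1) by (simp add: U_def)
  have "\<forall>r\<in>U. \<exists>s\<in>U. val_ge v 1 (t * r - s)"
  proof
    fix r assume r: "r \<in> U"
    have "val_ge v 0 (t * r)" using Uu[OF r] t0 by (simp add: val_ge_def place_mult v)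
    then obtain s where s: "s \<in> R" "val_ge v 1 (t * r - s)" using R(3) by blast
    have "\<not> val_ge v 1 s"
    proof
      assume "val_ge v 1 s"
      then have "val_ge v 1 (t * r - s + s)" using val_ge_add[OF v s(2)] by blast
      then show False using Uu[OF r] t0 by (simp add: val_ge_def place_mult v)
    qed
    then show "\<exists>s\<in>U. val_ge v 1 (t * r - s)" using s by (auto simp: U_def)
  qed
  then obtain h where h: "\<And>r. r \<in> U \<Longrightarrow> h r \<in> U \<and> val_ge v 1 (t * r - h r)" by metis
  have "inj_on h U"
  proof (rule inj_onI)
    fix r s assume rs: "r \<in> U" "s \<in> U" "h r = h s"
    have "val_ge v 1 ((t * r - h r) - (t * s - h s))"
      using conjunct2[OF h[OF rs(1)]] conjunct2[OF h[OF rs(2)]] by (rule val_ge_diff[OF v])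
    then have "val_ge v 1 ((r - s) * t)" by (simp add: rs(3) algebra_simps)
    then have "val_ge v 1 (r - s)" using t0 by (simp add: val_ge_mult_iff v)
    then show "r = s" using Rf(3) rs by (auto simp: U_def)
  qed
  then have bij: "bij_betw h U U"
    using finU h by (metis bij_betw_def card_image card_subset_eq image_subsetI)
  have prod_cong: "val_ge v 1 ((\<Prod>r\<in>A. t * r) - (\<Prod>r\<in>A. h r))" if "A \<subseteq> U" for A
    using finite_subset[OF that finU] that
  proof (induction A)
    case (insert a A)
    have ha: "val_ge v 1 (t * a - h a)" using h insert by blast
    have IH: "val_ge v 1 ((\<Prod>r\<in>A. t * r) - (\<Prod>r\<in>A. h r))" using insert by blast
    have hA: "val_ge v 0 (\<Prod>r\<in>A. h r)"
    proof -
      have "\<And>r. r \<in> A \<Longrightarrow> h r \<noteq> 0 \<and> v (h r) = 0" using h Uu insert.prems by blast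
      then have "v (\<Prod>r\<in>A. h r) = (\<Sum>r\<in>A. 0)" by (subst place_prod[OF v]) auto
      then show ?thesis by (simp add: val_ge_def)
    qed
    have ta: "val_ge v 0 (t * a)" using Uu[of a] insert.prems t0 by (simp add: val_ge_def place_mult v)
    have "(\<Prod>r\<in>insert a A. t * r) - (\<Prod>r\<in>insert a A. h r)
        = ((\<Prod>r\<in>A. t * r) - (\<Prod>r\<in>A. h r)) * (t * a) + (t * a - h a) * (\<Prod>r\<in>A. h r)"
    proof -
      have "(t * a) * b - h a * c = (b - c) * (t * a) + (t * a - h a) * c" for b c
        by (simp add: algebra_simps)
      then show ?thesis by (simp only: prod.insert[OF insert.hyps])
    qed
    then show ?case using val_ge_add[OF v val_ge_mult_0[OF v IH ta] val_ge_mult_0[OF v ha hA]] by simp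
  qed simp
  let ?p = "\<Prod>r\<in>U. r"
  have p0: "?p \<noteq> 0 \<and> v ?p = 0"
  proof -
    have "v ?p = (\<Sum>r\<in>U. v r)" by (rule place_prod[OF v]) (use Uu in auto)
    then show ?thesis using Uu finU by simp
  qed
  have "(\<Prod>r\<in>U. h r) = ?p" using prod.reindex_bij_betw[OF bij, of id] by simp
  moreover have "(\<Prod>r\<in>U. t * r) = t ^ (residue_size v - 1) * ?p" by (simp add: prod.distrib cardU)
  ultimately have "val_ge v 1 (t ^ (residue_size v - 1) * ?p - ?p)" using prod_cong[of U] by simp
  then have "val_ge v 1 ((t ^ (residue_size v - 1) - 1) * ?p)" by (simp add: algebra_simps)
  then have "val_ge v 1 (t ^ (residue_size v - 1) - 1)" using p0 by (simp add: val_ge_mult_iff v)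
  then have "val_ge v 1 ((t ^ (residue_size v - 1) - 1) * t)" by (rule val_ge_mult_0[OF v _ t])
  moreover have "(t ^ (residue_size v - 1) - 1) * t = t ^ residue_size v - t"
    using residue_size_pos[OF v] by (cases "residue_size v") (auto simp: algebra_simps)
  ultimately show ?thesis by simp
qed

text \<open>Away from the poles of \<open>t\<close>, every place of residue size \<open>Q\<close> is a zero of \<open>t^Q - t\<close>.\<close>

lemma count_places:
  "\<exists>a. \<forall>Q V. finite V \<longrightarrow> V \<subseteq> {v \<in> places. residue_size v = Q} \<longrightarrow> card (V :: ('f \<Rightarrow> int) set) \<le> a * (Q + 1)"
proof -
  obtain t n w where sp: "spanning t n w" using spanning_exists by blast
  then have tr: "transc t" by (simp add: spanning_def)
  have t0: "t \<noteq> 0" using transc_nonzero[OF tr] .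
  let ?pol = "{v \<in> places. v t < 0}"
  have finp: "finite ?pol" by (rule finite_subset[OF _ finite_support[OF t0]]) auto
  \<comment> \<open>The two summands account for the N places where \<open>t\<close> is integral, by
    2^N <= q^(n Q) <= 2^(q n Q), and for the finitely many poles of \<open>t\<close>.\<close>
  define a where "a = q * n + card ?pol"
  have "card V \<le> a * (Q + 1)" if V: "finite V" "V \<subseteq> {v \<in> places. residue_size v = Q}" for Q and V :: "('f \<Rightarrow> int) set"
  proof (cases "V = {}")
    case False
    then obtain v0 where "v0 \<in> V" by blast
    then have Q: "2 \<le> Q" using V residue_size_ge_2[of v0] by auto
    define Y where "Y = monom (1::'f) Q - monom 1 1"
    have Yk: "Y \<in> kpol" unfolding Y_def by (intro kpol_diff kpol_monom one_k)
    have "coeff Y Q = 1" using Q by (simp add: Y_def)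
    then have Y0: "Y \<noteq> 0" by auto
    have "degree Y \<le> Q" unfolding Y_def
      by (rule degree_diff_le) (use Q in \<open>auto simp: degree_monom_eq\<close>)
    let ?y = "poly Y t"
    have y: "?y = t ^ Q - t" by (simp add: Y_def poly_monom)
    have y0: "?y \<noteq> 0" using tr Yk Y0 by (auto simp: transc_def)
    let ?Z = "{v \<in> V. 0 \<le> v t}"
    have "2 ^ card ?Z \<le> q ^ (n * degree Y)"
    proof (rule card_zeros_bound[OF growth_poly[OF sp Yk] y0])
      fix v assume v: "v \<in> ?Z"
      have "v \<in> places" "residue_size v = Q" using v V by auto
      then have "val_ge v 1 ?y" unfolding y using residue_fermat[of v t] v by (auto simp: val_ge_def)
      then show "0 < v ?y" using y0 by (simp add: val_ge_def)
    qed (use V in auto)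
    also have "\<dots> \<le> q ^ (n * Q)" using \<open>degree Y \<le> Q\<close> q_ge_2 by (intro power_increasing) auto
    also have "\<dots> \<le> (2 ^ q) ^ (n * Q)" using less_exp[of q] by (intro power_mono) auto
    finally have "2 ^ card ?Z \<le> (2::nat) ^ (q * (n * Q))" by (simp add: power_mult)
    then have "card ?Z \<le> q * (n * Q)" by simp
    moreover have "card (V - ?Z) \<le> card ?pol" using V by (intro card_mono finp) auto
    moreover have "card V = card ?Z + card (V - ?Z)"
      using V by (subst card_Un_disjoint[symmetric]) (auto intro: arg_cong[where f = card])
    ultimately have "card V \<le> q * n * Q + card ?pol" by simp
    also have "\<dots> \<le> a * (Q + 1)" by (simp add: a_def algebra_simps)
    finally show ?thesis .
  qed simp
  then show ?thesis by blast
qed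

text \<open>At most a (Q + 1) <= 2 a Q places have residue size Q, so the exponent 3 leaves the
  convergent series of Q^-2.\<close>

lemma summable_residue_sizes:
  "(\<lambda>v::'f \<Rightarrow> int. 1 / real (residue_size v) ^ 3) summable_on places"
proof -
  obtain a where a: "\<forall>Q V. finite V \<longrightarrow> V \<subseteq> {v \<in> places. residue_size v = Q} \<longrightarrow> card (V :: ('f \<Rightarrow> int) set) \<le> a * (Q + 1)"
    using count_places by (elim exE)
  have sq: "summable (\<lambda>Q::nat. inverse (real Q ^ 2))" using inverse_power_summable[of 2] by simp
  define B where "B = 2 * real a * suminf (\<lambda>Q. inverse (real Q ^ 2))"
  have "sum (\<lambda>v. 1 / real (residue_size v) ^ 3) V \<le> B" if V: "finite V" "V \<subseteq> places" for V :: "('f \<Rightarrow> int) set"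
  proof -
    have "sum (\<lambda>v. 1 / real (residue_size v) ^ 3) V
        = (\<Sum>Q\<in>residue_size ` V. \<Sum>v\<in>{v \<in> V. residue_size v = Q}. 1 / real (residue_size v) ^ 3)"
      by (rule sum.image_gen[OF V(1)])
    also have "\<dots> \<le> (\<Sum>Q\<in>residue_size ` V. 2 * real a * inverse (real Q ^ 2))"
    proof (rule sum_mono)
      fix Q assume "Q \<in> residue_size ` V"
      then have Q: "1 \<le> Q" using V residue_size_pos by fastforce
      let ?V = "{v \<in> V. residue_size v = Q}"
      have "card ?V \<le> a * (Q + 1)" by (rule a[rule_format]) (use V in auto)
      also have "\<dots> \<le> a * (2 * Q)" using Q by simp
      finally have "real (card ?V) \<le> real (a * (2 * Q))" by (rule of_nat_mono)
      then have c: "real (card ?V) \<le> 2 * real a * real Q" by simp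
      have "(\<Sum>v\<in>?V. 1 / real (residue_size v) ^ 3) = real (card ?V) * (1 / real Q ^ 3)" by simp
      also have "\<dots> \<le> (2 * real a * real Q) * (1 / real Q ^ 3)" using c by (intro mult_right_mono) auto
      also have "\<dots> = 2 * real a * inverse (real Q ^ 2)" using Q by (simp add: field_simps power3_eq_cube power2_eq_square)
      finally show "(\<Sum>v\<in>?V. 1 / real (residue_size v) ^ 3) \<le> 2 * real a * inverse (real Q ^ 2)" .
    qed
    also have "\<dots> = 2 * real a * (\<Sum>Q\<in>residue_size ` V. inverse (real Q ^ 2))" by (simp add: sum_distrib_left)
    also have "\<dots> \<le> B" unfolding B_def using V sq by (intro mult_left_mono sum_le_suminf) auto
    finally show ?thesis .
  qed
  then show ?thesis by (intro nonneg_bdd_above_summable_on) (auto simp: bdd_above_def)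
qed

end

section \<open>Rings of HOL-Algebra carried by types\<close>

lemma type_ring_simps [simp]:
  "carrier ring_of_type_algebra = UNIV" "x \<otimes>\<^bsub>ring_of_type_algebra\<^esub> y = x * y"
  "x \<oplus>\<^bsub>ring_of_type_algebra\<^esub> y = x + y" "\<one>\<^bsub>ring_of_type_algebra\<^esub> = 1" "\<zero>\<^bsub>ring_of_type_algebra\<^esub> = 0"
  by (simp_all add: ring_of_type_algebra_def)

lemma type_ring_uminus: "\<ominus>\<^bsub>ring_of_type_algebra\<^esub> x = - (x :: 'a::comm_ring_1)"
proof -
  interpret cring "ring_of_type_algebra :: 'a ring" by (rule cring_from_type_algebra)
  show ?thesis by (rule minus_equality) auto
qed

lemma type_ring_inverse: "(x :: 'a::field) \<noteq> 0 \<Longrightarrow> inv\<^bsub>ring_of_type_algebra\<^esub> x = inverse x"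
proof -
  assume x: "x \<noteq> 0"
  interpret cring "ring_of_type_algebra :: 'a ring" by (rule cring_from_type_algebra)
  show ?thesis by (rule comm_inv_char) (use x in auto)
qed

lemma type_ring_pow: "x [^]\<^bsub>ring_of_type_algebra\<^esub> (n::nat) = (x :: 'a::comm_ring_1) ^ n"
proof -
  interpret cring "ring_of_type_algebra :: 'a ring" by (rule cring_from_type_algebra)
  show ?thesis by (induction n) (simp_all add: mult.commute)
qed

text \<open>Transcendence and finite dimension over the generated subfield are translated into
  \<open>transc\<close> and \<open>spanning\<close>. Elements of k(t) are fractions of polynomials
  in \<open>t\<close>, and the finitely many coefficients of a vector have a common
  denominator.\<close>

lemma function_field_global:
  fixes k :: "'f::field set"
  assumes ff: "function_field k"
  shows "global_function_field k"
proof -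
  let ?R = "ring_of_type_algebra :: 'f ring"
  interpret F: field ?R by (rule field_from_type_algebra)
  have sub: "subfield k ?R" using ff by (simp add: function_field_def)
  note sr = subringE[OF subfieldE(1)[OF sub]]
  interpret constant_field k
  proof
    show "finite k" using ff by (simp add: function_field_def)
    show "1 \<in> k" using sr(3) by simp
    show "a + b \<in> k" "a * b \<in> k" if "a \<in> k" "b \<in> k" for a b using sr(6)[OF that] sr(7)[OF that] by simp_all
    show "- a \<in> k" if "a \<in> k" for a using sr(5)[OF that] by (simp add: type_ring_uminus)
    show "inverse a \<in> k" if "a \<in> k" for a
      using F.subfield_m_inv(1)[OF sub, of a] that by (cases "a = 0") (simp_all add: type_ring_inverse)
  qed
  \<comment> \<open>HOL-Algebra lists polynomial coefficients from the highest degree down, hence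
    \<open>rev\<close>.\<close>
  have eval: "F.eval l x = poly (Poly (rev l)) x" for l x
    by (induction l) (simp_all add: Poly_append poly_monom type_ring_pow)
  have tr: "transc x" if x: "F.transcendental k x" for x
    unfolding transc_def
  proof (intro ballI impI)
    fix p assume p: "p \<in> kpol" "poly p x = 0"
    let ?l = "rev (coeffs p)"
    have "set (coeffs p) \<subseteq> k" using p(1) by (auto simp: kpol_def coeffs_def)
    then have "polynomial\<^bsub>?R\<^esub> k ?l"
      by (cases "p = 0") (simp_all add: polynomial_def hd_rev last_coeffs_eq_coeff_degree)
    then have "?l \<in> carrier (k [X]\<^bsub>?R\<^esub>)" by (simp add: univ_poly_def)
    moreover have "[] \<in> carrier (k [X]\<^bsub>?R\<^esub>)" by (simp add: univ_poly_def polynomial_def)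
    moreover have "F.eval ?l x = F.eval [] x" using p(2) by (simp add: eval)
    ultimately have "?l = []" using x unfolding F.transcendental_def by (meson inj_onD)
    then show "p = 0" by simp
  qed
  show ?thesis
  proof
    fix x assume "\<not> transc x"
    then have "\<not> F.transcendental k x" using tr by blast
    then show "x \<in> k" using ff by (simp add: function_field_def)
  next
    obtain t where t: "F.transcendental k t" "F.finite_dimension (generate_field ?R (insert t k)) UNIV"
      using ff by (auto simp: function_field_def)
    have trt: "transc t" using tr t by blast
    let ?K = "generate_field ?R (insert t k)"
    have K: "\<exists>p g. p \<in> kpol \<and> g \<in> kpol \<and> g \<noteq> 0 \<and> poly g t * h = poly p t" if "h \<in> ?K" for h
      using that
    proof (induction rule: generate_field.induct)
      case one
      show ?case using kpol_1 by (intro exI[of _ 1]) simp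
    next
      case (incl h)
      show ?case
      proof (cases "h = t")
        case True
        then show ?thesis using kpol_1 kpol_monom[OF one_k, of 1]
          by (intro exI[of _ "monom 1 1"] exI[of _ 1]) (simp add: poly_monom)
      next
        case False
        then show ?thesis using kpol_1 kpol_const incl by (intro exI[of _ "[:h:]"] exI[of _ 1]) simp
      qed
    next
      case (a_inv h)
      then obtain p g where "p \<in> kpol" "g \<in> kpol" "g \<noteq> 0" "poly g t * h = poly p t" by blast
      then show ?case using kpol_uminus by (intro exI[of _ "- p"] exI[of _ g]) (simp add: type_ring_uminus)
    next
      case (m_inv h)
      then obtain p g where pg: "p \<in> kpol" "g \<in> kpol" "g \<noteq> 0" "poly g t * h = poly p t" by blast
      have h0: "h \<noteq> 0" using m_inv by simp
      have gt: "poly g t \<noteq> 0" using trt pg by (auto simp: transc_def)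
      then have "p \<noteq> 0" using pg h0 by auto
      moreover have "poly p t * inverse h = poly g t" using h0 by (simp add: pg(4)[symmetric])
      ultimately show ?case using pg h0 by (intro exI[of _ g] exI[of _ p]) (simp add: type_ring_inverse)
    next
      case (eng_add h1 h2)
      then obtain p g p' g' where a: "p \<in> kpol" "g \<in> kpol" "g \<noteq> 0" "poly g t * h1 = poly p t"
        "p' \<in> kpol" "g' \<in> kpol" "g' \<noteq> 0" "poly g' t * h2 = poly p' t" by metis
      have "poly (g * g') t * (h1 + h2) = poly (p * g' + p' * g) t"
        by (simp add: a(4,8)[symmetric] algebra_simps)
      then show ?case using a kpol_mult kpol_add
        by (intro exI[of _ "p * g' + p' * g"] exI[of _ "g * g'"]) simp
    next
      case (eng_mult h1 h2)
      then obtain p g p' g' where a: "p \<in> kpol" "g \<in> kpol" "g \<noteq> 0" "poly g t * h1 = poly p t"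
        "p' \<in> kpol" "g' \<in> kpol" "g' \<noteq> 0" "poly g' t * h2 = poly p' t" by metis
      have "poly (g * g') t * (h1 * h2) = poly (p * p') t"
        by (simp add: a(4,8)[symmetric] algebra_simps)
      then show ?case using a kpol_mult by (intro exI[of _ "p * p'"] exI[of _ "g * g'"]) simp
    qed
    obtain n where "F.dimension n ?K UNIV" using t(2) by (auto simp: F.finite_dimension_def)
    moreover have subK: "subfield ?K ?R" by (rule F.generate_field_is_subfield) simp
    ultimately obtain Us where Us: "length Us = n" "F.Span ?K Us = UNIV" using F.exists_base by metis
    define w where "w i = Us ! i" for i
    have comb: "\<exists>c. (\<forall>i<length Us. c i \<in> ?K) \<and> F.combine Ks Us = (\<Sum>i<length Us. c i * Us ! i)"
      if "set Ks \<subseteq> ?K" for Ks Us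
      using that
    proof (induction Ks Us rule: F.combine.induct)
      case (1 a Ks u Us)
      then obtain c where c: "\<forall>i<length Us. c i \<in> ?K" "F.combine Ks Us = (\<Sum>i<length Us. c i * Us ! i)" by auto
      show ?case
        by (rule exI[of _ "case_nat a c"])
          (use 1 c in \<open>auto simp: sum.lessThan_Suc_shift less_Suc_eq_0_disj simp del: sum.lessThan_Suc\<close>)
    next
      case ("2_1" Us)
      have "0 \<in> ?K" using F.zero_in_generate by simp
      then show ?case by (intro exI[of _ "\<lambda>_. 0"]) simp
    qed simp
    have "spanning t n w"
      unfolding spanning_def
    proof (intro conjI allI trt)
      fix f
      have "f \<in> F.Span ?K Us" using Us by simp
      then obtain Ks where Ks: "set Ks \<subseteq> ?K" "f = F.combine Ks Us"
        using F.Span_eq_combine_set[OF subK, of Us] by auto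
      obtain c where c: "\<And>i. i < n \<Longrightarrow> c i \<in> ?K" "f = (\<Sum>i<n. c i * w i)"
        using comb[OF Ks(1), of Us] Ks(2) Us(1) unfolding w_def by blast
      have "\<forall>i<n. \<exists>p g. p \<in> kpol \<and> g \<in> kpol \<and> g \<noteq> 0 \<and> poly g t * c i = poly p t" using K c(1) by blast
      then obtain p g where pg: "\<And>i. i < n \<Longrightarrow> p i \<in> kpol \<and> g i \<in> kpol \<and> g i \<noteq> 0 \<and> poly (g i) t * c i = poly (p i) t"
        by metis
      define G where "G = (\<Prod>i<n. g i)"
      have prodk: "(\<Prod>i\<in>A. g i) \<in> kpol" if "A \<subseteq> {..<n}" for A
        using finite_subset[OF that] that by (induction A rule: infinite_finite_induct) (use pg in \<open>auto intro: kpol_1 kpol_mult\<close>)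
      have G: "G \<in> kpol" "G \<noteq> 0" using prodk[of "{..<n}"] pg by (auto simp: G_def)
      define P where "P i = p i * (\<Prod>j\<in>{..<n} - {i}. g j)" for i
      have Pk: "P i \<in> kpol" if "i < n" for i unfolding P_def using pg[OF that] prodk by (intro kpol_mult) auto
      have eq: "poly G t * f = (\<Sum>i<n. poly (P i) t * w i)"
        unfolding c(2) sum_distrib_left
      proof (rule sum.cong[OF refl])
        fix i assume i: "i \<in> {..<n}"
        have "G = g i * (\<Prod>j\<in>{..<n} - {i}. g j)" unfolding G_def by (rule prod.remove) (use i in auto)
        then have Gt: "poly G t = poly (g i) t * poly (\<Prod>j\<in>{..<n} - {i}. g j) t" by simp
        have "poly G t * (c i * w i) = (poly (g i) t * c i) * poly (\<Prod>j\<in>{..<n} - {i}. g j) t * w i"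
          unfolding Gt by (simp only: mult_ac)
        also have "poly (g i) t * c i = poly (p i) t" using pg i by simp
        finally show "poly G t * (c i * w i) = poly (P i) t * w i" by (simp add: P_def)
      qed
      have "f \<in> ratspan t n w (poly G t) (\<Sum>i<n. degree (P i))"
        unfolding ratspan_def
      proof (intro CollectI exI[of _ P] conjI allI impI eq)
        fix i assume i: "i < n"
        have "degree (P i) \<le> (\<Sum>i<n. degree (P i))" by (rule member_le_sum) (use i in auto)
        then show "P i \<in> kpl (\<Sum>i<n. degree (P i))" using Pk[OF i] by (simp add: kpl_def)
      qed
      then show "\<exists>g\<in>kpol. g \<noteq> 0 \<and> (\<exists>l. f \<in> ratspan t n w (poly g t) l)" using G by blast
    qed
    then show "\<exists>t n w. spanning t n w" by blast
  qed
qed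

section \<open>Completions\<close>

definition cauchy_seq :: "('f::field \<Rightarrow> int) \<Rightarrow> (nat \<Rightarrow> 'f) \<Rightarrow> bool" where
  "cauchy_seq v x \<longleftrightarrow> (\<forall>N. \<exists>n0. \<forall>m\<ge>n0. \<forall>n\<ge>n0. val_ge v N (x m - x n))"

lemma cauchy_ring_simps [simp]:
  "carrier (cauchy_ring v) = {x. cauchy_seq v x}"
  "x \<otimes>\<^bsub>cauchy_ring v\<^esub> y = (\<lambda>n. x n * y n)" "\<one>\<^bsub>cauchy_ring v\<^esub> = (\<lambda>_. 1)"
  "\<zero>\<^bsub>cauchy_ring v\<^esub> = (\<lambda>_. 0)" "x \<oplus>\<^bsub>cauchy_ring v\<^esub> y = (\<lambda>n. x n + y n)"
  by (simp_all add: cauchy_ring_def cauchy_seq_def)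

locale place =
  fixes v :: "'f::field \<Rightarrow> int"
  assumes place: "v \<in> places"
begin

lemma cauchy_const: "cauchy_seq v (\<lambda>_. c)"
  by (simp add: cauchy_seq_def)

lemma cauchy_add:
  assumes "cauchy_seq v x" "cauchy_seq v y" shows "cauchy_seq v (\<lambda>n. x n + y n)"
  unfolding cauchy_seq_def
proof
  fix N
  obtain n0 n1 where n: "\<forall>m\<ge>n0. \<forall>n\<ge>n0. val_ge v N (x m - x n)" "\<forall>m\<ge>n1. \<forall>n\<ge>n1. val_ge v N (y m - y n)"
    using assms unfolding cauchy_seq_def by meson
  have "val_ge v N ((x m + y m) - (x n + y n))" if "m \<ge> max n0 n1" "n \<ge> max n0 n1" for m n
    using val_ge_add[OF place, of N "x m - x n" "y m - y n"] n that by (simp add: algebra_simps)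
  then show "\<exists>n0. \<forall>m\<ge>n0. \<forall>n\<ge>n0. val_ge v N ((x m + y m) - (x n + y n))" by blast
qed

lemma cauchy_bounded:
  assumes "cauchy_seq v x" shows "\<exists>B\<le>0. \<forall>n. val_ge v B (x n)"
proof -
  obtain n0 where n0: "\<forall>m\<ge>n0. \<forall>n\<ge>n0. val_ge v 0 (x m - x n)" using assms unfolding cauchy_seq_def by meson
  define B where "B = - (\<Sum>n\<le>n0. \<bar>v (x n)\<bar>)"
  have B0: "B \<le> 0" unfolding B_def by (simp add: sum_nonneg)
  have small: "val_ge v B (x n)" if "n \<le> n0" for n
  proof -
    have "\<bar>v (x n)\<bar> \<le> (\<Sum>n\<le>n0. \<bar>v (x n)\<bar>)" by (rule member_le_sum) (use that in auto)
    then show ?thesis unfolding B_def val_ge_def by linarith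
  qed
  have "val_ge v B (x n)" for n
  proof (cases "n \<le> n0")
    case False
    then have "val_ge v B (x n - x n0)" using n0 B0 False by (meson val_ge_mono nat_le_linear order_refl)
    then show ?thesis using val_ge_add[OF place _ small[of n0], of "x n - x n0"] by simp
  qed (use small in auto)
  then show ?thesis using B0 by blast
qed

lemma cauchy_mult:
  assumes "cauchy_seq v x" "cauchy_seq v y" shows "cauchy_seq v (\<lambda>n. x n * y n)"
  unfolding cauchy_seq_def
proof
  fix N
  obtain B C where B: "\<forall>n. val_ge v B (x n)" "\<forall>n. val_ge v C (y n)"
    using cauchy_bounded assms by meson
  obtain n0 n1 where n: "\<forall>m\<ge>n0. \<forall>n\<ge>n0. val_ge v (N - C) (x m - x n)" "\<forall>m\<ge>n1. \<forall>n\<ge>n1. val_ge v (N - B) (y m - y n)"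
    using assms unfolding cauchy_seq_def by meson
  have "val_ge v N (x m * y m - x n * y n)" if "m \<ge> max n0 n1" "n \<ge> max n0 n1" for m n
  proof -
    have "val_ge v (N - B + B) ((y m - y n) * x m)" by (rule val_ge_mult[OF place]) (use n B that in auto)
    moreover have "val_ge v (N - C + C) ((x m - x n) * y n)" by (rule val_ge_mult[OF place]) (use n B that in auto)
    ultimately have "val_ge v N ((y m - y n) * x m + (x m - x n) * y n)" by (intro val_ge_add place) simp_all
    then show ?thesis by (simp add: algebra_simps)
  qed
  then show "\<exists>n0. \<forall>m\<ge>n0. \<forall>n\<ge>n0. val_ge v N (x m * y m - x n * y n)" by blast
qed

lemma cauchy_uminus: "cauchy_seq v x \<Longrightarrow> cauchy_seq v (\<lambda>n. - x n)"
  using cauchy_mult[OF cauchy_const[of "-1"]] by simp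

sublocale cauchy: cring "cauchy_ring v"
proof (intro cringI abelian_groupI comm_monoidI)
  fix x assume "x \<in> carrier (cauchy_ring v)"
  then show "\<exists>y\<in>carrier (cauchy_ring v). y \<oplus>\<^bsub>cauchy_ring v\<^esub> x = \<zero>\<^bsub>cauchy_ring v\<^esub>"
    by (intro bexI[of _ "\<lambda>n. - x n"]) (auto intro: cauchy_uminus)
qed (simp_all add: cauchy_add cauchy_mult cauchy_const fun_eq_iff algebra_simps)

lemma cauchy_ring_uminus: "cauchy_seq v x \<Longrightarrow> \<ominus>\<^bsub>cauchy_ring v\<^esub> x = (\<lambda>n. - x n)"
  by (rule cauchy.minus_equality) (auto intro: cauchy_uminus)

lemma null_iff: "x \<in> null_seqs v \<longleftrightarrow> (\<forall>N. \<exists>n0. \<forall>n\<ge>n0. val_ge v N (x n))"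
  by (simp add: null_seqs_def)

lemma null_cauchy: "x \<in> null_seqs v \<Longrightarrow> cauchy_seq v x"
  unfolding null_seqs_def cauchy_seq_def mem_Collect_eq
proof
  fix N assume "\<forall>N. \<exists>n0. \<forall>n\<ge>n0. val_ge v N (x n)"
  then obtain n0 where "\<forall>n\<ge>n0. val_ge v N (x n)" by blast
  then show "\<exists>n0. \<forall>m\<ge>n0. \<forall>n\<ge>n0. val_ge v N (x m - x n)" using val_ge_diff[OF place] by blast
qed

lemma null_add: "x \<in> null_seqs v \<Longrightarrow> y \<in> null_seqs v \<Longrightarrow> (\<lambda>n. x n + y n) \<in> null_seqs v"
  unfolding null_seqs_def mem_Collect_eq
proof
  fix N assume "\<forall>N. \<exists>n0. \<forall>n\<ge>n0. val_ge v N (x n)" "\<forall>N. \<exists>n0. \<forall>n\<ge>n0. val_ge v N (y n)"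
  then obtain n0 n1 where "\<forall>n\<ge>n0. val_ge v N (x n)" "\<forall>n\<ge>n1. val_ge v N (y n)" by meson
  then have "\<forall>n\<ge>max n0 n1. val_ge v N (x n + y n)" using val_ge_add[OF place] by simp
  then show "\<exists>n0. \<forall>n\<ge>n0. val_ge v N (x n + y n)" by blast
qed

lemma null_mult: "x \<in> null_seqs v \<Longrightarrow> cauchy_seq v y \<Longrightarrow> (\<lambda>n. x n * y n) \<in> null_seqs v"
  unfolding null_seqs_def mem_Collect_eq
proof
  fix N assume x: "\<forall>N. \<exists>n0. \<forall>n\<ge>n0. val_ge v N (x n)" and "cauchy_seq v y"
  then obtain B where B: "\<forall>n. val_ge v B (y n)" using cauchy_bounded by meson
  obtain n0 where "\<forall>n\<ge>n0. val_ge v (N - B) (x n)" using x by blast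
  then have "\<forall>n\<ge>n0. val_ge v N (x n * y n)" using val_ge_mult[OF place, of "N - B" _ B] B by simp
  then show "\<exists>n0. \<forall>n\<ge>n0. val_ge v N (x n * y n)" by blast
qed

lemma null_uminus: "x \<in> null_seqs v \<Longrightarrow> (\<lambda>n. - x n) \<in> null_seqs v"
  using null_mult[OF _ cauchy_const[of "-1"]] by simp

sublocale null: ideal "null_seqs v" "cauchy_ring v"
proof (rule idealI[OF cauchy.ring_axioms])
  show "subgroup (null_seqs v) (add_monoid (cauchy_ring v))"
  proof
    fix x assume x: "x \<in> null_seqs v"
    have "inv\<^bsub>add_monoid (cauchy_ring v)\<^esub> x = (\<lambda>n. - x n)"
      using cauchy_ring_uminus[OF null_cauchy[OF x]] by (simp add: a_inv_def)
    then show "inv\<^bsub>add_monoid (cauchy_ring v)\<^esub> x \<in> null_seqs v" using null_uminus[OF x] by simp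
  qed (simp_all add: null_cauchy null_add subset_iff, simp add: null_seqs_def)
qed (use null_mult in \<open>simp_all add: mult.commute\<close>)

sublocale completion: cring "completion v"
  unfolding completion_def by (rule null.quotient_is_cring[OF cauchy.is_cring])

abbreviation cls :: "(nat \<Rightarrow> 'f) \<Rightarrow> (nat \<Rightarrow> 'f) set" where
  "cls x \<equiv> null_seqs v +>\<^bsub>cauchy_ring v\<^esub> x"

lemma cls_iff: "y \<in> cls x \<longleftrightarrow> (\<lambda>n. y n - x n) \<in> null_seqs v"
proof
  assume "y \<in> cls x"
  then obtain h where "h \<in> null_seqs v" "y = (\<lambda>n. h n + x n)" by (auto simp: a_r_coset_def' )
  then show "(\<lambda>n. y n - x n) \<in> null_seqs v" by simp
next
  assume "(\<lambda>n. y n - x n) \<in> null_seqs v"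
  then show "y \<in> cls x" unfolding a_r_coset_def' by (auto intro!: bexI[of _ "\<lambda>n. y n - x n"])
qed

lemma cls_self: "x \<in> cls x"
  by (simp add: cls_iff null_iff)

lemma completion_carrierE:
  assumes "C \<in> carrier (completion v)"
  obtains x where "cauchy_seq v x" "C = cls x"
  using assms by (auto simp: completion_def FactRing_def A_RCOSETS_def')

lemma cls_carrier: "cauchy_seq v x \<Longrightarrow> cls x \<in> carrier (completion v)"
  by (auto simp: completion_def FactRing_def A_RCOSETS_def')

lemma cls_hom:
  assumes "cauchy_seq v x" "cauchy_seq v y"
  shows "cls x \<otimes>\<^bsub>completion v\<^esub> cls y = cls (\<lambda>n. x n * y n)"
    "cls x \<oplus>\<^bsub>completion v\<^esub> cls y = cls (\<lambda>n. x n + y n)"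
  using ring_hom_mult[OF null.rcos_ring_hom, of x y] ring_hom_add[OF null.rcos_ring_hom, of x y] assms
  by (simp_all add: completion_def)

lemma cls_one: "\<one>\<^bsub>completion v\<^esub> = cls (\<lambda>_. 1)"
  using ring_hom_one[OF null.rcos_ring_hom] by (simp add: completion_def)

lemma cls_zero: "\<zero>\<^bsub>completion v\<^esub> = cls (\<lambda>_. 0)"
proof -
  have "cls (\<lambda>_. 0) = null_seqs v" by (rule Set.set_eqI) (simp add: cls_iff)
  then show ?thesis by (simp add: completion_def FactRing_def)
qed

lemma cls_eq: "y \<in> cls x \<Longrightarrow> cauchy_seq v x \<Longrightarrow> cls y = cls x \<and> cauchy_seq v y"
proof -
  assume y: "y \<in> cls x" and x: "cauchy_seq v x"
  then have d: "(\<lambda>n. y n - x n) \<in> null_seqs v" by (simp add: cls_iff)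
  have "z \<in> cls y \<longleftrightarrow> z \<in> cls x" for z
    using null_add[OF _ d, of "\<lambda>n. z n - y n"] null_add[OF _ null_uminus[OF d], of "\<lambda>n. z n - x n"]
    by (auto simp: cls_iff)
  moreover have "cauchy_seq v y" using cauchy_add[OF null_cauchy[OF d] x] by simp
  ultimately show ?thesis by blast
qed

text \<open>A Cauchy sequence that is not null has eventually constant valuation. Looking only at
  eventual behaviour makes this a property of the class, as \<open>eventual_val_cls\<close>
  shows.\<close>

definition eventual_val :: "(nat \<Rightarrow> 'f) \<Rightarrow> int \<Rightarrow> bool" where
  "eventual_val x j \<longleftrightarrow> (\<exists>n0. \<forall>n\<ge>n0. x n \<noteq> 0 \<and> v (x n) = j)"

lemma eventual_val_cls:
  assumes "eventual_val x j" "y \<in> cls x" shows "eventual_val y j"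
proof -
  obtain n0 where n0: "\<And>n. n \<ge> n0 \<Longrightarrow> x n \<noteq> 0 \<and> v (x n) = j" using assms(1) unfolding eventual_val_def by blast
  obtain n1 where n1: "\<And>n. n \<ge> n1 \<Longrightarrow> val_ge v (j + 1) (y n - x n)"
    using assms(2) unfolding cls_iff null_iff by blast
  have "y n \<noteq> 0 \<and> v (y n) = j" if "n \<ge> max n0 n1" for n
    using place_add_strict[OF place, of "x n" "y n - x n"] n0[of n] n1[of n] that by (auto simp: val_ge_def)
  then show ?thesis unfolding eventual_val_def by blast
qed

lemma eventual_val_unique: "eventual_val x j \<Longrightarrow> eventual_val x j' \<Longrightarrow> j = j'"
  unfolding eventual_val_def by (metis max.cobounded1 max.cobounded2)

lemma completion_val_cls:
  assumes "eventual_val x j" "cauchy_seq v x" shows "completion_val v (cls x) = j"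
  unfolding completion_val_def
proof (rule the_equality)
  show "\<exists>y\<in>cls x. \<exists>n0. \<forall>n\<ge>n0. y n \<noteq> 0 \<and> v (y n) = j"
    using assms(1) cls_self unfolding eventual_val_def by blast
  fix j' assume "\<exists>y\<in>cls x. \<exists>n0. \<forall>n\<ge>n0. y n \<noteq> 0 \<and> v (y n) = j'"
  then obtain y where "y \<in> cls x" "eventual_val y j'" unfolding eventual_val_def by blast
  then show "j' = j" using eventual_val_cls[OF assms(1)] eventual_val_unique by blast
qed

lemma eventual_val_mult: "eventual_val x j \<Longrightarrow> eventual_val y l \<Longrightarrow> eventual_val (\<lambda>n. x n * y n) (j + l)"
proof -
  assume "eventual_val x j" "eventual_val y l"
  then obtain n0 n1 where "\<And>n. n \<ge> n0 \<Longrightarrow> x n \<noteq> 0 \<and> v (x n) = j" "\<And>n. n \<ge> n1 \<Longrightarrow> y n \<noteq> 0 \<and> v (y n) = l"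
    unfolding eventual_val_def by blast
  then show ?thesis unfolding eventual_val_def by (intro exI[of _ "max n0 n1"]) (simp add: place_mult place)
qed

text \<open>A sequence for the inverse class has valuations at least some \<open>B\<close>, so
  eventually v(x n) <= -B. Once the differences of \<open>x\<close> have valuation at least 1 - B,
  they can no longer change v(x n).\<close>

lemma unit_eventual_val:
  assumes "C \<in> Units (completion v)"
  obtains x j where "cauchy_seq v x" "C = cls x" "eventual_val x j"
proof -
  obtain D where D: "D \<in> carrier (completion v)" "C \<otimes>\<^bsub>completion v\<^esub> D = \<one>\<^bsub>completion v\<^esub>" "C \<in> carrier (completion v)"
    using assms by (auto simp: Units_def)
  obtain x where x: "cauchy_seq v x" "C = cls x" using D(3) by (rule completion_carrierE)
  obtain y where y: "cauchy_seq v y" "D = cls y" using D(1) by (rule completion_carrierE)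
  have "cls (\<lambda>n. x n * y n) = cls (\<lambda>_. 1)" using D(2) cls_hom(1)[OF x(1) y(1)] x y cls_one by simp
  then have "(\<lambda>n. x n * y n) \<in> cls (\<lambda>_. 1)" using cls_self by blast
  then obtain n0 where n0: "\<And>n. n \<ge> n0 \<Longrightarrow> val_ge v 1 (x n * y n - 1)" unfolding cls_iff null_iff by blast
  have xy: "x n \<noteq> 0 \<and> y n \<noteq> 0 \<and> v (x n) + v (y n) = 0" if "n \<ge> n0" for n
  proof -
    have "1 + (x n * y n - 1) \<noteq> 0 \<and> v (1 + (x n * y n - 1)) = v 1"
      by (rule place_add_strict[OF place]) (use n0[OF that] in \<open>auto simp: val_ge_def place_1 place\<close>)
    then show ?thesis by (auto simp: place_1 place_mult place)
  qed
  obtain B where B: "\<And>n. val_ge v B (y n)" using cauchy_bounded[OF y(1)] by blast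
  obtain n1 where n1: "\<And>m n. m \<ge> n1 \<Longrightarrow> n \<ge> n1 \<Longrightarrow> val_ge v (1 - B) (x m - x n)"
    using x(1) unfolding cauchy_seq_def by blast
  have "eventual_val x (v (x (max n0 n1)))"
    unfolding eventual_val_def
  proof (intro exI[of _ "max n0 n1"] allI impI)
    fix n assume n: "n \<ge> max n0 n1"
    let ?l = "max n0 n1"
    have "v (x ?l) \<le> - B" using xy[of ?l] B[of ?l] by (auto simp: val_ge_def)
    moreover have "val_ge v (1 - B) (x n - x ?l)" using n1 n by simp
    ultimately have "x ?l + (x n - x ?l) \<noteq> 0 \<and> v (x ?l + (x n - x ?l)) = v (x ?l)"
      using xy[of ?l] by (intro place_add_strict[OF place]) (auto simp: val_ge_def)
    then show "x n \<noteq> 0 \<and> v (x n) = v (x ?l)" by simp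
  qed
  then show ?thesis using that x by blast
qed

lemma completion_val_mult:
  assumes "C \<in> Units (completion v)" "D \<in> Units (completion v)"
  shows "completion_val v (C \<otimes>\<^bsub>completion v\<^esub> D) = completion_val v C + completion_val v D"
proof -
  obtain x j where x: "cauchy_seq v x" "C = cls x" "eventual_val x j" using assms(1) by (rule unit_eventual_val)
  obtain y l where y: "cauchy_seq v y" "D = cls y" "eventual_val y l" using assms(2) by (rule unit_eventual_val)
  show ?thesis unfolding x(2) y(2) cls_hom(1)[OF x(1) y(1)]
    using completion_val_cls[OF eventual_val_mult[OF x(3) y(3)] cauchy_mult[OF x(1) y(1)]]
      completion_val_cls[OF x(3,1)] completion_val_cls[OF y(3,1)] by simp
qed

lemma integers_iff:
  assumes x: "cauchy_seq v x"
  shows "cls x \<in> completion_integers v \<longleftrightarrow> (\<exists>n0. \<forall>n\<ge>n0. val_ge v 0 (x n))"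
proof
  assume "cls x \<in> completion_integers v"
  then obtain y where y: "y \<in> cls x" "\<And>n. val_ge v 0 (y n)" unfolding completion_integers_def by blast
  then obtain n0 where n0: "\<And>n. n \<ge> n0 \<Longrightarrow> val_ge v 0 (y n - x n)" unfolding cls_iff null_iff by blast
  have "val_ge v 0 (x n)" if "n \<ge> n0" for n using val_ge_diff[OF place y(2)[of n] n0[OF that]] by simp
  then show "\<exists>n0. \<forall>n\<ge>n0. val_ge v 0 (x n)" by blast
next
  assume "\<exists>n0. \<forall>n\<ge>n0. val_ge v 0 (x n)"
  then obtain n0 where n0: "\<And>n. n \<ge> n0 \<Longrightarrow> val_ge v 0 (x n)" by blast
  \<comment> \<open>\<open>completion_integers\<close> asks for a representative that is integral at
    every index, so the finitely many early terms are replaced by 0.\<close>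
  let ?y = "\<lambda>n. if n \<ge> n0 then x n else 0"
  have "?y \<in> cls x" unfolding cls_iff null_iff by (intro CollectI allI exI[of _ n0]) simp
  moreover have "\<forall>n. val_ge v 0 (?y n)" using n0 by simp
  ultimately show "cls x \<in> completion_integers v"
    unfolding completion_integers_def using cls_carrier[OF x] by (intro CollectI conjI bexI[of _ ?y])
qed

lemma integers_carrier: "completion_integers v \<subseteq> carrier (completion v)"
  by (auto simp: completion_integers_def)

lemma integers_const: "val_ge v 0 c \<Longrightarrow> cls (\<lambda>_. c) \<in> completion_integers v"
  by (simp add: integers_iff cauchy_const)

lemma integers_mult:
  assumes "C \<in> completion_integers v" "D \<in> completion_integers v"
  shows "C \<otimes>\<^bsub>completion v\<^esub> D \<in> completion_integers v" "C \<oplus>\<^bsub>completion v\<^esub> D \<in> completion_integers v"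
proof -
  obtain x where x: "cauchy_seq v x" "C = cls x" using assms(1) integers_carrier completion_carrierE by blast
  obtain y where y: "cauchy_seq v y" "D = cls y" using assms(2) integers_carrier completion_carrierE by blast
  obtain n0 n1 where n: "\<forall>n\<ge>n0. val_ge v 0 (x n)" "\<forall>n\<ge>n1. val_ge v 0 (y n)"
    using assms integers_iff x y by meson
  have "\<forall>n\<ge>max n0 n1. val_ge v 0 (x n * y n)" "\<forall>n\<ge>max n0 n1. val_ge v 0 (x n + y n)"
    using n val_ge_mult_0[OF place] val_ge_add[OF place] by simp_all
  then show "C \<otimes>\<^bsub>completion v\<^esub> D \<in> completion_integers v" "C \<oplus>\<^bsub>completion v\<^esub> D \<in> completion_integers v"
    unfolding x(2) y(2) cls_hom[OF x(1) y(1)]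
    using integers_iff[OF cauchy_mult[OF x(1) y(1)]] integers_iff[OF cauchy_add[OF x(1) y(1)]] by blast+
qed

lemma integers_one: "\<one>\<^bsub>completion v\<^esub> \<in> completion_integers v"
  unfolding cls_one by (rule integers_const) (simp add: val_ge_1 place)

lemma integers_zero: "\<zero>\<^bsub>completion v\<^esub> \<in> completion_integers v"
  unfolding cls_zero by (rule integers_const) simp

lemma integers_uminus:
  assumes "C \<in> completion_integers v" shows "\<ominus>\<^bsub>completion v\<^esub> C \<in> completion_integers v"
proof -
  have C: "C \<in> carrier (completion v)" using assms integers_carrier by blast
  have m: "cls (\<lambda>_. -1) \<in> completion_integers v"
    by (rule integers_const) (use val_ge_uminus[OF place, of 0 1] val_ge_1[OF place] in simp)
  have "cls (\<lambda>_. -1) = \<ominus>\<^bsub>completion v\<^esub> \<one>\<^bsub>completion v\<^esub>"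
  proof (rule completion.minus_equality[symmetric])
    show "cls (\<lambda>_. -1) \<oplus>\<^bsub>completion v\<^esub> \<one>\<^bsub>completion v\<^esub> = \<zero>\<^bsub>completion v\<^esub>"
      by (simp add: cls_one cls_zero cls_hom cauchy_const)
  qed (auto intro: cls_carrier cauchy_const)
  then have "\<ominus>\<^bsub>completion v\<^esub> C = cls (\<lambda>_. -1) \<otimes>\<^bsub>completion v\<^esub> C" using C completion.l_minus by simp
  then show ?thesis using integers_mult(1)[OF m assms] by simp
qed

lemma unit_integer_iff:
  assumes "C \<in> Units (completion v)"
  shows "C \<in> completion_integers v \<longleftrightarrow> 0 \<le> completion_val v C"
proof -
  obtain x j where x: "cauchy_seq v x" "C = cls x" "eventual_val x j" using assms by (rule unit_eventual_val)
  obtain n1 where n1: "\<And>n. n \<ge> n1 \<Longrightarrow> x n \<noteq> 0 \<and> v (x n) = j" using x(3) unfolding eventual_val_def by blast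
  have "(\<exists>n0. \<forall>n\<ge>n0. val_ge v 0 (x n)) \<longleftrightarrow> 0 \<le> j"
  proof
    assume "\<exists>n0. \<forall>n\<ge>n0. val_ge v 0 (x n)"
    then obtain n0 where "\<And>n. n \<ge> n0 \<Longrightarrow> val_ge v 0 (x n)" by blast
    then have "val_ge v 0 (x (max n0 n1))" by simp
    then show "0 \<le> j" using n1[of "max n0 n1"] by (simp add: val_ge_def)
  next
    assume "0 \<le> j"
    then show "\<exists>n0. \<forall>n\<ge>n0. val_ge v 0 (x n)" using n1 by (auto simp: val_ge_def)
  qed
  then show ?thesis using integers_iff[OF x(1)] completion_val_cls[OF x(3,1)] x(2) by simp
qed

lemma completion_val_one: "completion_val v \<one>\<^bsub>completion v\<^esub> = 0"
  using completion_val_mult[of "\<one>\<^bsub>completion v\<^esub>" "\<one>\<^bsub>completion v\<^esub>"] by simp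

lemma completion_val_inv:
  "C \<in> Units (completion v) \<Longrightarrow> completion_val v (inv\<^bsub>completion v\<^esub> C) = - completion_val v C"
  using completion_val_mult[of C "inv\<^bsub>completion v\<^esub> C"] completion_val_one by simp

lemma to_completion_cls: "to_completion v a = cls (\<lambda>_. a)"
  by (simp add: to_completion_def)

lemma to_completion_hom:
  "to_completion v (a * b) = to_completion v a \<otimes>\<^bsub>completion v\<^esub> to_completion v b"
  "to_completion v 1 = \<one>\<^bsub>completion v\<^esub>"
  by (simp_all add: to_completion_cls cls_hom cls_one cauchy_const)

lemma to_completion_unit:
  assumes "a \<noteq> 0"
  shows "to_completion v a \<in> Units (completion v)" "completion_val v (to_completion v a) = v a"
proof -
  have "to_completion v a \<otimes>\<^bsub>completion v\<^esub> to_completion v (inverse a) = \<one>\<^bsub>completion v\<^esub>"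
    "to_completion v (inverse a) \<otimes>\<^bsub>completion v\<^esub> to_completion v a = \<one>\<^bsub>completion v\<^esub>"
    using assms by (simp_all flip: to_completion_hom)
  moreover have "\<And>b. to_completion v b \<in> carrier (completion v)" by (simp add: to_completion_cls cls_carrier cauchy_const)
  ultimately show "to_completion v a \<in> Units (completion v)" unfolding Units_def by blast
  show "completion_val v (to_completion v a) = v a"
    unfolding to_completion_cls by (rule completion_val_cls) (use assms in \<open>auto simp: eventual_val_def cauchy_const\<close>)
qed

end

section \<open>Adeles and split tori\<close>

text \<open>Meant for valuations at a place, which are additive on units only; hence additivity is
  assumed on the carrier and carried over to powers and products.\<close>

lemma (in comm_group) additive_int_pow:
  fixes F :: "'a \<Rightarrow> int"
  assumes F: "\<And>a b. a \<in> carrier G \<Longrightarrow> b \<in> carrier G \<Longrightarrow> F (a \<otimes> b) = F a + F b"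
  shows "F \<one> = 0" "a \<in> carrier G \<Longrightarrow> F (inv a) = - F a"
    "a \<in> carrier G \<Longrightarrow> F (a [^] (n :: int)) = n * F a"
    "g \<in> A \<rightarrow> carrier G \<Longrightarrow> F (finprod G g A) = (\<Sum>i\<in>A. F (g i))"
proof -
  show one: "F \<one> = 0" using F[of \<one> \<one>] by simp
  show inv: "\<And>a. a \<in> carrier G \<Longrightarrow> F (inv a) = - F a"
  proof -
    fix a assume a: "a \<in> carrier G"
    show "F (inv a) = - F a" using F[OF a inv_closed[OF a]] one a by simp
  qed
  have nat: "F (a [^] (n :: nat)) = int n * F a" if "a \<in> carrier G" for a n
    using that by (induction n) (simp_all add: one F algebra_simps)
  show "F (a [^] (n :: int)) = n * F a" if a: "a \<in> carrier G"
  proof (cases "n < 0")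
    case True
    then have "a [^] n = inv (a [^] nat (- n))" by (subst int_pow_def2) (simp only: if_True)
    then have "F (a [^] n) = F (inv (a [^] nat (- n)))" by (rule arg_cong)
    also have "\<dots> = - (int (nat (- n)) * F a)" by (simp only: inv[OF nat_pow_closed[OF a]] nat[OF a])
    finally show ?thesis using True by simp
  next
    case False
    then have "a [^] n = a [^] nat n" by (subst int_pow_def2) (simp only: if_False)
    then have "F (a [^] n) = F (a [^] nat n)" by (rule arg_cong)
    also have "\<dots> = int (nat n) * F a" by (rule nat[OF a])
    finally show ?thesis using False by simp
  qed
  show "F (finprod G g A) = (\<Sum>i\<in>A. F (g i))" if "g \<in> A \<rightarrow> carrier G"
    using that
  proof (induction A rule: infinite_finite_induct)
    case (insert x A)
    then have "g x \<in> carrier G" "g \<in> A \<rightarrow> carrier G" by auto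
    then show ?case using insert by (simp add: F)
  qed (simp_all add: one)
qed

lemma (in place) completion_cring: "cring (completion v)"
  by (rule completion.is_cring)

section \<open>Characters and cocharacters of a split torus\<close>

locale torus_over = cring R for R :: "'a ring" (structure) + fixes r :: nat
begin

sublocale units: comm_group "units_of R" by (rule units_comm_group)

abbreviation T :: "(nat \<Rightarrow> 'a) monoid" where "T \<equiv> torus r R"

lemma T_carrier: "carrier T = ({..<r} \<rightarrow>\<^sub>E Units R)"
  by (simp add: torus_def units_of_carrier)

lemma T_mult: "s \<otimes>\<^bsub>T\<^esub> t = (\<lambda>i\<in>{..<r}. s i \<otimes> t i)"
  by (simp add: torus_def units_of_mult)

lemma T_one: "\<one>\<^bsub>T\<^esub> = (\<lambda>i\<in>{..<r}. \<one>)"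
  by (simp add: torus_def units_of_one)

lemma T_unit: "t \<in> carrier T \<Longrightarrow> i < r \<Longrightarrow> t i \<in> Units R"
  by (auto simp: T_carrier)

sublocale T: comm_group T
proof -
  interpret group T unfolding torus_def by (rule product_group) (rule units.group_axioms)
  show "comm_group T"
    by (rule group_comm_groupI)
      (auto simp: T_mult T_carrier m_comm PiE_iff intro!: restrict_ext m_comm Units_closed)
qed

lemma char_terms: "t \<in> carrier T \<Longrightarrow> (\<lambda>i. t i [^]\<^bsub>units_of R\<^esub> m i) \<in> {..<r} \<rightarrow> carrier (units_of R)"
  for m :: "nat \<Rightarrow> int"
  using units.int_pow_closed by (auto simp: T_carrier units_of_carrier)

lemma char_closed: "t \<in> carrier T \<Longrightarrow> torus_char r R m t \<in> Units R"
  unfolding torus_char_def using units.finprod_closed[OF char_terms] by (simp add: units_of_carrier)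

lemma char_mult:
  assumes "s \<in> carrier T" "t \<in> carrier T"
  shows "torus_char r R m (s \<otimes>\<^bsub>T\<^esub> t) = torus_char r R m s \<otimes> torus_char r R m t"
proof -
  have "torus_char r R m (s \<otimes>\<^bsub>T\<^esub> t) = finprod (units_of R) (\<lambda>i. (s i [^]\<^bsub>units_of R\<^esub> m i) \<otimes>\<^bsub>units_of R\<^esub> (t i [^]\<^bsub>units_of R\<^esub> m i)) {..<r}"
    unfolding torus_char_def
  proof (rule units.finprod_cong'[OF refl])
    show "((\<lambda>i. (s i [^]\<^bsub>units_of R\<^esub> m i) \<otimes>\<^bsub>units_of R\<^esub> (t i [^]\<^bsub>units_of R\<^esub> m i)) \<in> {..<r} \<rightarrow> carrier (units_of R))"
      using char_terms assms by (auto simp: Pi_iff intro!: units.m_closed)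
    fix i assume "i \<in> {..<r}"
    then show "(s \<otimes>\<^bsub>T\<^esub> t) i [^]\<^bsub>units_of R\<^esub> m i = (s i [^]\<^bsub>units_of R\<^esub> m i) \<otimes>\<^bsub>units_of R\<^esub> (t i [^]\<^bsub>units_of R\<^esub> m i)"
      using units.int_pow_distrib[of "s i" "t i" "m i"] T_unit assms
      by (simp add: T_mult units_of_carrier units_of_mult)
  qed
  also have "\<dots> = torus_char r R m s \<otimes> torus_char r R m t"
    unfolding torus_char_def using units.finprod_multf[OF char_terms[OF assms(1)] char_terms[OF assms(2)]]
    by (simp add: units_of_mult)
  finally show ?thesis .
qed

lemma char_add:
  assumes "t \<in> carrier T"
  shows "torus_char r R (m + m') t = torus_char r R m t \<otimes> torus_char r R m' t"
proof -
  have "torus_char r R (m + m') t = finprod (units_of R) (\<lambda>i. (t i [^]\<^bsub>units_of R\<^esub> m i) \<otimes>\<^bsub>units_of R\<^esub> (t i [^]\<^bsub>units_of R\<^esub> m' i)) {..<r}"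
    unfolding torus_char_def
  proof (rule units.finprod_cong'[OF refl])
    show "((\<lambda>i. (t i [^]\<^bsub>units_of R\<^esub> m i) \<otimes>\<^bsub>units_of R\<^esub> (t i [^]\<^bsub>units_of R\<^esub> m' i)) \<in> {..<r} \<rightarrow> carrier (units_of R))"
      using char_terms assms by (auto simp: Pi_iff intro!: units.m_closed)
    fix i assume "i \<in> {..<r}"
    then show "t i [^]\<^bsub>units_of R\<^esub> (m + m') i = (t i [^]\<^bsub>units_of R\<^esub> m i) \<otimes>\<^bsub>units_of R\<^esub> (t i [^]\<^bsub>units_of R\<^esub> m' i)"
      using units.int_pow_mult[of "t i" "m i" "m' i"] T_unit assms by (simp add: units_of_carrier)
  qed
  also have "\<dots> = torus_char r R m t \<otimes> torus_char r R m' t"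
    unfolding torus_char_def using units.finprod_multf[OF char_terms[OF assms] char_terms[OF assms]]
    by (simp add: units_of_mult)
  finally show ?thesis .
qed

lemma char_0: "t \<in> carrier T \<Longrightarrow> torus_char r R 0 t = \<one>"
  using char_add[of t 0 0] char_closed[of t 0] Units_l_cancel[of "torus_char r R 0 t" "torus_char r R 0 t" \<one>]
  by (simp add: Units_closed)

lemma cochar_closed: "u \<in> Units R \<Longrightarrow> torus_cochar r R l u \<in> carrier T"
  using units.int_pow_closed by (auto simp: torus_cochar_def T_carrier units_of_carrier)

end

context global_function_field
begin

lemma place_locale: "v \<in> places \<Longrightarrow> place v"
  for v :: "'f \<Rightarrow> int" by unfold_locales

section \<open>Adeles and their units\<close>

abbreviation Ad :: "'f adele ring" where "Ad \<equiv> adele_ring"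

lemma adele_simps:
  "a \<otimes>\<^bsub>Ad\<^esub> b = (\<lambda>v\<in>places. a v \<otimes>\<^bsub>completion v\<^esub> b v)"
  "a \<oplus>\<^bsub>Ad\<^esub> b = (\<lambda>v\<in>places. a v \<oplus>\<^bsub>completion v\<^esub> b v)"
  "\<one>\<^bsub>Ad\<^esub> = (\<lambda>v\<in>places. \<one>\<^bsub>completion v\<^esub>)" "\<zero>\<^bsub>Ad\<^esub> = (\<lambda>v\<in>places. \<zero>\<^bsub>completion v\<^esub>)"
  by (simp_all add: adele_ring_def)

lemma adele_carrier:
  "a \<in> carrier Ad \<longleftrightarrow> a \<in> (\<Pi>\<^sub>E v\<in>places. carrier (completion v)) \<and> finite {v \<in> places. a v \<notin> completion_integers v}"
  by (simp add: adele_ring_def)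

lemma adeleI:
  assumes "\<And>v. v \<in> places \<Longrightarrow> f v \<in> carrier (completion v)"
    "finite A" "\<And>v. v \<in> places \<Longrightarrow> v \<notin> A \<Longrightarrow> f v \<in> completion_integers v"
  shows "restrict f places \<in> carrier Ad"
  unfolding adele_carrier
proof
  show "restrict f places \<in> (\<Pi>\<^sub>E v\<in>places. carrier (completion v))" using assms(1) by auto
  show "finite {v \<in> places. restrict f places v \<notin> completion_integers v}"
    by (rule finite_subset[OF _ assms(2)]) (use assms(3) in auto)
qed

lemma adele_comp: "a \<in> carrier Ad \<Longrightarrow> v \<in> places \<Longrightarrow> a v \<in> carrier (completion v)"
  by (auto simp: adele_carrier)

lemma adele_int: "a \<in> carrier Ad \<Longrightarrow> finite {v \<in> places. a v \<notin> completion_integers v}"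
  by (simp add: adele_carrier)

lemma adele_ext: "a \<in> carrier Ad \<Longrightarrow> restrict a places = a"
  by (auto simp: adele_carrier PiE_iff extensional_restrict)

sublocale adele: cring Ad
proof (intro cringI abelian_groupI comm_monoidI)
  show "\<one>\<^bsub>Ad\<^esub> \<in> carrier Ad" unfolding adele_simps
    by (rule adeleI[of _ "{}"]) (use place.integers_one[OF place_locale] place.integers_carrier[OF place_locale] in auto)
  show "\<zero>\<^bsub>Ad\<^esub> \<in> carrier Ad" unfolding adele_simps
    by (rule adeleI[of _ "{}"]) (use place.integers_zero[OF place_locale] place.integers_carrier[OF place_locale] in auto)
  fix a b assume ab: "a \<in> carrier Ad" "b \<in> carrier Ad"
  let ?A = "{v \<in> places. a v \<notin> completion_integers v} \<union> {v \<in> places. b v \<notin> completion_integers v}"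
  have fin: "finite ?A" using adele_int ab by simp
  have cr: "cring (completion v)" if "v \<in> places" for v :: "'f \<Rightarrow> int"
    using place.completion_cring[OF place_locale[OF that]] .
  show "a \<otimes>\<^bsub>Ad\<^esub> b \<in> carrier Ad" unfolding adele_simps
  proof (rule adeleI[OF _ fin])
    fix v :: "'f \<Rightarrow> int" assume v: "v \<in> places"
    interpret place v by (rule place_locale[OF v])
    show "a v \<otimes>\<^bsub>completion v\<^esub> b v \<in> carrier (completion v)" using adele_comp ab v by simp
    show "v \<notin> ?A \<Longrightarrow> a v \<otimes>\<^bsub>completion v\<^esub> b v \<in> completion_integers v" using integers_mult v by blast
  qed
  show "a \<oplus>\<^bsub>Ad\<^esub> b \<in> carrier Ad" unfolding adele_simps
  proof (rule adeleI[OF _ fin])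
    fix v :: "'f \<Rightarrow> int" assume v: "v \<in> places"
    interpret place v by (rule place_locale[OF v])
    show "a v \<oplus>\<^bsub>completion v\<^esub> b v \<in> carrier (completion v)" using adele_comp ab v by simp
    show "v \<notin> ?A \<Longrightarrow> a v \<oplus>\<^bsub>completion v\<^esub> b v \<in> completion_integers v" using integers_mult v by blast
  qed
  have E: "a v \<otimes>\<^bsub>completion v\<^esub> b v = b v \<otimes>\<^bsub>completion v\<^esub> a v"
    "a v \<oplus>\<^bsub>completion v\<^esub> b v = b v \<oplus>\<^bsub>completion v\<^esub> a v"
    "\<one>\<^bsub>completion v\<^esub> \<otimes>\<^bsub>completion v\<^esub> a v = a v" "\<zero>\<^bsub>completion v\<^esub> \<oplus>\<^bsub>completion v\<^esub> a v = a v"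
    "\<ominus>\<^bsub>completion v\<^esub> a v \<oplus>\<^bsub>completion v\<^esub> a v = \<zero>\<^bsub>completion v\<^esub>" if v: "v \<in> places" for v
  proof -
    interpret place v by (rule place_locale[OF v])
    have "a v \<in> carrier (completion v)" "b v \<in> carrier (completion v)" using adele_comp ab v by auto
    then show "a v \<otimes>\<^bsub>completion v\<^esub> b v = b v \<otimes>\<^bsub>completion v\<^esub> a v"
      "a v \<oplus>\<^bsub>completion v\<^esub> b v = b v \<oplus>\<^bsub>completion v\<^esub> a v"
      "\<one>\<^bsub>completion v\<^esub> \<otimes>\<^bsub>completion v\<^esub> a v = a v" "\<zero>\<^bsub>completion v\<^esub> \<oplus>\<^bsub>completion v\<^esub> a v = a v"
      "\<ominus>\<^bsub>completion v\<^esub> a v \<oplus>\<^bsub>completion v\<^esub> a v = \<zero>\<^bsub>completion v\<^esub>"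
      by (simp_all add: completion.m_comm completion.a_comm completion.r_neg)
  qed
  show "a \<otimes>\<^bsub>Ad\<^esub> b = b \<otimes>\<^bsub>Ad\<^esub> a" "a \<oplus>\<^bsub>Ad\<^esub> b = b \<oplus>\<^bsub>Ad\<^esub> a" unfolding adele_simps
    by (rule restrict_ext, simp only: E)+
  have "\<one>\<^bsub>Ad\<^esub> \<otimes>\<^bsub>Ad\<^esub> a = restrict a places" unfolding adele_simps
    by (rule restrict_ext) (simp add: E)
  then show "\<one>\<^bsub>Ad\<^esub> \<otimes>\<^bsub>Ad\<^esub> a = a" using adele_ext ab by simp
  have "\<zero>\<^bsub>Ad\<^esub> \<oplus>\<^bsub>Ad\<^esub> a = restrict a places" unfolding adele_simps
    by (rule restrict_ext) (simp add: E)
  then show "\<zero>\<^bsub>Ad\<^esub> \<oplus>\<^bsub>Ad\<^esub> a = a" using adele_ext ab by simp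
  show "\<exists>b\<in>carrier Ad. b \<oplus>\<^bsub>Ad\<^esub> a = \<zero>\<^bsub>Ad\<^esub>"
  proof (rule bexI[of _ "\<lambda>v\<in>places. \<ominus>\<^bsub>completion v\<^esub> a v"])
    show "(\<lambda>v\<in>places. \<ominus>\<^bsub>completion v\<^esub> a v) \<in> carrier Ad"
    proof (rule adeleI[OF _ fin])
      fix v :: "'f \<Rightarrow> int" assume v: "v \<in> places"
      interpret place v by (rule place_locale[OF v])
      show "\<ominus>\<^bsub>completion v\<^esub> a v \<in> carrier (completion v)" using adele_comp ab v by simp
      show "v \<notin> ?A \<Longrightarrow> \<ominus>\<^bsub>completion v\<^esub> a v \<in> completion_integers v" using integers_uminus v by blast
    qed
    show "(\<lambda>v\<in>places. \<ominus>\<^bsub>completion v\<^esub> a v) \<oplus>\<^bsub>Ad\<^esub> a = \<zero>\<^bsub>Ad\<^esub>" unfolding adele_simps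
      by (rule restrict_ext) (simp add: E)
  qed
  fix c assume c: "c \<in> carrier Ad"
  show "a \<otimes>\<^bsub>Ad\<^esub> b \<otimes>\<^bsub>Ad\<^esub> c = a \<otimes>\<^bsub>Ad\<^esub> (b \<otimes>\<^bsub>Ad\<^esub> c)"
    "a \<oplus>\<^bsub>Ad\<^esub> b \<oplus>\<^bsub>Ad\<^esub> c = a \<oplus>\<^bsub>Ad\<^esub> (b \<oplus>\<^bsub>Ad\<^esub> c)"
    "(a \<oplus>\<^bsub>Ad\<^esub> b) \<otimes>\<^bsub>Ad\<^esub> c = a \<otimes>\<^bsub>Ad\<^esub> c \<oplus>\<^bsub>Ad\<^esub> b \<otimes>\<^bsub>Ad\<^esub> c"
    unfolding adele_simps
  proof -
    have E: "a v \<otimes>\<^bsub>completion v\<^esub> b v \<otimes>\<^bsub>completion v\<^esub> c v = a v \<otimes>\<^bsub>completion v\<^esub> (b v \<otimes>\<^bsub>completion v\<^esub> c v)"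
      "a v \<oplus>\<^bsub>completion v\<^esub> b v \<oplus>\<^bsub>completion v\<^esub> c v = a v \<oplus>\<^bsub>completion v\<^esub> (b v \<oplus>\<^bsub>completion v\<^esub> c v)"
      "(a v \<oplus>\<^bsub>completion v\<^esub> b v) \<otimes>\<^bsub>completion v\<^esub> c v = a v \<otimes>\<^bsub>completion v\<^esub> c v \<oplus>\<^bsub>completion v\<^esub> b v \<otimes>\<^bsub>completion v\<^esub> c v"
      if v: "v \<in> places" for v
    proof -
      interpret place v by (rule place_locale[OF v])
      have "a v \<in> carrier (completion v)" "b v \<in> carrier (completion v)" "c v \<in> carrier (completion v)"
        using adele_comp ab c v by auto
      then show "a v \<otimes>\<^bsub>completion v\<^esub> b v \<otimes>\<^bsub>completion v\<^esub> c v = a v \<otimes>\<^bsub>completion v\<^esub> (b v \<otimes>\<^bsub>completion v\<^esub> c v)"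
        "a v \<oplus>\<^bsub>completion v\<^esub> b v \<oplus>\<^bsub>completion v\<^esub> c v = a v \<oplus>\<^bsub>completion v\<^esub> (b v \<oplus>\<^bsub>completion v\<^esub> c v)"
        "(a v \<oplus>\<^bsub>completion v\<^esub> b v) \<otimes>\<^bsub>completion v\<^esub> c v = a v \<otimes>\<^bsub>completion v\<^esub> c v \<oplus>\<^bsub>completion v\<^esub> b v \<otimes>\<^bsub>completion v\<^esub> c v"
        by (simp_all add: completion.m_assoc completion.a_assoc completion.l_distr)
    qed
    show "(\<lambda>v\<in>places. (\<lambda>v\<in>places. a v \<otimes>\<^bsub>completion v\<^esub> b v) v \<otimes>\<^bsub>completion v\<^esub> c v) = (\<lambda>v\<in>places. a v \<otimes>\<^bsub>completion v\<^esub> (\<lambda>v\<in>places. b v \<otimes>\<^bsub>completion v\<^esub> c v) v)"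
      "(\<lambda>v\<in>places. (\<lambda>v\<in>places. a v \<oplus>\<^bsub>completion v\<^esub> b v) v \<oplus>\<^bsub>completion v\<^esub> c v) = (\<lambda>v\<in>places. a v \<oplus>\<^bsub>completion v\<^esub> (\<lambda>v\<in>places. b v \<oplus>\<^bsub>completion v\<^esub> c v) v)"
      "(\<lambda>v\<in>places. (\<lambda>v\<in>places. a v \<oplus>\<^bsub>completion v\<^esub> b v) v \<otimes>\<^bsub>completion v\<^esub> c v) = (\<lambda>v\<in>places. (\<lambda>v\<in>places. a v \<otimes>\<^bsub>completion v\<^esub> c v) v \<oplus>\<^bsub>completion v\<^esub> (\<lambda>v\<in>places. b v \<otimes>\<^bsub>completion v\<^esub> c v) v)"
      by (rule restrict_ext, simp add: E)+
  qed
qed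

text \<open>At a place where both \<open>a\<close> and its inverse are integral, two nonnegative
  valuations add up to 0; this gives finiteness. Conversely, the componentwise inverse is integral
  wherever the valuation vanishes, so it is again an adele.\<close>

lemma adele_Units:
  "a \<in> Units Ad \<longleftrightarrow> a \<in> (\<Pi>\<^sub>E v\<in>places. Units (completion v)) \<and> finite {v \<in> places. completion_val v (a v) \<noteq> 0}"
  (is "_ \<longleftrightarrow> ?R a")
proof
  assume a: "a \<in> Units Ad"
  then obtain b where b: "a \<in> carrier Ad" "b \<in> carrier Ad" "a \<otimes>\<^bsub>Ad\<^esub> b = \<one>\<^bsub>Ad\<^esub>" "b \<otimes>\<^bsub>Ad\<^esub> a = \<one>\<^bsub>Ad\<^esub>"
    by (auto simp: Units_def)
  have ab: "a v \<otimes>\<^bsub>completion v\<^esub> b v = \<one>\<^bsub>completion v\<^esub>" "b v \<otimes>\<^bsub>completion v\<^esub> a v = \<one>\<^bsub>completion v\<^esub>" if "v \<in> places" for v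
    using fun_cong[OF b(3), of v] fun_cong[OF b(4), of v] that by (simp_all add: adele_simps)
  have au: "a v \<in> Units (completion v)" "b v \<in> Units (completion v)" if "v \<in> places" for v
    using ab[OF that] adele_comp[OF b(1) that] adele_comp[OF b(2) that] unfolding Units_def by blast+
  have "{v \<in> places. completion_val v (a v) \<noteq> 0} \<subseteq>
      {v \<in> places. a v \<notin> completion_integers v} \<union> {v \<in> places. b v \<notin> completion_integers v}"
  proof
    fix v assume v: "v \<in> {v \<in> places. completion_val v (a v) \<noteq> 0}"
    then interpret place v using place_locale by blast
    have vp: "v \<in> places" using v by simp
    have "completion_val v (a v) + completion_val v (b v) = 0"
      using completion_val_mult[OF au[OF vp]] ab[OF vp] completion_val_one by simp
    then show "v \<in> {v \<in> places. a v \<notin> completion_integers v} \<union> {v \<in> places. b v \<notin> completion_integers v}"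
      using v unit_integer_iff[OF au(1)[OF vp]] unit_integer_iff[OF au(2)[OF vp]] by auto
  qed
  then have "finite {v \<in> places. completion_val v (a v) \<noteq> 0}"
    using adele_int b finite_subset by blast
  moreover have "a \<in> (\<Pi>\<^sub>E v\<in>places. Units (completion v))" using au b(1) by (auto simp: adele_carrier PiE_iff)
  ultimately show "?R a" by simp
next
  assume a: "?R a"
  let ?A = "{v \<in> places. completion_val v (a v) \<noteq> 0}"
  have fin: "finite ?A" using a by simp
  have au: "a v \<in> Units (completion v)" if "v \<in> places" for v using a that by auto
  have "restrict a places \<in> carrier Ad"
  proof (rule adeleI[OF _ fin])
    fix v :: "'f \<Rightarrow> int" assume v: "v \<in> places"
    interpret place v by (rule place_locale[OF v])
    show "a v \<in> carrier (completion v)" using au[OF v] by (rule completion.Units_closed)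
    show "v \<notin> ?A \<Longrightarrow> a v \<in> completion_integers v" using unit_integer_iff[OF au[OF v]] v by simp
  qed
  then have aA: "a \<in> carrier Ad" using a by (auto simp: PiE_iff extensional_restrict)
  let ?b = "\<lambda>v\<in>places. inv\<^bsub>completion v\<^esub> (a v)"
  have bA: "?b \<in> carrier Ad"
  proof (rule adeleI[OF _ fin])
    fix v :: "'f \<Rightarrow> int" assume v: "v \<in> places"
    interpret place v by (rule place_locale[OF v])
    show "inv\<^bsub>completion v\<^esub> (a v) \<in> carrier (completion v)" using au[OF v] by simp
    show "v \<notin> ?A \<Longrightarrow> inv\<^bsub>completion v\<^esub> (a v) \<in> completion_integers v"
      using unit_integer_iff[OF completion.Units_inv_Units[OF au[OF v]]] completion_val_inv[OF au[OF v]] v by simp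
  qed
  have "a \<otimes>\<^bsub>Ad\<^esub> ?b = \<one>\<^bsub>Ad\<^esub>" unfolding adele_simps
  proof (rule restrict_ext)
    fix v :: "'f \<Rightarrow> int" assume v: "v \<in> places"
    interpret place v by (rule place_locale[OF v])
    show "a v \<otimes>\<^bsub>completion v\<^esub> ?b v = \<one>\<^bsub>completion v\<^esub>" using au[OF v] v by simp
  qed
  then show "a \<in> Units Ad" using aA bA adele.m_comm[OF aA bA] unfolding Units_def by auto
qed

lemma adele_unit_comp: "a \<in> Units Ad \<Longrightarrow> v \<in> places \<Longrightarrow> a v \<in> Units (completion v)"
  by (auto simp: adele_Units)

lemma adele_val_mult:
  assumes "a \<in> Units Ad" "b \<in> Units Ad" "v \<in> places"
  shows "completion_val v ((a \<otimes>\<^bsub>Ad\<^esub> b) v) = completion_val v (a v) + completion_val v (b v)"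
  using place.completion_val_mult[OF place_locale] adele_unit_comp assms by (simp add: adele_simps)

lemma integral_units:
  "a \<in> Units integral_adeles \<longleftrightarrow> a \<in> Units Ad \<and> (\<forall>v\<in>places. completion_val v (a v) = 0)"
proof
  assume a: "a \<in> Units integral_adeles"
  then obtain b where b: "a \<in> (\<Pi>\<^sub>E v\<in>places. completion_integers v)" "b \<in> (\<Pi>\<^sub>E v\<in>places. completion_integers v)"
    "a \<otimes>\<^bsub>Ad\<^esub> b = \<one>\<^bsub>Ad\<^esub>" "b \<otimes>\<^bsub>Ad\<^esub> a = \<one>\<^bsub>Ad\<^esub>"
    unfolding Units_def integral_adeles_def by auto
  have int: "c \<in> carrier Ad" if c: "c \<in> (\<Pi>\<^sub>E v\<in>places. completion_integers v)" for c
  proof -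
    have "restrict c places \<in> carrier Ad"
      by (rule adeleI[of _ "{}"]) (use c place.integers_carrier[OF place_locale] in auto)
    then show ?thesis using c by (auto simp: PiE_iff extensional_restrict)
  qed
  have u: "a \<in> Units Ad" "b \<in> Units Ad" using int b unfolding Units_def by blast+
  have "completion_val v (a v) = 0" if v: "v \<in> places" for v
  proof -
    interpret place v by (rule place_locale[OF v])
    have "a v \<in> completion_integers v" "b v \<in> completion_integers v" using b v by auto
    then have "0 \<le> completion_val v (a v)" "0 \<le> completion_val v (b v)"
      using unit_integer_iff[OF adele_unit_comp[OF u(1) v]] unit_integer_iff[OF adele_unit_comp[OF u(2) v]] by auto
    moreover have "completion_val v (a v) + completion_val v (b v) = 0"
    proof -
      have "completion_val v ((a \<otimes>\<^bsub>Ad\<^esub> b) v) = 0" unfolding b(3) adele_simps(3) using v completion_val_one by simp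
      then show ?thesis using adele_val_mult[OF u v] by simp
    qed
    ultimately show ?thesis by simp
  qed
  then show "a \<in> Units Ad \<and> (\<forall>v\<in>places. completion_val v (a v) = 0)" using u by simp
next
  assume a: "a \<in> Units Ad \<and> (\<forall>v\<in>places. completion_val v (a v) = 0)"
  have aux: "c \<in> (\<Pi>\<^sub>E v\<in>places. completion_integers v)" if c: "c \<in> Units Ad" "\<forall>v\<in>places. completion_val v (c v) = 0" for c
  proof (rule PiE_I)
    fix v :: "'f \<Rightarrow> int" assume v: "v \<in> places"
    interpret place v by (rule place_locale[OF v])
    show "c v \<in> completion_integers v" using unit_integer_iff[OF adele_unit_comp[OF c(1) v]] c(2) v by simp
  qed (use c in \<open>auto simp: adele_Units PiE_iff extensional_def\<close>)
  let ?b = "inv\<^bsub>Ad\<^esub> a"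
  have b: "?b \<in> Units Ad" using a by simp
  have "completion_val v (?b v) = 0" if v: "v \<in> places" for v
  proof -
    interpret place v by (rule place_locale[OF v])
    have "completion_val v ((a \<otimes>\<^bsub>Ad\<^esub> ?b) v) = 0"
      using a v completion_val_one by (simp add: adele_simps(3))
    then have "completion_val v (a v) + completion_val v (?b v) = 0"
      using adele_val_mult[of a ?b v] a b v by simp
    then show ?thesis using a v by simp
  qed
  then have "?b \<in> (\<Pi>\<^sub>E v\<in>places. completion_integers v)" using aux b by blast
  moreover have "a \<in> (\<Pi>\<^sub>E v\<in>places. completion_integers v)" using aux a by blast
  moreover have "?b \<otimes>\<^bsub>Ad\<^esub> a = \<one>\<^bsub>Ad\<^esub>" "a \<otimes>\<^bsub>Ad\<^esub> ?b = \<one>\<^bsub>Ad\<^esub>" using a by simp_all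
  ultimately show "a \<in> Units integral_adeles" unfolding Units_def integral_adeles_def by auto
qed

lemma diagonal_unit: "x \<noteq> 0 \<Longrightarrow> diagonal x \<in> Units Ad"
  for x :: 'f
  unfolding adele_Units diagonal_def using place.to_completion_unit[OF place_locale] finite_support[of x]
  by (auto cong: conj_cong)

lemma diagonal_val: "x \<noteq> 0 \<Longrightarrow> v \<in> places \<Longrightarrow> completion_val v (diagonal x v) = v x"
  for x :: 'f
  using place.to_completion_unit[OF place_locale] by (simp add: diagonal_def)

lemma diagonal_mult: "diagonal (x * y) = diagonal x \<otimes>\<^bsub>Ad\<^esub> diagonal y"
  unfolding adele_simps diagonal_def
  by (rule restrict_ext) (simp add: place.to_completion_hom[OF place_locale])

lemma local_uniformizer_unit:
  assumes "uniformizers \<pi>" "v \<in> places"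
  shows "local_uniformizer \<pi> v \<in> Units Ad"
    "w \<in> places \<Longrightarrow> completion_val w (local_uniformizer \<pi> v w) = (if w = v then 1 else 0)"
proof -
  show val: "completion_val w (local_uniformizer \<pi> v w) = (if w = v then 1 else 0)" if "w \<in> places" for w
    using assms that place.completion_val_one[OF place_locale] by (simp add: local_uniformizer_def uniformizers_def)
  have un: "local_uniformizer \<pi> v w \<in> Units (completion w)" if "w \<in> places" for w
  proof -
    interpret place w by (rule place_locale[OF that])
    show ?thesis using assms that by (simp add: local_uniformizer_def uniformizers_def)
  qed
  have "{w \<in> places. completion_val w (local_uniformizer \<pi> v w) \<noteq> 0} \<subseteq> {v}" using val by auto
  then have "finite {w \<in> places. completion_val w (local_uniformizer \<pi> v w) \<noteq> 0}"
    by (rule finite_subset) simp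
  moreover have "local_uniformizer \<pi> v \<in> (\<Pi>\<^sub>E w\<in>places. Units (completion w))"
    by (rule PiE_I) (use un in \<open>auto simp: local_uniformizer_def\<close>)
  ultimately show "local_uniformizer \<pi> v \<in> Units Ad" by (simp only: adele_Units simp_thms)
qed

lemma half_different_unit:
  assumes "uniformizers \<pi>" "finite {v \<in> places. m v \<noteq> 0}"
  shows "half_different \<pi> m \<in> Units Ad"
    "v \<in> places \<Longrightarrow> completion_val v (half_different \<pi> m v) = m v"
proof -
  have *: "half_different \<pi> m v \<in> Units (completion v) \<and> completion_val v (half_different \<pi> m v) = m v"
    if v: "v \<in> places" for v
  proof -
    interpret place v by (rule place_locale[OF v])
    interpret U: comm_group "units_of (completion v)" by (rule completion.units_comm_group)
    have p: "\<pi> v \<in> carrier (units_of (completion v))" "completion_val v (\<pi> v) = 1"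
      using assms v by (auto simp: uniformizers_def units_of_carrier)
    have "completion_val v (\<pi> v [^]\<^bsub>units_of (completion v)\<^esub> m v) = m v * completion_val v (\<pi> v)"
      by (rule U.additive_int_pow(3)) (use p in \<open>auto simp: units_of_carrier units_of_mult completion_val_mult\<close>)
    then show ?thesis using U.int_pow_closed[OF p(1), of "m v"] p(2) v
      by (simp add: half_different_def units_of_carrier)
  qed
  then show "v \<in> places \<Longrightarrow> completion_val v (half_different \<pi> m v) = m v" by blast
  have "{v \<in> places. completion_val v (half_different \<pi> m v) \<noteq> 0} = {v \<in> places. m v \<noteq> 0}" using * by auto
  then show "half_different \<pi> m \<in> Units Ad"
    unfolding adele_Units using * assms(2) by (auto simp: half_different_def)
qed

lemma idele_abs_pos: "0 < idele_abs (a :: 'f adele)"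
  unfolding idele_abs_def
proof (rule prod_pos)
  fix v assume "v \<in> {v. v \<in> places \<and> completion_val v (a v) \<noteq> 0}"
  then have "0 < real (residue_size v)" using residue_size_pos[of v] by simp
  then show "0 < real (residue_size v) powi (- completion_val v (a v))" by (rule zero_less_power_int)
qed

text \<open>\<open>idele_abs\<close> multiplies over the support of its argument; a common finite
  superset lets the products of different ideles be compared factor by factor.\<close>

lemma idele_abs_superset:
  fixes a :: "'f adele"
  assumes "finite S" "S \<subseteq> places" "\<And>v. v \<in> places \<Longrightarrow> completion_val v (a v) \<noteq> 0 \<Longrightarrow> v \<in> S"
  shows "idele_abs a = (\<Prod>v\<in>S. real (residue_size v) powi (- completion_val v (a v)))"
  unfolding idele_abs_def
proof (rule prod.mono_neutral_left[OF assms(1)])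
  show "{v. v \<in> places \<and> completion_val v (a v) \<noteq> 0} \<subseteq> S" using assms(3) by blast
  show "\<forall>v\<in>S - {v. v \<in> places \<and> completion_val v (a v) \<noteq> 0}. real (residue_size v) powi (- completion_val v (a v)) = 1"
  proof
    fix v assume "v \<in> S - {v. v \<in> places \<and> completion_val v (a v) \<noteq> 0}"
    then have "completion_val v (a v) = 0" using assms(2) by blast
    then show "real (residue_size v) powi (- completion_val v (a v)) = 1" by simp
  qed
qed

lemma idele_abs_mult:
  assumes "a \<in> Units Ad" "b \<in> Units Ad"
  shows "idele_abs (a \<otimes>\<^bsub>Ad\<^esub> b) = idele_abs a * idele_abs b"
proof -
  let ?S = "{v \<in> places. completion_val v (a v) \<noteq> 0} \<union> {v \<in> places. completion_val v (b v) \<noteq> 0}"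
  have "finite {v \<in> places. completion_val v (a v) \<noteq> 0}" "finite {v \<in> places. completion_val v (b v) \<noteq> 0}"
    using assms by (simp_all add: adele_Units)
  then have fin: "finite ?S" "?S \<subseteq> places" by auto
  have ab: "a \<otimes>\<^bsub>Ad\<^esub> b \<in> Units Ad" using assms by simp
  have "idele_abs (a \<otimes>\<^bsub>Ad\<^esub> b) = (\<Prod>v\<in>?S. real (residue_size v) powi (- completion_val v ((a \<otimes>\<^bsub>Ad\<^esub> b) v)))"
    by (rule idele_abs_superset[OF fin]) (auto simp: adele_val_mult[OF assms])
  also have "\<dots> = (\<Prod>v\<in>?S. real (residue_size v) powi (- completion_val v (a v)) * real (residue_size v) powi (- completion_val v (b v)))"
  proof (rule prod.cong[OF refl])
    fix v assume "v \<in> ?S"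
    then have v: "v \<in> places" by auto
    have "real (residue_size v) \<noteq> 0" using residue_size_pos[OF v] by simp
    then show "real (residue_size v) powi (- completion_val v ((a \<otimes>\<^bsub>Ad\<^esub> b) v)) = real (residue_size v) powi (- completion_val v (a v)) * real (residue_size v) powi (- completion_val v (b v))"
      using power_int_add[of "real (residue_size v)" "- completion_val v (a v)" "- completion_val v (b v)"]
      by (simp add: adele_val_mult[OF assms v])
  qed
  also have "\<dots> = idele_abs a * idele_abs b"
    proof -
    have "idele_abs a = (\<Prod>v\<in>?S. real (residue_size v) powi (- completion_val v (a v)))"
      "idele_abs b = (\<Prod>v\<in>?S. real (residue_size v) powi (- completion_val v (b v)))"
      by (rule idele_abs_superset[OF fin], blast)+
    then show ?thesis by (simp only: prod.distrib)
  qed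
  finally show ?thesis .
qed

lemma idele_abs_diagonal: "x \<noteq> 0 \<Longrightarrow> idele_abs (diagonal x) = 1"
  for x :: 'f
proof -
  assume x: "x \<noteq> 0"
  have "{v. v \<in> places \<and> completion_val v (diagonal x v) \<noteq> 0} = {v. v \<in> places \<and> v x \<noteq> 0}"
    using diagonal_val[OF x] by (metis (lifting))
  then have "idele_abs (diagonal x) = (\<Prod>v | v \<in> places \<and> v x \<noteq> 0. real (residue_size v) powi (- v x))"
    unfolding idele_abs_def by (rule prod.cong) (simp add: diagonal_val[OF x])
  then show ?thesis using product_formula[OF x] by simp
qed

end

section \<open>Monoid algebras and characters\<close>

lemma poly_mapping_sum_single:
  fixes p :: "'a \<Rightarrow>\<^sub>0 'b::comm_monoid_add"
  shows "(\<Sum>m\<in>Poly_Mapping.keys p. Poly_Mapping.single m (Poly_Mapping.lookup p m)) = p"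
proof (rule poly_mapping_eqI)
  fix k
  show "Poly_Mapping.lookup (\<Sum>m\<in>Poly_Mapping.keys p. Poly_Mapping.single m (Poly_Mapping.lookup p m)) k = Poly_Mapping.lookup p k"
    by (cases "k \<in> Poly_Mapping.keys p")
      (auto simp: lookup_sum lookup_single when_def in_keys_iff)
qed

lemma poly_mapping_keys_induct [consumes 1, case_names zero add]:
  fixes p :: "'a \<Rightarrow>\<^sub>0 'b::comm_monoid_add"
  assumes "Poly_Mapping.keys p \<subseteq> M" and "P 0"
    and add: "\<And>p m a. Poly_Mapping.keys p \<subseteq> M \<Longrightarrow> m \<in> M \<Longrightarrow> P p \<Longrightarrow> P (p + Poly_Mapping.single m a)"
  shows "P p"
proof -
  have "Poly_Mapping.keys (\<Sum>m\<in>A. Poly_Mapping.single m (Poly_Mapping.lookup p m)) \<subseteq> M \<and>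
    P (\<Sum>m\<in>A. Poly_Mapping.single m (Poly_Mapping.lookup p m))" if "finite A" "A \<subseteq> M" for A
    using that
  proof (induction A)
    case (insert m A)
    let ?s = "\<Sum>m\<in>A. Poly_Mapping.single m (Poly_Mapping.lookup p m)"
    have IH: "Poly_Mapping.keys ?s \<subseteq> M" "P ?s" and m: "m \<in> M" using insert by auto
    have "(\<Sum>m\<in>insert m A. Poly_Mapping.single m (Poly_Mapping.lookup p m)) = ?s + Poly_Mapping.single m (Poly_Mapping.lookup p m)"
      using insert by (simp add: add.commute)
    moreover have "Poly_Mapping.keys (?s + Poly_Mapping.single m (Poly_Mapping.lookup p m)) \<subseteq> M"
      using keys_add[of ?s "Poly_Mapping.single m (Poly_Mapping.lookup p m)"] IH m by (auto split: if_splits)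
    ultimately show ?case using add[OF IH(1) m IH(2)] by simp
  qed (simp add: assms(2))
  then show ?thesis using poly_mapping_sum_single[of p] assms(1) by (metis finite_keys)
qed

lemma monoid_algebra_simps [simp]:
  "carrier (monoid_algebra M) = {p. Poly_Mapping.keys p \<subseteq> M}"
  "p \<otimes>\<^bsub>monoid_algebra M\<^esub> p' = p * p'" "p \<oplus>\<^bsub>monoid_algebra M\<^esub> p' = p + p'"
  "\<one>\<^bsub>monoid_algebra M\<^esub> = 1" "\<zero>\<^bsub>monoid_algebra M\<^esub> = 0"
  by (simp_all add: monoid_algebra_def ring_of_type_algebra_def)

text \<open>The linear extension of \<open>\<xi>\<close> to Z[M]; it becomes a ring homomorphism
  when \<open>\<xi>\<close> is multiplicative on \<open>M\<close>.\<close>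

definition monomial_eval :: "'a ring \<Rightarrow> ((nat \<Rightarrow> int) \<Rightarrow> 'a) \<Rightarrow> ((nat \<Rightarrow> int) \<Rightarrow>\<^sub>0 int) \<Rightarrow> 'a" where
  "monomial_eval R \<xi> p = finsum R (\<lambda>m. add_pow R (Poly_Mapping.lookup p m) (\<xi> m)) (Poly_Mapping.keys p)"

context ring
begin

lemma add_pow_int_closed: "a \<in> carrier R \<Longrightarrow> add_pow R (i::int) a \<in> carrier R"
  using group.int_pow_closed[OF a_group, of a i] by (simp add: add_pow_def)

lemma add_pow_int_add: "a \<in> carrier R \<Longrightarrow> add_pow R (i + j::int) a = add_pow R i a \<oplus> add_pow R j a"
  using group.int_pow_mult[OF a_group, of a i j] by (simp add: add_pow_def)

lemma add_pow_int_mult: "a \<in> carrier R \<Longrightarrow> add_pow R (i * j::int) a = add_pow R i (add_pow R j a)"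
  using group.int_pow_pow[OF a_group, of a j i] by (simp add: add_pow_def mult.commute)

lemma add_pow_int_0: "add_pow R (0::int) a = \<zero>"
  by (simp add: add_pow_def int_pow_def)

lemma add_pow_int_1: "a \<in> carrier R \<Longrightarrow> add_pow R (1::int) a = a"
  using group.int_pow_1[OF a_group, of a] by (simp add: add_pow_def)

end

text \<open>The values need not be units: besides restrictions of torus characters this covers the
  character that is 0 off the origin, which is the torus-fixed point.\<close>

locale monoid_character = cring R for R :: "'a ring" (structure) +
  fixes M :: "(nat \<Rightarrow> int) set" and \<xi> :: "(nat \<Rightarrow> int) \<Rightarrow> 'a"
  assumes M0: "0 \<in> M" and M_add: "\<And>m m'. m \<in> M \<Longrightarrow> m' \<in> M \<Longrightarrow> m + m' \<in> M"
    and chi_closed: "\<And>m. m \<in> M \<Longrightarrow> \<xi> m \<in> carrier R" and chi_0: "\<xi> 0 = \<one>"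
    and chi_add: "\<And>m m'. m \<in> M \<Longrightarrow> m' \<in> M \<Longrightarrow> \<xi> (m + m') = \<xi> m \<otimes> \<xi> m'"
begin

abbreviation ev :: "((nat \<Rightarrow> int) \<Rightarrow>\<^sub>0 int) \<Rightarrow> 'a" where "ev \<equiv> monomial_eval R \<xi>"

lemma ev_terms:
  fixes p :: "(nat \<Rightarrow> int) \<Rightarrow>\<^sub>0 int"
  assumes "A \<subseteq> M"
  shows "(\<lambda>m. add_pow R (Poly_Mapping.lookup p m) (\<xi> m)) \<in> A \<rightarrow> carrier R"
proof (rule Pi_I)
  fix m assume "m \<in> A"
  then have "\<xi> m \<in> carrier R" using assms chi_closed by blast
  then show "add_pow R (Poly_Mapping.lookup p m) (\<xi> m) \<in> carrier R" by (rule add_pow_int_closed)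
qed

lemma ev_superset:
  assumes "finite A" "Poly_Mapping.keys p \<subseteq> A" "A \<subseteq> M"
  shows "ev p = finsum R (\<lambda>m. add_pow R (Poly_Mapping.lookup p m) (\<xi> m)) A"
  unfolding monomial_eval_def
proof (rule add.finprod_mono_neutral_cong_left[OF assms(1,2)])
  fix i assume "i \<in> A - Poly_Mapping.keys p"
  then show "add_pow R (Poly_Mapping.lookup p i) (\<xi> i) = \<zero>" by (simp add: in_keys_iff add_pow_int_0)
qed (simp_all add: ev_terms[OF assms(3)])

lemma ev_closed: "Poly_Mapping.keys p \<subseteq> M \<Longrightarrow> ev p \<in> carrier R"
  unfolding monomial_eval_def by (rule finsum_closed) (rule ev_terms)

lemma ev_add:
  assumes "Poly_Mapping.keys p \<subseteq> M" "Poly_Mapping.keys p' \<subseteq> M"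
  shows "ev (p + p') = ev p \<oplus> ev p'"
proof -
  let ?A = "Poly_Mapping.keys p \<union> Poly_Mapping.keys p'"
  have A: "finite ?A" "?A \<subseteq> M" using assms by auto
  have "ev (p + p') = finsum R (\<lambda>m. add_pow R (Poly_Mapping.lookup (p + p') m) (\<xi> m)) ?A"
    by (rule ev_superset[OF A(1) keys_add A(2)])
  also have "\<dots> = finsum R (\<lambda>m. add_pow R (Poly_Mapping.lookup p m) (\<xi> m) \<oplus> add_pow R (Poly_Mapping.lookup p' m) (\<xi> m)) ?A"
  proof (rule finsum_cong'[OF refl])
    show "(\<lambda>m. add_pow R (Poly_Mapping.lookup p m) (\<xi> m) \<oplus> add_pow R (Poly_Mapping.lookup p' m) (\<xi> m)) \<in> ?A \<rightarrow> carrier R"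
      using ev_terms[OF A(2), of p] ev_terms[OF A(2), of p'] by blast
    fix m assume "m \<in> ?A"
    then have "\<xi> m \<in> carrier R" using A(2) chi_closed by blast
    then show "add_pow R (Poly_Mapping.lookup (p + p') m) (\<xi> m) = add_pow R (Poly_Mapping.lookup p m) (\<xi> m) \<oplus> add_pow R (Poly_Mapping.lookup p' m) (\<xi> m)"
      by (simp add: lookup_add add_pow_int_add)
  qed
  also have "\<dots> = ev p \<oplus> ev p'"
    using finsum_addf[OF ev_terms[OF A(2), of p] ev_terms[OF A(2), of p']]
      ev_superset[OF A(1) Un_upper1 A(2)] ev_superset[OF A(1) Un_upper2 A(2)] by simp
  finally show ?thesis .
qed

lemma ev_0: "ev 0 = \<zero>"
  by (simp add: monomial_eval_def)

lemma ev_single: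
  assumes m: "m \<in> M"
  shows "ev (Poly_Mapping.single m a) = add_pow R a (\<xi> m)"
proof -
  have "ev (Poly_Mapping.single m a) = finsum R (\<lambda>l. add_pow R (Poly_Mapping.lookup (Poly_Mapping.single m a) l) (\<xi> l)) {m}"
    by (rule ev_superset) (use m in simp_all)
  then show ?thesis using add_pow_int_closed[OF chi_closed[OF m], of a] by simp
qed

lemma single_keys: "m \<in> M \<Longrightarrow> Poly_Mapping.keys (Poly_Mapping.single m a) \<subseteq> M"
  by auto

lemma mult_keys: "Poly_Mapping.keys p \<subseteq> M \<Longrightarrow> Poly_Mapping.keys p' \<subseteq> M \<Longrightarrow> Poly_Mapping.keys (p * p') \<subseteq> M"
  using keys_mult[of p p'] M_add by blast

lemma ev_mult_single:
  assumes "Poly_Mapping.keys p \<subseteq> M" "m \<in> M"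
  shows "ev (p * Poly_Mapping.single m a) = ev p \<otimes> ev (Poly_Mapping.single m a)"
  using assms(1)
proof (induction p rule: poly_mapping_keys_induct)
  case zero
  then show ?case using ev_closed[OF single_keys[OF assms(2)], of a] by (simp add: ev_0)
next
  case (add p l b)
  have c: "\<xi> l \<in> carrier R" "\<xi> m \<in> carrier R" using add assms chi_closed by auto
  have "ev (Poly_Mapping.single l b * Poly_Mapping.single m a) = add_pow R (b * a) (\<xi> l \<otimes> \<xi> m)"
    using add assms(2) M_add by (simp add: mult_single ev_single chi_add)
  also have "\<dots> = add_pow R b (\<xi> l) \<otimes> add_pow R a (\<xi> m)"
    by (simp only: add_pow_ldistr_int[OF c(1) add_pow_int_closed[OF c(2)]] add_pow_rdistr_int[OF c] add_pow_int_mult[OF m_closed[OF c]])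
  finally have s: "ev (Poly_Mapping.single l b * Poly_Mapping.single m a) = ev (Poly_Mapping.single l b) \<otimes> ev (Poly_Mapping.single m a)"
    using add assms by (simp add: ev_single)
  note k = single_keys[OF add(2), of b] single_keys[OF assms(2), of a]
  have "ev ((p + Poly_Mapping.single l b) * Poly_Mapping.single m a)
      = ev (p * Poly_Mapping.single m a) \<oplus> ev (Poly_Mapping.single l b * Poly_Mapping.single m a)"
    unfolding distrib_right by (rule ev_add[OF mult_keys[OF add(1) k(2)] mult_keys[OF k]])
  also have "\<dots> = (ev p \<oplus> ev (Poly_Mapping.single l b)) \<otimes> ev (Poly_Mapping.single m a)"
    unfolding add.IH s using ev_closed add(1) k by (simp add: l_distr)
  also have "\<dots> = ev (p + Poly_Mapping.single l b) \<otimes> ev (Poly_Mapping.single m a)"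
    by (simp add: ev_add[OF add(1) k(1)])
  finally show ?case .
qed

lemma ev_mult:
  assumes p: "Poly_Mapping.keys p \<subseteq> M" and "Poly_Mapping.keys p' \<subseteq> M"
  shows "ev (p * p') = ev p \<otimes> ev p'"
  using assms(2)
proof (induction p' rule: poly_mapping_keys_induct)
  case zero
  then show ?case using ev_closed[OF p] by (simp add: ev_0)
next
  case (add p' m a)
  note k = single_keys[OF add(2), of a]
  have "ev (p * (p' + Poly_Mapping.single m a)) = ev (p * p') \<oplus> ev (p * Poly_Mapping.single m a)"
    unfolding distrib_left by (rule ev_add[OF mult_keys[OF p add(1)] mult_keys[OF p k]])
  also have "\<dots> = ev p \<otimes> (ev p' \<oplus> ev (Poly_Mapping.single m a))"
    unfolding add.IH ev_mult_single[OF p add(2)] using ev_closed p add(1) k by (simp add: r_distr)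
  also have "\<dots> = ev p \<otimes> ev (p' + Poly_Mapping.single m a)"
    by (simp add: ev_add[OF add(1) k])
  finally show ?case .
qed

lemma ev_1: "ev 1 = \<one>"
  using ev_single[OF M0, of 1] by (simp add: chi_0 add_pow_int_1)

lemma ev_hom: "(\<lambda>p\<in>carrier (int_monoid_algebra M). ev p) \<in> ring_hom (int_monoid_algebra M) R"
proof (rule ring_hom_memI)
  fix p assume p: "p \<in> carrier (int_monoid_algebra M)"
  then show "(\<lambda>p\<in>carrier (int_monoid_algebra M). ev p) p \<in> carrier R" by (simp add: ev_closed)
  fix p' assume p': "p' \<in> carrier (int_monoid_algebra M)"
  have k: "Poly_Mapping.keys p \<subseteq> M" "Poly_Mapping.keys p' \<subseteq> M" using p p' by simp_all
  have "Poly_Mapping.keys (p + p') \<subseteq> M" using keys_add[of p p'] k by blast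
  then show "(\<lambda>p\<in>carrier (int_monoid_algebra M). ev p) (p \<oplus>\<^bsub>int_monoid_algebra M\<^esub> p')
    = (\<lambda>p\<in>carrier (int_monoid_algebra M). ev p) p \<oplus> (\<lambda>p\<in>carrier (int_monoid_algebra M). ev p) p'"
    using k by (simp add: ev_add)
  show "(\<lambda>p\<in>carrier (int_monoid_algebra M). ev p) (p \<otimes>\<^bsub>int_monoid_algebra M\<^esub> p')
    = (\<lambda>p\<in>carrier (int_monoid_algebra M). ev p) p \<otimes> (\<lambda>p\<in>carrier (int_monoid_algebra M). ev p) p'"
    using k mult_keys[OF k] by (simp add: ev_mult)
qed (use M0 in \<open>simp add: ev_1\<close>)

end

section \<open>Tori over a field and conical gradings\<close>

lemma type_ring_Units: "Units (ring_of_type_algebra :: 'a::field ring) = {x. x \<noteq> 0}"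
proof (rule Set.set_eqI)
  fix x :: 'a
  have "x \<in> Units ring_of_type_algebra \<longleftrightarrow> (\<exists>y. y * x = 1 \<and> x * y = 1)"
    unfolding Units_def by simp
  also have "\<dots> \<longleftrightarrow> x \<noteq> 0"
  proof
    assume "x \<noteq> 0"
    then show "\<exists>y. y * x = 1 \<and> x * y = 1" by (intro exI[of _ "inverse x"]) simp
  qed auto
  finally show "x \<in> Units ring_of_type_algebra \<longleftrightarrow> x \<in> {x. x \<noteq> 0}" by simp
qed

lemma type_units_nat_pow: "x [^]\<^bsub>units_of (ring_of_type_algebra :: 'a::field ring)\<^esub> (n::nat) = x ^ n"
proof -
  interpret cring "ring_of_type_algebra :: 'a ring" by (rule cring_from_type_algebra)
  interpret U: comm_group "units_of (ring_of_type_algebra :: 'a ring)" by (rule units_comm_group)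
  show ?thesis
    by (induction n) (simp_all add: nat_pow_def units_of_mult units_of_one)
qed

lemma type_units_int_pow:
  assumes "x \<noteq> 0"
  shows "x [^]\<^bsub>units_of (ring_of_type_algebra :: 'a::field ring)\<^esub> (n::int) = x powi n"
proof -
  interpret cring "ring_of_type_algebra :: 'a ring" by (rule cring_from_type_algebra)
  interpret U: comm_group "units_of (ring_of_type_algebra :: 'a ring)" by (rule units_comm_group)
  have inv: "inv\<^bsub>units_of (ring_of_type_algebra :: 'a ring)\<^esub> y = inverse y" if "y \<noteq> 0" for y :: 'a
    using units_of_inv[of y] that by (simp add: type_ring_Units type_ring_inverse)
  show ?thesis
  proof (cases "n < 0")
    case True
    then have "x [^]\<^bsub>units_of (ring_of_type_algebra :: 'a ring)\<^esub> n = inverse (x ^ nat (- n))"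
      unfolding int_pow_def2 type_units_nat_pow using inv assms by simp
    then show ?thesis using True by (simp add: power_int_def power_inverse)
  next
    case False
    then have "x [^]\<^bsub>units_of (ring_of_type_algebra :: 'a ring)\<^esub> n = x ^ nat n"
      unfolding int_pow_def2 type_units_nat_pow by simp
    then show ?thesis using False by (simp add: power_int_def)
  qed
qed

lemma type_units_finprod:
  fixes f :: "'b \<Rightarrow> 'a::field"
  assumes "\<And>i. i \<in> A \<Longrightarrow> f i \<noteq> 0"
  shows "finprod (units_of ring_of_type_algebra) f A = prod f A"
proof -
  interpret cring "ring_of_type_algebra :: 'a ring" by (rule cring_from_type_algebra)
  interpret U: comm_group "units_of (ring_of_type_algebra :: 'a ring)" by (rule units_comm_group)
  show ?thesis using assms
  proof (induction A rule: infinite_finite_induct)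
    case (insert x A)
    then have "f \<in> A \<rightarrow> carrier (units_of ring_of_type_algebra)" "f x \<in> carrier (units_of ring_of_type_algebra)"
      by (auto simp: units_of_carrier type_ring_Units)
    then show ?case using insert by (simp add: units_of_mult)
  qed (simp_all add: units_of_one)
qed

lemma type_torus_char:
  fixes t :: "nat \<Rightarrow> 'a::field"
  assumes "\<And>i. i < r \<Longrightarrow> t i \<noteq> 0"
  shows "torus_char r ring_of_type_algebra m t = (\<Prod>i<r. t i powi m i)"
  unfolding torus_char_def using assms
  by (subst type_units_finprod) (auto simp: type_units_int_pow intro!: prod.cong)

lemma type_torus_carrier: "t \<in> carrier (torus r (ring_of_type_algebra :: 'a::field ring)) \<longleftrightarrow> t \<in> {..<r} \<rightarrow>\<^sub>E {x. x \<noteq> 0}"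
  by (simp add: torus_def units_of_carrier type_ring_Units)

lemma type_torus_cochar:
  "z \<noteq> 0 \<Longrightarrow> torus_cochar r (ring_of_type_algebra :: 'a::field ring) l z = (\<lambda>i\<in>{..<r}. z powi l i)"
  unfolding torus_cochar_def by (simp add: type_units_int_pow)

lemma type_torus_cochar_closed:
  "z \<noteq> 0 \<Longrightarrow> torus_cochar r (ring_of_type_algebra :: 'a::field ring) l z \<in> carrier (torus r ring_of_type_algebra)"
  by (auto simp: type_torus_cochar type_torus_carrier)

lemma type_char_cochar:
  fixes z :: "'a::field"
  assumes "z \<noteq> 0"
  shows "torus_char r ring_of_type_algebra m (torus_cochar r ring_of_type_algebra l z) = z powi lattice_pairing r l m"
proof -
  have "torus_char r ring_of_type_algebra m (torus_cochar r ring_of_type_algebra l z) = (\<Prod>i<r. z powi (l i * m i))"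
    using assms by (subst type_torus_char) (auto simp: type_torus_cochar power_int_mult intro!: prod.cong)
  also have "\<dots> = z powi (\<Sum>i<r. l i * m i)"
    by (induction r) (simp_all add: power_int_add assms)
  finally show ?thesis by (simp add: lattice_pairing_def)
qed

lemma type_add_pow:
  fixes a :: "'a::comm_ring_1"
  shows "add_pow ring_of_type_algebra (n::int) a = of_int n * a"
proof -
  interpret cring "ring_of_type_algebra :: 'a ring" by (rule cring_from_type_algebra)
  have nat: "add_pow (ring_of_type_algebra :: 'a ring) (n::nat) a = of_nat n * a" for n
    by (induction n) (simp_all add: add_pow_def nat_pow_def algebra_simps)
  show ?thesis
  proof (cases "0 \<le> n")
    case True
    then show ?thesis unfolding add_pow_int_ge[OF True] nat by simp
  next
    case False
    then have n: "n < 0" by simp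
    show ?thesis unfolding add_pow_int_lt[OF n] nat type_ring_uminus using n by simp
  qed
qed

lemma type_finsum:
  fixes f :: "'b \<Rightarrow> 'a::comm_ring_1"
  shows "finsum ring_of_type_algebra f A = sum f A"
proof -
  interpret cring "ring_of_type_algebra :: 'a ring" by (rule cring_from_type_algebra)
  show ?thesis by (induction A rule: infinite_finite_induct) simp_all
qed

lemma fun_act_lookup:
  "Poly_Mapping.lookup (fun_act r t f) m = torus_char r complex_ring m t * Poly_Mapping.lookup f m"
proof -
  have "Poly_Mapping.lookup (fun_act r t f) m = (\<Sum>l\<in>Poly_Mapping.keys f. (torus_char r complex_ring l t * Poly_Mapping.lookup f l) when l = m)"
    by (simp add: fun_act_def lookup_sum lookup_single)
  also have "\<dots> = torus_char r complex_ring m t * Poly_Mapping.lookup f m"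
    by (cases "m \<in> Poly_Mapping.keys f") (auto simp: when_def in_keys_iff)
  finally show ?thesis .
qed

lemma const_mult_lookup: "Poly_Mapping.lookup (Poly_Mapping.single 0 c * f) m = c * Poly_Mapping.lookup f m"
  for f :: "(nat \<Rightarrow> int) \<Rightarrow>\<^sub>0 'a::comm_ring_1"
proof -
  have "Poly_Mapping.keys f \<subseteq> UNIV" by simp
  then show ?thesis
  proof (induction f rule: poly_mapping_keys_induct)
    case (add p l b)
    have "Poly_Mapping.single 0 c * Poly_Mapping.single l b = Poly_Mapping.single l (c * b)"
      using mult_single[of 0 c l b] by (simp only: add_0)
    then have eq: "Poly_Mapping.lookup (Poly_Mapping.single 0 c * (p + Poly_Mapping.single l b)) m
        = Poly_Mapping.lookup (Poly_Mapping.single 0 c * p) m + Poly_Mapping.lookup (Poly_Mapping.single l (c * b)) m"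
      by (simp only: distrib_left lookup_add)
    have single: "Poly_Mapping.lookup (Poly_Mapping.single l (c * b)) m = c * Poly_Mapping.lookup (Poly_Mapping.single l b) m"
      by (simp add: lookup_single when_def)
    show ?case unfolding eq add.IH single by (simp only: lookup_add distrib_left)
  qed simp
qed

text \<open>Conicality is tested on the monomial of exponent \<open>m\<close>, whose weight is
  \<open>lattice_pairing r \<rho> m\<close>: a negative weight would make it 0, and weight 0 makes
  it a constant.\<close>

lemma conical_pairing:
  assumes "conical r M \<rho>" "m \<in> M"
  shows "0 \<le> lattice_pairing r \<rho> m" "lattice_pairing r \<rho> m = 0 \<Longrightarrow> m = 0"
proof -
  let ?e = "Poly_Mapping.single m (1::complex)"
  have w: "?e \<in> weight_part r M \<rho> (lattice_pairing r \<rho> m)"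
    unfolding weight_part_def
  proof (intro CollectI conjI allI impI poly_mapping_eqI)
    fix z :: complex and l assume z: "z \<noteq> 0"
    show "Poly_Mapping.lookup (fun_act r (torus_cochar r complex_ring \<rho> z) ?e) l
        = Poly_Mapping.lookup (Poly_Mapping.single 0 (z powi lattice_pairing r \<rho> m) * ?e) l"
      using z by (simp add: fun_act_lookup const_mult_lookup lookup_single when_def type_char_cochar)
  qed (use assms(2) in simp)
  have e: "?e \<noteq> 0" by (metis lookup_single_eq lookup_zero zero_neq_one)
  show "0 \<le> lattice_pairing r \<rho> m"
  proof (rule ccontr)
    assume "\<not> 0 \<le> lattice_pairing r \<rho> m"
    then have "weight_part r M \<rho> (lattice_pairing r \<rho> m) = {0}" using assms(1) by (simp add: conical_def)
    then show False using w e by auto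
  qed
  assume "lattice_pairing r \<rho> m = 0"
  then have "?e \<in> range (Poly_Mapping.single 0)" using w assms(1) by (simp add: conical_def)
  then obtain c where "?e = Poly_Mapping.single 0 c" by blast
  then have "Poly_Mapping.lookup (Poly_Mapping.single 0 c) m = 1" by (metis lookup_single_eq)
  then show "m = 0" by (simp add: lookup_single when_def split: if_splits)
qed

section \<open>Dual cones\<close>

text \<open>Induction on the generators. If \<open>y\<close> separates \<open>l\<close> from the
  cone over \<open>I\<close> but is negative on the new generator \<open>s a\<close>, project along
  \<open>s a\<close> to the hyperplane where \<open>y\<close> vanishes and apply the induction
  hypothesis there. The ordered field is arbitrary because rational separating vectors are wanted
  later.\<close>

lemma farkas:
  fixes s :: "'i \<Rightarrow> nat \<Rightarrow> 'a::linordered_field"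
  assumes "finite I"
  shows "(\<exists>c. (\<forall>i\<in>I. 0 \<le> c i) \<and> (\<forall>j<r. l j = (\<Sum>i\<in>I. c i * s i j))) \<or>
    (\<exists>y. (\<forall>i\<in>I. 0 \<le> (\<Sum>j<r. y j * s i j)) \<and> (\<Sum>j<r. y j * l j) < 0)"
  using assms
proof (induction I arbitrary: s l)
  case empty
  show ?case
  proof (cases "\<forall>j<r. l j = 0")
    case False
    then obtain j0 where j0: "j0 < r" "l j0 \<noteq> 0" by blast
    have "0 < (\<Sum>j<r. l j * l j)" by (rule sum_pos2[of _ j0]) (use j0 in \<open>auto simp: less_le\<close>)
    then have "(\<Sum>j<r. - l j * l j) < 0" by (simp add: sum_negf)
    then show ?thesis by (intro disjI2 exI[of _ "\<lambda>j. - l j"]) simp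
  qed simp
next
  case (insert a I)
  let ?p = "\<lambda>y x. \<Sum>j<r. (y j :: 'a) * x j"
  have lin: "?p y (\<lambda>j. x j + c * x' j) = ?p y x + c * ?p y x'" for y x c x'
    by (simp add: sum.distrib algebra_simps sum_distrib_left)
  have lin': "?p (\<lambda>j. y j + c * y' j) x = ?p y x + c * ?p y' x" for y x c y'
    by (simp add: sum.distrib algebra_simps sum_distrib_left)
  show ?case
  proof (cases "\<exists>c. (\<forall>i\<in>I. 0 \<le> c i) \<and> (\<forall>j<r. l j = (\<Sum>i\<in>I. c i * s i j))")
    case True
    then obtain c where c: "\<forall>i\<in>I. 0 \<le> c i" "\<forall>j<r. l j = (\<Sum>i\<in>I. c i * s i j)" by blast
    have "(\<Sum>i\<in>insert a I. (c(a := 0)) i * s i j) = (\<Sum>i\<in>I. c i * s i j)" for j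
      using insert by (simp, intro sum.cong) auto
    then show ?thesis using c by (intro disjI1 exI[of _ "c(a := 0)"]) auto
  next
    case False
    then obtain y where y: "\<forall>i\<in>I. 0 \<le> ?p y (s i)" "?p y l < 0" using insert.IH[of l s] by blast
    show ?thesis
    proof (cases "0 \<le> ?p y (s a)")
      case True
      then show ?thesis using y by blast
    next
      case False
      then have ya: "?p y (s a) < 0" by simp
      \<comment> \<open>The multiple of \<open>s a\<close> that moves \<open>x\<close> into the
        hyperplane; it is nonnegative for the old generators and negative for
        \<open>l\<close>.\<close>
      define t where "t x = - ?p y x / ?p y (s a)" for x
      define s' where "s' i = (\<lambda>j. s i j + t (s i) * s a j)" for i
      define l' where "l' = (\<lambda>j. l j + t l * s a j)"
      have ts: "0 \<le> t (s i)" if "i \<in> I" for i using y(1) that ya by (simp add: t_def divide_nonneg_neg zero_le_divide_iff)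
      have tl: "t l < 0" using divide_neg_neg[OF y(2) ya] by (simp add: t_def)
      have ys: "?p y (s' i) = ?p y (s i) + t (s i) * ?p y (s a)" for i unfolding s'_def by (rule lin)
      have yl: "?p y l' = ?p y l + t l * ?p y (s a)" unfolding l'_def by (rule lin)
      have y0: "?p y (s' i) = 0" "?p y l' = 0" for i
        unfolding ys yl using ya by (simp_all add: t_def)
      consider (1) c where "\<forall>i\<in>I. 0 \<le> c i" "\<forall>j<r. l' j = (\<Sum>i\<in>I. c i * s' i j)"
        | (2) z where "\<forall>i\<in>I. 0 \<le> ?p z (s' i)" "?p z l' < 0"
        using insert.IH[of l' s'] by blast
      then show ?thesis
      proof cases
        case 1
        define e where "e = (\<Sum>i\<in>I. c i * t (s i)) - t l"
        have e: "0 \<le> e" proof -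
          have "0 \<le> (\<Sum>i\<in>I. c i * t (s i))" using 1(1) ts by (intro sum_nonneg mult_nonneg_nonneg) auto
          then show ?thesis unfolding e_def using tl by simp
        qed
        have "l j = (\<Sum>i\<in>insert a I. (c(a := e)) i * s i j)" if "j < r" for j
        proof -
          have "l j = (\<Sum>i\<in>I. c i * s' i j) - t l * s a j" using 1(2) that by (simp add: l'_def algebra_simps)
          also have "\<dots> = (\<Sum>i\<in>I. c i * s i j) + e * s a j"
            by (simp add: s'_def e_def algebra_simps sum.distrib sum_distrib_left)
          also have "(\<Sum>i\<in>I. c i * s i j) = (\<Sum>i\<in>I. (c(a := e)) i * s i j)"
            using insert by (intro sum.cong) auto
          finally show ?thesis using insert by simp
        qed
        then show ?thesis using 1(1) e by (intro disjI1 exI[of _ "c(a := e)"]) auto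
      next
        case 2
        \<comment> \<open>Adding a multiple of \<open>y\<close> makes the functional vanish on
          \<open>s a\<close>; on the projected vectors \<open>y\<close> is 0, so nothing changes
          there.\<close>
        define w where "w = (\<lambda>j. z j + (- ?p z (s a) / ?p y (s a)) * y j)"
        have wa: "?p w (s a) = 0" unfolding w_def lin' using ya by simp
        have ws: "?p w (s i) = ?p z (s' i)" for i
        proof -
          have "?p w (s' i) = ?p w (s i) + t (s i) * ?p w (s a)" unfolding s'_def by (rule lin)
          moreover have "?p w (s' i) = ?p z (s' i)" unfolding w_def lin' by (simp add: y0)
          ultimately show ?thesis using wa by simp
        qed
        have wl: "?p w l = ?p z l'"
        proof -
          have "?p w l' = ?p w l + t l * ?p w (s a)" unfolding l'_def by (rule lin)
          moreover have "?p w l' = ?p z l'" unfolding w_def lin' by (simp add: y0)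
          ultimately show ?thesis using wa by simp
        qed
        show ?thesis using 2 ws wl wa by (intro disjI2 exI[of _ w]) auto
      qed
    qed
  qed
qed

text \<open>Over the rationals the separating functional can be scaled to a lattice vector by a
  common denominator; the coefficients in the other alternative are merely read as reals.\<close>

lemma integral_farkas:
  fixes s :: "'i \<Rightarrow> nat \<Rightarrow> int"
  assumes "finite I"
  shows "(\<exists>c. (\<forall>i\<in>I. 0 \<le> (c i :: real)) \<and> (\<forall>j<r. real_of_int (l j) = (\<Sum>i\<in>I. c i * real_of_int (s i j)))) \<or>
    (\<exists>m\<in>lattice_vecs r. (\<forall>i\<in>I. 0 \<le> lattice_pairing r m (s i)) \<and> lattice_pairing r m l < 0)"
proof -
  consider (1) c where "\<forall>i\<in>I. 0 \<le> (c i :: rat)" "\<forall>j<r. of_int (l j) = (\<Sum>i\<in>I. c i * of_int (s i j))"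
    | (2) y where "\<forall>i\<in>I. 0 \<le> (\<Sum>j<r. (y j :: rat) * of_int (s i j))" "(\<Sum>j<r. y j * of_int (l j)) < 0"
    using farkas[OF assms, where 'a = rat, of r "\<lambda>j. of_int (l j)" "\<lambda>i j. of_int (s i j)"] by blast
  then show ?thesis
  proof cases
    case 1
    have "real_of_int (l j) = (\<Sum>i\<in>I. real_of_rat (c i) * real_of_int (s i j))" if "j < r" for j
    proof -
      have "real_of_rat (of_int (l j)) = real_of_rat (\<Sum>i\<in>I. c i * of_int (s i j))" using 1(2) that by simp
      then show ?thesis by (simp add: of_rat_sum of_rat_mult)
    qed
    then show ?thesis using 1(1) by (intro disjI1 exI[of _ "\<lambda>i. real_of_rat (c i)"]) simp
  next
    case 2
    define d where "d = (\<Prod>j<r. snd (quotient_of (y j)))"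
    have dpos: "0 < d" unfolding d_def by (intro prod_pos) (auto simp: quotient_of_denom_pos')
    have "\<exists>k. of_int d * y j = of_int k" if "j < r" for j
    proof -
      obtain p q where pq: "quotient_of (y j) = (p, q)" by (cases "quotient_of (y j)")
      have q: "q \<noteq> 0" using quotient_of_denom_pos[OF pq] by simp
      have "d = q * (\<Prod>j\<in>{..<r} - {j}. snd (quotient_of (y j)))"
        unfolding d_def using prod.remove[of "{..<r}" j "\<lambda>j. snd (quotient_of (y j))"] that pq by simp
      then have "of_int d * y j = of_int (p * (\<Prod>j\<in>{..<r} - {j}. snd (quotient_of (y j))))"
        using quotient_of_div[OF pq] q by simp
      then show ?thesis by blast
    qed
    then obtain k where k: "\<And>j. j < r \<Longrightarrow> of_int d * y j = of_int (k j)" by metis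
    define m where "m j = (if j < r then k j else 0)" for j
    have pair: "(of_int (lattice_pairing r m x) :: rat) = of_int d * (\<Sum>j<r. y j * of_int (x j))" for x
    proof -
      have "(of_int (lattice_pairing r m x) :: rat) = (\<Sum>j<r. of_int (k j) * of_int (x j))"
        by (simp add: lattice_pairing_def m_def)
      also have "\<dots> = (\<Sum>j<r. of_int d * (y j * of_int (x j)))"
        by (intro sum.cong) (auto simp flip: k)
      finally show ?thesis by (simp add: sum_distrib_left)
    qed
    have "0 \<le> lattice_pairing r m (s i)" if "i \<in> I" for i
    proof -
      have "(0::rat) \<le> of_int (lattice_pairing r m (s i))" unfolding pair using 2(1) that dpos by simp
      then show ?thesis by simp
    qed
    moreover have "lattice_pairing r m l < 0"
    proof -
      have "(of_int (lattice_pairing r m l) :: rat) < 0" unfolding pair using 2(2) dpos by (simp add: mult_pos_neg)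
      then show ?thesis by simp
    qed
    moreover have "m \<in> lattice_vecs r" by (simp add: m_def lattice_vecs_def)
    ultimately show ?thesis by blast
  qed
qed

lemma lattice_pairing_commute: "lattice_pairing r l m = lattice_pairing r m l"
  by (simp add: lattice_pairing_def mult.commute)

lemma lattice_vecs_add: "m \<in> lattice_vecs r \<Longrightarrow> m' \<in> lattice_vecs r \<Longrightarrow> m + m' \<in> lattice_vecs r"
  by (simp add: lattice_vecs_def)

text \<open>\<open>A\<close> is the quantitative form of conicality: the degree controls every
  coordinate. It yields finite level sets and the convergence of sums over \<open>N\<close>. Duality
  of the two varieties becomes an interpretation with \<open>M\<close> and \<open>N\<close>
  exchanged.\<close>

locale dual_monoids =
  fixes r :: nat and M N :: "(nat \<Rightarrow> int) set" and \<eta> :: "nat \<Rightarrow> int" and A :: real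
  assumes M: "M \<subseteq> lattice_vecs r" "0 \<in> M" "\<And>m m'. m \<in> M \<Longrightarrow> m' \<in> M \<Longrightarrow> m + m' \<in> M"
    and N_iff: "\<And>n. n \<in> N \<longleftrightarrow> n \<in> lattice_vecs r \<and> (\<forall>m\<in>M. 0 \<le> lattice_pairing r n m)"
    and A: "0 < A" "\<And>n i. n \<in> N \<Longrightarrow> i < r \<Longrightarrow> real_of_int \<bar>n i\<bar> \<le> A * real_of_int (lattice_pairing r \<eta> n)"

lemma dual_monoidsI:
  assumes M: "M \<subseteq> lattice_vecs r" "0 \<in> M" "\<And>m m'. m \<in> M \<Longrightarrow> m' \<in> M \<Longrightarrow> m + m' \<in> M"
    and N: "\<And>n. n \<in> N \<longleftrightarrow> n \<in> lattice_vecs r \<and> (\<forall>m\<in>M. 0 \<le> lattice_pairing r n m)"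
    and pos: "\<And>n. n \<in> N \<Longrightarrow> 0 \<le> lattice_pairing r \<eta> n"
    and A: "\<And>i. i < r \<Longrightarrow> \<exists>A. \<forall>n\<in>N. real_of_int \<bar>n i\<bar> \<le> A * real_of_int (lattice_pairing r \<eta> n)"
  shows "\<exists>A. dual_monoids r M N \<eta> A"
proof -
  obtain B where B: "\<And>i n. i < r \<Longrightarrow> n \<in> N \<Longrightarrow> real_of_int \<bar>n i\<bar> \<le> B i * real_of_int (lattice_pairing r \<eta> n)"
    using A by metis
  \<comment> \<open>The summand 1 keeps the constant positive also for \<open>r = 0\<close>, and the
    sum majorizes every \<open>B i\<close>.\<close>
  define C where "C = 1 + (\<Sum>i<r. \<bar>B i\<bar>)"
  have "dual_monoids r M N \<eta> C"
  proof
    show "0 < C" unfolding C_def by (simp add: sum_nonneg add_pos_nonneg)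
    fix n i assume n: "n \<in> N" "i < r"
    have "B i \<le> \<bar>B i\<bar>" by simp
    also have "\<bar>B i\<bar> \<le> (\<Sum>i<r. \<bar>B i\<bar>)" by (rule member_le_sum) (use n in auto)
    finally have "B i \<le> C" by (simp add: C_def)
    then have "B i * real_of_int (lattice_pairing r \<eta> n) \<le> C * real_of_int (lattice_pairing r \<eta> n)"
      using pos[OF n(1)] by (intro mult_right_mono) auto
    then show "real_of_int \<bar>n i\<bar> \<le> C * real_of_int (lattice_pairing r \<eta> n)" using B[OF n(2,1)] by linarith
  qed (fact M N)+
  then show ?thesis by blast
qed

section \<open>Rational cones, double duality and coordinate bounds\<close>

locale polyhedral_cone =
  fixes r :: nat and \<sigma> :: "(nat \<Rightarrow> real) set" and S :: "(nat \<Rightarrow> int) set"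
  assumes S: "finite S" "S \<subseteq> lattice_vecs r"
    and sigma: "\<sigma> = {x. \<exists>c. (\<forall>u\<in>S. 0 \<le> c u) \<and> x = (\<lambda>i. \<Sum>u\<in>S. c u * real_of_int (u i))}"
begin

abbreviation "N \<equiv> lattice_points r \<sigma>"
abbreviation "M \<equiv> lattice_points r (dual_cone r \<sigma>)"

lemma S_sigma: "u \<in> S \<Longrightarrow> (\<lambda>i. real_of_int (u i)) \<in> \<sigma>"
  unfolding sigma
proof (intro CollectI exI[of _ "\<lambda>v. if v = u then 1 else 0"] conjI ext)
  fix i assume u: "u \<in> S"
  show "real_of_int (u i) = (\<Sum>v\<in>S. (if v = u then 1 else 0) * real_of_int (v i))"
    using u S(1) by (simp add: if_distrib[where f = "\<lambda>x. x * _"] cong: if_cong)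
qed simp

lemma pairing_combination:
  "(\<Sum>i<r. (\<Sum>u\<in>S. c u * real_of_int (u i)) * real_of_int (m i)) = (\<Sum>u\<in>S. c u * real_of_int (lattice_pairing r u m))"
proof -
  have "(\<Sum>i<r. (\<Sum>u\<in>S. c u * real_of_int (u i)) * real_of_int (m i)) = (\<Sum>i<r. \<Sum>u\<in>S. c u * (real_of_int (u i) * real_of_int (m i)))"
    by (simp only: sum_distrib_right mult.assoc)
  also have "\<dots> = (\<Sum>u\<in>S. \<Sum>i<r. c u * (real_of_int (u i) * real_of_int (m i)))" by (rule sum.swap)
  finally show ?thesis by (simp add: lattice_pairing_def sum_distrib_left)
qed

lemma M_iff: "m \<in> M \<longleftrightarrow> m \<in> lattice_vecs r \<and> (\<forall>u\<in>S. 0 \<le> lattice_pairing r m u)"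
proof
  assume m: "m \<in> M"
  have "0 \<le> lattice_pairing r m u" if u: "u \<in> S" for u
  proof -
    have "0 \<le> (\<Sum>i<r. real_of_int (u i) * real_of_int (m i))"
      using m S_sigma[OF u] by (auto simp: lattice_points_def dual_cone_def)
    then have "0 \<le> real_of_int (lattice_pairing r m u)" by (simp add: lattice_pairing_def mult.commute)
    then show ?thesis by simp
  qed
  then show "m \<in> lattice_vecs r \<and> (\<forall>u\<in>S. 0 \<le> lattice_pairing r m u)"
    using m by (simp add: lattice_points_def)
next
  assume m: "m \<in> lattice_vecs r \<and> (\<forall>u\<in>S. 0 \<le> lattice_pairing r m u)"
  have "0 \<le> (\<Sum>i<r. x i * real_of_int (m i))" if x: "x \<in> \<sigma>" for x
  proof -
    obtain c where c: "\<forall>u\<in>S. 0 \<le> c u" "x = (\<lambda>i. \<Sum>u\<in>S. c u * real_of_int (u i))" using x unfolding sigma by blast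
    show ?thesis unfolding c(2) pairing_combination
      using c(1) m by (intro sum_nonneg mult_nonneg_nonneg) (auto simp: lattice_pairing_commute[of r _ m])
  qed
  then show "m \<in> M" using m by (auto simp: lattice_points_def dual_cone_def real_vecs_def lattice_vecs_def)
qed

lemma N_combination:
  assumes "n \<in> N"
  shows "\<exists>c. (\<forall>u\<in>S. 0 \<le> c u) \<and> (\<forall>i. real_of_int (n i) = (\<Sum>u\<in>S. c u * real_of_int (u i))) \<and>
    (\<forall>m. real_of_int (lattice_pairing r n m) = (\<Sum>u\<in>S. c u * real_of_int (lattice_pairing r u m)))"
proof -
  have "(\<lambda>i. real_of_int (n i)) \<in> \<sigma>" using assms by (simp add: lattice_points_def)
  then obtain c where c: "\<forall>u\<in>S. 0 \<le> c u" "(\<lambda>i. real_of_int (n i)) = (\<lambda>i. \<Sum>u\<in>S. c u * real_of_int (u i))"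
    unfolding sigma by blast
  have n: "real_of_int (n i) = (\<Sum>u\<in>S. c u * real_of_int (u i))" for i using fun_cong[OF c(2), of i] .
  have "real_of_int (lattice_pairing r n m) = (\<Sum>i<r. (\<Sum>u\<in>S. c u * real_of_int (u i)) * real_of_int (m i))" for m
    by (simp add: lattice_pairing_def flip: n)
  then show ?thesis using c(1) n pairing_combination by (intro exI[of _ c] conjI allI ballI) simp_all
qed

lemma pairing_nonneg:
  assumes "n \<in> N" "m \<in> M" shows "0 \<le> lattice_pairing r n m"
proof -
  obtain c where c: "\<And>u. u \<in> S \<Longrightarrow> 0 \<le> c u" "\<And>i. real_of_int (n i) = (\<Sum>u\<in>S. c u * real_of_int (u i))"
    "\<And>m. real_of_int (lattice_pairing r n m) = (\<Sum>u\<in>S. c u * real_of_int (lattice_pairing r u m))"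
    using N_combination[OF assms(1)] by blast
  have "0 \<le> real_of_int (lattice_pairing r n m)"
    unfolding c(3) using c(1) assms(2) by (intro sum_nonneg mult_nonneg_nonneg) (auto simp: M_iff lattice_pairing_commute[of r _ m])
  then show ?thesis by simp
qed

lemma S_N: "u \<in> S \<Longrightarrow> u \<in> N"
  using S S_sigma by (auto simp: lattice_points_def)

lemma M_dual: "m \<in> M \<longleftrightarrow> m \<in> lattice_vecs r \<and> (\<forall>n\<in>N. 0 \<le> lattice_pairing r m n)"
proof
  assume m: "m \<in> M"
  then show "m \<in> lattice_vecs r \<and> (\<forall>n\<in>N. 0 \<le> lattice_pairing r m n)"
    using pairing_nonneg[OF _ m] lattice_pairing_commute[of r m] unfolding M_iff[of m] by simp
next
  assume "m \<in> lattice_vecs r \<and> (\<forall>n\<in>N. 0 \<le> lattice_pairing r m n)"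
  then show "m \<in> M" unfolding M_iff[of m] using S_N by simp
qed

text \<open>Double duality on lattice points: by \<open>integral_farkas\<close> a lattice vector
  outside the cone is separated from it by a lattice vector nonnegative on the generators, and such
  a vector belongs to \<open>M\<close>.\<close>

lemma N_dual: "n \<in> N \<longleftrightarrow> n \<in> lattice_vecs r \<and> (\<forall>m\<in>M. 0 \<le> lattice_pairing r n m)"
proof
  assume "n \<in> N"
  then show "n \<in> lattice_vecs r \<and> (\<forall>m\<in>M. 0 \<le> lattice_pairing r n m)"
    using pairing_nonneg by (auto simp: lattice_points_def)
next
  assume n: "n \<in> lattice_vecs r \<and> (\<forall>m\<in>M. 0 \<le> lattice_pairing r n m)"
  have "\<not> (\<exists>m\<in>lattice_vecs r. (\<forall>u\<in>S. 0 \<le> lattice_pairing r m u) \<and> lattice_pairing r m n < 0)"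
    using n M_iff by (metis lattice_pairing_commute not_less)
  then obtain c where c: "\<forall>u\<in>S. 0 \<le> (c u :: real)" "\<forall>j<r. real_of_int (n j) = (\<Sum>u\<in>S. c u * real_of_int (u j))"
    using integral_farkas[OF S(1), of r n "\<lambda>u. u"] by blast
  have "real_of_int (n j) = (\<Sum>u\<in>S. c u * real_of_int (u j))" for j
  proof (cases "j < r")
    case False
    then have "u j = 0" if "u \<in> S" for u using that S(2) by (auto simp: lattice_vecs_def)
    then have "(\<Sum>u\<in>S. c u * real_of_int (u j)) = 0" by (intro sum.neutral) simp
    then show ?thesis using n False by (simp add: lattice_vecs_def)
  qed (use c in simp)
  then show "n \<in> N" using n c(1) unfolding lattice_points_def sigma by blast
qed

lemma pairing_add_left: "lattice_pairing r (l + l') m = lattice_pairing r l m + lattice_pairing r l' m"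
  by (simp add: lattice_pairing_def algebra_simps sum.distrib)

lemma N_closed: "0 \<in> N" "n \<in> N \<Longrightarrow> n' \<in> N \<Longrightarrow> n + n' \<in> N"
proof -
  have "0 \<in> lattice_vecs r" "\<And>m. lattice_pairing r 0 m = 0" by (simp_all add: lattice_vecs_def lattice_pairing_def)
  then show "0 \<in> N" using N_dual by simp
  show "n + n' \<in> N" if "n \<in> N" "n' \<in> N"
    using that lattice_vecs_add unfolding N_dual[of n] N_dual[of n'] N_dual[of "n + n'"] pairing_add_left by simp
qed

lemma M_closed: "0 \<in> M" "n \<in> M \<Longrightarrow> n' \<in> M \<Longrightarrow> n + n' \<in> M"
proof -
  have "0 \<in> lattice_vecs r" "\<And>m. lattice_pairing r 0 m = 0" by (simp_all add: lattice_vecs_def lattice_pairing_def)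
  then show "0 \<in> M" using M_iff by simp
  show "n + n' \<in> M" if "n \<in> M" "n' \<in> M"
    using that lattice_vecs_add unfolding M_iff[of n] M_iff[of n'] M_iff[of "n + n'"] pairing_add_left by simp
qed

text \<open>A point of \<open>N\<close> is a nonnegative combination of generators, and the degree
  of a nonzero generator is a positive integer, hence at least 1. So the coefficients that matter,
  and with them each coordinate, are bounded by a multiple of the degree.\<close>

lemma dual_N:
  assumes con: "conical r N \<eta>"
  shows "\<exists>A. dual_monoids r M N \<eta> A"
proof (rule dual_monoidsI)
  fix i assume i: "i < r"
  define C where "C = (\<Sum>u\<in>S. real_of_int \<bar>u i\<bar>)"
  show "\<exists>A. \<forall>n\<in>N. real_of_int \<bar>n i\<bar> \<le> A * real_of_int (lattice_pairing r \<eta> n)"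
  proof (intro exI[of _ C] ballI)
    fix n assume n: "n \<in> N"
    obtain c where c: "\<And>u. u \<in> S \<Longrightarrow> 0 \<le> c u" "\<And>i. real_of_int (n i) = (\<Sum>u\<in>S. c u * real_of_int (u i))"
      "\<And>m. real_of_int (lattice_pairing r n m) = (\<Sum>u\<in>S. c u * real_of_int (lattice_pairing r u m))"
      using N_combination[OF n] by blast
    have "real_of_int \<bar>n i\<bar> = \<bar>\<Sum>u\<in>S. c u * real_of_int (u i)\<bar>" using c(2)[of i] by simp
    also have "\<dots> \<le> (\<Sum>u\<in>S. \<bar>c u * real_of_int (u i)\<bar>)" by (rule sum_abs)
    also have "\<dots> \<le> (\<Sum>u\<in>S. C * (c u * real_of_int (lattice_pairing r u \<eta>)))"
    proof (rule sum_mono)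
      fix u assume u: "u \<in> S"
      show "\<bar>c u * real_of_int (u i)\<bar> \<le> C * (c u * real_of_int (lattice_pairing r u \<eta>))"
      proof (cases "u = 0")
        case False
        have "lattice_pairing r \<eta> u \<noteq> 0" "0 \<le> lattice_pairing r \<eta> u"
          using conical_pairing[OF con S_N[OF u]] False by auto
        then have p: "1 \<le> real_of_int (lattice_pairing r u \<eta>)" by (simp add: lattice_pairing_commute[of r u])
        have uC: "real_of_int \<bar>u i\<bar> \<le> C" unfolding C_def by (rule member_le_sum) (use u S in auto)
        then have C0: "0 \<le> C" by linarith
        have "\<bar>c u * real_of_int (u i)\<bar> = c u * real_of_int \<bar>u i\<bar>" using c(1)[OF u] by (simp add: abs_mult)
        also have "\<dots> \<le> c u * C" using uC c(1)[OF u] by (rule mult_left_mono)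
        also have "\<dots> \<le> (c u * C) * real_of_int (lattice_pairing r u \<eta>)"
          using mult_left_mono[OF p, of "c u * C"] c(1)[OF u] C0 by simp
        finally show ?thesis by (simp add: mult_ac)
      qed (simp add: lattice_pairing_def)
    qed
    also have "\<dots> = C * real_of_int (lattice_pairing r \<eta> n)"
      by (simp add: c(3) lattice_pairing_commute[of r \<eta>] sum_distrib_left)
    finally show "real_of_int \<bar>n i\<bar> \<le> C * real_of_int (lattice_pairing r \<eta> n)" .
  qed
next
  show "M \<subseteq> lattice_vecs r" by (auto simp: lattice_points_def)
qed (fact M_closed N_dual conical_pairing(1)[OF con])+

text \<open>The dual cone comes without generators. Conicality says that no nonzero lattice point of
  it has degree at most 0, and Farkas turns this into the statement that a multiple of
  \<open>\<eta>\<close> minus \<open>u\<close> lies in \<open>\<sigma>\<close>, for each generator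
  \<open>u\<close>; so \<open>u\<close> pairs with \<open>m\<close> to at most a constant times the
  degree. Full dimension writes every coordinate function as a difference of two elements of
  \<open>\<sigma>\<close>.\<close>

lemma dual_M:
  assumes con: "conical r M \<eta>" and eta: "\<eta> \<in> lattice_vecs r" and full: "full_dimensional r \<sigma>"
  shows "\<exists>A. dual_monoids r N M \<eta> A"
proof (rule dual_monoidsI)
  have K: "\<exists>K. \<forall>m\<in>M. real_of_int (lattice_pairing r u m) \<le> K * real_of_int (lattice_pairing r \<eta> m)" if u: "u \<in> S" for u
  proof -
    \<comment> \<open>\<open>None\<close> carries the extra inequality that the degree of
      \<open>m\<close> is at most 0.\<close>
    let ?s = "\<lambda>w. case w of None \<Rightarrow> - \<eta> | Some u \<Rightarrow> u"
    let ?I = "insert None (Some ` S)"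
    have neg: "lattice_pairing r m (- x) = - lattice_pairing r m x" for m x
      by (simp add: lattice_pairing_def sum_negf)
    have "\<not> (\<exists>m\<in>lattice_vecs r. (\<forall>i\<in>?I. 0 \<le> lattice_pairing r m (?s i)) \<and> lattice_pairing r m (- u) < 0)"
    proof
      assume "\<exists>m\<in>lattice_vecs r. (\<forall>i\<in>?I. 0 \<le> lattice_pairing r m (?s i)) \<and> lattice_pairing r m (- u) < 0"
      then obtain m where m: "m \<in> lattice_vecs r" "\<forall>u\<in>S. 0 \<le> lattice_pairing r m u"
        "lattice_pairing r m \<eta> \<le> 0" "0 < lattice_pairing r m u" by (auto simp: neg)
      have mM: "m \<in> M" using m M_iff by blast
      then have "m = 0" using conical_pairing[OF con mM] m(3) by (simp add: lattice_pairing_commute[of r m])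
      then show False using m(4) by (simp add: lattice_pairing_def)
    qed
    then obtain c where c: "\<forall>i\<in>?I. 0 \<le> (c i :: real)" "\<forall>j<r. real_of_int ((- u) j) = (\<Sum>i\<in>?I. c i * real_of_int (?s i j))"
      using integral_farkas[of ?I r "- u" ?s] S(1) by blast
    have c2: "- real_of_int (u j) = - c None * real_of_int (\<eta> j) + (\<Sum>v\<in>S. c (Some v) * real_of_int (v j))" if "j < r" for j
      using c(2)[rule_format, OF that] S(1) by (simp add: sum.reindex)
    have "real_of_int (lattice_pairing r u m) \<le> c None * real_of_int (lattice_pairing r \<eta> m)" if m: "m \<in> M" for m
    proof -
      have "- real_of_int (lattice_pairing r u m) = (\<Sum>j<r. - real_of_int (u j) * real_of_int (m j))"
        by (simp add: lattice_pairing_def sum_negf)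
      also have "\<dots> = (\<Sum>j<r. - c None * real_of_int (\<eta> j) * real_of_int (m j) + (\<Sum>v\<in>S. c (Some v) * real_of_int (v j)) * real_of_int (m j))"
        by (intro sum.cong) (auto simp: c2 algebra_simps)
      also have "\<dots> = - c None * real_of_int (lattice_pairing r \<eta> m) + (\<Sum>v\<in>S. c (Some v) * real_of_int (lattice_pairing r v m))"
        unfolding sum.distrib pairing_combination by (simp add: lattice_pairing_def sum_distrib_left mult.assoc sum_negf)
      finally have "- real_of_int (lattice_pairing r u m) = \<dots>" .
      moreover have "0 \<le> (\<Sum>v\<in>S. c (Some v) * real_of_int (lattice_pairing r v m))"
        using c(1) m by (intro sum_nonneg mult_nonneg_nonneg) (auto simp: M_iff lattice_pairing_commute[of r _ m])
      ultimately show ?thesis by linarith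
    qed
    then show ?thesis by blast
  qed
  then obtain K where K: "\<And>u m. u \<in> S \<Longrightarrow> m \<in> M \<Longrightarrow> real_of_int (lattice_pairing r u m) \<le> K u * real_of_int (lattice_pairing r \<eta> m)"
    by metis
  fix i assume i: "i < r"
  have "(\<lambda>j. if j = i then 1 else 0) \<in> real_vecs r" using i by (auto simp: real_vecs_def)
  then obtain a b where ab: "a \<in> \<sigma>" "b \<in> \<sigma>" "(\<lambda>j. if j = i then 1 else 0) = a - b"
    using full unfolding full_dimensional_def by blast
  obtain c where c: "\<forall>u\<in>S. 0 \<le> c u" "a = (\<lambda>i. \<Sum>u\<in>S. c u * real_of_int (u i))" using ab(1) unfolding sigma by blast
  obtain d where d: "\<forall>u\<in>S. 0 \<le> d u" "b = (\<lambda>i. \<Sum>u\<in>S. d u * real_of_int (u i))" using ab(2) unfolding sigma by blast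
  define C where "C = (\<Sum>u\<in>S. (c u + d u) * K u)"
  show "\<exists>A. \<forall>m\<in>M. real_of_int \<bar>m i\<bar> \<le> A * real_of_int (lattice_pairing r \<eta> m)"
  proof (intro exI[of _ C] ballI)
    fix m assume m: "m \<in> M"
    let ?p = "\<lambda>u. real_of_int (lattice_pairing r u m)"
    have p: "0 \<le> ?p u" if "u \<in> S" for u using m that by (simp add: M_iff lattice_pairing_commute[of r _ m])
    have "real_of_int (m i) = (\<Sum>j<r. (if j = i then 1 else 0) * real_of_int (m j))"
      using i by (simp add: if_distrib[where f = "\<lambda>x. x * _"] cong: if_cong)
    also have "\<dots> = (\<Sum>j<r. (a j - b j) * real_of_int (m j))"
      using fun_cong[OF ab(3)] by simp
    also have "\<dots> = (\<Sum>u\<in>S. c u * ?p u) - (\<Sum>u\<in>S. d u * ?p u)"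
      unfolding c(2) d(2) left_diff_distrib sum_subtractf pairing_combination ..
    finally have mi: "real_of_int (m i) = (\<Sum>u\<in>S. c u * ?p u) - (\<Sum>u\<in>S. d u * ?p u)" .
    have "0 \<le> (\<Sum>u\<in>S. c u * ?p u)" "0 \<le> (\<Sum>u\<in>S. d u * ?p u)"
      using c(1) d(1) p by (auto intro!: sum_nonneg mult_nonneg_nonneg)
    then have "real_of_int \<bar>m i\<bar> \<le> (\<Sum>u\<in>S. c u * ?p u) + (\<Sum>u\<in>S. d u * ?p u)" using mi by linarith
    also have "\<dots> = (\<Sum>u\<in>S. (c u + d u) * ?p u)" by (simp add: sum.distrib algebra_simps)
    also have "\<dots> \<le> (\<Sum>u\<in>S. (c u + d u) * (K u * real_of_int (lattice_pairing r \<eta> m)))"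
      using c(1) d(1) K m by (intro sum_mono mult_left_mono) auto
    also have "\<dots> = C * real_of_int (lattice_pairing r \<eta> m)" by (simp add: C_def sum_distrib_right mult.assoc)
    finally show "real_of_int \<bar>m i\<bar> \<le> C * real_of_int (lattice_pairing r \<eta> m)" .
  qed
next
  show "N \<subseteq> lattice_vecs r" by (auto simp: lattice_points_def)
qed (fact N_closed M_dual conical_pairing(1)[OF con])+

end

section \<open>Divisors attached to adelic points of a torus\<close>

locale idele_torus = global_function_field k for k :: "'f::field set" + fixes r :: nat
begin

sublocale AT: torus_over "adele_ring :: 'f adele ring" r
  by unfold_locales

abbreviation TA :: "(nat \<Rightarrow> 'f adele) monoid" where "TA \<equiv> torus r adele_ring"

text \<open>Extended by 0 off the places and beyond the rank, so that equality of divisors is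
  equality of functions and the values lie in \<open>lattice_vecs r\<close>.\<close>

definition tdiv :: "(nat \<Rightarrow> 'f adele) \<Rightarrow> ('f \<Rightarrow> int) \<Rightarrow> nat \<Rightarrow> int" where
  "tdiv t v = (\<lambda>i. if i < r \<and> v \<in> places then completion_val v (t i v) else 0)"

lemma tdiv_outside: "v \<notin> places \<Longrightarrow> tdiv t v = 0"
  by (rule ext) (simp add: tdiv_def)

lemma tdiv_lattice: "tdiv t v \<in> lattice_vecs r"
  by (simp add: tdiv_def lattice_vecs_def)

lemma tdiv_mult:
  assumes "s \<in> carrier TA" "t \<in> carrier TA"
  shows "tdiv (s \<otimes>\<^bsub>TA\<^esub> t) v = tdiv s v + tdiv t v"
proof
  fix i
  show "tdiv (s \<otimes>\<^bsub>TA\<^esub> t) v i = (tdiv s v + tdiv t v) i"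
    using AT.T_unit[OF assms(1), of i] AT.T_unit[OF assms(2), of i]
    by (simp add: tdiv_def AT.T_mult adele_val_mult)
qed

lemma tdiv_one: "tdiv \<one>\<^bsub>TA\<^esub> v = 0"
proof -
  have "tdiv (\<one>\<^bsub>TA\<^esub> \<otimes>\<^bsub>TA\<^esub> \<one>\<^bsub>TA\<^esub>) v = tdiv \<one>\<^bsub>TA\<^esub> v + tdiv \<one>\<^bsub>TA\<^esub> v"
    by (rule tdiv_mult) simp_all
  then show ?thesis by simp
qed

lemma tdiv_inv: "t \<in> carrier TA \<Longrightarrow> tdiv (inv\<^bsub>TA\<^esub> t) v = - tdiv t v"
  using tdiv_mult[of t "inv\<^bsub>TA\<^esub> t" v] tdiv_one[of v] by (simp add: eq_neg_iff_add_eq_0 add.commute)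

lemma tdiv_finite:
  assumes "t \<in> carrier TA" shows "finite {v. tdiv t v \<noteq> 0}"
proof (rule finite_subset)
  show "{v. tdiv t v \<noteq> 0} \<subseteq> (\<Union>i<r. {v \<in> places. completion_val v (t i v) \<noteq> 0})"
  proof
    fix v assume "v \<in> {v. tdiv t v \<noteq> 0}"
    then obtain i where "tdiv t v i \<noteq> 0" by (auto simp: fun_eq_iff)
    then show "v \<in> (\<Union>i<r. {v \<in> places. completion_val v (t i v) \<noteq> 0})"
      by (auto simp: tdiv_def split: if_splits)
  qed
  show "finite (\<Union>i<r. {v \<in> places. completion_val v (t i v) \<noteq> 0})"
    using AT.T_unit[OF assms] by (auto simp: adele_Units)
qed

lemma char_val:
  assumes t: "t \<in> carrier TA" and v: "v \<in> places"
  shows "completion_val v (torus_char r adele_ring m t v) = lattice_pairing r m (tdiv t v)"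
proof -
  let ?F = "\<lambda>a. completion_val v (a v)"
  have F: "?F (a \<otimes>\<^bsub>units_of adele_ring\<^esub> b) = ?F a + ?F b"
    if "a \<in> carrier (units_of adele_ring)" "b \<in> carrier (units_of adele_ring)" for a b
    using adele_val_mult that v by (simp add: units_of_carrier units_of_mult)
  have "?F (torus_char r adele_ring m t) = (\<Sum>i<r. ?F (t i [^]\<^bsub>units_of adele_ring\<^esub> m i))"
    unfolding torus_char_def by (rule AT.units.additive_int_pow(4)[of ?F, OF F AT.char_terms[OF t]])
  also have "\<dots> = (\<Sum>i<r. m i * ?F (t i))"
    using AT.T_unit[OF t] by (intro sum.cong refl AT.units.additive_int_pow(3)[of ?F, OF F]) (auto simp: units_of_carrier)
  finally show ?thesis by (simp add: lattice_pairing_def tdiv_def v)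
qed

lemma tdiv_cochar:
  assumes "u \<in> Units adele_ring"
  shows "tdiv (torus_cochar r adele_ring l u) v = (\<lambda>i. if i < r \<and> v \<in> places then l i * completion_val v (u v) else 0)"
proof
  fix i
  let ?F = "\<lambda>a. completion_val v (a v)"
  show "tdiv (torus_cochar r adele_ring l u) v i = (if i < r \<and> v \<in> places then l i * completion_val v (u v) else 0)"
  proof (cases "i < r \<and> v \<in> places")
    case True
    have F: "?F (a \<otimes>\<^bsub>units_of adele_ring\<^esub> b) = ?F a + ?F b"
      if "a \<in> carrier (units_of adele_ring)" "b \<in> carrier (units_of adele_ring)" for a b
      using adele_val_mult that True by (simp add: units_of_carrier units_of_mult)
    have "u \<in> carrier (units_of adele_ring)" using assms by (simp add: units_of_carrier)
    from AT.units.additive_int_pow(3)[of ?F, OF F this] show ?thesis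
      using True by (simp add: tdiv_def torus_cochar_def)
  qed (auto simp: tdiv_def)
qed

lemma integral_torus_iff: "t \<in> integral_torus r \<longleftrightarrow> t \<in> carrier TA \<and> (\<forall>v. tdiv t v = 0)"
proof -
  have "t \<in> integral_torus r \<longleftrightarrow> t \<in> ({..<r} \<rightarrow>\<^sub>E Units integral_adeles)"
    by (simp add: integral_torus_def torus_def units_of_carrier)
  also have "\<dots> \<longleftrightarrow> t \<in> carrier TA \<and> (\<forall>i<r. \<forall>v\<in>places. completion_val v (t i v) = 0)"
    by (auto simp: AT.T_carrier PiE_iff integral_units)
  also have "\<dots> \<longleftrightarrow> t \<in> carrier TA \<and> (\<forall>v. tdiv t v = 0)"
    by (auto simp: tdiv_def fun_eq_iff)
  finally show ?thesis .
qed

abbreviation TF :: "(nat \<Rightarrow> 'f) monoid" where "TF \<equiv> torus r field_ring"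
abbreviation rmap :: "(nat \<Rightarrow> 'f) \<Rightarrow> nat \<Rightarrow> 'f adele" where "rmap \<equiv> torus_map r diagonal"

lemma TF_nonzero: "x \<in> carrier TF \<Longrightarrow> i < r \<Longrightarrow> x i \<noteq> 0"
  by (auto simp: type_torus_carrier)

lemma rmap_closed: "x \<in> carrier TF \<Longrightarrow> rmap x \<in> carrier TA"
  using diagonal_unit TF_nonzero by (simp add: AT.T_carrier torus_map_def)

lemma tdiv_rmap: "x \<in> carrier TF \<Longrightarrow> tdiv (rmap x) v = (\<lambda>i. if i < r \<and> v \<in> places then v (x i) else 0)"
  by (rule ext) (auto simp: tdiv_def torus_map_def diagonal_val TF_nonzero)

lemma rmap_mult: "rmap (x \<otimes>\<^bsub>TF\<^esub> y) = rmap x \<otimes>\<^bsub>TA\<^esub> rmap y"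
  unfolding AT.T_mult torus_map_def
  by (rule restrict_ext) (simp add: torus_def units_of_mult diagonal_mult)

lemma place_powi:
  fixes x :: 'f
  assumes "v \<in> places" "x \<noteq> 0" shows "v (x powi n) = n * v x"
  using assms by (simp add: power_int_def place_power place_inverse power_inverse)

text \<open>The idele has the same valuations as the principal idele of the monomial in the
  \<open>x i\<close> with exponents \<open>\<eta> i\<close>, to which the product formula
  applies.\<close>

lemma idele_abs_rmap:
  assumes x: "x \<in> carrier TF"
  shows "idele_abs (torus_char r adele_ring \<eta> (rmap x)) = 1"
proof -
  define y where "y = (\<Prod>i<r. x i powi \<eta> i)"
  have y0: "y \<noteq> 0" using TF_nonzero[OF x] by (simp add: y_def)
  have val: "completion_val v (torus_char r adele_ring \<eta> (rmap x) v) = completion_val v (diagonal y v)" if v: "v \<in> places" for v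
  proof -
    have "v y = (\<Sum>i<r. v (x i powi \<eta> i))" unfolding y_def
      by (rule place_prod[OF v]) (use TF_nonzero[OF x] in simp)
    also have "\<dots> = (\<Sum>i<r. \<eta> i * v (x i))" using TF_nonzero[OF x] v by (intro sum.cong) (auto simp: place_powi)
    also have "\<dots> = lattice_pairing r \<eta> (tdiv (rmap x) v)" by (simp add: lattice_pairing_def tdiv_rmap[OF x] v)
    finally show ?thesis by (simp add: char_val[OF rmap_closed[OF x] v] diagonal_val[OF y0 v])
  qed
  have "idele_abs (torus_char r adele_ring \<eta> (rmap x)) = idele_abs (diagonal y)"
    unfolding idele_abs_def using val by (intro prod.cong) auto
  then show ?thesis using idele_abs_diagonal[OF y0] by simp
qed

lemma idele_abs_char_mult:
  "s \<in> carrier TA \<Longrightarrow> t \<in> carrier TA \<Longrightarrow>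
    idele_abs (torus_char r adele_ring \<eta> (s \<otimes>\<^bsub>TA\<^esub> t)) = idele_abs (torus_char r adele_ring \<eta> s) * idele_abs (torus_char r adele_ring \<eta> t)"
  by (simp add: AT.char_mult AT.char_closed idele_abs_mult)

lemma idele_abs_char_prod:
  assumes t: "t \<in> carrier TA" and S: "finite S" "S \<subseteq> places" "\<And>v. tdiv t v \<noteq> 0 \<Longrightarrow> v \<in> S"
  shows "idele_abs (torus_char r adele_ring \<eta> t) = (\<Prod>v\<in>S. real (residue_size v) powi (- lattice_pairing r \<eta> (tdiv t v)))"
proof -
  have "idele_abs (torus_char r adele_ring \<eta> t) = (\<Prod>v\<in>S. real (residue_size v) powi (- completion_val v (torus_char r adele_ring \<eta> t v)))"
  proof (rule idele_abs_superset[OF S(1,2)])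
    fix v assume v: "v \<in> places" "completion_val v (torus_char r adele_ring \<eta> t v) \<noteq> 0"
    then have "lattice_pairing r \<eta> (tdiv t v) \<noteq> 0" using char_val[OF t] by simp
    then have "tdiv t v \<noteq> 0" by (auto simp: lattice_pairing_def)
    then show "v \<in> S" by (rule S(3))
  qed
  also have "\<dots> = (\<Prod>v\<in>S. real (residue_size v) powi (- lattice_pairing r \<eta> (tdiv t v)))"
    by (rule prod.cong) (use char_val[OF t] S(2) in auto)
  finally show ?thesis .
qed

text \<open>Coordinates without zeros and poles are constants, so these points lie in the finite set
  k^r.\<close>

lemma finite_rational_integral: "finite {x \<in> carrier TF. rmap x \<in> integral_torus r}"
  and rational_integral_one: "\<one>\<^bsub>TF\<^esub> \<in> {x \<in> carrier TF. rmap x \<in> integral_torus r}"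
proof -
  have "{x \<in> carrier TF. rmap x \<in> integral_torus r} \<subseteq> {..<r} \<rightarrow>\<^sub>E k"
  proof
    fix x assume "x \<in> {x \<in> carrier TF. rmap x \<in> integral_torus r}"
    then have x: "x \<in> carrier TF" "\<And>v. tdiv (rmap x) v = 0" by (auto simp: integral_torus_iff)
    have "x i \<in> k" if i: "i < r" for i
    proof (rule integral_const)
      fix v :: "'f \<Rightarrow> int" assume v: "v \<in> places"
      have "v (x i) = 0" using fun_cong[OF x(2)[of v, unfolded tdiv_rmap[OF x(1)]], of i] i v by simp
      then show "val_ge v 0 (x i)" by (simp add: val_ge_def)
    qed
    then show "x \<in> {..<r} \<rightarrow>\<^sub>E k" using x(1) by (auto simp: type_torus_carrier)
  qed
  then show "finite {x \<in> carrier TF. rmap x \<in> integral_torus r}"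
    using finite_subset finite_PiE[of "{..<r}" "\<lambda>_. k"] finite_k by blast
  have one: "\<one>\<^bsub>TF\<^esub> = (\<lambda>i\<in>{..<r}. 1)" by (simp add: torus_def units_of_one)
  have c: "\<one>\<^bsub>TF\<^esub> \<in> carrier TF" by (simp add: one type_torus_carrier)
  have "tdiv (rmap \<one>\<^bsub>TF\<^esub>) v = 0" for v
    unfolding tdiv_rmap[OF c] by (rule ext) (simp add: one place_1)
  then show "\<one>\<^bsub>TF\<^esub> \<in> {x \<in> carrier TF. rmap x \<in> integral_torus r}"
    using c rmap_closed[OF c] by (simp add: integral_torus_iff)
qed

section \<open>Points with a prescribed divisor and unramified characters\<close>

definition divisor_rep :: "'f adele \<Rightarrow> (('f \<Rightarrow> int) \<Rightarrow> nat \<Rightarrow> int) \<Rightarrow> ('f \<Rightarrow> int) set \<Rightarrow> nat \<Rightarrow> 'f adele" where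
  "divisor_rep \<pi> D S = finprod TA (\<lambda>v. torus_cochar r adele_ring (D v) (local_uniformizer \<pi> v)) S"

context
  fixes \<pi> :: "'f adele" assumes unif: "uniformizers \<pi>"
begin

lemma local_cochar_closed: "v \<in> places \<Longrightarrow> torus_cochar r adele_ring l (local_uniformizer \<pi> v) \<in> carrier TA"
  by (rule AT.cochar_closed[OF local_uniformizer_unit(1)[OF unif]])

lemma divisor_rep_terms:
  "S \<subseteq> places \<Longrightarrow> (\<lambda>v. torus_cochar r adele_ring (D v) (local_uniformizer \<pi> v)) \<in> S \<rightarrow> carrier TA"
  using local_cochar_closed by blast

lemma divisor_rep_closed: "S \<subseteq> places \<Longrightarrow> divisor_rep \<pi> D S \<in> carrier TA"
  unfolding divisor_rep_def using AT.T.finprod_closed[OF divisor_rep_terms] .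

lemma tdiv_divisor_rep:
  assumes S: "finite S" "S \<subseteq> places" and D: "\<And>v. v \<in> S \<Longrightarrow> D v \<in> lattice_vecs r"
  shows "tdiv (divisor_rep \<pi> D S) v = (if v \<in> S then D v else 0)"
proof
  fix i
  let ?F = "\<lambda>t. tdiv t v i"
  have F: "?F (s \<otimes>\<^bsub>TA\<^esub> t) = ?F s + ?F t" if "s \<in> carrier TA" "t \<in> carrier TA" for s t
    using tdiv_mult[OF that] by simp
  have "?F (divisor_rep \<pi> D S) = (\<Sum>w\<in>S. ?F (torus_cochar r adele_ring (D w) (local_uniformizer \<pi> w)))"
    unfolding divisor_rep_def by (rule AT.T.additive_int_pow(4)[of ?F, OF F divisor_rep_terms[OF S(2)]])
  also have "\<dots> = (\<Sum>w\<in>S. if w = v then (if i < r then D w i else 0) else 0)"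
  proof (rule sum.cong[OF refl])
    fix w assume w: "w \<in> S"
    then have wp: "w \<in> places" using S by blast
    show "?F (torus_cochar r adele_ring (D w) (local_uniformizer \<pi> w)) = (if w = v then (if i < r then D w i else 0) else 0)"
      unfolding tdiv_cochar[OF local_uniformizer_unit(1)[OF unif wp]]
      using local_uniformizer_unit(2)[OF unif wp, of v] wp by auto
  qed
  also have "\<dots> = (if v \<in> S then D v else 0) i"
    using S(1) D[of v] by (auto simp: lattice_vecs_def)
  finally show "tdiv (divisor_rep \<pi> D S) v i = (if v \<in> S then D v else 0) i" .
qed

context
  fixes \<psi> :: "(nat \<Rightarrow> 'f adele) \<Rightarrow> complex" assumes psi: "unramified_character r \<psi>"
begin

lemma psi_mult: "s \<in> carrier TA \<Longrightarrow> t \<in> carrier TA \<Longrightarrow> \<psi> (s \<otimes>\<^bsub>TA\<^esub> t) = \<psi> s * \<psi> t"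
  using psi by (auto simp: unramified_character_def hom_def units_of_mult)

lemma psi_nonzero: "t \<in> carrier TA \<Longrightarrow> \<psi> t \<noteq> 0"
  using psi by (auto simp: unramified_character_def hom_def units_of_carrier type_ring_Units)

lemma psi_one: "\<psi> \<one>\<^bsub>TA\<^esub> = 1"
  using psi_mult[of "\<one>\<^bsub>TA\<^esub>" "\<one>\<^bsub>TA\<^esub>"] psi_nonzero[of "\<one>\<^bsub>TA\<^esub>"] by simp

lemma psi_rmap: "x \<in> carrier TF \<Longrightarrow> \<psi> (rmap x) = 1"
  using psi by (auto simp: unramified_character_def rational_torus_def)

text \<open>The kernel of the divisor map is T(O), on which an unramified character is trivial, so
  the character factors through divisors.\<close>

lemma psi_tdiv:
  assumes "s \<in> carrier TA" "t \<in> carrier TA" "\<And>v. tdiv s v = tdiv t v"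
  shows "\<psi> s = \<psi> t"
proof -
  let ?u = "s \<otimes>\<^bsub>TA\<^esub> inv\<^bsub>TA\<^esub> t"
  have u: "?u \<in> carrier TA" using assms by simp
  have "tdiv ?u v = 0" for v using assms by (simp add: tdiv_mult tdiv_inv)
  then have "?u \<in> integral_torus r" using u by (simp add: integral_torus_iff)
  then have "\<psi> ?u = 1" using psi by (auto simp: unramified_character_def)
  moreover have "s = ?u \<otimes>\<^bsub>TA\<^esub> t" using assms(1,2) by (simp add: AT.T.m_assoc)
  ultimately show ?thesis using psi_mult[OF u assms(2)] by simp
qed

lemma psi_divisor_rep:
  assumes S: "finite S" "S \<subseteq> places"
  shows "\<psi> (divisor_rep \<pi> D S) = (\<Prod>v\<in>S. \<psi> (torus_cochar r adele_ring (D v) (local_uniformizer \<pi> v)))"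
  unfolding divisor_rep_def using S
proof (induction S)
  case (insert v S)
  then have "torus_cochar r adele_ring (D v) (local_uniformizer \<pi> v) \<in> carrier TA"
    "finprod TA (\<lambda>v. torus_cochar r adele_ring (D v) (local_uniformizer \<pi> v)) S \<in> carrier TA"
    using local_cochar_closed AT.T.finprod_closed[OF divisor_rep_terms[of S D]] by auto
  then show ?case using insert divisor_rep_terms[of S D] by (simp add: psi_mult)
qed (simp add: psi_one)

lemma psi_prod:
  assumes t: "t \<in> carrier TA" and S: "finite S" "S \<subseteq> places" "\<And>v. tdiv t v \<noteq> 0 \<Longrightarrow> v \<in> S"
  shows "\<psi> t = (\<Prod>v\<in>S. \<psi> (torus_cochar r adele_ring (tdiv t v) (local_uniformizer \<pi> v)))"
proof -
  have "tdiv t v = tdiv (divisor_rep \<pi> (tdiv t) S) v" for v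
    using tdiv_divisor_rep[OF S(1,2), of "tdiv t" v] tdiv_lattice S(3)[of v] by auto
  then have "\<psi> t = \<psi> (divisor_rep \<pi> (tdiv t) S)" by (intro psi_tdiv t divisor_rep_closed S(2))
  then show ?thesis using psi_divisor_rep[OF S(1,2)] by simp
qed

end

text \<open>By \<open>psi_prod\<close> every value is a product of values at local uniformizers. The
  definite description in \<open>spectral_period\<close> rests on this.\<close>

lemma psi_unique:
  assumes "unramified_character r \<psi>" "unramified_character r \<psi>'"
    and eq: "\<And>v l. v \<in> places \<Longrightarrow> l \<in> lattice_vecs r \<Longrightarrow>
      \<psi>' (torus_cochar r adele_ring l (local_uniformizer \<pi> v)) = \<psi> (torus_cochar r adele_ring l (local_uniformizer \<pi> v))"
  shows "\<psi>' = \<psi>"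
proof
  fix t
  show "\<psi>' t = \<psi> t"
  proof (cases "t \<in> carrier TA")
    case False
    then show ?thesis using assms(1,2) by (auto simp: unramified_character_def extensional_def)
  next
    case True
    let ?S = "{v. tdiv t v \<noteq> 0}"
    have S: "finite ?S" "?S \<subseteq> places" using tdiv_finite[OF True] tdiv_outside by auto
    have "\<psi>' t = (\<Prod>v\<in>?S. \<psi>' (torus_cochar r adele_ring (tdiv t v) (local_uniformizer \<pi> v)))"
      by (rule psi_prod[OF assms(2) True S]) simp
    also have "\<dots> = (\<Prod>v\<in>?S. \<psi> (torus_cochar r adele_ring (tdiv t v) (local_uniformizer \<pi> v)))"
      by (rule prod.cong[OF refl]) (use S(2) eq tdiv_lattice in blast)
    also have "\<dots> = \<psi> t"
      by (rule psi_prod[OF assms(1) True S, symmetric]) simp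
    finally show ?thesis .
  qed
qed

end

section \<open>Integrality of points in the open orbit\<close>

lemma adele_uminus_comp: "a \<in> carrier Ad \<Longrightarrow> v \<in> places \<Longrightarrow> (\<ominus>\<^bsub>Ad\<^esub> a) v = \<ominus>\<^bsub>completion v\<^esub> a v"
proof -
  assume a: "a \<in> carrier Ad" and v: "v \<in> places"
  interpret place v by (rule place_locale[OF v])
  have b: "\<ominus>\<^bsub>Ad\<^esub> a \<in> carrier Ad" using a by simp
  have "(\<ominus>\<^bsub>Ad\<^esub> a \<oplus>\<^bsub>Ad\<^esub> a) v = \<zero>\<^bsub>completion v\<^esub>"
    using a v by (simp add: adele.l_neg adele_simps(4))
  then have "(\<ominus>\<^bsub>Ad\<^esub> a) v \<oplus>\<^bsub>completion v\<^esub> a v = \<zero>\<^bsub>completion v\<^esub>" using v by (simp add: adele_simps(2))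
  then have "\<ominus>\<^bsub>completion v\<^esub> (a v) = (\<ominus>\<^bsub>Ad\<^esub> a) v"
    by (rule completion.minus_equality) (use adele_comp a b v in auto)
  then show ?thesis by simp
qed

lemma add_pow_integral:
  assumes a: "a \<in> carrier Ad" "v \<in> places" "a v \<in> completion_integers v"
  shows "add_pow Ad (n::int) a v \<in> completion_integers v"
proof -
  interpret place v by (rule place_locale[OF a(2)])
  have nat: "add_pow Ad (n::nat) a \<in> carrier Ad \<and> add_pow Ad n a v \<in> completion_integers v" for n
  proof (induction n)
    case 0
    show ?case using a(2) integers_zero adele.zero_closed by (simp add: add_pow_def nat_pow_def adele_simps(4)[symmetric]) (simp add: adele_simps(4))
  next
    case (Suc n)
    have "add_pow Ad (Suc n) a = add_pow Ad n a \<oplus>\<^bsub>Ad\<^esub> a" by (simp add: add_pow_def nat_pow_def)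
    then show ?case using Suc a integers_mult(2) by (simp add: adele_simps(2)[of "add_pow Ad n a" a, symmetric]) (simp add: adele_simps(2))
  qed
  show ?thesis
  proof (cases "0 \<le> n")
    case True
    then show ?thesis unfolding add_pow_int_ge[OF True] using nat by blast
  next
    case False
    then have n: "n < 0" by simp
    show ?thesis unfolding add_pow_int_lt[OF n] using nat adele_uminus_comp a(2) integers_uminus by simp
  qed
qed

lemma toric_orbit_point:
  assumes M: "0 \<in> M" "\<And>m m'. m \<in> M \<Longrightarrow> m' \<in> M \<Longrightarrow> m + m' \<in> M"
    and s: "s \<in> carrier TA" and t: "t \<in> carrier TA"
  shows "toric_act r M Ad (toric_act r M Ad (toric_base M Ad) t) s
    = (\<lambda>p\<in>carrier (int_monoid_algebra M). monomial_eval Ad (\<lambda>m. torus_char r Ad m (t \<otimes>\<^bsub>TA\<^esub> s)) p)"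
proof -
  have c: "torus_char r Ad m u \<in> carrier Ad" if "u \<in> carrier TA" for m u
    using AT.char_closed[OF that] by (rule adele.Units_closed)
  have single: "Poly_Mapping.single m 1 \<in> carrier (int_monoid_algebra M)" if "m \<in> M" for m using that by simp
  have base: "toric_base M Ad (Poly_Mapping.single m 1) = \<one>\<^bsub>Ad\<^esub>" if "m \<in> M" for m
    using single[OF that] by (simp add: toric_base_def adele.add_pow_int_1)
  have y: "toric_act r M Ad (toric_base M Ad) t (Poly_Mapping.single m 1) = torus_char r Ad m t" if "m \<in> M" for m
    using single[OF that] base[OF that] c[OF t] by (simp add: toric_act_def adele.add_pow_int_1)
  have "finsum Ad (\<lambda>m. add_pow Ad (Poly_Mapping.lookup p m) (toric_act r M Ad (toric_base M Ad) t (Poly_Mapping.single m 1) \<otimes>\<^bsub>Ad\<^esub> torus_char r Ad m s)) (Poly_Mapping.keys p)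
    = monomial_eval Ad (\<lambda>m. torus_char r Ad m (t \<otimes>\<^bsub>TA\<^esub> s)) p" if "Poly_Mapping.keys p \<subseteq> M" for p
    unfolding monomial_eval_def
  proof (rule adele.finsum_cong'[OF refl])
    show "(\<lambda>m. add_pow Ad (Poly_Mapping.lookup p m) (torus_char r Ad m (t \<otimes>\<^bsub>TA\<^esub> s))) \<in> Poly_Mapping.keys p \<rightarrow> carrier Ad"
      using c s t by (intro Pi_I adele.add_pow_int_closed) simp
    fix m assume "m \<in> Poly_Mapping.keys p"
    then have "m \<in> M" using that by blast
    then show "add_pow Ad (Poly_Mapping.lookup p m) (toric_act r M Ad (toric_base M Ad) t (Poly_Mapping.single m 1) \<otimes>\<^bsub>Ad\<^esub> torus_char r Ad m s)
      = add_pow Ad (Poly_Mapping.lookup p m) (torus_char r Ad m (t \<otimes>\<^bsub>TA\<^esub> s))"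
      by (simp only: y AT.char_mult[OF t s])
  qed
  then show ?thesis
    unfolding toric_act_def[of r M Ad "toric_act r M Ad (toric_base M Ad) t" s] by (intro restrict_ext) simp
qed

text \<open>Integrality of a point of Spec Z[M] can be tested on monomials. On the open orbit the
  monomial of exponent \<open>m\<close> takes a unit of the completion as value, and a unit is
  integral exactly when its valuation, here the pairing of \<open>m\<close> with the divisor, is
  nonnegative.\<close>

lemma basic_function_orbit:
  assumes M: "0 \<in> M" "\<And>m m'. m \<in> M \<Longrightarrow> m' \<in> M \<Longrightarrow> m + m' \<in> M"
    and s: "s \<in> carrier TA" and t: "t \<in> carrier TA"
  shows "basic_function M (toric_act r M Ad (toric_act r M Ad (toric_base M Ad) t) s)
    = (if \<forall>v\<in>places. \<forall>m\<in>M. 0 \<le> lattice_pairing r m (tdiv (t \<otimes>\<^bsub>TA\<^esub> s) v) then 1 else 0)"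
proof -
  let ?u = "t \<otimes>\<^bsub>TA\<^esub> s"
  have u: "?u \<in> carrier TA" using s t by simp
  define \<xi> where "\<xi> m = torus_char r Ad m ?u" for m
  let ?O = "\<lambda>v. completion v\<lparr>carrier := completion_integers v\<rparr>"
  have xc: "\<xi> m \<in> carrier Ad" for m
    unfolding \<xi>_def using AT.char_closed[OF u] by (rule adele.Units_closed)
  interpret ch: monoid_character "adele_ring :: 'f adele ring" M \<xi>
    by unfold_locales (use M xc in \<open>simp_all add: \<xi>_def AT.char_0[OF u] AT.char_add[OF u]\<close>)
  have xint: "\<xi> m v \<in> completion_integers v \<longleftrightarrow> 0 \<le> lattice_pairing r m (tdiv ?u v)" if v: "v \<in> places" for m v
    unfolding \<xi>_def using place.unit_integer_iff[OF place_locale[OF v] adele_unit_comp[OF AT.char_closed[OF u] v]]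
    by (simp add: char_val[OF u v])
  have key: "(\<lambda>p\<in>carrier (int_monoid_algebra M). (\<lambda>p\<in>carrier (int_monoid_algebra M). monomial_eval Ad \<xi> p) p v) \<in> toric_points M (?O v)
      \<longleftrightarrow> (\<forall>m\<in>M. 0 \<le> lattice_pairing r m (tdiv ?u v))" (is "?h \<in> _ \<longleftrightarrow> ?R") if v: "v \<in> places" for v
  proof
    assume h: "?h \<in> toric_points M (?O v)"
    show ?R
    proof
      fix m assume m: "m \<in> M"
      have "?h (Poly_Mapping.single m 1) \<in> completion_integers v"
        using ring_hom_closed[of ?h "int_monoid_algebra M" "?O v" "Poly_Mapping.single m 1"] h m by (simp add: toric_points_def)
      then have "\<xi> m v \<in> completion_integers v" using m by (simp add: ch.ev_single adele.add_pow_int_1 xc)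
      then show "0 \<le> lattice_pairing r m (tdiv ?u v)" using xint[OF v] by simp
    qed
  next
    assume R: ?R
    interpret place v by (rule place_locale[OF v])
    have int: "monomial_eval Ad \<xi> p v \<in> completion_integers v" if "Poly_Mapping.keys p \<subseteq> M" for p
      using that
    proof (induction p rule: poly_mapping_keys_induct)
      case zero
      then show ?case using v integers_zero by (simp add: ch.ev_0 adele_simps(4))
    next
      case (add p m a)
      have "monomial_eval Ad \<xi> (p + Poly_Mapping.single m a) = monomial_eval Ad \<xi> p \<oplus>\<^bsub>Ad\<^esub> add_pow Ad a (\<xi> m)"
        using ch.ev_add[OF add(1) ch.single_keys[OF add(2)]] ch.ev_single[OF add(2)] by simp
      moreover have "add_pow Ad a (\<xi> m) v \<in> completion_integers v"
        by (rule add_pow_integral[OF xc v]) (use xint[OF v] R add(2) in simp)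
      ultimately show ?case using add.IH integers_mult(2) v by (simp add: adele_simps(2))
    qed
    have "?h \<in> ring_hom (int_monoid_algebra M) (?O v)"
    proof (rule ring_hom_memI)
      fix p p' assume p: "p \<in> carrier (int_monoid_algebra M)" "p' \<in> carrier (int_monoid_algebra M)"
      then have k: "Poly_Mapping.keys p \<subseteq> M" "Poly_Mapping.keys p' \<subseteq> M" by simp_all
      have k': "Poly_Mapping.keys (p * p') \<subseteq> M" "Poly_Mapping.keys (p + p') \<subseteq> M"
        using ch.mult_keys[OF k] keys_add[of p p'] k by blast+
      show "?h (p \<otimes>\<^bsub>int_monoid_algebra M\<^esub> p') = ?h p \<otimes>\<^bsub>?O v\<^esub> ?h p'"
        using k k' v by (simp add: ch.ev_mult adele_simps(1))
      show "?h (p \<oplus>\<^bsub>int_monoid_algebra M\<^esub> p') = ?h p \<oplus>\<^bsub>?O v\<^esub> ?h p'"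
        using k k' v by (simp add: ch.ev_add adele_simps(2))
    next
      fix p assume "p \<in> carrier (int_monoid_algebra M)"
      then show "?h p \<in> carrier (?O v)" using int by simp
    next
      show "?h \<one>\<^bsub>int_monoid_algebra M\<^esub> = \<one>\<^bsub>?O v\<^esub>" using M(1) v by (simp add: ch.ev_1 adele_simps(3))
    qed
    then show "?h \<in> toric_points M (?O v)" by (simp add: toric_points_def)
  qed
  have eq: "toric_act r M Ad (toric_act r M Ad (toric_base M Ad) t) s
      = (\<lambda>p\<in>carrier (int_monoid_algebra M). monomial_eval Ad \<xi> p)"
    unfolding \<xi>_def by (rule toric_orbit_point[OF M s t])
  have "(\<forall>v\<in>places. (\<lambda>p\<in>carrier (int_monoid_algebra M). (\<lambda>p\<in>carrier (int_monoid_algebra M). monomial_eval Ad \<xi> p) p v) \<in> toric_points M (?O v))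
      \<longleftrightarrow> (\<forall>v\<in>places. \<forall>m\<in>M. 0 \<le> lattice_pairing r m (tdiv ?u v))"
    by (rule ball_cong[OF refl key])
  then show ?thesis unfolding eq basic_function_def by (simp only:)
qed

end

section \<open>The graded trace at the torus-fixed point\<close>

text \<open>A diagonal operator on functions on \<open>S\<close>, but written in an arbitrary basis
  \<open>B\<close>, since \<open>trace_on\<close> works with a basis picked by \<open>SOME\<close>.
  The coordinates \<open>Q\<close> of the delta functions are inverse to \<open>F\<close>, and the
  basis drops out of the trace.\<close>

lemma trace_eq_sum_eigenvalues:
  fixes F :: "'b \<Rightarrow> 'm \<Rightarrow> complex"
  assumes S: "finite S" and B: "finite B"
    and basis: "\<And>u. \<exists>!c. c \<in> extensional B \<and> (\<forall>m\<in>S. u m = (\<Sum>b\<in>B. c b * F b m))"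
  shows "(\<Sum>b\<in>B. (THE c. c \<in> extensional B \<and> (\<forall>m\<in>S. \<xi> m * F b m = (\<Sum>b'\<in>B. c b' * F b' m))) b) = sum \<xi> S"
proof -
  define co where "co u = (THE c. c \<in> extensional B \<and> (\<forall>m\<in>S. u m = (\<Sum>b\<in>B. c b * F b m)))" for u
  have co: "co u \<in> extensional B \<and> (\<forall>m\<in>S. u m = (\<Sum>b\<in>B. co u b * F b m))" for u
    unfolding co_def by (rule theI'[OF basis[of u]])
  have co_unique: "co u = c" if "c \<in> extensional B" "\<And>m. m \<in> S \<Longrightarrow> u m = (\<Sum>b\<in>B. c b * F b m)" for u c
    unfolding co_def by (rule the1_equality[OF basis[of u]]) (intro conjI ballI that)
  define Q where "Q m = co (\<lambda>l. if l = m then 1 else 0)" for m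
  have Q: "(\<Sum>b\<in>B. Q m b * F b l) = (if l = m then 1 else 0)" if "l \<in> S" for l m
    using co[of "\<lambda>l. if l = m then 1 else 0"] that by (simp add: Q_def)
  have lin: "co u = (\<lambda>b\<in>B. \<Sum>m\<in>S. u m * Q m b)" for u
  proof (rule co_unique)
    fix l assume l: "l \<in> S"
    have "(\<Sum>b\<in>B. (\<lambda>b\<in>B. \<Sum>m\<in>S. u m * Q m b) b * F b l) = (\<Sum>b\<in>B. \<Sum>m\<in>S. u m * (Q m b * F b l))"
      by (intro sum.cong refl) (simp add: sum_distrib_right mult.assoc)
    also have "\<dots> = (\<Sum>m\<in>S. u m * (\<Sum>b\<in>B. Q m b * F b l))"
      by (subst sum.swap) (simp add: sum_distrib_left)
    also have "\<dots> = (\<Sum>m\<in>S. if l = m then u m else 0)" using Q[OF l] by (intro sum.cong refl) simp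
    also have "\<dots> = u l" using S l by simp
    finally show "u l = (\<Sum>b\<in>B. (\<lambda>b\<in>B. \<Sum>m\<in>S. u m * Q m b) b * F b l)" by simp
  qed simp
  have dual: "(\<Sum>b\<in>B. F b m * Q m b) = 1" if "m \<in> S" for m using Q[OF that, of m] by (simp add: mult.commute)
  have "(\<Sum>b\<in>B. co (\<lambda>m. \<xi> m * F b m) b) = (\<Sum>b\<in>B. \<Sum>m\<in>S. \<xi> m * (F b m * Q m b))"
    unfolding lin by (intro sum.cong refl) (simp add: mult.assoc)
  also have "\<dots> = (\<Sum>m\<in>S. \<xi> m * (\<Sum>b\<in>B. F b m * Q m b))"
    by (subst sum.swap) (simp add: sum_distrib_left)
  also have "\<dots> = sum \<xi> S" using dual by simp
  finally show ?thesis by (simp add: co_def)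
qed

locale graded_monoid =
  fixes r :: nat and N :: "(nat \<Rightarrow> int) set" and \<eta> :: "nat \<Rightarrow> int"
  assumes N0: "0 \<in> N" and N_add: "\<And>m n. m \<in> N \<Longrightarrow> n \<in> N \<Longrightarrow> m + n \<in> N"
    and deg_nonneg: "\<And>n. n \<in> N \<Longrightarrow> 0 \<le> lattice_pairing r \<eta> n"
    and deg_zero: "\<And>n. n \<in> N \<Longrightarrow> lattice_pairing r \<eta> n = 0 \<Longrightarrow> n = 0"
    and deg_finite: "\<And>d. finite {n \<in> N. lattice_pairing r \<eta> n = d}"
begin

abbreviation deg :: "(nat \<Rightarrow> int) \<Rightarrow> int" where "deg n \<equiv> lattice_pairing r \<eta> n"

lemma deg_add: "deg (m + n) = deg m + deg n"
  by (simp add: lattice_pairing_def sum.distrib algebra_simps)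

lemma deg_pos: "n \<in> N \<Longrightarrow> n \<noteq> 0 \<Longrightarrow> 0 < deg n"
  using deg_nonneg deg_zero by (metis order_le_less)

lemma add_eq_0: "m \<in> N \<Longrightarrow> n \<in> N \<Longrightarrow> m + n = 0 \<longleftrightarrow> m = 0 \<and> n = 0"
proof -
  assume mn: "m \<in> N" "n \<in> N"
  have "m = 0 \<and> n = 0" if "m + n = 0"
  proof -
    have "deg m + deg n = 0" using deg_add[of m n] that by (simp add: lattice_pairing_def)
    then have "deg m = 0" "deg n = 0" using deg_nonneg[OF mn(1)] deg_nonneg[OF mn(2)] by linarith+
    then show ?thesis using deg_zero mn by simp
  qed
  then show ?thesis by auto
qed

lemma type_toric_act:
  fixes x :: "((nat \<Rightarrow> int) \<Rightarrow>\<^sub>0 int) \<Rightarrow> complex"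
  assumes "Poly_Mapping.keys p \<subseteq> N"
  shows "toric_act r N complex_ring x t p
    = (\<Sum>m\<in>Poly_Mapping.keys p. of_int (Poly_Mapping.lookup p m) * (x (Poly_Mapping.single m 1) * torus_char r complex_ring m t))"
  using assms by (simp add: toric_act_def type_finsum type_add_pow)

text \<open>A fixed point is in particular fixed under the cocharacter \<open>\<eta>\<close>, and
  nontrivial monomials have positive degree, so it must send them to 0. The resulting map is
  multiplicative because in \<open>N\<close> a sum vanishes only if both summands do.\<close>

lemma torus_fixed_point_eq:
  "torus_fixed_point r N = (\<lambda>p\<in>carrier (int_monoid_algebra N). of_int (Poly_Mapping.lookup p 0))" (is "_ = ?x")
proof -
  define \<xi> :: "(nat \<Rightarrow> int) \<Rightarrow> complex" where "\<xi> m = (if m = 0 then 1 else 0)" for m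
  interpret C: cring "complex_ring" by (rule cring_from_type_algebra)
  interpret ch: monoid_character complex_ring N \<xi>
  proof unfold_locales
    fix m m' assume "m \<in> N" "m' \<in> N"
    then have "m + m' = 0 \<longleftrightarrow> m = 0 \<and> m' = 0" by (rule add_eq_0)
    then show "\<xi> (m + m') = \<xi> m \<otimes>\<^bsub>complex_ring\<^esub> \<xi> m'" unfolding \<xi>_def by (cases "m = 0"; cases "m' = 0") (simp_all only: type_ring_simps simp_thms if_True if_False mult_1_left mult_zero_left mult_zero_right)
  qed (simp_all add: \<xi>_def N0 N_add)
  have sumk: "(\<Sum>m\<in>Poly_Mapping.keys p. of_int (Poly_Mapping.lookup p m) * g m) = of_int (Poly_Mapping.lookup p 0)"
    if "g 0 = 1" "\<And>m. m \<in> Poly_Mapping.keys p \<Longrightarrow> m \<noteq> 0 \<Longrightarrow> g m = 0" for g and p :: "(nat \<Rightarrow> int) \<Rightarrow>\<^sub>0 int"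
  proof -
    have "(\<Sum>m\<in>Poly_Mapping.keys p. of_int (Poly_Mapping.lookup p m) * g m)
      = (\<Sum>m\<in>Poly_Mapping.keys p. if 0 = m then of_int (Poly_Mapping.lookup p m) else 0)"
      using that by (intro sum.cong refl) auto
    also have "\<dots> = of_int (Poly_Mapping.lookup p 0)" by (simp add: in_keys_iff)
    finally show ?thesis .
  qed
  have ev: "ch.ev p = of_int (Poly_Mapping.lookup p 0)" for p
    unfolding monomial_eval_def type_finsum type_add_pow by (rule sumk) (auto simp: \<xi>_def)
  have pt: "?x \<in> toric_points N complex_ring"
    using ch.ev_hom unfolding toric_points_def ev by auto
  have char0: "torus_char r complex_ring 0 t = 1" if "t \<in> carrier (torus r complex_ring)" for t
    using that by (subst type_torus_char) (auto simp: type_torus_carrier PiE_iff)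
  have fixed: "toric_act r N complex_ring ?x t = ?x" if t: "t \<in> carrier (torus r complex_ring)" for t
  proof (rule ext)
    fix p
    show "toric_act r N complex_ring ?x t p = ?x p"
    proof (cases "Poly_Mapping.keys p \<subseteq> N")
      case True
      have "toric_act r N complex_ring ?x t p = of_int (Poly_Mapping.lookup p 0)"
        unfolding type_toric_act[OF True]
        by (rule sumk) (use True N0 in \<open>auto simp: char0[OF t] lookup_single when_def\<close>)
      then show ?thesis using True by simp
    qed (simp add: toric_act_def)
  qed
  show ?thesis unfolding torus_fixed_point_def
  proof (rule the_equality)
    show "?x \<in> toric_points N complex_ring \<and> (\<forall>t\<in>carrier (torus r complex_ring). toric_act r N complex_ring ?x t = ?x)"
      using pt fixed by blast
    fix x :: "((nat \<Rightarrow> int) \<Rightarrow>\<^sub>0 int) \<Rightarrow> complex"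
    assume x: "x \<in> toric_points N complex_ring \<and> (\<forall>t\<in>carrier (torus r complex_ring). toric_act r N complex_ring x t = x)"
    have t: "torus_cochar r complex_ring \<eta> z \<in> carrier (torus r complex_ring)" if "z \<noteq> 0" for z
      using type_torus_cochar_closed[OF that] .
    have act: "x p = (\<Sum>m\<in>Poly_Mapping.keys p. of_int (Poly_Mapping.lookup p m) * (x (Poly_Mapping.single m 1) * z powi deg m))"
      if "Poly_Mapping.keys p \<subseteq> N" "z \<noteq> 0" for p z
    proof -
      have "x p = toric_act r N complex_ring x (torus_cochar r complex_ring \<eta> z) p"
        using x t[OF that(2)] by simp
      then show ?thesis unfolding type_toric_act[OF that(1)] type_char_cochar[OF that(2)] .
    qed
    have x1: "x (Poly_Mapping.single 0 1) = 1"
      using x ring_hom_one[of x "int_monoid_algebra N" complex_ring] by (simp add: toric_points_def)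
    have x0: "x (Poly_Mapping.single m 1) = 0" if m: "m \<in> N" "m \<noteq> 0" for m
    proof -
      \<comment> \<open>A single scalar of infinite order, here 2, is enough to detect a nonzero
        weight.\<close>
      have "x (Poly_Mapping.single m 1) = x (Poly_Mapping.single m 1) * 2 powi deg m"
        using act[of "Poly_Mapping.single m 1" 2] m by simp
      moreover have "(2::complex) powi deg m \<noteq> 1"
      proof -
        have "1 < (2::real) powi deg m" using deg_pos[OF m] by (intro one_less_power_int) auto
        then have "norm ((2::complex) powi deg m) > 1" by (simp add: norm_power_int)
        then show ?thesis by auto
      qed
      ultimately show ?thesis by simp
    qed
    show "x = ?x"
    proof
      fix p
      show "x p = ?x p"
      proof (cases "Poly_Mapping.keys p \<subseteq> N")
        case True
        have "x p = (\<Sum>m\<in>Poly_Mapping.keys p. of_int (Poly_Mapping.lookup p m) * x (Poly_Mapping.single m 1))"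
          using act[OF True, of 1] by simp
        also have "\<dots> = of_int (Poly_Mapping.lookup p 0)"
          by (rule sumk) (use True x0 x1 in auto)
        finally show ?thesis using True by simp
      next
        case False
        then show ?thesis using x by (simp add: toric_points_def extensional_def)
      qed
    qed
  qed
qed

section \<open>Powers of the maximal ideal and the completion\<close>

abbreviation Alg :: "((nat \<Rightarrow> int) \<Rightarrow>\<^sub>0 complex) ring" where "Alg \<equiv> cpx_monoid_algebra N"
abbreviation mxi :: "((nat \<Rightarrow> int) \<Rightarrow>\<^sub>0 complex) set" where "mxi \<equiv> maximal_ideal_at N (torus_fixed_point r N)"
abbreviation Kr :: "(complex, nat \<Rightarrow> ((nat \<Rightarrow> int) \<Rightarrow>\<^sub>0 complex) set) module" where "Kr \<equiv> completed_local_ring r N"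

lemma maximal_ideal_eq: "mxi = {f. Poly_Mapping.keys f \<subseteq> N \<and> Poly_Mapping.lookup f 0 = 0}"
proof -
  have "(\<Sum>m\<in>Poly_Mapping.keys f. Poly_Mapping.lookup f m * torus_fixed_point r N (Poly_Mapping.single m 1)) = Poly_Mapping.lookup f 0"
    if "Poly_Mapping.keys f \<subseteq> N" for f
  proof -
    have "(\<Sum>m\<in>Poly_Mapping.keys f. Poly_Mapping.lookup f m * torus_fixed_point r N (Poly_Mapping.single m 1))
      = (\<Sum>m\<in>Poly_Mapping.keys f. if 0 = m then Poly_Mapping.lookup f m else 0)"
      using that by (intro sum.cong refl) (auto simp: torus_fixed_point_eq lookup_single when_def)
    also have "\<dots> = Poly_Mapping.lookup f 0" by (simp add: in_keys_iff)
    finally show ?thesis .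
  qed
  then show ?thesis by (auto simp: maximal_ideal_at_def)
qed

text \<open>The exponents of the monomials lying in the \<open>j\<close>-th power of the maximal ideal.\<close>

primrec Npow :: "nat \<Rightarrow> (nat \<Rightarrow> int) set" where
  "Npow 0 = N"
| "Npow (Suc j) = {a + b | a b. a \<in> Npow j \<and> b \<in> N \<and> b \<noteq> 0}"

lemma Npow_sub: "Npow j \<subseteq> N"
  by (induction j) (auto intro: N_add)

lemma Npow_add: "a \<in> Npow j \<Longrightarrow> n \<in> N \<Longrightarrow> a + n \<in> Npow j"
proof (induction j arbitrary: a)
  case (Suc j)
  then obtain a' b where ab: "a = a' + b" "a' \<in> Npow j" "b \<in> N" "b \<noteq> 0" by auto
  have "b + n \<noteq> 0" using add_eq_0[OF ab(3) Suc.prems(2)] ab(4) by simp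
  then have "a' + (b + n) \<in> Npow (Suc j)" using ab Suc.prems N_add by auto
  then show ?case unfolding ab(1) add.assoc .
qed (auto intro: N_add)

lemma Npow_Suc_sub: "Npow (Suc j) \<subseteq> Npow j"
  using Npow_add by auto

lemma Npow_deg: "a \<in> Npow j \<Longrightarrow> int j \<le> deg a"
proof (induction j arbitrary: a)
  case (Suc j)
  then obtain a' b where ab: "a = a' + b" "a' \<in> Npow j" "b \<in> N" "b \<noteq> 0" by auto
  then have "int j \<le> deg a'" "0 < deg b" "deg a = deg a' + deg b"
    using Suc.IH[of a'] deg_pos[of b] deg_add[of a' b] by blast+
  then show ?case by simp
qed (simp add: deg_nonneg)

abbreviation Jpow :: "nat \<Rightarrow> ((nat \<Rightarrow> int) \<Rightarrow>\<^sub>0 complex) set" where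
  "Jpow j \<equiv> {f. Poly_Mapping.keys f \<subseteq> Npow j}"

text \<open>The maximal ideal is spanned by monomials, hence so are its powers: a coefficient of a
  product can be nonzero only at a sum of exponents.\<close>

lemma ideal_power_eq: "ideal_power Alg mxi j = Jpow j"
proof (induction j)
  case (Suc j)
  have "ideal_prod Alg (Jpow j) mxi = Jpow (Suc j)"
  proof (intro Set.set_eqI iffI)
    fix f assume "f \<in> ideal_prod Alg (Jpow j) mxi"
    then show "f \<in> Jpow (Suc j)"
    proof (induction rule: ideal_prod.induct)
      case (prod i h)
      have "m \<in> Npow (Suc j)" if m: "m \<in> Poly_Mapping.keys (i * h)" for m
      proof -
        obtain a b where "m = a + b" "a \<in> Poly_Mapping.keys i" "b \<in> Poly_Mapping.keys h"
          using keys_mult[of i h] m by blast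
        moreover have "a \<in> Npow j" using calculation(2) prod(1) by blast
        moreover have "b \<in> N" "b \<noteq> 0" using calculation(3) prod(2) by (auto simp: maximal_ideal_eq in_keys_iff)
        ultimately show ?thesis by auto
      qed
      then show ?case by auto
    next
      case (sum s t)
      then show ?case using keys_add[of s t] by auto
    qed
  next
    fix f assume "f \<in> Jpow (Suc j)"
    then have "Poly_Mapping.keys f \<subseteq> Npow (Suc j)" by simp
    then show "f \<in> ideal_prod Alg (Jpow j) mxi"
    proof (induction rule: poly_mapping_keys_induct)
      case zero
      have "(0::(nat \<Rightarrow> int) \<Rightarrow>\<^sub>0 complex) \<otimes>\<^bsub>Alg\<^esub> 0 \<in> ideal_prod Alg (Jpow j) mxi"
        by (rule ideal_prod.prod) (auto simp: maximal_ideal_eq)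
      then show ?case by simp
    next
      case (add p m c)
      then obtain a b where ab: "m = a + b" "a \<in> Npow j" "b \<in> N" "b \<noteq> 0" by auto
      have "Poly_Mapping.single a c \<otimes>\<^bsub>Alg\<^esub> Poly_Mapping.single b 1 \<in> ideal_prod Alg (Jpow j) mxi"
        by (rule ideal_prod.prod) (use ab in \<open>auto simp: maximal_ideal_eq lookup_single when_def\<close>)
      then have "Poly_Mapping.single m c \<in> ideal_prod Alg (Jpow j) mxi" using ab by (simp add: mult_single)
      then show ?case using ideal_prod.sum[OF add.IH, of "Poly_Mapping.single m c"] by simp
    qed
  qed
  then show ?case using Suc by simp
qed simp

lemma keys_mult_N: "Poly_Mapping.keys f \<subseteq> N \<Longrightarrow> Poly_Mapping.keys g \<subseteq> N \<Longrightarrow> Poly_Mapping.keys (f * g) \<subseteq> N"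
  for f g :: "(nat \<Rightarrow> int) \<Rightarrow>\<^sub>0 complex"
  using keys_mult[of f g] N_add by blast

sublocale alg: cring Alg
proof (rule cringI)
  show "abelian_group Alg"
  proof (rule abelian_groupI)
    fix f assume "f \<in> carrier Alg"
    then have "- f \<in> carrier Alg" "(- f) \<oplus>\<^bsub>Alg\<^esub> f = \<zero>\<^bsub>Alg\<^esub>" by simp_all
    then show "\<exists>y\<in>carrier Alg. y \<oplus>\<^bsub>Alg\<^esub> f = \<zero>\<^bsub>Alg\<^esub>" by blast
  qed (auto simp: algebra_simps dest!: subsetD[OF keys_add])
  show "comm_monoid Alg"
    by (rule comm_monoidI) (use keys_mult_N N0 in \<open>auto simp: algebra_simps\<close>)
qed (simp add: algebra_simps)

lemma Jpow_ideal: "ideal (Jpow j) Alg"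
proof (rule idealI[OF alg.ring_axioms])
  have sub: "Jpow j \<subseteq> carrier Alg" using Npow_sub by auto
  show "subgroup (Jpow j) (add_monoid Alg)"
  proof (rule group.subgroupI[OF alg.a_group])
    show "Jpow j \<subseteq> carrier (add_monoid Alg)" using sub by simp
    show "Jpow j \<noteq> {}" by (auto intro: exI[of _ 0])
    fix a assume a: "a \<in> Jpow j"
    then have ac: "a \<in> carrier Alg" using sub by blast
    have "\<ominus>\<^bsub>Alg\<^esub> a = - a"
      by (rule alg.minus_equality) (use ac in simp_all)
    then have inv: "inv\<^bsub>add_monoid Alg\<^esub> a = - a" unfolding a_inv_def .
    show "inv\<^bsub>add_monoid Alg\<^esub> a \<in> Jpow j" unfolding inv using a by simp
    fix b assume "b \<in> Jpow j"
    then have "Poly_Mapping.keys (a + b) \<subseteq> Npow j" using a keys_add[of a b] by blast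
    then show "a \<otimes>\<^bsub>add_monoid Alg\<^esub> b \<in> Jpow j" by simp
  qed
  fix a x assume ax: "a \<in> Jpow j" "x \<in> carrier Alg"
  have "Poly_Mapping.keys (a * x) \<subseteq> Npow j" 
  proof
    fix m assume "m \<in> Poly_Mapping.keys (a * x)"
    then obtain b c where "m = b + c" "b \<in> Poly_Mapping.keys a" "c \<in> Poly_Mapping.keys x"
      using keys_mult[of a x] by blast
    moreover from this have "b \<in> Npow j" "c \<in> N" using ax by auto
    ultimately show "m \<in> Npow j" using Npow_add by simp
  qed
  then show "a \<otimes>\<^bsub>Alg\<^esub> x \<in> Jpow j" "x \<otimes>\<^bsub>Alg\<^esub> a \<in> Jpow j" by (simp_all add: mult.commute)
qed

abbreviation cls :: "nat \<Rightarrow> ((nat \<Rightarrow> int) \<Rightarrow>\<^sub>0 complex) \<Rightarrow> ((nat \<Rightarrow> int) \<Rightarrow>\<^sub>0 complex) set" where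
  "cls j f \<equiv> a_r_coset Alg (Jpow j) f"

text \<open>The ideal is spanned by monomials, so congruence is equality of the coefficients outside
  \<open>Npow j\<close>; computations in the completion reduce to this.\<close>

lemma cls_eq:
  assumes f: "Poly_Mapping.keys f \<subseteq> N"
  shows "cls j f = {h. Poly_Mapping.keys h \<subseteq> N \<and> (\<forall>m. m \<notin> Npow j \<longrightarrow> Poly_Mapping.lookup h m = Poly_Mapping.lookup f m)}"
proof (intro Set.set_eqI iffI)
  fix h assume "h \<in> cls j f"
  then obtain g where g: "Poly_Mapping.keys g \<subseteq> Npow j" "h = g + f" by (auto simp: a_r_coset_def')
  then have "Poly_Mapping.keys h \<subseteq> N" using keys_add[of g f] f Npow_sub by blast
  then show "h \<in> {h. Poly_Mapping.keys h \<subseteq> N \<and> (\<forall>m. m \<notin> Npow j \<longrightarrow> Poly_Mapping.lookup h m = Poly_Mapping.lookup f m)}"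
    using g by (auto simp: lookup_add in_keys_iff)
next
  fix h assume h: "h \<in> {h. Poly_Mapping.keys h \<subseteq> N \<and> (\<forall>m. m \<notin> Npow j \<longrightarrow> Poly_Mapping.lookup h m = Poly_Mapping.lookup f m)}"
  have "Poly_Mapping.keys (h - f) \<subseteq> Npow j" using h by (auto simp: in_keys_iff lookup_minus)
  moreover have "h = (h - f) + f" by simp
  ultimately show "h \<in> cls j f" unfolding a_r_coset_def' by auto
qed

lemma cls_self: "Poly_Mapping.keys f \<subseteq> N \<Longrightarrow> f \<in> cls j f"
  by (simp add: cls_eq)

lemma cls_Suc: "Poly_Mapping.keys f \<subseteq> N \<Longrightarrow> cls (Suc j) f \<subseteq> cls j f"
proof -
  assume f: "Poly_Mapping.keys f \<subseteq> N"
  show ?thesis unfolding cls_eq[OF f] using Npow_Suc_sub[of j] by blast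
qed

lemma Kr_simps:
  "carrier Kr = {a. \<forall>n. (\<exists>f. Poly_Mapping.keys f \<subseteq> N \<and> a n = cls n f) \<and> a (Suc n) \<subseteq> a n}"
  "\<zero>\<^bsub>Kr\<^esub> = (\<lambda>n. Jpow n)"
  "a \<oplus>\<^bsub>Kr\<^esub> b = (\<lambda>n. set_add Alg (a n) (b n))"
  "c \<odot>\<^bsub>Kr\<^esub> a = (\<lambda>n. rcoset_mult Alg (Jpow n) (cls n (Poly_Mapping.single 0 c)) (a n))"
proof -
  have "a_rcosets\<^bsub>Alg\<^esub> (Jpow n) = {C. \<exists>f. Poly_Mapping.keys f \<subseteq> N \<and> C = cls n f}" for n
    by (auto simp: A_RCOSETS_def RCOSETS_def a_r_coset_def)
  then show "carrier Kr = {a. \<forall>n. (\<exists>f. Poly_Mapping.keys f \<subseteq> N \<and> a n = cls n f) \<and> a (Suc n) \<subseteq> a n}"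
    by (simp add: completed_ring_def Let_def ideal_power_eq FactRing_def)
  have "ideal_power Alg mxi = (\<lambda>n. Jpow n)" by (rule ext) (rule ideal_power_eq)
  then show "\<zero>\<^bsub>Kr\<^esub> = (\<lambda>n. Jpow n)" by (simp add: completed_ring_def Let_def FactRing_def)
qed (simp_all add: completed_ring_def Let_def ideal_power_eq FactRing_def)

definition emb :: "((nat \<Rightarrow> int) \<Rightarrow>\<^sub>0 complex) \<Rightarrow> nat \<Rightarrow> ((nat \<Rightarrow> int) \<Rightarrow>\<^sub>0 complex) set" where
  "emb f = (\<lambda>n. cls n f)"

lemma emb_closed: "Poly_Mapping.keys f \<subseteq> N \<Longrightarrow> emb f \<in> carrier Kr"
  using cls_Suc unfolding Kr_simps emb_def by blast

lemma cls_add: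
  "Poly_Mapping.keys f \<subseteq> N \<Longrightarrow> Poly_Mapping.keys g \<subseteq> N \<Longrightarrow> set_add Alg (cls j f) (cls j g) = cls j (f + g)"
proof -
  interpret I: ideal "Jpow j" Alg by (rule Jpow_ideal)
  show "Poly_Mapping.keys f \<subseteq> N \<Longrightarrow> Poly_Mapping.keys g \<subseteq> N \<Longrightarrow> set_add Alg (cls j f) (cls j g) = cls j (f + g)"
    using I.a_rcos_sum[of f g] by simp
qed

lemma cls_0: "cls j 0 = Jpow j"
  by (auto simp: a_r_coset_def')

lemma cls_smult:
  "Poly_Mapping.keys f \<subseteq> N \<Longrightarrow>
    rcoset_mult Alg (Jpow j) (cls j (Poly_Mapping.single 0 c)) (cls j f) = cls j (Poly_Mapping.single 0 c * f)"
proof -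
  interpret I: ideal "Jpow j" Alg by (rule Jpow_ideal)
  show "Poly_Mapping.keys f \<subseteq> N \<Longrightarrow>
    rcoset_mult Alg (Jpow j) (cls j (Poly_Mapping.single 0 c)) (cls j f) = cls j (Poly_Mapping.single 0 c * f)"
    using I.rcoset_mult_add[of "Poly_Mapping.single 0 c" f] N0 by simp
qed

lemma emb_add: "Poly_Mapping.keys f \<subseteq> N \<Longrightarrow> Poly_Mapping.keys g \<subseteq> N \<Longrightarrow> emb f \<oplus>\<^bsub>Kr\<^esub> emb g = emb (f + g)"
  by (simp add: emb_def Kr_simps cls_add)

lemma emb_0: "emb 0 = \<zero>\<^bsub>Kr\<^esub>"
  by (simp add: emb_def Kr_simps cls_0)

lemma emb_smult: "Poly_Mapping.keys f \<subseteq> N \<Longrightarrow> c \<odot>\<^bsub>Kr\<^esub> emb f = emb (Poly_Mapping.single 0 c * f)"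
  by (simp add: emb_def Kr_simps cls_smult)

text \<open>Gives meaning to the finite sums in \<open>has_coords\<close>. Each level is handled
  through polynomial representatives, whose choice may vary with the level.\<close>

lemma Kr_abelian_monoid: "abelian_monoid Kr"
proof (rule abelian_monoidI)
  have rep: "\<exists>f. \<forall>n. Poly_Mapping.keys (f n) \<subseteq> N \<and> a n = cls n (f n)" if "a \<in> carrier Kr" for a
    using that unfolding Kr_simps by (intro choice) blast
  fix a b c assume a: "a \<in> carrier Kr" and b: "b \<in> carrier Kr" and c: "c \<in> carrier Kr"
  obtain f where f': "\<forall>n. Poly_Mapping.keys (f n) \<subseteq> N \<and> a n = cls n (f n)" using rep[OF a] by (elim exE)
  obtain g where g': "\<forall>n. Poly_Mapping.keys (g n) \<subseteq> N \<and> b n = cls n (g n)" using rep[OF b] by (elim exE)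
  obtain h where h': "\<forall>n. Poly_Mapping.keys (h n) \<subseteq> N \<and> c n = cls n (h n)" using rep[OF c] by (elim exE)
  note f = f'[THEN spec, THEN conjunct1] f'[THEN spec, THEN conjunct2]
  note g = g'[THEN spec, THEN conjunct1] g'[THEN spec, THEN conjunct2]
  note h = h'[THEN spec, THEN conjunct1] h'[THEN spec, THEN conjunct2]
  have k: "Poly_Mapping.keys (f n + g n) \<subseteq> N" "Poly_Mapping.keys (g n + h n) \<subseteq> N" for n
    using keys_add[of "f n" "g n"] keys_add[of "g n" "h n"] f g h by blast+
  have mono: "set_add Alg (a (Suc n)) (b (Suc n)) \<subseteq> set_add Alg (a n) (b n)" for n
    using a b unfolding set_add_def' Kr_simps by blast
  have "\<exists>p. Poly_Mapping.keys p \<subseteq> N \<and> set_add Alg (a n) (b n) = cls n p" for n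
    using k(1)[of n] f g by (auto simp: cls_add)
  then show "a \<oplus>\<^bsub>Kr\<^esub> b \<in> carrier Kr" unfolding Kr_simps using mono by blast
  show "a \<oplus>\<^bsub>Kr\<^esub> b \<oplus>\<^bsub>Kr\<^esub> c = a \<oplus>\<^bsub>Kr\<^esub> (b \<oplus>\<^bsub>Kr\<^esub> c)"
    by (simp add: Kr_simps f g h k cls_add add.assoc)
  show "a \<oplus>\<^bsub>Kr\<^esub> b = b \<oplus>\<^bsub>Kr\<^esub> a"
    by (simp add: Kr_simps f g cls_add add.commute)
  show "\<zero>\<^bsub>Kr\<^esub> \<oplus>\<^bsub>Kr\<^esub> a = a"
  proof -
    have "set_add Alg (Jpow n) (a n) = a n" for n
      using cls_add[of 0 "f n" n, unfolded cls_0] f by simp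
    then show ?thesis by (simp add: Kr_simps)
  qed
next
  show "\<zero>\<^bsub>Kr\<^esub> \<in> carrier Kr" using emb_closed[of 0] unfolding emb_0 by simp
qed

lemma emb_sum:
  assumes "finite B" "\<And>b. b \<in> B \<Longrightarrow> Poly_Mapping.keys (g b) \<subseteq> N"
  shows "finsum Kr (\<lambda>b. emb (g b)) B = emb (\<Sum>b\<in>B. g b) \<and> Poly_Mapping.keys (\<Sum>b\<in>B. g b) \<subseteq> N"
  using assms
proof (induction B)
  case empty
  interpret abelian_monoid Kr by (rule Kr_abelian_monoid)
  show ?case by (simp add: emb_0)
next
  case (insert b B)
  interpret abelian_monoid Kr by (rule Kr_abelian_monoid)
  have "finsum Kr (\<lambda>b. emb (g b)) (insert b B) = emb (g b) \<oplus>\<^bsub>Kr\<^esub> finsum Kr (\<lambda>b. emb (g b)) B"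
    by (rule finsum_insert) (use insert emb_closed in auto)
  moreover have "Poly_Mapping.keys (g b + sum g B) \<subseteq> N" using insert keys_add[of "g b" "sum g B"] by auto
  ultimately show ?case using insert by (simp add: emb_add)
qed

lemma torus_char_nonzero: "t \<in> carrier (torus r complex_ring) \<Longrightarrow> torus_char r complex_ring m t \<noteq> 0"
  by (subst type_torus_char) (auto simp: type_torus_carrier PiE_iff)

lemma keys_fun_act: "Poly_Mapping.keys (fun_act r t f) \<subseteq> Poly_Mapping.keys f"
  by (auto simp: in_keys_iff fun_act_lookup)

lemma keys_const_mult: "Poly_Mapping.keys (Poly_Mapping.single 0 c * f) \<subseteq> Poly_Mapping.keys f"
  for f :: "(nat \<Rightarrow> int) \<Rightarrow>\<^sub>0 complex"
  by (auto simp: in_keys_iff const_mult_lookup)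

lemma emb_act:
  assumes t: "t \<in> carrier (torus r complex_ring)" and f: "Poly_Mapping.keys f \<subseteq> N"
  shows "fun_act r t ` cls j f = cls j (fun_act r t f)"
proof (intro Set.set_eqI iffI)
  have tf: "Poly_Mapping.keys (fun_act r t f) \<subseteq> N" using keys_fun_act[of t f] f by blast
  {
    fix h assume "h \<in> fun_act r t ` cls j f"
    then obtain g where g: "g \<in> cls j f" "h = fun_act r t g" by blast
    then show "h \<in> cls j (fun_act r t f)"
      using keys_fun_act[of t g] unfolding cls_eq[OF f] cls_eq[OF tf] by (auto simp: fun_act_lookup)
  next
    fix h assume h: "h \<in> cls j (fun_act r t f)"
    define g where "g = (\<Sum>m\<in>Poly_Mapping.keys h. Poly_Mapping.single m (inverse (torus_char r complex_ring m t) * Poly_Mapping.lookup h m))"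
    have g: "Poly_Mapping.lookup g m = inverse (torus_char r complex_ring m t) * Poly_Mapping.lookup h m" for m
    proof -
      have "Poly_Mapping.lookup g m = (\<Sum>l\<in>Poly_Mapping.keys h. (inverse (torus_char r complex_ring l t) * Poly_Mapping.lookup h l) when l = m)"
        by (simp add: g_def lookup_sum lookup_single)
      also have "\<dots> = inverse (torus_char r complex_ring m t) * Poly_Mapping.lookup h m"
        by (cases "m \<in> Poly_Mapping.keys h") (auto simp: when_def in_keys_iff)
      finally show ?thesis .
    qed
    have "h = fun_act r t g"
      by (rule poly_mapping_eqI) (simp add: fun_act_lookup g torus_char_nonzero[OF t])
    moreover have "Poly_Mapping.keys g \<subseteq> Poly_Mapping.keys h" by (auto simp: in_keys_iff g)
    then have "g \<in> cls j f"
      using h unfolding cls_eq[OF f] cls_eq[OF tf] by (auto simp: fun_act_lookup g torus_char_nonzero[OF t])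
    ultimately show "h \<in> fun_act r t ` cls j f" by blast
  }
qed

lemma completed_act_emb:
  "t \<in> carrier (torus r complex_ring) \<Longrightarrow> Poly_Mapping.keys f \<subseteq> N \<Longrightarrow> completed_act r t (emb f) = emb (fun_act r t f)"
  by (simp add: completed_act_def emb_def emb_act)

section \<open>Graded pieces and traces\<close>

definition Nd :: "int \<Rightarrow> (nat \<Rightarrow> int) set" where "Nd n = {m \<in> N. deg m = n}"

lemma Nd_finite: "finite (Nd n)" unfolding Nd_def by (rule deg_finite)

lemma Nd_sub: "Nd n \<subseteq> N" by (auto simp: Nd_def)

text \<open>Monomials in the j-th power of the maximal ideal have degree at least j, so the power n
  + 1 leaves all monomials of degree \<open>n\<close> visible in the quotient.\<close>

lemma Nd_disjoint: "m \<in> Nd n \<Longrightarrow> m \<notin> Npow (nat (n + 1))"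
  using Npow_deg[of m "nat (n + 1)"] deg_nonneg[of m] by (auto simp: Nd_def)

lemma emb_inj:
  assumes "Poly_Mapping.keys f \<subseteq> Nd n" "Poly_Mapping.keys g \<subseteq> Nd n" "emb f = emb g"
  shows "f = g"
proof (rule poly_mapping_eqI)
  fix m
  have k: "Poly_Mapping.keys f \<subseteq> N" "Poly_Mapping.keys g \<subseteq> N" using assms Nd_sub by blast+
  let ?j = "nat (n + 1)"
  show "Poly_Mapping.lookup f m = Poly_Mapping.lookup g m"
  proof (cases "m \<in> Npow ?j")
    case True
    then have "m \<notin> Nd n" using Nd_disjoint by blast
    then have "m \<notin> Poly_Mapping.keys f" "m \<notin> Poly_Mapping.keys g" using assms by blast+
    then show ?thesis by (simp add: in_keys_iff)
  next
    case False
    have "f \<in> cls ?j g" using cls_self[OF k(1), of ?j] assms(3) by (simp add: emb_def fun_eq_iff)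
    then show ?thesis using False by (simp add: cls_eq[OF k(2)])
  qed
qed

text \<open>An element of the completion might involve infinitely many monomials. The weight
  condition kills every coefficient outside \<open>Nd n\<close>, and this set is finite, so a
  homogeneous element comes from a polynomial.\<close>

lemma graded_piece_eq: "graded_piece r N \<eta> n = emb ` {f. Poly_Mapping.keys f \<subseteq> Nd n}"
proof (intro Set.set_eqI iffI)
  fix a assume "a \<in> emb ` {f. Poly_Mapping.keys f \<subseteq> Nd n}"
  then obtain f where f: "Poly_Mapping.keys f \<subseteq> Nd n" "a = emb f" by blast
  then have fN: "Poly_Mapping.keys f \<subseteq> N" using Nd_sub by blast
  have "fun_act r (torus_cochar r complex_ring \<eta> z) f = Poly_Mapping.single 0 (z powi n) * f" if z: "z \<noteq> 0" for z
  proof (rule poly_mapping_eqI)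
    fix m
    show "Poly_Mapping.lookup (fun_act r (torus_cochar r complex_ring \<eta> z) f) m = Poly_Mapping.lookup (Poly_Mapping.single 0 (z powi n) * f) m"
    proof (cases "m \<in> Poly_Mapping.keys f")
      case True
      then have "deg m = n" using f(1) by (auto simp: Nd_def)
      then show ?thesis by (simp add: fun_act_lookup const_mult_lookup type_char_cochar[OF z])
    qed (simp add: fun_act_lookup const_mult_lookup in_keys_iff)
  qed
  then show "a \<in> graded_piece r N \<eta> n"
    unfolding graded_piece_def using f(2) fN emb_closed[OF fN]
    by (simp add: completed_act_emb[OF type_torus_cochar_closed fN] emb_smult[OF fN])
next
  fix a assume a: "a \<in> graded_piece r N \<eta> n"
  then have aK: "a \<in> carrier Kr"
    and act: "completed_act r (torus_cochar r complex_ring \<eta> 2) a = (2 powi n) \<odot>\<^bsub>Kr\<^esub> a"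
    unfolding graded_piece_def by auto
  have "\<exists>f. \<forall>j. Poly_Mapping.keys (f j) \<subseteq> N \<and> a j = cls j (f j)"
    using aK unfolding Kr_simps by (intro choice) blast
  then obtain f where f': "\<forall>j. Poly_Mapping.keys (f j) \<subseteq> N \<and> a j = cls j (f j)" by (elim exE)
  note fN = f'[THEN spec, THEN conjunct1] and fa = f'[THEN spec, THEN conjunct2]
  have "a (Suc j) \<subseteq> a j" for j using aK unfolding Kr_simps by blast
  then have mono: "a i \<subseteq> a j" if "j \<le> i" for i j using lift_Suc_antimono_le[of a j i] that by blast
  have coh: "Poly_Mapping.lookup (f i) m = Poly_Mapping.lookup (f j) m" if "j \<le> i" "m \<notin> Npow j" for i j m
  proof -
    have "f i \<in> a j" using mono[OF that(1)] cls_self[OF fN, of i i] fa[of i] by auto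
    then show ?thesis using that(2) by (simp add: fa[of j] cls_eq[OF fN])
  qed
  \<comment> \<open>Homogeneity is used for the scalar 2 alone; its integral powers are distinct and
    so separate the degrees.\<close>
  let ?t = "torus_cochar r complex_ring \<eta> 2"
  have t: "?t \<in> carrier (torus r complex_ring)" by (rule type_torus_cochar_closed) simp
  have hom: "Poly_Mapping.lookup (f j) m = 0" if m: "m \<notin> Npow j" "m \<notin> Nd n" for j m
  proof (cases "m \<in> N")
    case False
    then show ?thesis using fN[of j] by (auto simp: in_keys_iff subset_iff)
  next
    case True
    have k: "Poly_Mapping.keys (fun_act r ?t (f j)) \<subseteq> N" "Poly_Mapping.keys (Poly_Mapping.single 0 (2 powi n) * f j) \<subseteq> N"
      using keys_fun_act[of ?t "f j"] keys_const_mult[of "2 powi n" "f j"] fN[of j] by blast+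
    have "fun_act r ?t ` a j = rcoset_mult Alg (Jpow j) (cls j (Poly_Mapping.single 0 (2 powi n))) (a j)"
      using fun_cong[OF act, of j] by (simp add: completed_act_def Kr_simps)
    then have "cls j (fun_act r ?t (f j)) = cls j (Poly_Mapping.single 0 (2 powi n) * f j)"
      unfolding fa[of j] emb_act[OF t fN] cls_smult[OF fN] .
    then have "fun_act r ?t (f j) \<in> cls j (Poly_Mapping.single 0 (2 powi n) * f j)" using cls_self[OF k(1)] by blast
    then have "2 powi deg m * Poly_Mapping.lookup (f j) m = 2 powi n * Poly_Mapping.lookup (f j) m"
      using m(1) by (simp add: cls_eq[OF k(2)] fun_act_lookup const_mult_lookup type_char_cochar)
    moreover have "(2::complex) powi deg m \<noteq> 2 powi n"
    proof
      assume "(2::complex) powi deg m = 2 powi n"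
      then have "norm ((2::complex) powi deg m) = norm ((2::complex) powi n)" by simp
      then have "(2::real) powi deg m = 2 powi n" by (simp add: norm_power_int)
      then have "deg m = n"
        using power_int_strict_increasing[of "deg m" n "2::real"] power_int_strict_increasing[of n "deg m" "2::real"]
        by (cases "deg m" n rule: linorder_cases) auto
      then show False using m(2) True by (simp add: Nd_def)
    qed
    ultimately show ?thesis by simp
  qed
  \<comment> \<open>Coefficients of degree \<open>n\<close> are read off at level n + 1, where by
    \<open>Nd_disjoint\<close> they do not depend on the representative.\<close>
  let ?j = "nat (n + 1)"
  define g where "g = (\<Sum>m\<in>Nd n. Poly_Mapping.single m (Poly_Mapping.lookup (f ?j) m))"
  have g: "Poly_Mapping.lookup g m = (if m \<in> Nd n then Poly_Mapping.lookup (f ?j) m else 0)" for m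
    using Nd_finite[of n] by (simp add: g_def lookup_sum lookup_single when_def)
  have gk: "Poly_Mapping.keys g \<subseteq> Nd n" by (auto simp: in_keys_iff g split: if_splits)
  then have gN: "Poly_Mapping.keys g \<subseteq> N" using Nd_sub by blast
  have "a j = cls j g" for j
  proof -
    have "Poly_Mapping.lookup (f j) m = Poly_Mapping.lookup g m" if m: "m \<notin> Npow j" for m
    proof (cases "m \<in> Nd n")
      case True
      have "Poly_Mapping.lookup (f j) m = Poly_Mapping.lookup (f ?j) m"
        using coh[of ?j j m] coh[of j ?j m] m Nd_disjoint[OF True] by (cases "j \<le> ?j") auto
      then show ?thesis using True g by simp
    next
      case False
      then show ?thesis using hom[OF m] g by simp
    qed
    then show ?thesis unfolding fa[of j] cls_eq[OF fN] cls_eq[OF gN] by auto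
  qed
  then have "a = emb g" by (auto simp: emb_def)
  then show "a \<in> emb ` {f. Poly_Mapping.keys f \<subseteq> Nd n}" using gk by blast
qed

text \<open>Turns coordinates in the completion into linear equations between coefficients of degree
  \<open>n\<close>, the form required by \<open>trace_eq_sum_eigenvalues\<close>.\<close>

lemma emb_span:
  assumes B: "finite B" and k': "\<forall>b\<in>B. Poly_Mapping.keys (F b) \<subseteq> Nd n \<and> b = emb (F b)"
    and g: "Poly_Mapping.keys g \<subseteq> Nd n"
  shows "has_coords Kr B (emb g) c \<longleftrightarrow>
    c \<in> extensional B \<and> (\<forall>m\<in>Nd n. Poly_Mapping.lookup g m = (\<Sum>b\<in>B. c b * Poly_Mapping.lookup (F b) m))"
proof -
  interpret K: abelian_monoid Kr by (rule Kr_abelian_monoid)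
  note k = k'[THEN bspec]
  have kN: "Poly_Mapping.keys (F b) \<subseteq> N" if "b \<in> B" for b using k[OF that] Nd_sub by blast
  have ck: "Poly_Mapping.keys (Poly_Mapping.single 0 (c b) * F b) \<subseteq> Nd n" if "b \<in> B" for b
    using keys_const_mult[of "c b" "F b"] k[OF that] by blast
  then have ckN: "Poly_Mapping.keys (Poly_Mapping.single 0 (c b) * F b) \<subseteq> N" if "b \<in> B" for b
    using that Nd_sub by blast
  let ?h = "\<Sum>b\<in>B. Poly_Mapping.single 0 (c b) * F b"
  have h: "Poly_Mapping.lookup ?h m = (\<Sum>b\<in>B. c b * Poly_Mapping.lookup (F b) m)" for m
    by (simp add: lookup_sum const_mult_lookup)
  have hk: "Poly_Mapping.keys ?h \<subseteq> Nd n"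
  proof
    fix m assume "m \<in> Poly_Mapping.keys ?h"
    then have "(\<Sum>b\<in>B. c b * Poly_Mapping.lookup (F b) m) \<noteq> 0" by (simp add: in_keys_iff h)
    then obtain b where "b \<in> B" "c b * Poly_Mapping.lookup (F b) m \<noteq> 0" by (rule sum.not_neutral_contains_not_neutral)
    then show "m \<in> Nd n" using k[of b] by (auto simp: in_keys_iff subset_iff)
  qed
  have "finsum Kr (\<lambda>b. c b \<odot>\<^bsub>Kr\<^esub> b) B = finsum Kr (\<lambda>b. emb (Poly_Mapping.single 0 (c b) * F b)) B"
  proof (rule K.finsum_cong'[OF refl])
    show "(\<lambda>b. emb (Poly_Mapping.single 0 (c b) * F b)) \<in> B \<rightarrow> carrier Kr" using emb_closed[OF ckN] by blast
    fix b assume b: "b \<in> B"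
    have "c b \<odot>\<^bsub>Kr\<^esub> emb (F b) = emb (Poly_Mapping.single 0 (c b) * F b)" by (rule emb_smult[OF kN[OF b]])
    then show "c b \<odot>\<^bsub>Kr\<^esub> b = emb (Poly_Mapping.single 0 (c b) * F b)" using k[OF b] by simp
  qed
  also have "\<dots> = emb ?h" using emb_sum[of B "\<lambda>b. Poly_Mapping.single 0 (c b) * F b"] B ckN by blast
  finally have "has_coords Kr B (emb g) c \<longleftrightarrow> c \<in> extensional B \<and> emb g = emb ?h"
    by (simp add: has_coords_def)
  also have "emb g = emb ?h \<longleftrightarrow> g = ?h" using emb_inj[OF g hk] by blast
  also have "g = ?h \<longleftrightarrow> (\<forall>m\<in>Nd n. Poly_Mapping.lookup g m = Poly_Mapping.lookup ?h m)"
  proof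
    assume eq: "\<forall>m\<in>Nd n. Poly_Mapping.lookup g m = Poly_Mapping.lookup ?h m"
    show "g = ?h"
    proof (rule poly_mapping_eqI)
      fix m
      show "Poly_Mapping.lookup g m = Poly_Mapping.lookup ?h m"
      proof (cases "m \<in> Nd n")
        case False
        then have "m \<notin> Poly_Mapping.keys g" "m \<notin> Poly_Mapping.keys ?h" using g hk by blast+
        then show ?thesis by (simp only: in_keys_iff not_not)
      qed (use eq in blast)
    qed
  qed simp
  finally show ?thesis by (simp only: h)
qed

text \<open>The monomials of degree \<open>n\<close> serve; existence is what licenses the choice by
  \<open>SOME\<close> in \<open>trace_on\<close>.\<close>

lemma basis_exists: "\<exists>B. is_basis Kr (graded_piece r N \<eta> n) B"
proof -
  let ?e = "\<lambda>m. Poly_Mapping.single m (1::complex)"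
  let ?B = "(\<lambda>m. emb (?e m)) ` Nd n"
  have ek: "Poly_Mapping.keys (?e m) \<subseteq> Nd n" if "m \<in> Nd n" for m using that by simp
  have inj: "inj_on (\<lambda>m. emb (?e m)) (Nd n)"
  proof (rule inj_onI)
    fix m m' assume "m \<in> Nd n" "m' \<in> Nd n" "emb (?e m) = emb (?e m')"
    then have "?e m = ?e m'" using emb_inj[OF ek ek] by blast
    then have "Poly_Mapping.lookup (?e m) m = Poly_Mapping.lookup (?e m') m" by simp
    then show "m = m'" by (simp add: lookup_single when_def split: if_splits)
  qed
  define F where "F b = ?e (the_inv_into (Nd n) (\<lambda>m. emb (?e m)) b)" for b
  have F: "F (emb (?e m)) = ?e m" if "m \<in> Nd n" for m
    using the_inv_into_f_f[OF inj that] by (simp add: F_def)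
  have k: "\<forall>b\<in>?B. Poly_Mapping.keys (F b) \<subseteq> Nd n \<and> b = emb (F b)"
    using F ek by auto
  have B: "finite ?B" using Nd_finite by simp
  have "\<exists>!c. has_coords Kr ?B (emb g) c" if g: "Poly_Mapping.keys g \<subseteq> Nd n" for g
  proof -
    have sum: "(\<Sum>b\<in>?B. c b * Poly_Mapping.lookup (F b) m) = c (emb (?e m))" if m: "m \<in> Nd n" for c :: "_ \<Rightarrow> complex" and m
    proof -
      have "(\<Sum>b\<in>?B. c b * Poly_Mapping.lookup (F b) m) = (\<Sum>l\<in>Nd n. c (emb (?e l)) * Poly_Mapping.lookup (?e l) m)"
        by (subst sum.reindex[OF inj]) (auto simp: F intro!: sum.cong)
      also have "\<dots> = (\<Sum>l\<in>Nd n. if l = m then c (emb (?e l)) else 0)"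
        by (intro sum.cong refl) (simp add: lookup_single when_def)
      finally show ?thesis using Nd_finite[of n] m by simp
    qed
    show ?thesis
    proof (rule ex1I)
      show "has_coords Kr ?B (emb g) (\<lambda>b\<in>?B. Poly_Mapping.lookup g (the_inv_into (Nd n) (\<lambda>m. emb (?e m)) b))"
        unfolding emb_span[OF B k g] using sum the_inv_into_f_f[OF inj] by simp
      fix c assume "has_coords Kr ?B (emb g) c"
      then have c: "c \<in> extensional ?B" "\<And>m. m \<in> Nd n \<Longrightarrow> Poly_Mapping.lookup g m = c (emb (?e m))"
        unfolding emb_span[OF B k g] using sum by auto
      show "c = (\<lambda>b\<in>?B. Poly_Mapping.lookup g (the_inv_into (Nd n) (\<lambda>m. emb (?e m)) b))"
        by (rule extensionalityI[OF c(1) restrict_extensional]) (auto simp: c(2) the_inv_into_f_f[OF inj])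
    qed
  qed
  then have "is_basis Kr (graded_piece r N \<eta> n) ?B"
    unfolding is_basis_def graded_piece_eq using B ek by auto
  then show ?thesis by blast
qed

lemma trace_on_graded_piece:
  assumes t: "t \<in> carrier (torus r complex_ring)"
  shows "trace_on Kr (graded_piece r N \<eta> n) (completed_act r t) = (\<Sum>m\<in>Nd n. torus_char r complex_ring m t)"
proof -
  define B where "B = (SOME B. is_basis Kr (graded_piece r N \<eta> n) B)"
  have "is_basis Kr (graded_piece r N \<eta> n) B" unfolding B_def by (rule someI_ex[OF basis_exists])
  then have B: "finite B" "B \<subseteq> emb ` {f. Poly_Mapping.keys f \<subseteq> Nd n}"
    and uni: "\<And>g. Poly_Mapping.keys g \<subseteq> Nd n \<Longrightarrow> \<exists>!c. has_coords Kr B (emb g) c"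
    unfolding is_basis_def graded_piece_eq by auto
  define F where "F = inv_into {f. Poly_Mapping.keys f \<subseteq> Nd n} emb"
  have k': "\<forall>b\<in>B. Poly_Mapping.keys (F b) \<subseteq> Nd n \<and> b = emb (F b)"
  proof
    fix b assume "b \<in> B"
    then have "b \<in> emb ` {f. Poly_Mapping.keys f \<subseteq> Nd n}" using B by blast
    from inv_into_into[OF this] f_inv_into_f[OF this]
    show "Poly_Mapping.keys (F b) \<subseteq> Nd n \<and> b = emb (F b)" by (simp add: F_def)
  qed
  note k = k'[THEN bspec]
  have basis: "\<exists>!c. c \<in> extensional B \<and> (\<forall>m\<in>Nd n. u m = (\<Sum>b\<in>B. c b * Poly_Mapping.lookup (F b) m))" for u
  proof -
    define g where "g = (\<Sum>m\<in>Nd n. Poly_Mapping.single m (u m))"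
    have g: "Poly_Mapping.lookup g m = (if m \<in> Nd n then u m else 0)" for m
      using Nd_finite[of n] by (simp add: g_def lookup_sum lookup_single when_def)
    have gk: "Poly_Mapping.keys g \<subseteq> Nd n" by (auto simp: in_keys_iff g split: if_splits)
    have "(\<forall>m\<in>Nd n. Poly_Mapping.lookup g m = (\<Sum>b\<in>B. c b * Poly_Mapping.lookup (F b) m))
        \<longleftrightarrow> (\<forall>m\<in>Nd n. u m = (\<Sum>b\<in>B. c b * Poly_Mapping.lookup (F b) m))" for c
      using g by simp
    then show ?thesis using uni[OF gk] unfolding emb_span[OF B(1) k' gk] by simp
  qed
  have act: "has_coords Kr B (completed_act r t b) c \<longleftrightarrow> c \<in> extensional B \<and>
      (\<forall>m\<in>Nd n. torus_char r complex_ring m t * Poly_Mapping.lookup (F b) m = (\<Sum>b'\<in>B. c b' * Poly_Mapping.lookup (F b') m))"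
    if b: "b \<in> B" for b c
  proof -
    have kb: "Poly_Mapping.keys (fun_act r t (F b)) \<subseteq> Nd n" using keys_fun_act[of t "F b"] k[OF b] by blast
    have "Poly_Mapping.keys (F b) \<subseteq> N" using k[OF b] Nd_sub by blast
    then have "completed_act r t b = emb (fun_act r t (F b))" using completed_act_emb[OF t] k[OF b] by metis
    then show ?thesis using emb_span[OF B(1) k' kb] by (simp only: fun_act_lookup)
  qed
  have "trace_on Kr (graded_piece r N \<eta> n) (completed_act r t) = (\<Sum>b\<in>B. (THE c. has_coords Kr B (completed_act r t b) c) b)"
    unfolding trace_on_def B_def Let_def ..
  also have "\<dots> = (\<Sum>b\<in>B. (THE c. c \<in> extensional B \<and>
      (\<forall>m\<in>Nd n. torus_char r complex_ring m t * Poly_Mapping.lookup (F b) m = (\<Sum>b'\<in>B. c b' * Poly_Mapping.lookup (F b') m))) b)"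
    by (rule sum.cong[OF refl]) (simp only: act)
  also have "\<dots> = (\<Sum>m\<in>Nd n. torus_char r complex_ring m t)"
    by (rule trace_eq_sum_eigenvalues[OF Nd_finite B(1) basis])
  finally show ?thesis .
qed

text \<open>The sum over \<open>N\<close> is regrouped by degree; each degree contributes a finite
  sum, which is the trace on a graded piece.\<close>

lemma graded_trace_eq:
  assumes t: "t \<in> carrier (torus r complex_ring)"
    and sum: "(\<lambda>m. torus_char r complex_ring m t * z powi deg m) summable_on N"
  shows "graded_trace r N \<eta> t z = (\<Sum>\<^sub>\<infinity>m\<in>N. torus_char r complex_ring m t * z powi deg m)"
proof -
  let ?f = "\<lambda>(n, m). torus_char r complex_ring m t * z powi deg m"
  have bij: "bij_betw (\<lambda>m. (deg m, m)) N (Sigma UNIV Nd)"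
    by (rule bij_betwI[where g = snd]) (auto simp: Nd_def)
  have sS: "?f summable_on Sigma UNIV Nd"
    using summable_on_reindex_bij_betw[OF bij, of ?f] sum by simp
  have "(\<Sum>\<^sub>\<infinity>m\<in>N. torus_char r complex_ring m t * z powi deg m) = infsum ?f (Sigma UNIV Nd)"
    using infsum_reindex_bij_betw[OF bij, of ?f] by simp
  also have "\<dots> = (\<Sum>\<^sub>\<infinity>n\<in>UNIV. \<Sum>\<^sub>\<infinity>m\<in>Nd n. ?f (n, m))"
    by (rule infsum_Sigma_banach[OF sS, symmetric])
  also have "\<dots> = (\<Sum>\<^sub>\<infinity>n\<in>UNIV. (\<Sum>m\<in>Nd n. torus_char r complex_ring m t) * z powi n)"
  proof (rule infsum_cong)
    fix n
    have "(\<Sum>\<^sub>\<infinity>m\<in>Nd n. ?f (n, m)) = (\<Sum>m\<in>Nd n. torus_char r complex_ring m t * z powi deg m)"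
      using infsum_finite[OF Nd_finite] by simp
    also have "\<dots> = (\<Sum>m\<in>Nd n. torus_char r complex_ring m t) * z powi n"
      unfolding sum_distrib_right by (rule sum.cong) (auto simp: Nd_def)
    finally show "(\<Sum>\<^sub>\<infinity>m\<in>Nd n. ?f (n, m)) = (\<Sum>m\<in>Nd n. torus_char r complex_ring m t) * z powi n" .
  qed
  finally show ?thesis by (simp add: graded_trace_def trace_on_graded_piece[OF t])
qed

end

section \<open>Euler products and regularized values\<close>

text \<open>A finite set of functions lies in a finite box, over which the sum factors into bounded
  finite sums.\<close>

lemma summable_on_prod_PiE:
  fixes f :: "'a \<Rightarrow> 'b \<Rightarrow> real"
  assumes A: "finite A" and pos: "\<And>x y. 0 \<le> f x y" and sum: "\<And>x. x \<in> A \<Longrightarrow> f x summable_on B x"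
  shows "(\<lambda>g. \<Prod>x\<in>A. f x (g x)) summable_on PiE A B"
proof (rule nonneg_bdd_above_summable_on)
  show "0 \<le> (\<Prod>x\<in>A. f x (g x))" for g by (simp add: pos prod_nonneg)
  show "bdd_above (sum (\<lambda>g. \<Prod>x\<in>A. f x (g x)) ` {F. F \<subseteq> PiE A B \<and> finite F})"
  proof (rule bdd_aboveI2)
    fix F assume "F \<in> {F. F \<subseteq> PiE A B \<and> finite F}"
    then have F: "F \<subseteq> PiE A B" "finite F" by auto
    define C where "C x = (\<lambda>g. g x) ` F" for x
    have C: "finite (C x)" for x using F by (simp add: C_def)
    have CB: "C x \<subseteq> B x" if "x \<in> A" for x using F(1) that by (auto simp: C_def)
    have sub: "F \<subseteq> PiE A C" using F(1) by (auto simp: C_def PiE_iff)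
    have fin: "finite (PiE A C)" by (rule finite_PiE[OF A C])
    have "(\<Sum>g\<in>F. \<Prod>x\<in>A. f x (g x)) \<le> (\<Sum>g\<in>PiE A C. \<Prod>x\<in>A. f x (g x))"
      by (rule sum_mono2[OF fin sub]) (simp add: pos prod_nonneg)
    also have "\<dots> = infsum (\<lambda>g. \<Prod>x\<in>A. f x (g x)) (PiE A C)" using fin by simp
    also have "\<dots> = (\<Prod>x\<in>A. infsum (f x) (C x))"
      by (rule infsum_prod_PiE_abs[OF A]) (simp add: C)
    also have "\<dots> \<le> (\<Prod>x\<in>A. infsum (f x) (B x))"
    proof (rule prod_mono)
      fix x assume x: "x \<in> A"
      have "sum (f x) (C x) \<le> infsum (f x) (B x)"
        by (rule finite_sum_le_infsum[OF sum[OF x] C CB[OF x]]) (simp add: pos)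
      then show "0 \<le> infsum (f x) (C x) \<and> infsum (f x) (C x) \<le> infsum (f x) (B x)"
        using C by (simp add: sum_nonneg pos)
    qed
    finally show "(\<Sum>g\<in>F. \<Prod>x\<in>A. f x (g x)) \<le> (\<Prod>x\<in>A. infsum (f x) (B x))" .
  qed
qed

text \<open>Grouping the summands by their image gives \<open>K\<close> equal terms for each value.
  It serves for the map from [T] x T(F) to divisors, where \<open>K\<close> is the order of T(F)
  \<inter> T(O).\<close>

lemma infsum_fibres:
  fixes F :: "'b \<Rightarrow> complex"
  assumes h: "\<And>a. a \<in> A \<Longrightarrow> h a \<in> B" and K: "0 < K"
    and fib: "\<And>b. b \<in> B \<Longrightarrow> card {a \<in> A. h a = b} = K"
  shows "(\<lambda>a. norm (F (h a))) summable_on A \<longleftrightarrow> (\<lambda>b. norm (F b)) summable_on B"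
    and "(\<lambda>b. norm (F b)) summable_on B \<Longrightarrow> infsum (\<lambda>a. F (h a)) A = of_nat K * infsum F B"
proof -
  let ?S = "\<lambda>b. {a \<in> A. h a = b}"
  let ?f = "\<lambda>(b, a). F (h a)"
  have fin: "finite (?S b)" if "b \<in> B" for b using fib[OF that] K by (metis card.infinite less_irrefl)
  have bij: "bij_betw (\<lambda>a. (h a, a)) A (Sigma B ?S)"
    by (rule bij_betwI[where g = snd]) (auto simp: h)
  have red: "(\<lambda>a. norm (F (h a))) summable_on A \<longleftrightarrow> (\<lambda>p. norm (?f p)) summable_on Sigma B ?S"
    using summable_on_reindex_bij_betw[OF bij, of "\<lambda>p. norm (?f p)"] by simp
  have inner: "infsum (\<lambda>a. g (h a)) (?S b) = of_nat K * g b" if "b \<in> B" for b and g :: "'b \<Rightarrow> 'c::{real_normed_algebra_1}"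
  proof -
    have "infsum (\<lambda>a. g (h a)) (?S b) = (\<Sum>a\<in>?S b. g b)" using fin[OF that] by simp
    then show ?thesis using fib[OF that] by simp
  qed
  have "(\<lambda>p. norm (?f p)) summable_on Sigma B ?S \<longleftrightarrow>
      (\<forall>b\<in>B. (\<lambda>a. norm (F (h a))) summable_on ?S b) \<and>
      ((\<lambda>b. norm (infsum (\<lambda>a. norm (F (h a))) (?S b))) summable_on B)"
    using Infinite_Sum.abs_summable_on_Sigma_iff[of ?f B ?S] by simp
  also have "\<dots> \<longleftrightarrow> (\<lambda>b. real K * norm (F b)) summable_on B"
  proof -
    have "norm (infsum (\<lambda>a. norm (F (h a))) (?S b)) = real K * norm (F b)" if "b \<in> B" for b
      unfolding inner[OF that, of "\<lambda>b. norm (F b)"] by simp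
    then have "((\<lambda>b. norm (infsum (\<lambda>a. norm (F (h a))) (?S b))) summable_on B) \<longleftrightarrow> (\<lambda>b. real K * norm (F b)) summable_on B"
      by (intro summable_on_cong) simp
    moreover have "\<forall>b\<in>B. (\<lambda>a. norm (F (h a))) summable_on ?S b" using fin by simp
    ultimately show ?thesis by blast
  qed
  also have "\<dots> \<longleftrightarrow> (\<lambda>b. norm (F b)) summable_on B"
    using K summable_on_cmult_right'[of "real K" "\<lambda>b. norm (F b)" B] by simp
  finally show eq: "(\<lambda>a. norm (F (h a))) summable_on A \<longleftrightarrow> (\<lambda>b. norm (F b)) summable_on B"
    using red by blast
  assume "(\<lambda>b. norm (F b)) summable_on B"
  then have "(\<lambda>p. norm (?f p)) summable_on Sigma B ?S" using eq red by blast
  then have s: "?f summable_on Sigma B ?S" by (rule abs_summable_summable)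
  have "infsum (\<lambda>a. F (h a)) A = infsum ?f (Sigma B ?S)"
    using infsum_reindex_bij_betw[OF bij, of ?f] by simp
  also have "\<dots> = infsum (\<lambda>b. infsum (\<lambda>a. F (h a)) (?S b)) B"
    using infsum_Sigma_banach[OF s] by simp
  also have "\<dots> = infsum (\<lambda>b. of_nat K * F b) B"
    by (rule infsum_cong) (rule inner)
  also have "\<dots> = of_nat K * infsum F B" by (rule infsum_cmult_right')
  finally show "infsum (\<lambda>a. F (h a)) A = of_nat K * infsum F B" .
qed

text \<open>On a discrete space integrability is absolute summability, so integrals over [T] become
  unordered sums.\<close>

lemma scale_count_space:
  fixes f :: "'a \<Rightarrow> complex"
  assumes c: "0 < c"
  shows "integrable (scale_measure (ennreal c) (count_space A)) f \<longleftrightarrow> (\<lambda>x. norm (f x)) summable_on A"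
    and "(\<lambda>x. norm (f x)) summable_on A \<Longrightarrow>
      integral\<^sup>L (scale_measure (ennreal c) (count_space A)) f = complex_of_real c * infsum f A"
proof -
  have dens: "scale_measure (ennreal c) (count_space A) = density (count_space A) (\<lambda>x. ennreal c)"
    by (rule measure_eqI) (simp_all add: emeasure_density nn_integral_cmult)
  have abs: "integrable (count_space A) g \<longleftrightarrow> (\<lambda>x. norm (g x)) summable_on A" for g :: "'a \<Rightarrow> complex"
    using abs_summable_equivalent[of g A] by (simp add: Infinite_Set_Sum.abs_summable_on_def)
  have "integrable (scale_measure (ennreal c) (count_space A)) f \<longleftrightarrow> integrable (count_space A) (\<lambda>x. c *\<^sub>R f x)"
    unfolding dens using c by (subst integrable_density) auto
  also have "\<dots> \<longleftrightarrow> (\<lambda>x. c * norm (f x)) summable_on A" unfolding abs using c by simp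
  also have "\<dots> \<longleftrightarrow> (\<lambda>x. norm (f x)) summable_on A"
    using c summable_on_cmult_right'[of c "\<lambda>x. norm (f x)" A] by simp
  finally show "integrable (scale_measure (ennreal c) (count_space A)) f \<longleftrightarrow> (\<lambda>x. norm (f x)) summable_on A" .
  assume s: "(\<lambda>x. norm (f x)) summable_on A"
  have "integral\<^sup>L (scale_measure (ennreal c) (count_space A)) f = integral\<^sup>L (count_space A) (\<lambda>x. c *\<^sub>R f x)"
    unfolding dens using c by (subst integral_density) auto
  also have "\<dots> = c *\<^sub>R integral\<^sup>L (count_space A) f" by simp
  also have "integral\<^sup>L (count_space A) f = infsum f A"
    using infsetsum_infsum[of f A] s abs_summable_equivalent[of f A] by (simp add: infsetsum_def)
  finally show "integral\<^sup>L (scale_measure (ennreal c) (count_space A)) f = complex_of_real c * infsum f A"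
    by (simp add: scaleR_conv_of_real)
qed

section \<open>Euler products over finitely supported functions\<close>

definition finsupp :: "'a set \<Rightarrow> 'b::zero set \<Rightarrow> ('a \<Rightarrow> 'b) set" where
  "finsupp P N = {D. finite {v. D v \<noteq> 0} \<and> {v. D v \<noteq> 0} \<subseteq> P \<and> (\<forall>v. D v \<in> N)}"

locale euler_product_data =
  fixes P :: "'a set" and N :: "'b::zero set" and f :: "'a \<Rightarrow> 'b \<Rightarrow> complex"
  assumes zero: "0 \<in> N" and f_zero: "\<And>v. v \<in> P \<Longrightarrow> f v 0 = 1"
begin

definition ef :: "('a \<Rightarrow> 'b) \<Rightarrow> complex" where
  "ef D = (\<Prod>v | D v \<noteq> 0. f v (D v))"

lemma ef_superset:
  assumes "finite S" "S \<subseteq> P" "{v. D v \<noteq> 0} \<subseteq> S"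
  shows "ef D = (\<Prod>v\<in>S. f v (D v))"
  unfolding ef_def by (rule prod.mono_neutral_left) (use assms f_zero in auto)

lemma finsupp_mono: "S \<subseteq> P \<Longrightarrow> finsupp S N \<subseteq> finsupp P N"
  by (auto simp: finsupp_def)

lemma finsupp_bij:
  assumes "finite S" "S \<subseteq> P"
  shows "bij_betw (\<lambda>D. restrict D S) (finsupp S N) (PiE S (\<lambda>_. N))"
proof (rule bij_betwI[where g = "\<lambda>g v. if v \<in> S then g v else 0"])
  show "(\<lambda>g v. if v \<in> S then g v else 0) \<in> PiE S (\<lambda>_. N) \<rightarrow> finsupp S N"
  proof
    fix g assume g: "g \<in> PiE S (\<lambda>_. N)"
    have "{v. (if v \<in> S then g v else 0) \<noteq> 0} \<subseteq> S" by auto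
    then show "(\<lambda>v. if v \<in> S then g v else 0) \<in> finsupp S N"
      using g zero finite_subset[OF _ assms(1)] by (auto simp: finsupp_def PiE_iff)
  qed
  show "(\<lambda>v. if v \<in> S then restrict D S v else 0) = D" if "D \<in> finsupp S N" for D
    using that by (auto simp: finsupp_def fun_eq_iff)
  show "restrict (\<lambda>v. if v \<in> S then g v else 0) S = g" if "g \<in> PiE S (\<lambda>_. N)" for g
    using that by (auto simp: PiE_iff extensional_def fun_eq_iff)
qed (auto simp: finsupp_def)

lemma ef_restrict:
  assumes "finite S" "S \<subseteq> P" "D \<in> finsupp S N"
  shows "(\<Prod>v\<in>S. f v (restrict D S v)) = ef D"
  using ef_superset[OF assms(1,2), of D] assms(3) by (simp add: finsupp_def)

lemma finsupp_summable:
  assumes S: "finite S" "S \<subseteq> P" and f: "\<And>v. v \<in> S \<Longrightarrow> (\<lambda>n. norm (f v n)) summable_on N"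
  shows "(\<lambda>D. norm (ef D)) summable_on finsupp S N"
    and "infsum (\<lambda>D. norm (ef D)) (finsupp S N) = (\<Prod>v\<in>S. infsum (\<lambda>n. norm (f v n)) N)"
    and "infsum ef (finsupp S N) = (\<Prod>v\<in>S. infsum (f v) N)"
proof -
  note bij = finsupp_bij[OF S]
  have nr: "norm (ef D) = (\<Prod>v\<in>S. norm (f v (restrict D S v)))" if "D \<in> finsupp S N" for D
    using ef_restrict[OF S that, symmetric] by (simp add: prod_norm)
  have "(\<lambda>g. \<Prod>v\<in>S. norm (f v (g v))) summable_on PiE S (\<lambda>_. N)"
    by (rule summable_on_prod_PiE[OF S(1)]) (use f in auto)
  then have "(\<lambda>D. \<Prod>v\<in>S. norm (f v (restrict D S v))) summable_on finsupp S N"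
    using summable_on_reindex_bij_betw[OF bij, of "\<lambda>g. \<Prod>v\<in>S. norm (f v (g v))"] by simp
  then show "(\<lambda>D. norm (ef D)) summable_on finsupp S N"
    by (rule summable_on_cong[THEN iffD1, rotated]) (simp add: nr)
  have "infsum (\<lambda>D. norm (ef D)) (finsupp S N) = infsum (\<lambda>D. \<Prod>v\<in>S. norm (f v (restrict D S v))) (finsupp S N)"
    by (rule infsum_cong) (rule nr)
  also have "\<dots> = infsum (\<lambda>g. \<Prod>v\<in>S. norm (f v (g v))) (PiE S (\<lambda>_. N))"
    using infsum_reindex_bij_betw[OF bij, of "\<lambda>g. \<Prod>v\<in>S. norm (f v (g v))"] .
  also have "\<dots> = (\<Prod>v\<in>S. infsum (\<lambda>n. norm (f v n)) N)"
    by (rule infsum_prod_PiE_abs[OF S(1)]) (use f in auto)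
  finally show "infsum (\<lambda>D. norm (ef D)) (finsupp S N) = (\<Prod>v\<in>S. infsum (\<lambda>n. norm (f v n)) N)" .
  have "infsum ef (finsupp S N) = infsum (\<lambda>D. \<Prod>v\<in>S. f v (restrict D S v)) (finsupp S N)"
    by (rule infsum_cong) (rule ef_restrict[OF S, symmetric])
  also have "\<dots> = infsum (\<lambda>g. \<Prod>v\<in>S. f v (g v)) (PiE S (\<lambda>_. N))"
    using infsum_reindex_bij_betw[OF bij, of "\<lambda>g. \<Prod>v\<in>S. f v (g v)"] .
  also have "\<dots> = (\<Prod>v\<in>S. infsum (f v) N)"
    by (rule infsum_prod_PiE_abs[OF S(1)]) (use f in auto)
  finally show "infsum ef (finsupp S N) = (\<Prod>v\<in>S. infsum (f v) N)" .
qed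

text \<open>Functions supported at the single point \<open>v\<close> form a subfamily, along which
  \<open>ef\<close> is the local term.\<close>

lemma local_summable:
  assumes F: "(\<lambda>D. norm (ef D)) summable_on finsupp P N" and v: "v \<in> P"
  shows "(\<lambda>n. norm (f v n)) summable_on N"
proof -
  let ?h = "\<lambda>n w. if w = v then n else 0"
  have inj: "inj_on ?h N" by (rule inj_onI) (metis (full_types))
  have img: "?h ` N \<subseteq> finsupp P N"
  proof (rule image_subsetI)
    fix n assume n: "n \<in> N"
    have "{w. ?h n w \<noteq> 0} \<subseteq> {v}" by auto
    then show "?h n \<in> finsupp P N" unfolding finsupp_def using n v zero finite_subset[of _ "{v}"] by auto
  qed
  have "(\<lambda>D. norm (ef D)) summable_on ?h ` N" by (rule summable_on_subset_banach[OF F img])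
  then have "((\<lambda>D. norm (ef D)) \<circ> ?h) summable_on N" by (subst (asm) summable_on_reindex[OF inj])
  moreover have "norm (ef (?h n)) = norm (f v n)" for n
  proof -
    have "{w. ?h n w \<noteq> 0} \<subseteq> {v}" by auto
    then show ?thesis using ef_superset[of "{v}" "?h n"] v by simp
  qed
  ultimately show ?thesis by (simp add: o_def)
qed

lemma finite_sub_finsupp:
  assumes "finite F" "F \<subseteq> finsupp P N"
  obtains S where "finite S" "S \<subseteq> P" "F \<subseteq> finsupp S N"
proof
  show "finite (\<Union>D\<in>F. {v. D v \<noteq> 0})" "(\<Union>D\<in>F. {v. D v \<noteq> 0}) \<subseteq> P" using assms by (auto simp: finsupp_def)
  show "F \<subseteq> finsupp (\<Union>D\<in>F. {v. D v \<noteq> 0}) N" using assms(2) by (auto simp: finsupp_def)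
qed

text \<open>The partial product over \<open>S\<close> is the sum over the functions supported in
  \<open>S\<close>; what is missing is bounded by a tail of the absolutely convergent
  series.\<close>

theorem euler_product_tendsto:
  assumes F: "(\<lambda>D. norm (ef D)) summable_on finsupp P N"
  shows "((\<lambda>S. \<Prod>v\<in>S. infsum (f v) N) \<longlongrightarrow> infsum ef (finsupp P N)) (finite_subsets_at_top P)"
proof (rule tendstoI)
  fix e :: real assume e: "0 < e"
  let ?g = "\<lambda>D. norm (ef D)"
  obtain Y where Y: "finite Y" "Y \<subseteq> finsupp P N" "dist (sum ?g Y) (infsum ?g (finsupp P N)) \<le> e / 2"
    using infsum_finite_approximation[OF F, of "e / 2"] e by auto
  obtain S0 where S0: "finite S0" "S0 \<subseteq> P" "Y \<subseteq> finsupp S0 N" using finite_sub_finsupp[OF Y(1,2)] .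
  have "dist (\<Prod>v\<in>S. infsum (f v) N) (infsum ef (finsupp P N)) < e" if S: "finite S" "S0 \<subseteq> S" "S \<subseteq> P" for S
  proof -
    let ?A = "finsupp S N" and ?B = "finsupp P N"
    have sub: "?A \<subseteq> ?B" using S(3) by (rule finsupp_mono)
    have YA: "Y \<subseteq> ?A" using S0(3) S(2) by (auto simp: finsupp_def)
    have sA: "?g summable_on ?A" and sD: "?g summable_on ?B - ?A"
      using summable_on_subset_banach[OF F] sub by auto
    have split: "infsum h ?B = infsum h ?A + infsum h (?B - ?A)"
      if "h summable_on ?A" "h summable_on ?B - ?A" for h :: "('a \<Rightarrow> 'b) \<Rightarrow> 'c::{topological_comm_monoid_add, t2_space}"
      using infsum_Un_disjoint[OF that] sub by (simp add: Un_absorb1)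
    have "(\<Prod>v\<in>S. infsum (f v) N) = infsum ef ?A"
      by (rule finsupp_summable(3)[OF S(1,3), symmetric]) (use local_summable[OF F] S(3) in blast)
    then have "dist (\<Prod>v\<in>S. infsum (f v) N) (infsum ef ?B) = norm (infsum ef (?B - ?A))"
      using split[of ef] abs_summable_summable[OF sA] abs_summable_summable[OF sD] by (simp add: dist_norm)
    also have "\<dots> \<le> infsum ?g (?B - ?A)" by (rule norm_infsum_bound[OF sD])
    also have "\<dots> = infsum ?g ?B - infsum ?g ?A" using split[OF sA sD] by simp
    also have "\<dots> \<le> infsum ?g ?B - sum ?g Y"
      using finite_sum_le_infsum[OF sA Y(1) YA] by simp
    also have "\<dots> \<le> e / 2" using Y(3) unfolding dist_real_def by linarith
    finally show ?thesis using e by simp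
  qed
  then show "\<forall>\<^sub>F S in finite_subsets_at_top P. dist (\<Prod>v\<in>S. infsum (f v) N) (infsum ef (finsupp P N)) < e"
    unfolding eventually_finite_subsets_at_top using S0(1,2) by blast
qed

text \<open>A finite partial sum involves only functions supported in some finite \<open>S\<close>,
  and the sum over all of those is a product of factors at most 1 + a v <= exp (a v).\<close>

theorem euler_product_summable:
  assumes f: "\<And>v. v \<in> P \<Longrightarrow> (\<lambda>n. norm (f v n)) summable_on N"
    and a: "\<And>v. v \<in> P \<Longrightarrow> infsum (\<lambda>n. norm (f v n)) N \<le> 1 + a v"
    and a0: "\<And>v. v \<in> P \<Longrightarrow> 0 \<le> a v" and as: "a summable_on P"
  shows "(\<lambda>D. norm (ef D)) summable_on finsupp P N"
proof (rule nonneg_bdd_above_summable_on)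
  show "bdd_above (sum (\<lambda>D. norm (ef D)) ` {F. F \<subseteq> finsupp P N \<and> finite F})"
  proof (rule bdd_aboveI2)
    fix F assume "F \<in> {F. F \<subseteq> finsupp P N \<and> finite F}"
    then have F: "finite F" "F \<subseteq> finsupp P N" by auto
    obtain S where S: "finite S" "S \<subseteq> P" "F \<subseteq> finsupp S N" using finite_sub_finsupp[OF F] .
    have fS: "\<And>v. v \<in> S \<Longrightarrow> (\<lambda>n. norm (f v n)) summable_on N" using f S(2) by blast
    have "(\<Sum>D\<in>F. norm (ef D)) \<le> infsum (\<lambda>D. norm (ef D)) (finsupp S N)"
      by (rule finite_sum_le_infsum[OF finsupp_summable(1)[OF S(1,2) fS] F(1) S(3)]) simp_all
    also have "\<dots> = (\<Prod>v\<in>S. infsum (\<lambda>n. norm (f v n)) N)"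
      by (rule finsupp_summable(2)[OF S(1,2) fS])
    also have "\<dots> \<le> (\<Prod>v\<in>S. exp (a v))"
    proof (rule prod_mono)
      fix v assume "v \<in> S"
      then have "v \<in> P" using S by blast
      then show "0 \<le> infsum (\<lambda>n. norm (f v n)) N \<and> infsum (\<lambda>n. norm (f v n)) N \<le> exp (a v)"
        using order_trans[OF a exp_ge_add_one_self] by (simp add: infsum_nonneg)
    qed
    also have "\<dots> = exp (sum a S)" by (simp add: exp_sum[OF S(1)])
    also have "\<dots> \<le> exp (infsum a P)" using finite_sum_le_infsum[OF as S(1,2)] a0 by simp
    finally show "(\<Sum>D\<in>F. norm (ef D)) \<le> exp (infsum a P)" .
  qed
qed simp

end

section \<open>Comparison series on the lattice\<close>

lemma summable_geometric_int: "(\<lambda>j::int. (1 / 2 :: real) ^ nat \<bar>j\<bar>) summable_on UNIV"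
proof -
  have nat: "(\<lambda>n::nat. (1 / 2 :: real) ^ n) summable_on UNIV"
    by (rule norm_summable_imp_summable_on) (simp add: summable_geometric)
  have "(\<lambda>j::int. (1 / 2 :: real) ^ nat \<bar>j\<bar>) summable_on range int"
    using nat by (subst summable_on_reindex) (simp_all add: o_def)
  moreover have "(\<lambda>j::int. (1 / 2 :: real) ^ nat \<bar>j\<bar>) summable_on range (\<lambda>n. - int n)"
    using nat by (subst summable_on_reindex) (simp_all add: o_def inj_on_def)
  moreover have "(UNIV :: int set) = range int \<union> range (\<lambda>n. - int n)"
  proof -
    have "j \<in> range int \<union> range (\<lambda>n. - int n)" for j
      by (cases j rule: int_cases2) auto
    then show ?thesis by auto
  qed
  ultimately show ?thesis by (metis summable_on_union)
qed

text \<open>The majorant for sums over \<open>N\<close>; the ratio 1/2 corresponds to 2, the lower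
  bound for residue sizes.\<close>

lemma summable_lattice_vecs: "(\<lambda>n. \<Prod>i<r. (1 / 2 :: real) ^ nat \<bar>n i\<bar>) summable_on lattice_vecs r"
proof -
  have bij: "bij_betw (\<lambda>n. restrict n {..<r}) (lattice_vecs r) (PiE {..<r} (\<lambda>_. UNIV))"
  proof (rule bij_betwI[where g = "\<lambda>g i. if i < r then g i else 0"])
    show "(\<lambda>i. if i < r then restrict n {..<r} i else 0) = n" if "n \<in> lattice_vecs r" for n
      using that by (auto simp: lattice_vecs_def fun_eq_iff)
    show "restrict (\<lambda>i. if i < r then g i else 0) {..<r} = g" if "g \<in> PiE {..<r} (\<lambda>_. UNIV)" for g
      using that by (auto simp: PiE_iff extensional_def fun_eq_iff)
  qed (auto simp: lattice_vecs_def)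
  have "(\<lambda>g. \<Prod>i<r. (1 / 2 :: real) ^ nat \<bar>g i :: int\<bar>) summable_on PiE {..<r} (\<lambda>_. UNIV)"
    by (rule summable_on_prod_PiE) (simp_all add: summable_geometric_int)
  then show ?thesis
    using summable_on_reindex_bij_betw[OF bij, of "\<lambda>g. \<Prod>i<r. (1 / 2 :: real) ^ nat \<bar>g i\<bar>"] by simp
qed

section \<open>Uniqueness of the regularized value\<close>

lemma open_eventually_at:
  fixes Q :: "'a::t1_space \<Rightarrow> bool"
  shows "open {z. eventually Q (at z)}"
proof (subst open_subopen, intro ballI)
  fix z assume "z \<in> {z. eventually Q (at z)}"
  then obtain S where S: "open S" "z \<in> S" "\<And>x. x \<in> S \<Longrightarrow> x \<noteq> z \<Longrightarrow> Q x"
    unfolding eventually_at_topological by auto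
  have "S \<subseteq> {z. eventually Q (at z)}"
  proof
    fix y assume y: "y \<in> S"
    show "y \<in> {z. eventually Q (at z)}"
    proof (cases "y = z")
      case True
      then show ?thesis using S by (auto simp: eventually_at_topological)
    next
      case False
      have "open (S - {z})" using S(1) by (simp add: open_Diff)
      then show ?thesis using S(3) y False unfolding eventually_at_topological by blast
    qed
  qed
  then show "\<exists>T. open T \<and> z \<in> T \<and> T \<subseteq> {z. eventually Q (at z)}" using S by blast
qed

text \<open>The identity theorem for meromorphic functions. The points around which the difference
  vanishes and those around which it has no zeros form two open sets that cover the connected
  half-plane. Far to the right the difference vanishes, so it does around 1/2, and continuity there
  gives equality at 1/2 itself.\<close>

lemma regularized_value_unique:
  assumes "has_regularized_value f z1" "has_regularized_value f z2" shows "z1 = z2"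
proof -
  obtain G1 c1 where G1: "G1 meromorphic_on {w. 1/2 \<le> Re w}" "G1 analytic_on {1/2}"
    "\<And>w. c1 < Re w \<Longrightarrow> G1 w = f w" "G1 (1/2) = z1" using assms(1) unfolding has_regularized_value_def by blast
  obtain G2 c2 where G2: "G2 meromorphic_on {w. 1/2 \<le> Re w}" "G2 analytic_on {1/2}"
    "\<And>w. c2 < Re w \<Longrightarrow> G2 w = f w" "G2 (1/2) = z2" using assms(2) unfolding has_regularized_value_def by blast
  define D where "D w = G1 w - G2 w" for w
  let ?S = "{w::complex. 1/2 \<le> Re w}"
  have mero: "D meromorphic_on ?S" unfolding D_def using G1(1) G2(1) by (intro meromorphic_intros)
  let ?A = "{z. eventually (\<lambda>w. D w = 0) (at z)}" and ?B = "{z. eventually (\<lambda>w. D w \<noteq> 0) (at z)}"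
  have "?S \<subseteq> ?A \<union> ?B"
  proof
    fix z assume z: "z \<in> ?S"
    have "D meromorphic_on {z}" using meromorphic_on_subset[OF mero] z by blast
    then have m: "isolated_singularity_at D z" "not_essential D z" by (simp_all add: meromorphic_at_iff)
    show "z \<in> ?A \<union> ?B"
    proof (cases "\<exists>\<^sub>F w in at z. D w \<noteq> 0")
      case True
      then show ?thesis using non_zero_neighbour[OF m] by blast
    next
      case False
      then show ?thesis by (simp add: frequently_def)
    qed
  qed
  moreover have "?A \<inter> ?B \<inter> ?S = {}"
  proof -
    have "\<not> (eventually (\<lambda>w. D w = 0) (at z) \<and> eventually (\<lambda>w. D w \<noteq> 0) (at z))" for z
    proof
      assume "eventually (\<lambda>w. D w = 0) (at z) \<and> eventually (\<lambda>w. D w \<noteq> 0) (at z)"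
      then have "eventually (\<lambda>w. D w = 0 \<and> D w \<noteq> 0) (at z)" using eventually_conj by blast
      then show False by simp
    qed
    then show ?thesis by blast
  qed
  moreover have "connected ?S"
    by (rule convex_connected) (rule convex_halfspace_Re_ge)
  ultimately have AB: "?A \<inter> ?S = {} \<or> ?B \<inter> ?S = {}"
    using connectedD[of ?S ?A ?B] open_eventually_at by blast
  \<comment> \<open>Including 1/2 in the maximum puts the real point c + 1 inside the
    half-plane.\<close>
  define c where "c = max (max c1 c2) (1/2)"
  have "complex_of_real (c + 1) \<in> ?A"
  proof -
    have "open {w. c < Re w}" by (rule open_halfspace_Re_gt)
    moreover have "complex_of_real (c + 1) \<in> {w. c < Re w}" by simp
    moreover have "\<forall>w\<in>{w. c < Re w}. D w = 0" using G1(3) G2(3) by (simp add: D_def c_def)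
    ultimately show ?thesis unfolding eventually_at_topological mem_Collect_eq by blast
  qed
  moreover have "complex_of_real (c + 1) \<in> ?S" by (simp add: c_def)
  ultimately have "?B \<inter> ?S = {}" using AB by blast
  then have ev: "eventually (\<lambda>w. D w = 0) (at (1/2))" using \<open>?S \<subseteq> ?A \<union> ?B\<close> by force
  have "D analytic_on {1/2}" unfolding D_def using G1(2) G2(2) by (rule analytic_on_diff)
  then have "isCont D (1/2)" using analytic_at_imp_isCont by blast
  then have "(D \<longlongrightarrow> D (1/2)) (at (1/2))" by (simp add: isCont_def)
  moreover have "(D \<longlongrightarrow> 0) (at (1/2))" using ev by (rule tendsto_eventually)
  ultimately have "D (1/2) = 0" using tendsto_unique[of "at (1/2::complex)"] by simp
  then show ?thesis using G1(4) G2(4) by (simp add: D_def)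
qed

lemma has_regularized_value_cmult:
  assumes "has_regularized_value g z" and eq: "\<And>w. c < Re w \<Longrightarrow> f w = d * g w"
  shows "has_regularized_value f (d * z)"
proof -
  obtain G c' where G: "G meromorphic_on {w. 1/2 \<le> Re w}" "G analytic_on {1/2}"
    "\<And>w. c' < Re w \<Longrightarrow> G w = g w" "G (1/2) = z" using assms(1) unfolding has_regularized_value_def by blast
  have m: "(\<lambda>w. d * G w) meromorphic_on {w. 1/2 \<le> Re w}" using G(1) by (intro meromorphic_intros)
  have a: "(\<lambda>w. d * G w) analytic_on {1/2}" using G(2) by (intro analytic_intros)
  have e: "\<forall>w. max c c' < Re w \<longrightarrow> d * G w = f w" using G(3) eq by simp
  show ?thesis unfolding has_regularized_value_def
    by (rule exI[of _ "\<lambda>w. d * G w"], rule exI[of _ "max c c'"]) (use m a e G(4) in simp)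
qed

text \<open>For nonzero \<open>d\<close> the continuations of \<open>f\<close> and of
  \<open>g\<close> correspond to each other, so the default value 0 occurs on both sides at
  once.\<close>

lemma regularized_value_cmult:
  assumes d: "d \<noteq> 0" and eq: "\<And>w. c < Re w \<Longrightarrow> f w = d * g w"
  shows "regularized_value f = d * regularized_value g"
proof (cases "\<exists>z. has_regularized_value g z")
  case True
  then obtain z where z: "has_regularized_value g z" by blast
  have fz: "has_regularized_value f (d * z)" by (rule has_regularized_value_cmult[OF z eq])
  have "regularized_value g = z" "regularized_value f = d * z"
    unfolding regularized_value_def using z fz
    by (auto intro!: the_equality dest: regularized_value_unique)
  then show ?thesis by simp
next
  case False
  have "\<not> has_regularized_value f z" for z
  proof
    assume "has_regularized_value f z"
    then have "has_regularized_value g (inverse d * z)"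
      by (rule has_regularized_value_cmult[where c = c]) (use eq d in simp)
    then show False using False by blast
  qed
  then show ?thesis using False by (simp add: regularized_value_def)
qed

section \<open>Local estimates\<close>

context dual_monoids
begin

lemma N_lattice: "N \<subseteq> lattice_vecs r" using N_iff by blast

lemma deg_ge: "n \<in> N \<Longrightarrow> 0 \<le> lattice_pairing r \<eta> n"
proof (cases "r = 0")
  case True
  then show ?thesis by (simp add: lattice_pairing_def)
next
  case False
  assume n: "n \<in> N"
  have "0 \<le> real_of_int \<bar>n 0\<bar>" by simp
  also have "\<dots> \<le> A * real_of_int (lattice_pairing r \<eta> n)" using A(2)[OF n, of 0] False by simp
  finally show ?thesis using A(1) by (simp add: zero_le_mult_iff)
qed

lemma deg_eq_0: "n \<in> N \<Longrightarrow> lattice_pairing r \<eta> n = 0 \<Longrightarrow> n = 0"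
proof
  fix i assume n: "n \<in> N" "lattice_pairing r \<eta> n = 0"
  show "n i = 0 i"
  proof (cases "i < r")
    case True
    then show ?thesis using A(2)[OF n(1) True] n(2) by simp
  next
    case False
    then show ?thesis using n(1) N_lattice by (auto simp: lattice_vecs_def)
  qed
qed

text \<open>Each of the \<open>r\<close> coordinates is at most \<open>A\<close> times the degree,
  so the sum of their absolute values is at most A r times the degree; this is the origin of the
  bound on \<open>s\<close>.\<close>

lemma weight_bound:
  assumes n: "n \<in> N" and s: "A * real r \<le> s"
  shows "(2::real) powr (- s * real_of_int (lattice_pairing r \<eta> n)) \<le> (\<Prod>i<r. (1 / 2) ^ nat \<bar>n i\<bar>)"
proof -
  let ?d = "real_of_int (lattice_pairing r \<eta> n)"
  have "(\<Sum>i<r. real (nat \<bar>n i\<bar>)) \<le> (\<Sum>i<r. A * ?d)"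
    by (rule sum_mono) (use A(2)[OF n] in simp)
  also have "\<dots> = (A * real r) * ?d" by simp
  also have "\<dots> \<le> s * ?d" using s deg_ge[OF n] by (intro mult_right_mono) simp_all
  finally have "real (\<Sum>i<r. nat \<bar>n i\<bar>) \<le> s * ?d" by simp
  then have "(2::real) powr (- s * ?d) \<le> 2 powr (- real (\<Sum>i<r. nat \<bar>n i\<bar>))" by simp
  also have "\<dots> = (1 / 2) ^ (\<Sum>i<r. nat \<bar>n i\<bar>)"
    by (simp only: powr_minus powr_realpow zero_less_numeral inverse_eq_divide power_one_over)
  also have "\<dots> = (\<Prod>i<r. (1 / 2) ^ nat \<bar>n i\<bar>)" by (simp add: power_sum)
  finally show ?thesis .
qed

lemma deg_level_finite: "finite {n \<in> N. lattice_pairing r \<eta> n = d}"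
proof -
  let ?box = "{n \<in> lattice_vecs r. \<forall>i<r. n i \<in> {- \<lceil>A * real_of_int d\<rceil>..\<lceil>A * real_of_int d\<rceil>}}"
  have "inj_on (\<lambda>n. restrict n {..<r}) ?box"
  proof (rule inj_onI)
    fix n n' assume n: "n \<in> ?box" "n' \<in> ?box" and eq: "restrict n {..<r} = restrict n' {..<r}"
    show "n = n'"
    proof
      fix i show "n i = n' i" using fun_cong[OF eq, of i] n by (cases "i < r") (auto simp: lattice_vecs_def)
    qed
  qed
  moreover have "(\<lambda>n. restrict n {..<r}) ` ?box \<subseteq> PiE {..<r} (\<lambda>_. {- \<lceil>A * real_of_int d\<rceil>..\<lceil>A * real_of_int d\<rceil>})" by auto
  then have "finite ((\<lambda>n. restrict n {..<r}) ` ?box)" by (rule finite_subset) (simp add: finite_PiE)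
  ultimately have "finite ?box" using finite_image_iff by blast
  moreover have "{n \<in> N. lattice_pairing r \<eta> n = d} \<subseteq> ?box"
  proof
    fix n assume "n \<in> {n \<in> N. lattice_pairing r \<eta> n = d}"
    then have n: "n \<in> N" "lattice_pairing r \<eta> n = d" by auto
    have "n i \<in> {- \<lceil>A * real_of_int d\<rceil>..\<lceil>A * real_of_int d\<rceil>}" if "i < r" for i
    proof -
      have "real_of_int \<bar>n i\<bar> \<le> A * real_of_int d" using A(2)[OF n(1) that] n(2) by simp
      then have "\<bar>n i\<bar> \<le> \<lceil>A * real_of_int d\<rceil>" by linarith
      then show ?thesis by auto
    qed
    then show "n \<in> ?box" using n(1) N_lattice by blast
  qed
  ultimately show ?thesis by (rule finite_subset[rotated])
qed

sublocale grading: graded_monoid r N \<eta>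
proof
  show "0 \<in> N" unfolding N_iff by (simp add: lattice_vecs_def lattice_pairing_def)
  fix m n assume mn: "m \<in> N" "n \<in> N"
  have "lattice_pairing r (m + n) l = lattice_pairing r m l + lattice_pairing r n l" for l
    by (simp add: lattice_pairing_def sum.distrib algebra_simps)
  then show "m + n \<in> N" using mn unfolding N_iff by (auto simp: lattice_vecs_def)
qed (auto simp: deg_ge deg_eq_0 deg_level_finite)

definition weight_const :: real where
  "weight_const = infsum (\<lambda>n. \<Prod>i<r. (1 / 2 :: real) ^ nat \<bar>n i\<bar>) N"

text \<open>For nonzero \<open>n\<close> the exponent is split as 3 + (s - 3). The degree is at
  least 1, so the first part gives Q^-3, which \<open>summable_residue_sizes\<close> sums over the
  places. In the second part \<open>Q\<close> is replaced by 2, and the sum over \<open>N\<close> is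
  at most \<open>weight_const\<close>, whatever the place.\<close>

lemma local_bound:
  fixes Q s :: real and f :: "(nat \<Rightarrow> int) \<Rightarrow> complex"
  assumes Q: "2 \<le> Q" and s: "3 + A * real r \<le> s"
    and f: "\<And>n. n \<in> N \<Longrightarrow> norm (f n) = Q powr (- s * real_of_int (lattice_pairing r \<eta> n))"
  shows "(\<lambda>n. norm (f n)) summable_on N" and "infsum (\<lambda>n. norm (f n)) N \<le> 1 + weight_const * (1 / Q ^ 3)"
    and "0 \<le> weight_const"
proof -
  let ?w = "\<lambda>n. \<Prod>i<r. (1 / 2 :: real) ^ nat \<bar>n i\<bar>"
  have ws: "?w summable_on N" by (rule summable_on_subset_banach[OF summable_lattice_vecs N_lattice])
  have w0: "0 \<le> ?w n" for n by (simp add: prod_nonneg)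
  show "0 \<le> weight_const" unfolding weight_const_def by (rule infsum_nonneg) (rule w0)
  have le: "norm (f n) \<le> (if n = 0 then 1 else 0) + ?w n * (1 / Q ^ 3)" if n: "n \<in> N" for n
  proof (cases "n = 0")
    case True
    then show ?thesis using f[OF n] Q by (simp add: lattice_pairing_def)
  next
    case False
    let ?d = "real_of_int (lattice_pairing r \<eta> n)"
    have d: "1 \<le> ?d" using grading.deg_pos[OF n False] by simp
    have Ar: "0 \<le> A * real r" using A(1) by simp
    have sd: "(3 - s) * ?d \<le> 0" using d s Ar by (intro mult_nonpos_nonneg) auto
    have "norm (f n) = Q powr (- 3 * ?d) * Q powr (- (s - 3) * ?d)"
      unfolding f[OF n] powr_add[symmetric] by (simp add: algebra_simps)
    also have "\<dots> \<le> Q powr (- 3) * 2 powr (- (s - 3) * ?d)"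
    proof (rule mult_mono)
      show "Q powr (- 3 * ?d) \<le> Q powr (- 3)" using Q d by (intro powr_mono) auto
      show "Q powr (- (s - 3) * ?d) \<le> 2 powr (- (s - 3) * ?d)"
        using Q sd by (intro powr_mono2') auto
    qed simp_all
    also have "Q powr (- 3) = 1 / Q ^ 3" using Q by (simp add: powr_minus inverse_eq_divide powr_numeral)
    also have "1 / Q ^ 3 * 2 powr (- (s - 3) * ?d) \<le> 1 / Q ^ 3 * ?w n"
      using weight_bound[OF n, of "s - 3"] s Q by (intro mult_left_mono) auto
    finally show ?thesis using False by (simp add: mult.commute)
  qed
  have es: "(\<lambda>n. if n = 0 then 1 else (0::real)) summable_on N"
    by (rule finite_nonzero_values_imp_summable_on) (rule finite_subset[of _ "{0}"], auto)
  have bs: "(\<lambda>n. (if n = 0 then 1 else 0) + ?w n * (1 / Q ^ 3)) summable_on N"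
  proof (rule summable_on_add)
    show "(\<lambda>n. if n = 0 then 1 else (0::real)) summable_on N" by (rule es)
    show "(\<lambda>n. ?w n * (1 / Q ^ 3)) summable_on N" by (rule summable_on_cmult_left[OF ws])
  qed
  show fs: "(\<lambda>n. norm (f n)) summable_on N"
    by (rule summable_on_comparison_test[OF bs]) (use le in auto)
  have "infsum (\<lambda>n. norm (f n)) N \<le> infsum (\<lambda>n. (if n = 0 then 1 else 0) + ?w n * (1 / Q ^ 3)) N"
    by (rule infsum_mono[OF fs bs le])
  also have "\<dots> = infsum (\<lambda>n. if n = 0 then 1 else 0) N + infsum (\<lambda>n. ?w n * (1 / Q ^ 3)) N"
  proof (rule infsum_add)
    show "(\<lambda>n. if n = 0 then 1 else (0::real)) summable_on N" by (rule es)
    show "(\<lambda>n. ?w n * (1 / Q ^ 3)) summable_on N" by (rule summable_on_cmult_left[OF ws])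
  qed
  also have "infsum (\<lambda>n. if n = 0 then 1 else (0::real)) N = infsum (\<lambda>n. if n = 0 then 1 else (0::real)) {0 :: nat \<Rightarrow> int}"
    by (rule infsum_cong_neutral) (use grading.N0 in auto)
  also have "infsum (\<lambda>n. ?w n * (1 / Q ^ 3)) N = weight_const * (1 / Q ^ 3)"
    unfolding weight_const_def by (rule infsum_cmult_left')
  finally show "infsum (\<lambda>n. norm (f n)) N \<le> 1 + weight_const * (1 / Q ^ 3)" by simp
qed

end

section \<open>Periods\<close>

lemma of_real_powr_exp: "0 < x \<Longrightarrow> complex_of_real x powr w = exp (w * complex_of_real (ln x))"
  by (simp add: powr_def Ln_of_real)

text \<open>Without cancellation the triangle inequality is an equality. It is applied to the sum
  over T(F), along which only an indicator varies.\<close>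

lemma norm_infsum_constant_phase:
  fixes c :: complex and \<delta> :: "'a \<Rightarrow> real"
  assumes pos: "\<And>x. 0 \<le> \<delta> x" and sum: "(\<lambda>x. c * complex_of_real (\<delta> x)) summable_on A"
  shows "norm (infsum (\<lambda>x. c * complex_of_real (\<delta> x)) A) = infsum (\<lambda>x. norm (c * complex_of_real (\<delta> x))) A"
proof (cases "c = 0")
  case False
  then have "(\<lambda>x. complex_of_real (\<delta> x)) summable_on A"
    using summable_on_cmult_right'[of c "\<lambda>x. complex_of_real (\<delta> x)" A] sum by simp
  then have "(\<lambda>x. norm (complex_of_real (\<delta> x))) summable_on A"
    by (subst (asm) summable_on_iff_abs_summable_on_complex)
  then have s: "\<delta> summable_on A" using pos by simp
  have "infsum (\<lambda>x. complex_of_real (\<delta> x)) A = complex_of_real (infsum \<delta> A)"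
    by (rule infsumI[OF has_sum_of_real[OF has_sum_infsum[OF s]]])
  then have "norm (infsum (\<lambda>x. c * complex_of_real (\<delta> x)) A) = norm c * infsum \<delta> A"
    using infsum_nonneg[of A \<delta>] pos by (simp add: infsum_cmult_right' norm_mult)
  also have "\<dots> = infsum (\<lambda>x. norm (c * complex_of_real (\<delta> x))) A"
    using pos by (simp add: norm_mult infsum_cmult_right')
  finally show ?thesis .
qed simp

context idele_torus
begin

sublocale TFo: torus_over "field_ring :: 'f ring" r
  by (intro torus_over.intro cring_from_type_algebra)

lemma tdiv_mult_fun: "s \<in> carrier TA \<Longrightarrow> t \<in> carrier TA \<Longrightarrow> tdiv (s \<otimes>\<^bsub>TA\<^esub> t) = tdiv s + tdiv t"
  by (rule ext) (simp only: tdiv_mult plus_fun_apply)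

lemma tdiv_inv_fun: "t \<in> carrier TA \<Longrightarrow> tdiv (inv\<^bsub>TA\<^esub> t) = - tdiv t"
  by (rule ext) (simp only: tdiv_inv uminus_apply)

lemma tdiv_rmap_mult:
  assumes "x \<in> carrier TF" "y \<in> carrier TF"
  shows "tdiv (rmap (x \<otimes>\<^bsub>TF\<^esub> y)) = tdiv (rmap x) + tdiv (rmap y)"
  unfolding rmap_mult by (rule tdiv_mult_fun) (intro rmap_closed assms)+

lemma tdiv_rmap_one: "tdiv (rmap \<one>\<^bsub>TF\<^esub>) = 0"
  using tdiv_rmap_mult[of "\<one>\<^bsub>TF\<^esub>" "\<one>\<^bsub>TF\<^esub>"] by simp

lemma tdiv_rmap_inv:
  assumes "x \<in> carrier TF" shows "tdiv (rmap (inv\<^bsub>TF\<^esub> x)) = - tdiv (rmap x)"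
proof -
  have "tdiv (rmap x) + tdiv (rmap (inv\<^bsub>TF\<^esub> x)) = 0"
    using tdiv_rmap_mult[of x "inv\<^bsub>TF\<^esub> x"] assms tdiv_rmap_one by simp
  then show ?thesis by (simp only: eq_neg_iff_add_eq_0 add.commute)
qed

section \<open>The quotient [T] in terms of divisors\<close>

abbreviation rational_integral :: "(nat \<Rightarrow> 'f adele) set" where
  "rational_integral \<equiv> rational_torus r <#>\<^bsub>TA\<^esub> integral_torus r"

text \<open>Modulo T(O) a point is its divisor, so the subgroup T(F) T(O) consists of the points
  with principal divisor.\<close>

lemma rational_integral_iff: "t \<in> rational_integral \<longleftrightarrow> t \<in> carrier TA \<and> (\<exists>x\<in>carrier TF. tdiv t = tdiv (rmap x))"
proof
  assume "t \<in> rational_integral"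
  then obtain x u where xu: "x \<in> carrier TF" "u \<in> integral_torus r" "t = rmap x \<otimes>\<^bsub>TA\<^esub> u"
    by (auto simp: set_mult_def rational_torus_def)
  have u: "u \<in> carrier TA" "tdiv u = 0" using xu(2) by (auto simp: integral_torus_iff)
  have "tdiv t = tdiv (rmap x)" unfolding xu(3) tdiv_mult_fun[OF rmap_closed[OF xu(1)] u(1)] u(2) by (simp only: add_0_right)
  then show "t \<in> carrier TA \<and> (\<exists>x\<in>carrier TF. tdiv t = tdiv (rmap x))"
    using xu rmap_closed u by auto
next
  assume "t \<in> carrier TA \<and> (\<exists>x\<in>carrier TF. tdiv t = tdiv (rmap x))"
  then obtain x where t: "t \<in> carrier TA" and x: "x \<in> carrier TF" "tdiv t = tdiv (rmap x)" by blast
  have xc: "rmap x \<in> carrier TA" by (rule rmap_closed[OF x(1)])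
  let ?u = "inv\<^bsub>TA\<^esub> (rmap x) \<otimes>\<^bsub>TA\<^esub> t"
  have u: "?u \<in> carrier TA" using xc t by simp
  have "tdiv ?u = 0"
    using tdiv_mult_fun[of "inv\<^bsub>TA\<^esub> (rmap x)" t] xc t tdiv_inv_fun[OF xc] x(2) by (simp only: AT.T.inv_closed left_minus)
  then have "?u \<in> integral_torus r" using u by (simp add: integral_torus_iff)
  moreover have "t = rmap x \<otimes>\<^bsub>TA\<^esub> ?u" using xc t by (simp add: AT.T.m_assoc[symmetric])
  ultimately show "t \<in> rational_integral" using x(1) by (auto simp: set_mult_def rational_torus_def)
qed

lemma rational_integral_subgroup: "subgroup rational_integral TA"
proof (rule AT.T.subgroupI)
  show "rational_integral \<subseteq> carrier TA" by (auto simp: rational_integral_iff)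
  have "tdiv \<one>\<^bsub>TA\<^esub> = tdiv (rmap \<one>\<^bsub>TF\<^esub>)" by (rule ext) (simp only: tdiv_one tdiv_rmap_one zero_fun_apply)
  then have "\<one>\<^bsub>TA\<^esub> \<in> rational_integral" unfolding rational_integral_iff using TFo.T.one_closed by blast
  then show "rational_integral \<noteq> {}" by blast
  fix s assume "s \<in> rational_integral"
  then obtain x where s: "s \<in> carrier TA" and x: "x \<in> carrier TF" "tdiv s = tdiv (rmap x)" unfolding rational_integral_iff by blast
  have "tdiv (inv\<^bsub>TA\<^esub> s) = tdiv (rmap (inv\<^bsub>TF\<^esub> x))"
    unfolding tdiv_inv_fun[OF s] tdiv_rmap_inv[OF x(1)] x(2) ..
  then show "inv\<^bsub>TA\<^esub> s \<in> rational_integral" unfolding rational_integral_iff using s x(1) by (meson AT.T.inv_closed TFo.T.inv_closed)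
  fix t assume "t \<in> rational_integral"
  then obtain y where t: "t \<in> carrier TA" and y: "y \<in> carrier TF" "tdiv t = tdiv (rmap y)" unfolding rational_integral_iff by blast
  have "tdiv (s \<otimes>\<^bsub>TA\<^esub> t) = tdiv (rmap (x \<otimes>\<^bsub>TF\<^esub> y))"
    unfolding tdiv_mult_fun[OF s t] tdiv_rmap_mult[OF x(1) y(1)] x(2) y(2) ..
  then show "s \<otimes>\<^bsub>TA\<^esub> t \<in> rational_integral" unfolding rational_integral_iff using s t x(1) y(1) by (meson AT.T.m_closed TFo.T.m_closed)
qed

definition coset_rep :: "(nat \<Rightarrow> 'f adele) set \<Rightarrow> nat \<Rightarrow> 'f adele" where
  "coset_rep C = (SOME a. a \<in> carrier TA \<and> C = rational_integral #>\<^bsub>TA\<^esub> a)"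

abbreviation cosets :: "(nat \<Rightarrow> 'f adele) set set" where "cosets \<equiv> carrier (torus_quotient r)"

lemma cosets_eq: "cosets = (\<lambda>a. rational_integral #>\<^bsub>TA\<^esub> a) ` carrier TA"
  by (auto simp: torus_quotient_def FactGroup_def RCOSETS_def)

lemma coset_rep: 
  assumes "C \<in> cosets" shows "coset_rep C \<in> carrier TA" "C = rational_integral #>\<^bsub>TA\<^esub> coset_rep C"
proof -
  have "\<exists>a. a \<in> carrier TA \<and> C = rational_integral #>\<^bsub>TA\<^esub> a" using assms by (auto simp: cosets_eq)
  then have "coset_rep C \<in> carrier TA \<and> C = rational_integral #>\<^bsub>TA\<^esub> coset_rep C"
    unfolding coset_rep_def by (rule someI_ex)
  then show "coset_rep C \<in> carrier TA" "C = rational_integral #>\<^bsub>TA\<^esub> coset_rep C" by blast+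
qed

lemma coset_iff:
  assumes "a \<in> carrier TA"
  shows "t \<in> rational_integral #>\<^bsub>TA\<^esub> a \<longleftrightarrow> t \<in> carrier TA \<and> (\<exists>y\<in>carrier TF. tdiv t = tdiv (rmap y) + tdiv a)"
proof
  assume "t \<in> rational_integral #>\<^bsub>TA\<^esub> a"
  then obtain s where s: "s \<in> rational_integral" "t = s \<otimes>\<^bsub>TA\<^esub> a" by (auto simp: r_coset_def)
  then have sc: "s \<in> carrier TA" by (simp add: rational_integral_iff)
  obtain y where y: "y \<in> carrier TF" "tdiv s = tdiv (rmap y)" using s(1) unfolding rational_integral_iff by blast
  have "tdiv t = tdiv (rmap y) + tdiv a" unfolding s(2) tdiv_mult_fun[OF sc assms] y(2) ..
  then show "t \<in> carrier TA \<and> (\<exists>y\<in>carrier TF. tdiv t = tdiv (rmap y) + tdiv a)" using s(2) sc y(1) assms by auto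
next
  assume "t \<in> carrier TA \<and> (\<exists>y\<in>carrier TF. tdiv t = tdiv (rmap y) + tdiv a)"
  then obtain y where t: "t \<in> carrier TA" and y: "y \<in> carrier TF" "tdiv t = tdiv (rmap y) + tdiv a" by blast
  let ?s = "t \<otimes>\<^bsub>TA\<^esub> inv\<^bsub>TA\<^esub> a"
  have "tdiv ?s = tdiv (rmap y)"
    unfolding tdiv_mult_fun[OF t AT.T.inv_closed[OF assms]] tdiv_inv_fun[OF assms] y(2) by (simp only: add.assoc right_minus add_0_right)
  moreover have sc: "?s \<in> carrier TA" using t assms by simp
  ultimately have "?s \<in> rational_integral" unfolding rational_integral_iff using y(1) by blast
  moreover have "t = ?s \<otimes>\<^bsub>TA\<^esub> a" using t assms by (simp add: AT.T.m_assoc)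
  ultimately show "t \<in> rational_integral #>\<^bsub>TA\<^esub> a" unfolding r_coset_def by blast
qed

abbreviation intrat :: "(nat \<Rightarrow> 'f) set" where "intrat \<equiv> {x \<in> carrier TF. rmap x \<in> integral_torus r}"

lemma intrat_iff: "x \<in> intrat \<longleftrightarrow> x \<in> carrier TF \<and> tdiv (rmap x) = 0"
  using rmap_closed by (auto simp: integral_torus_iff fun_eq_iff)

lemma card_intrat: "0 < card intrat"
  using finite_rational_integral rational_integral_one by (auto simp: card_gt_0_iff)

text \<open>Given \<open>D\<close>, the class is forced to be that of s / c0, where \<open>s\<close>
  has divisor \<open>D\<close>; then the rational point is determined up to points with divisor 0,
  which are the elements of T(F) \<inter> T(O).\<close>

lemma fibre_card:
  assumes c0: "c0 \<in> carrier TA" and D: "D \<in> tdiv ` carrier TA"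
  shows "card {p \<in> cosets \<times> carrier TF. tdiv (rmap (snd p)) + (tdiv (coset_rep (fst p)) + tdiv c0) = D} = card intrat"
proof -
  obtain s where s: "s \<in> carrier TA" "D = tdiv s" using D by blast
  let ?s = "s \<otimes>\<^bsub>TA\<^esub> inv\<^bsub>TA\<^esub> c0" and ?c = "rational_integral #>\<^bsub>TA\<^esub> (s \<otimes>\<^bsub>TA\<^esub> inv\<^bsub>TA\<^esub> c0)"
  let ?a = "coset_rep ?c"
  have sc: "?s \<in> carrier TA" using s c0 by simp
  have ds: "tdiv ?s = D - tdiv c0"
    unfolding tdiv_mult_fun[OF s(1) AT.T.inv_closed[OF c0]] tdiv_inv_fun[OF c0] s(2) by (simp only: diff_conv_add_uminus)
  have cc: "?c \<in> cosets" using sc by (auto simp: cosets_eq)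
  note a = coset_rep[OF cc]
  have "?s \<in> rational_integral #>\<^bsub>TA\<^esub> ?a" unfolding a(2)[symmetric] using AT.T.rcos_self[OF sc rational_integral_subgroup] .
  then obtain y where y: "y \<in> carrier TF" "tdiv ?s = tdiv (rmap y) + tdiv ?a"
    unfolding coset_iff[OF a(1)] by blast
  have "{p \<in> cosets \<times> carrier TF. tdiv (rmap (snd p)) + (tdiv (coset_rep (fst p)) + tdiv c0) = D}
      = (\<lambda>x. (?c, x \<otimes>\<^bsub>TF\<^esub> y)) ` intrat" (is "?L = ?R")
  proof (intro equalityI subsetI)
    fix p assume "p \<in> ?L"
    then obtain C x where p: "p = (C, x)" "C \<in> cosets" "x \<in> carrier TF" "tdiv (rmap x) + (tdiv (coset_rep C) + tdiv c0) = D"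
      by (cases p) auto
    have dsC: "tdiv ?s = tdiv (rmap x) + tdiv (coset_rep C)" unfolding ds p(4)[symmetric] by (simp only: add.assoc[symmetric] add_diff_cancel_right')
    then have "?s \<in> rational_integral #>\<^bsub>TA\<^esub> coset_rep C" unfolding coset_iff[OF coset_rep(1)[OF p(2)]] using sc p(3) by blast
    then have "rational_integral #>\<^bsub>TA\<^esub> coset_rep C = ?c" by (rule AT.T.repr_independence[OF _ coset_rep(1)[OF p(2)] rational_integral_subgroup])
    then have C: "C = ?c" using coset_rep(2)[OF p(2)] by simp
    have eq: "tdiv (rmap x) = tdiv (rmap y)" using dsC y(2) unfolding C by (simp only: add_right_cancel)
    let ?x = "x \<otimes>\<^bsub>TF\<^esub> inv\<^bsub>TF\<^esub> y"
    have xc: "?x \<in> carrier TF" using p(3) y(1) by simp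
    have "tdiv (rmap ?x) = 0"
      unfolding tdiv_rmap_mult[OF p(3) TFo.T.inv_closed[OF y(1)]] tdiv_rmap_inv[OF y(1)] eq by (simp only: right_minus)
    then have "?x \<in> intrat" unfolding intrat_iff using xc by blast
    moreover have "x = ?x \<otimes>\<^bsub>TF\<^esub> y" using p(3) y(1) by (simp add: TFo.T.m_assoc)
    ultimately show "p \<in> ?R" unfolding p(1) C by blast
  next
    fix p assume "p \<in> ?R"
    then obtain x where p: "p = (?c, x \<otimes>\<^bsub>TF\<^esub> y)" "x \<in> intrat" by (elim imageE)
    have x: "x \<in> carrier TF" "tdiv (rmap x) = 0" using p(2) unfolding intrat_iff by blast+
    have "tdiv (rmap (x \<otimes>\<^bsub>TF\<^esub> y)) + (tdiv ?a + tdiv c0) = (tdiv (rmap y) + tdiv ?a) + tdiv c0"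
      unfolding tdiv_rmap_mult[OF x(1) y(1)] x(2) by (simp only: add_0_left add.assoc)
    also have "\<dots> = D" unfolding y(2)[symmetric] ds by (simp only: diff_add_cancel)
    finally show "p \<in> ?L" unfolding p(1) using cc x(1) y(1) by simp
  qed
  moreover have "inj_on (\<lambda>x. (?c, x \<otimes>\<^bsub>TF\<^esub> y)) intrat"
    by (rule inj_onI) (use y(1) TFo.T.r_cancel in auto)
  ultimately show ?thesis by (simp only: card_image)
qed

lemma rational_translate:
  assumes y: "y \<in> carrier TF"
  shows "bij_betw (\<lambda>x. x \<otimes>\<^bsub>TF\<^esub> y) (carrier TF) (carrier TF)"
  by (rule bij_betwI[where g = "\<lambda>x. x \<otimes>\<^bsub>TF\<^esub> inv\<^bsub>TF\<^esub> y"]) (use y in \<open>auto simp: TFo.T.m_assoc\<close>)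

end

section \<open>The period as a sum over effective divisors\<close>

locale theta_series = idele_torus k r + dual_monoids r M N \<eta> A
  for k :: "'f::field set" and r :: nat and M N :: "(nat \<Rightarrow> int) set" and \<eta> :: "nat \<Rightarrow> int" and A :: real +
  fixes \<rho> :: "nat \<Rightarrow> int" and \<pi> :: "'f adele" and m :: "('f \<Rightarrow> int) \<Rightarrow> int" and \<psi> :: "(nat \<Rightarrow> 'f adele) \<Rightarrow> complex"
  assumes unif: "uniformizers \<pi>" and m_finite: "finite {v \<in> places. m v \<noteq> 0}"
    and unitary: "unitary_character r \<psi>"
begin

lemma unram: "unramified_character r \<psi>" using unitary by (simp add: unitary_character_def)

abbreviation dh :: "'f adele" where "dh \<equiv> half_different \<pi> m"
abbreviation c0 :: "nat \<Rightarrow> 'f adele" where "c0 \<equiv> torus_cochar r adele_ring \<rho> dh"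
abbreviation deg :: "(nat \<Rightarrow> int) \<Rightarrow> int" where "deg n \<equiv> lattice_pairing r \<eta> n"

lemma dh_unit: "dh \<in> Units Ad" by (rule half_different_unit(1)[OF unif m_finite])

lemma c0_closed: "c0 \<in> carrier TA" by (rule AT.cochar_closed[OF dh_unit])

text \<open>The factor \<open>\<zz>\<close> of the spectral period in automorphic form;
  \<open>shift_factor_eq\<close> identifies the two.\<close>

definition shift_factor :: complex where "shift_factor = \<psi> (inv\<^bsub>TA\<^esub> c0)"

lemma shift_factor_nonzero: "shift_factor \<noteq> 0"
  unfolding shift_factor_def by (rule psi_nonzero[OF unif unram]) (simp add: c0_closed)

text \<open>The power of the residue size with exponent -w deg n is written through
  \<open>exp\<close>, so that \<open>w\<close> enters linearly and no branch of a complex power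
  matters.\<close>

definition local_term :: "complex \<Rightarrow> ('f \<Rightarrow> int) \<Rightarrow> (nat \<Rightarrow> int) \<Rightarrow> complex" where
  "local_term w v n = \<psi> (torus_cochar r adele_ring n (local_uniformizer \<pi> v))
    * exp (- (w * of_int (deg n) * complex_of_real (ln (real (residue_size v)))))"

lemma local_term_zero: "v \<in> places \<Longrightarrow> local_term w v 0 = 1"
proof -
  assume v: "v \<in> places"
  have "torus_cochar r adele_ring 0 (local_uniformizer \<pi> v) = \<one>\<^bsub>TA\<^esub>"
    by (simp add: torus_cochar_def AT.T_one units_of_one)
  then show ?thesis using psi_one[OF unif unram] by (simp add: local_term_def lattice_pairing_def)
qed

lemma norm_local_term:
  assumes v: "v \<in> places"
  shows "norm (local_term w v n) = real (residue_size v) powr (- Re w * real_of_int (deg n))"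
proof -
  have "norm (\<psi> (torus_cochar r adele_ring n (local_uniformizer \<pi> v))) = 1"
    using unitary local_cochar_closed[OF unif v] by (simp add: unitary_character_def)
  then show ?thesis using residue_size_ge_2[OF v] by (simp add: local_term_def norm_mult powr_def)
qed

sublocale ep: euler_product_data places N "local_term w" for w
  by unfold_locales (simp_all add: grading.N0 local_term_zero)

abbreviation ef :: "complex \<Rightarrow> (('f \<Rightarrow> int) \<Rightarrow> nat \<Rightarrow> int) \<Rightarrow> complex" where "ef w \<equiv> ep.ef w"
abbreviation effective :: "(('f \<Rightarrow> int) \<Rightarrow> nat \<Rightarrow> int) set" where "effective \<equiv> finsupp places N"

text \<open>The contribution of a divisor \<open>D\<close> to the period, where \<open>D\<close> already includes the shift by the divisor of \<open>\<rho>(\<partial>^{1/2})\<close>.\<close>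

definition divisor_value :: "complex \<Rightarrow> (('f \<Rightarrow> int) \<Rightarrow> nat \<Rightarrow> int) \<Rightarrow> complex" where
  "divisor_value w D = shift_factor * (if \<forall>v. D v \<in> N then ef w D else 0)"

lemma tdiv_range: "effective \<subseteq> tdiv ` carrier TA" "D \<in> tdiv ` carrier TA \<Longrightarrow> (\<forall>v. D v \<in> N) \<Longrightarrow> D \<in> effective"
proof -
  show "effective \<subseteq> tdiv ` carrier TA"
  proof
    fix D assume D: "D \<in> effective"
    let ?S = "{v. D v \<noteq> 0}"
    have S: "finite ?S" "?S \<subseteq> places" and DN: "\<And>v. D v \<in> lattice_vecs r"
      using D N_lattice by (auto simp: finsupp_def)
    have "tdiv (divisor_rep \<pi> D ?S) = D"
    proof
      fix v
      show "tdiv (divisor_rep \<pi> D ?S) v = D v"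
        unfolding tdiv_divisor_rep[OF unif S DN] by simp
    qed
    then show "D \<in> tdiv ` carrier TA" using divisor_rep_closed[OF unif S(2), of D] by (metis imageI)
  qed
  assume D: "D \<in> tdiv ` carrier TA" "\<forall>v. D v \<in> N"
  then obtain t where "t \<in> carrier TA" "D = tdiv t" by blast
  then show "D \<in> effective" using D(2) tdiv_finite tdiv_outside unfolding finsupp_def by auto
qed

lemma summable_divisor_value: "(\<lambda>D. norm (divisor_value w D)) summable_on tdiv ` carrier TA \<longleftrightarrow> (\<lambda>D. norm (ef w D)) summable_on effective"
proof -
  have "(\<lambda>D. norm (divisor_value w D)) summable_on tdiv ` carrier TA \<longleftrightarrow> (\<lambda>D. norm shift_factor * norm (ef w D)) summable_on effective"
  proof (rule summable_on_cong_neutral)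
    fix D assume "D \<in> effective - tdiv ` carrier TA"
    then show "norm shift_factor * norm (ef w D) = 0" using tdiv_range(1) by blast
  next
    fix D assume D: "D \<in> tdiv ` carrier TA - effective"
    then have "\<not> (\<forall>v. D v \<in> N)" using tdiv_range(2) by blast
    then show "norm (divisor_value w D) = 0" by (auto simp: divisor_value_def)
  next
    fix D assume "D \<in> tdiv ` carrier TA \<inter> effective"
    then have "\<forall>v. D v \<in> N" by (auto simp: finsupp_def)
    then show "norm (divisor_value w D) = norm shift_factor * norm (ef w D)" by (simp add: divisor_value_def norm_mult)
  qed
  then show ?thesis using summable_on_cmult_right'[of "norm shift_factor" "\<lambda>D. norm (ef w D)" effective] shift_factor_nonzero by simp
qed

lemma infsum_divisor_value: "infsum (divisor_value w) (tdiv ` carrier TA) = shift_factor * infsum (ef w) effective"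
proof -
  have "infsum (divisor_value w) (tdiv ` carrier TA) = infsum (\<lambda>D. shift_factor * ef w D) effective"
  proof (rule infsum_cong_neutral)
    fix D assume "D \<in> effective - tdiv ` carrier TA"
    then show "shift_factor * ef w D = 0" using tdiv_range(1) by blast
  next
    fix D assume D: "D \<in> tdiv ` carrier TA - effective"
    then have "\<not> (\<forall>v. D v \<in> N)" using tdiv_range(2) by blast
    then show "divisor_value w D = 0" by (auto simp: divisor_value_def)
  next
    fix D assume "D \<in> tdiv ` carrier TA \<inter> effective"
    then have "\<forall>v. D v \<in> N" by (auto simp: finsupp_def)
    then show "divisor_value w D = shift_factor * ef w D" by (simp add: divisor_value_def)
  qed
  then show ?thesis by (simp only: infsum_cmult_right')
qed

text \<open>The logarithm of the positive real absolute value turns the complex power into a finite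
  sum of exponents, one for each place in the support.\<close>

lemma abs_powr_prod:
  assumes u: "u \<in> carrier TA"
  shows "\<psi> u * complex_of_real (idele_abs (torus_char r adele_ring \<eta> u)) powr w = ef w (tdiv u)"
proof -
  let ?S = "{v. tdiv u v \<noteq> 0}"
  have S: "finite ?S" "?S \<subseteq> places" using tdiv_finite[OF u] tdiv_outside by auto
  let ?q = "\<lambda>v. real (residue_size v)"
  have q: "0 < ?q v" if "v \<in> ?S" for v using residue_size_pos[of v] S(2) that by auto
  have "ln (idele_abs (torus_char r adele_ring \<eta> u)) = (\<Sum>v\<in>?S. ln (?q v powi (- deg (tdiv u v))))"
    unfolding idele_abs_char_prod[OF u S, of \<eta>, simplified] using q S(1) by (intro ln_prod) auto
  also have "\<dots> = (\<Sum>v\<in>?S. - real_of_int (deg (tdiv u v)) * ln (?q v))"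
  proof (rule sum.cong[OF refl])
    fix v assume v: "v \<in> ?S"
    have "?q v powi (- deg (tdiv u v)) = ?q v powr (of_int (- deg (tdiv u v)))"
      using q[OF v] by (rule powr_real_of_int'[symmetric, OF less_imp_le]) (use q[OF v] in simp)
    then show "ln (?q v powi (- deg (tdiv u v))) = - real_of_int (deg (tdiv u v)) * ln (?q v)"
      using q[OF v] by (simp add: ln_powr)
  qed
  finally have ln: "ln (idele_abs (torus_char r adele_ring \<eta> u)) = (\<Sum>v\<in>?S. - real_of_int (deg (tdiv u v)) * ln (?q v))" .
  have "complex_of_real (idele_abs (torus_char r adele_ring \<eta> u)) powr w
      = exp (\<Sum>v\<in>?S. - (w * of_int (deg (tdiv u v)) * complex_of_real (ln (?q v))))"
    unfolding of_real_powr_exp[OF idele_abs_pos] ln by (simp add: sum_distrib_left mult.assoc sum_negf)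
  also have "\<dots> = (\<Prod>v\<in>?S. exp (- (w * of_int (deg (tdiv u v)) * complex_of_real (ln (?q v)))))"
    by (rule exp_sum[OF S(1)])
  finally show ?thesis
    unfolding psi_prod[OF unif unram u S, simplified] ep.ef_def local_term_def prod.distrib by simp
qed

lemma N_effective_iff:
  "(\<forall>v\<in>places. \<forall>l\<in>M. 0 \<le> lattice_pairing r l (tdiv u v)) \<longleftrightarrow> (\<forall>v. tdiv u v \<in> N)"
proof
  assume L: "\<forall>v\<in>places. \<forall>l\<in>M. 0 \<le> lattice_pairing r l (tdiv u v)"
  show "\<forall>v. tdiv u v \<in> N"
  proof
    fix v
    show "tdiv u v \<in> N"
    proof (cases "v \<in> places")
      case True
      then show ?thesis unfolding N_iff using L tdiv_lattice lattice_pairing_commute[of r "tdiv u v"] by simp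
    next
      case False
      then show ?thesis using grading.N0 tdiv_outside by simp
    qed
  qed
next
  assume R: "\<forall>v. tdiv u v \<in> N"
  show "\<forall>v\<in>places. \<forall>l\<in>M. 0 \<le> lattice_pairing r l (tdiv u v)"
  proof (intro ballI)
    fix v l assume "l \<in> M"
    then show "0 \<le> lattice_pairing r l (tdiv u v)"
      using R N_iff[of "tdiv u v"] lattice_pairing_commute[of r l "tdiv u v"] by simp
  qed
qed

abbreviation pterm :: "complex \<Rightarrow> (nat \<Rightarrow> 'f adele) \<Rightarrow> (nat \<Rightarrow> 'f) \<Rightarrow> complex" where
  "pterm w t x \<equiv> period_term r M \<rho> \<eta> dh w t x"

text \<open>The two forms serve different ends. In the first only an indicator depends on
  \<open>x\<close>, so the phase is constant along T(F). In the second the product formula replaces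
  \<open>t\<close> by x t inside the absolute value, and the term depends on the total divisor
  alone.\<close>

lemma pterm_eq:
  assumes t: "t \<in> carrier TA" and x: "x \<in> carrier TF"
  shows "pterm w t x = complex_of_real (idele_abs (torus_char r adele_ring \<eta> (t \<otimes>\<^bsub>TA\<^esub> c0))) powr w
      * complex_of_real (if \<forall>v. (tdiv (rmap x) + (tdiv t + tdiv c0)) v \<in> N then 1 else 0)"
    and "\<psi> t * pterm w t x = divisor_value w (tdiv (rmap x) + (tdiv t + tdiv c0))"
proof -
  have s: "t \<otimes>\<^bsub>TA\<^esub> c0 \<in> carrier TA" using t c0_closed by simp
  note xc = rmap_closed[OF x]
  let ?u = "rmap x \<otimes>\<^bsub>TA\<^esub> (t \<otimes>\<^bsub>TA\<^esub> c0)"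
  have u: "?u \<in> carrier TA" using s xc by simp
  have du: "tdiv ?u = tdiv (rmap x) + (tdiv t + tdiv c0)"
    unfolding tdiv_mult_fun[OF xc s] tdiv_mult_fun[OF t c0_closed] ..
  show eq: "pterm w t x = complex_of_real (idele_abs (torus_char r adele_ring \<eta> (t \<otimes>\<^bsub>TA\<^esub> c0))) powr w
      * complex_of_real (if \<forall>v. (tdiv (rmap x) + (tdiv t + tdiv c0)) v \<in> N then 1 else 0)"
  proof -
    have "basic_function M (toric_act r M Ad (toric_act r M Ad (toric_base M Ad) (rmap x)) (t \<otimes>\<^bsub>TA\<^esub> c0))
        = (if \<forall>v\<in>places. \<forall>l\<in>M. 0 \<le> lattice_pairing r l (tdiv ?u v) then 1 else 0)"
      by (rule basic_function_orbit[OF M(2) _ s xc]) (rule M(3))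
    then show ?thesis
      unfolding period_term_def Let_def N_effective_iff du[symmetric] by (simp only: of_real_1 of_real_0 if_distrib[of complex_of_real])
  qed
  have abs: "idele_abs (torus_char r adele_ring \<eta> (t \<otimes>\<^bsub>TA\<^esub> c0)) = idele_abs (torus_char r adele_ring \<eta> ?u)"
    using idele_abs_char_mult[OF xc s, of \<eta>] idele_abs_rmap[OF x, of \<eta>] by simp
  have "\<psi> c0 * shift_factor = 1"
    unfolding shift_factor_def psi_mult[OF unif unram c0_closed AT.T.inv_closed[OF c0_closed], symmetric]
    using psi_one[OF unif unram] c0_closed by simp
  then have psi: "\<psi> t = shift_factor * \<psi> ?u"
    using psi_mult[OF unif unram xc s] psi_mult[OF unif unram t c0_closed] psi_rmap[OF unif unram x]
    by (simp add: algebra_simps)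
  show "\<psi> t * pterm w t x = divisor_value w (tdiv (rmap x) + (tdiv t + tdiv c0))"
    unfolding eq divisor_value_def abs du[symmetric] psi using abs_powr_prod[OF u, of w] by (simp add: algebra_simps)
qed

lemma integrand_eq:
  "t \<in> carrier TA \<Longrightarrow> period_integrand r M \<rho> \<eta> dh w \<psi> t = infsum (\<lambda>x. divisor_value w (tdiv (rmap x) + (tdiv t + tdiv c0))) (carrier TF)"
  unfolding period_integrand_def infsum_cmult_right'[symmetric] by (rule infsum_cong) (rule pterm_eq(2))

lemma divisor_value_translate:
  assumes "y \<in> carrier TF" "tdiv t = tdiv (rmap y) + tdiv a" "x \<in> carrier TF"
  shows "divisor_value w (tdiv (rmap x) + (tdiv t + tdiv c0)) = divisor_value w (tdiv (rmap (x \<otimes>\<^bsub>TF\<^esub> y)) + (tdiv a + tdiv c0))"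
  unfolding assms(2) tdiv_rmap_mult[OF assms(3,1)] by (simp only: add.assoc)

text \<open>Moving \<open>t\<close> within its class translates the summation variable by a rational
  point, which is a bijection of T(F).\<close>

lemma integrand_coset:
  assumes C: "C \<in> cosets"
  shows "the_elem (period_integrand r M \<rho> \<eta> dh w \<psi> ` C)
    = infsum (\<lambda>x. divisor_value w (tdiv (rmap x) + (tdiv (coset_rep C) + tdiv c0))) (carrier TF)" (is "_ = ?I")
proof -
  note a = coset_rep[OF C]
  have "period_integrand r M \<rho> \<eta> dh w \<psi> t = ?I" if "t \<in> C" for t
  proof -
    have "t \<in> rational_integral #>\<^bsub>TA\<^esub> coset_rep C" using that a(2) by simp
    then obtain y where t: "t \<in> carrier TA" and y: "y \<in> carrier TF" "tdiv t = tdiv (rmap y) + tdiv (coset_rep C)"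
      unfolding coset_iff[OF a(1)] by blast
    have "period_integrand r M \<rho> \<eta> dh w \<psi> t
        = infsum (\<lambda>x. divisor_value w (tdiv (rmap (x \<otimes>\<^bsub>TF\<^esub> y)) + (tdiv (coset_rep C) + tdiv c0))) (carrier TF)"
      unfolding integrand_eq[OF t] by (rule infsum_cong) (rule divisor_value_translate[OF y])
    also have "\<dots> = ?I"
      by (rule infsum_reindex_bij_betw[OF rational_translate[OF y(1)], of "\<lambda>x. divisor_value w (tdiv (rmap x) + (tdiv (coset_rep C) + tdiv c0))"])
    finally show ?thesis .
  qed
  moreover have "coset_rep C \<in> C" using AT.T.rcos_self[OF a(1) rational_integral_subgroup] a(2) by simp
  ultimately have "period_integrand r M \<rho> \<eta> dh w \<psi> ` C = {?I}" by (intro equalityI subsetI) (auto intro: rev_image_eqI)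
  then show ?thesis by simp
qed

abbreviation total_divisor :: "(nat \<Rightarrow> 'f adele) set \<times> (nat \<Rightarrow> 'f) \<Rightarrow> ('f \<Rightarrow> int) \<Rightarrow> nat \<Rightarrow> int" where
  "total_divisor p \<equiv> tdiv (rmap (snd p)) + (tdiv (coset_rep (fst p)) + tdiv c0)"

lemma total_divisor_closed: "p \<in> cosets \<times> carrier TF \<Longrightarrow> total_divisor p \<in> tdiv ` carrier TA"
proof -
  assume p: "p \<in> cosets \<times> carrier TF"
  then have a: "coset_rep (fst p) \<in> carrier TA" and x: "rmap (snd p) \<in> carrier TA"
    using coset_rep(1) rmap_closed by auto
  have s: "coset_rep (fst p) \<otimes>\<^bsub>TA\<^esub> c0 \<in> carrier TA" using a c0_closed by simp
  have "total_divisor p = tdiv (rmap (snd p) \<otimes>\<^bsub>TA\<^esub> (coset_rep (fst p) \<otimes>\<^bsub>TA\<^esub> c0))"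
    unfolding tdiv_mult_fun[OF x s] tdiv_mult_fun[OF a c0_closed] ..
  then show ?thesis using x s by (metis AT.T.m_closed imageI)
qed

lemma summable_total_divisor: "(\<lambda>p. norm (divisor_value w (total_divisor p))) summable_on cosets \<times> carrier TF \<longleftrightarrow> (\<lambda>D. norm (ef w D)) summable_on effective"
  using infsum_fibres(1)[OF total_divisor_closed card_intrat fibre_card[OF c0_closed], of "divisor_value w"] summable_divisor_value by simp

abbreviation inner_sum :: "complex \<Rightarrow> (nat \<Rightarrow> 'f adele) set \<Rightarrow> complex" where
  "inner_sum w C \<equiv> infsum (\<lambda>x. divisor_value w (total_divisor (C, x))) (carrier TF)"

lemma summable_iff:
  "(\<lambda>D. norm (ef w D)) summable_on effective \<longleftrightarrow>
    (\<forall>C\<in>cosets. (\<lambda>x. norm (divisor_value w (total_divisor (C, x)))) summable_on carrier TF) \<and>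
    (\<lambda>C. infsum (\<lambda>x. norm (divisor_value w (total_divisor (C, x)))) (carrier TF)) summable_on cosets"
proof -
  have "norm (infsum (\<lambda>x. norm (divisor_value w (total_divisor (C, x)))) (carrier TF)) = infsum (\<lambda>x. norm (divisor_value w (total_divisor (C, x)))) (carrier TF)" for C
    by (simp only: real_norm_def abs_of_nonneg infsum_nonneg norm_ge_zero)
  then show ?thesis
    unfolding summable_total_divisor[symmetric] Infinite_Sum.abs_summable_on_Sigma_iff[of "\<lambda>p. divisor_value w (total_divisor p)" cosets "\<lambda>_. carrier TF"]
    by (simp only:)
qed

lemma norm_inner_sum:
  assumes C: "C \<in> cosets" and s: "(\<lambda>x. divisor_value w (total_divisor (C, x))) summable_on carrier TF"
  shows "norm (inner_sum w C) = infsum (\<lambda>x. norm (divisor_value w (total_divisor (C, x)))) (carrier TF)"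
proof -
  let ?a = "coset_rep C"
  define c where "c = \<psi> ?a * complex_of_real (idele_abs (torus_char r adele_ring \<eta> (?a \<otimes>\<^bsub>TA\<^esub> c0))) powr w"
  define \<delta> :: "(nat \<Rightarrow> 'f) \<Rightarrow> real" where "\<delta> x = (if \<forall>v. total_divisor (C, x) v \<in> N then 1 else 0)" for x
  have eq: "divisor_value w (total_divisor (C, x)) = c * complex_of_real (\<delta> x)" if x: "x \<in> carrier TF" for x
    using pterm_eq[OF coset_rep(1)[OF C] x, of w] unfolding c_def \<delta>_def fst_conv snd_conv by (simp only: mult.assoc)
  have s': "(\<lambda>x. c * complex_of_real (\<delta> x)) summable_on carrier TF"
    using s by (rule summable_on_cong[THEN iffD1, rotated]) (rule eq)
  have "inner_sum w C = infsum (\<lambda>x. c * complex_of_real (\<delta> x)) (carrier TF)" by (rule infsum_cong) (rule eq)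
  then have "norm (inner_sum w C) = norm (infsum (\<lambda>x. c * complex_of_real (\<delta> x)) (carrier TF))" by simp
  also have "\<dots> = infsum (\<lambda>x. norm (c * complex_of_real (\<delta> x))) (carrier TF)"
    by (rule norm_infsum_constant_phase[OF _ s']) (simp add: \<delta>_def)
  also have "\<dots> = infsum (\<lambda>x. norm (divisor_value w (total_divisor (C, x)))) (carrier TF)"
    by (rule infsum_cong) (simp only: eq)
  finally show ?thesis .
qed

lemma quotient_integral:
  "integrable (torus_quotient_measure r) (\<lambda>C. the_elem (period_integrand r M \<rho> \<eta> dh w \<psi> ` C))
      \<longleftrightarrow> (\<lambda>C. norm (inner_sum w C)) summable_on cosets"
  "(\<lambda>C. norm (inner_sum w C)) summable_on cosets \<Longrightarrow>
    automorphic_period r M \<rho> \<eta> dh \<psi> w = complex_of_real (1 / real (card intrat)) * infsum (inner_sum w) cosets"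
proof -
  have K: "0 < (1 / real (card intrat))" using card_intrat by simp
  have eq: "the_elem (period_integrand r M \<rho> \<eta> dh w \<psi> ` C) = inner_sum w C" if "C \<in> cosets" for C
    using integrand_coset[OF that] by simp
  have c: "(\<lambda>C. norm (the_elem (period_integrand r M \<rho> \<eta> dh w \<psi> ` C))) summable_on cosets \<longleftrightarrow> (\<lambda>C. norm (inner_sum w C)) summable_on cosets"
    by (rule summable_on_cong) (simp only: eq)
  then show "integrable (torus_quotient_measure r) (\<lambda>C. the_elem (period_integrand r M \<rho> \<eta> dh w \<psi> ` C))
      \<longleftrightarrow> (\<lambda>C. norm (inner_sum w C)) summable_on cosets"
    unfolding torus_quotient_measure_def scale_count_space(1)[OF K] .
  assume s: "(\<lambda>C. norm (inner_sum w C)) summable_on cosets"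
  have "automorphic_period r M \<rho> \<eta> dh \<psi> w = complex_of_real (1 / real (card intrat)) * infsum (\<lambda>C. the_elem (period_integrand r M \<rho> \<eta> dh w \<psi> ` C)) cosets"
    unfolding automorphic_period_def torus_quotient_measure_def
    by (rule scale_count_space(2)[OF K]) (use s c in simp)
  also have "infsum (\<lambda>C. the_elem (period_integrand r M \<rho> \<eta> dh w \<psi> ` C)) cosets = infsum (inner_sum w) cosets"
    by (rule infsum_cong) (rule eq)
  finally show "automorphic_period r M \<rho> \<eta> dh \<psi> w = complex_of_real (1 / real (card intrat)) * infsum (inner_sum w) cosets" .
qed

text \<open>The step from left to right is the delicate one: integrability controls only the norms
  of the inner sums, and \<open>norm_inner_sum\<close> upgrades these to sums of norms. In the other
  direction an arbitrary \<open>t\<close> is compared with the representative of its class.\<close>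

theorem period_converges_iff: "period_converges r M \<rho> \<eta> dh \<psi> w \<longleftrightarrow> (\<lambda>D. norm (ef w D)) summable_on effective"
proof
  assume conv: "period_converges r M \<rho> \<eta> dh \<psi> w"
  have s: "(\<lambda>x. divisor_value w (total_divisor (C, x))) summable_on carrier TF" if C: "C \<in> cosets" for C
  proof -
    note a = coset_rep(1)[OF C]
    have "(\<lambda>x. \<psi> (coset_rep C) * pterm w (coset_rep C) x) summable_on carrier TF"
      by (rule summable_on_cmult_right) (use conv a in \<open>simp add: period_converges_def\<close>)
    then show ?thesis
      by (rule summable_on_cong[THEN iffD1, rotated]) (simp only: pterm_eq(2)[OF a] fst_conv snd_conv)
  qed
  have "(\<lambda>C. norm (inner_sum w C)) summable_on cosets"
    using conv unfolding period_converges_def quotient_integral(1) by blast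
  then have "(\<lambda>C. infsum (\<lambda>x. norm (divisor_value w (total_divisor (C, x)))) (carrier TF)) summable_on cosets"
    by (rule summable_on_cong[THEN iffD1, rotated]) (rule norm_inner_sum[OF _ s])
  moreover have "(\<lambda>x. norm (divisor_value w (total_divisor (C, x)))) summable_on carrier TF" if "C \<in> cosets" for C
    using s[OF that] by (subst (asm) summable_on_iff_abs_summable_on_complex)
  ultimately show "(\<lambda>D. norm (ef w D)) summable_on effective" unfolding summable_iff by blast
next
  assume "(\<lambda>D. norm (ef w D)) summable_on effective"
  then have s: "\<And>C. C \<in> cosets \<Longrightarrow> (\<lambda>x. norm (divisor_value w (total_divisor (C, x)))) summable_on carrier TF"
    and o: "(\<lambda>C. infsum (\<lambda>x. norm (divisor_value w (total_divisor (C, x)))) (carrier TF)) summable_on cosets"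
    unfolding summable_iff by blast+
  have s': "(\<lambda>x. divisor_value w (total_divisor (C, x))) summable_on carrier TF" if "C \<in> cosets" for C
    by (rule abs_summable_summable[OF s[OF that]])
  have "(\<lambda>C. norm (inner_sum w C)) summable_on cosets"
    using o by (rule summable_on_cong[THEN iffD1, rotated]) (rule norm_inner_sum[OF _ s', symmetric])
  moreover have "pterm w t summable_on carrier TF" if t: "t \<in> carrier TA" for t
  proof -
    let ?C = "rational_integral #>\<^bsub>TA\<^esub> t"
    have C: "?C \<in> cosets" using t by (auto simp: cosets_eq)
    have "t \<in> rational_integral #>\<^bsub>TA\<^esub> coset_rep ?C" unfolding coset_rep(2)[OF C, symmetric] by (rule AT.T.rcos_self[OF t rational_integral_subgroup])
    then obtain y where y: "y \<in> carrier TF" "tdiv t = tdiv (rmap y) + tdiv (coset_rep ?C)"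
      unfolding coset_iff[OF coset_rep(1)[OF C]] by blast
    have "(\<lambda>x. divisor_value w (total_divisor (?C, x \<otimes>\<^bsub>TF\<^esub> y))) summable_on carrier TF"
      using summable_on_reindex_bij_betw[OF rational_translate[OF y(1)], of "\<lambda>x. divisor_value w (total_divisor (?C, x))"] s'[OF C] by simp
    then have "(\<lambda>x. \<psi> t * pterm w t x) summable_on carrier TF"
      by (rule summable_on_cong[THEN iffD1, rotated]) (simp only: pterm_eq(2)[OF t] divisor_value_translate[OF y] fst_conv snd_conv)
    then show ?thesis
      using summable_on_cmult_right'[of "\<psi> t" "pterm w t" "carrier TF"] psi_nonzero[OF unif unram t] by simp
  qed
  ultimately show "period_converges r M \<rho> \<eta> dh \<psi> w"
    unfolding period_converges_def quotient_integral(1) by blast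
qed

text \<open>Absolute convergence allows the integral and the sum over T(F) to be merged into one sum
  over pairs, which \<open>infsum_fibres\<close> collects by divisor.\<close>

theorem period_eq:
  assumes s: "(\<lambda>D. norm (ef w D)) summable_on effective"
  shows "automorphic_period r M \<rho> \<eta> dh \<psi> w = shift_factor * infsum (ef w) effective"
proof -
  have int: "(\<lambda>C. norm (inner_sum w C)) summable_on cosets"
    using period_converges_iff[THEN iffD2, OF s] unfolding period_converges_def quotient_integral(1) by blast
  have sh: "(\<lambda>p. divisor_value w (total_divisor p)) summable_on cosets \<times> carrier TF"
    using summable_total_divisor[THEN iffD2, OF s] by (rule abs_summable_summable)
  have "infsum (inner_sum w) cosets = infsum (\<lambda>p. divisor_value w (total_divisor p)) (cosets \<times> carrier TF)"
    by (rule infsum_Sigma_banach[OF sh])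
  also have "\<dots> = of_nat (card intrat) * infsum (divisor_value w) (tdiv ` carrier TA)"
    by (rule infsum_fibres(2)[OF total_divisor_closed card_intrat fibre_card[OF c0_closed]]) (use summable_divisor_value s in auto)
  also have "\<dots> = of_nat (card intrat) * (shift_factor * infsum (ef w) effective)" unfolding infsum_divisor_value ..
  finally have "automorphic_period r M \<rho> \<eta> dh \<psi> w
      = complex_of_real (1 / real (card intrat)) * (of_nat (card intrat) * (shift_factor * infsum (ef w) effective))"
    using quotient_integral(2)[OF int] by simp
  then show ?thesis using card_intrat by simp
qed

text \<open>\<open>local_bound\<close> leaves at each place an excess over 1 of the order of the
  inverse cube of the residue size, and these excesses are summable.\<close>

lemma converges_far:
  assumes "3 + A * real r < Re w" shows "(\<lambda>D. norm (ef w D)) summable_on effective"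
proof (rule ep.euler_product_summable[where a = "\<lambda>v. weight_const * (1 / real (residue_size v) ^ 3)"])
  fix v :: "'f \<Rightarrow> int" assume v: "v \<in> places"
  have Q: "2 \<le> real (residue_size v)" using residue_size_ge_2[OF v] by simp
  note b = local_bound[OF Q less_imp_le[OF assms], of "local_term w v", OF norm_local_term[OF v]]
  show "(\<lambda>n. norm (local_term w v n)) summable_on N" by (rule b(1))
  show "infsum (\<lambda>n. norm (local_term w v n)) N \<le> 1 + weight_const * (1 / real (residue_size v) ^ 3)" by (rule b(2))
  show "0 \<le> weight_const * (1 / real (residue_size v) ^ 3)" using b(3) by simp
next
  show "(\<lambda>v::'f \<Rightarrow> int. weight_const * (1 / real (residue_size v) ^ 3)) summable_on places"
    by (rule summable_on_cmult_right[OF summable_residue_sizes])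
qed

text \<open>The cocharacter at the inverse idele and the inverse of the torus point have the same
  divisor, so the character cannot distinguish them.\<close>

lemma shift_factor_eq: "\<psi> (torus_cochar r adele_ring \<rho> (inv\<^bsub>Ad\<^esub> dh)) = shift_factor"
proof -
  have i: "inv\<^bsub>Ad\<^esub> dh \<in> Units Ad" by (rule adele.Units_inv_Units[OF dh_unit])
  have one: "completion_val v (\<one>\<^bsub>Ad\<^esub> v) = 0" if v: "v \<in> places" for v
    using adele_val_mult[OF adele.Units_one_closed adele.Units_one_closed v] by simp
  have val: "completion_val v ((inv\<^bsub>Ad\<^esub> dh) v) = - completion_val v (dh v)" if v: "v \<in> places" for v
    using adele_val_mult[OF dh_unit i v] one[OF v] adele.Units_r_inv[OF dh_unit] by simp
  show ?thesis unfolding shift_factor_def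
  proof (rule psi_tdiv[OF unif unram])
    show "torus_cochar r adele_ring \<rho> (inv\<^bsub>Ad\<^esub> dh) \<in> carrier TA" by (rule AT.cochar_closed[OF i])
    show "inv\<^bsub>TA\<^esub> c0 \<in> carrier TA" using c0_closed by simp
    fix v
    show "tdiv (torus_cochar r adele_ring \<rho> (inv\<^bsub>Ad\<^esub> dh)) v = tdiv (inv\<^bsub>TA\<^esub> c0) v"
      unfolding tdiv_inv[OF c0_closed] tdiv_cochar[OF i] tdiv_cochar[OF dh_unit]
      by (rule ext) (simp add: val)
  qed
qed

section \<open>The spectral side\<close>

context
  fixes Fr :: "('f \<Rightarrow> int) \<Rightarrow> 'f alg_closure \<Rightarrow> 'f alg_closure"
    and \<phi> :: "('f alg_closure \<Rightarrow> 'f alg_closure) \<Rightarrow> nat \<Rightarrow> complex"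
  assumes Lp: "L_parameter k r \<pi> Fr \<psi> \<phi>" and Fr: "\<And>v. v \<in> places \<Longrightarrow> geometric_frobenius k v (Fr v)"
begin

lemma frobenius_image:
  assumes v: "v \<in> places" shows "\<phi> (Fr v) \<in> carrier (torus r complex_ring)"
proof -
  have "\<phi> \<in> hom (weil_group k) (torus r complex_ring)"
    using Lp unfolding L_parameter_def continuous_parameter_def by (elim conjE)
  moreover have "Fr v \<in> carrier (weil_group k)"
    using Fr[OF v] unfolding geometric_frobenius_def by (elim conjE)
  ultimately show ?thesis by (rule hom_in_carrier)
qed

text \<open>An element of \<open>N\<close> is read once as a character of the dual torus, at
  Frobenius, and once as a cocharacter of the torus, at a uniformizer; the L-parameter equates the
  two values.\<close>

lemma frobenius_char:
  assumes v: "v \<in> places" and n: "n \<in> N"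
  shows "torus_char r complex_ring n (\<phi> (Fr v)) * (of_nat (residue_size v) powr (- w)) powi deg n = local_term w v n"
proof -
  have q: "0 < real (residue_size v)" using residue_size_pos[OF v] by simp
  have "(of_nat (residue_size v) powr (- w)) powi deg n = exp (- w * complex_of_real (ln (real (residue_size v)))) powi deg n"
    using of_real_powr_exp[OF q, of "- w"] by simp
  also have "\<dots> = exp (of_int (deg n) * (- w * complex_of_real (ln (real (residue_size v)))))"
    by (rule exp_power_int)
  also have "\<dots> = exp (- (w * of_int (deg n) * complex_of_real (ln (real (residue_size v)))))"
    by (simp add: algebra_simps)
  finally have "(of_nat (residue_size v) powr (- w)) powi deg n = exp (- (w * of_int (deg n) * complex_of_real (ln (real (residue_size v)))))" .
  moreover have "torus_char r complex_ring n (\<phi> (Fr v)) = \<psi> (torus_cochar r adele_ring n (local_uniformizer \<pi> v))"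
    using Lp v n N_lattice unfolding L_parameter_def by blast
  ultimately show ?thesis by (simp only: local_term_def)
qed

lemma euler_product_eq:
  assumes s: "(\<lambda>D. norm (ef w D)) summable_on effective"
  shows "euler_product r N \<eta> Fr \<phi> w = infsum (ef w) effective"
proof -
  have fac: "graded_trace r N \<eta> (\<phi> (Fr v)) (of_nat (residue_size v) powr (- w)) = infsum (local_term w v) N" if v: "v \<in> places" for v
  proof -
    have "local_term w v summable_on N" by (rule abs_summable_summable[OF ep.local_summable[OF s v]])
    then have "(\<lambda>n. torus_char r complex_ring n (\<phi> (Fr v)) * (of_nat (residue_size v) powr (- w)) powi deg n) summable_on N"
      by (rule summable_on_cong[THEN iffD1, rotated]) (rule frobenius_char[OF v, symmetric])
    then have "graded_trace r N \<eta> (\<phi> (Fr v)) (of_nat (residue_size v) powr (- w))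
        = infsum (\<lambda>n. torus_char r complex_ring n (\<phi> (Fr v)) * (of_nat (residue_size v) powr (- w)) powi deg n) N"
      by (rule grading.graded_trace_eq[OF frobenius_image[OF v]])
    also have "\<dots> = infsum (local_term w v) N" by (rule infsum_cong) (rule frobenius_char[OF v])
    finally show ?thesis .
  qed
  \<comment> \<open>The local factors are identified at places only, hence for finite sets
    \<open>S\<close> of places, which is all that the filter sees.\<close>
  have ev: "\<forall>\<^sub>F S in finite_subsets_at_top places. (\<Prod>v\<in>S. infsum (local_term w v) N)
      = (\<Prod>v\<in>S. graded_trace r N \<eta> (\<phi> (Fr v)) (of_nat (residue_size v) powr (- w)))"
  proof (rule eventually_finite_subsets_at_top_weakI)
    fix S :: "('f \<Rightarrow> int) set" assume S: "S \<subseteq> places"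
    show "(\<Prod>v\<in>S. infsum (local_term w v) N) = (\<Prod>v\<in>S. graded_trace r N \<eta> (\<phi> (Fr v)) (of_nat (residue_size v) powr (- w)))"
      by (rule prod.cong[OF refl]) (rule fac[symmetric], use S in blast)
  qed
  have "((\<lambda>S. \<Prod>v\<in>S. graded_trace r N \<eta> (\<phi> (Fr v)) (of_nat (residue_size v) powr (- w))) \<longlongrightarrow> infsum (ef w) effective)
      (finite_subsets_at_top places)"
    using ep.euler_product_tendsto[OF s] unfolding tendsto_cong[OF ev] .
  then show ?thesis unfolding euler_product_def
    by (intro tendsto_Lim) (simp_all add: finite_subsets_at_top_neq_bot)
qed

lemma spectral_period_eq:
  "spectral_period k r N \<eta> \<rho> \<pi> dh Fr \<phi> w
    = shift_factor * complex_of_real (discriminant k powr ((real_of_int (lattice_pairing r \<rho> \<eta>) - real r) / 4)) * euler_product r N \<eta> Fr \<phi> w"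
proof -
  have "(THE \<psi>. unramified_character r \<psi> \<and> L_parameter k r \<pi> Fr \<psi> \<phi>) = \<psi>"
  proof (rule the_equality)
    show "unramified_character r \<psi> \<and> L_parameter k r \<pi> Fr \<psi> \<phi>" using unram Lp by blast
    fix \<psi>' assume h: "unramified_character r \<psi>' \<and> L_parameter k r \<pi> Fr \<psi>' \<phi>"
    show "\<psi>' = \<psi>"
    proof (rule psi_unique[OF unif unram conjunct1[OF h]])
      fix v :: "'f \<Rightarrow> int" and l assume "v \<in> places" "l \<in> lattice_vecs r"
      then have "torus_char r complex_ring l (\<phi> (Fr v)) = \<psi>' (torus_cochar r adele_ring l (local_uniformizer \<pi> v))"
        "torus_char r complex_ring l (\<phi> (Fr v)) = \<psi> (torus_cochar r adele_ring l (local_uniformizer \<pi> v))"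
        using h Lp unfolding L_parameter_def by blast+
      then show "\<psi>' (torus_cochar r adele_ring l (local_uniformizer \<pi> v)) = \<psi> (torus_cochar r adele_ring l (local_uniformizer \<pi> v))" by simp
    qed
  qed
  then show ?thesis unfolding spectral_period_def Let_def by (simp only: shift_factor_eq)
qed

text \<open>The exponent of \<open>d\<close> is opposite to the one inside
  \<open>spectral_period\<close>, so wherever the period converges both sides reduce to the same sum
  over effective divisors. The regularized values follow because they depend only on the functions
  far to the right.\<close>

theorem weak_numerical_duality:
  fixes d :: complex
  defines "d \<equiv> complex_of_real (discriminant k powr ((real r - real_of_int (lattice_pairing r \<rho> \<eta>)) / 4))"
  shows "\<exists>c. \<forall>w. c < Re w \<longrightarrow> period_converges r M \<rho> \<eta> dh \<psi> w"
    and "period_converges r M \<rho> \<eta> dh \<psi> w \<Longrightarrow>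
      automorphic_period r M \<rho> \<eta> dh \<psi> w = d * spectral_period k r N \<eta> \<rho> \<pi> dh Fr \<phi> w"
    and "regularized_value (automorphic_period r M \<rho> \<eta> dh \<psi>)
      = d * regularized_value (spectral_period k r N \<eta> \<rho> \<pi> dh Fr \<phi>)"
proof -
  let ?e = "(real r - real_of_int (lattice_pairing r \<rho> \<eta>)) / 4"
  have "0 < card k" using finite_k zero_k by (auto simp: card_gt_0_iff)
  then have disc: "0 < discriminant k" by (simp add: discriminant_def)
  have e': "(real_of_int (lattice_pairing r \<rho> \<eta>) - real r) / 4 = - ?e" by simp
  have "discriminant k powr ?e * discriminant k powr (- ?e) = 1"
    unfolding powr_add[symmetric] using disc by simp
  then have dd: "d * complex_of_real (discriminant k powr ((real_of_int (lattice_pairing r \<rho> \<eta>) - real r) / 4)) = 1"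
    unfolding d_def e' of_real_mult[symmetric] by simp
  show conv: "\<exists>c. \<forall>w. c < Re w \<longrightarrow> period_converges r M \<rho> \<eta> dh \<psi> w"
    using converges_far period_converges_iff by blast
  show eq: "automorphic_period r M \<rho> \<eta> dh \<psi> w = d * spectral_period k r N \<eta> \<rho> \<pi> dh Fr \<phi> w"
    if "period_converges r M \<rho> \<eta> dh \<psi> w" for w
  proof -
    have s: "(\<lambda>D. norm (ef w D)) summable_on effective" using that period_converges_iff by blast
    have "d * spectral_period k r N \<eta> \<rho> \<pi> dh Fr \<phi> w
      = (d * complex_of_real (discriminant k powr ((real_of_int (lattice_pairing r \<rho> \<eta>) - real r) / 4))) * (shift_factor * infsum (ef w) effective)"
      unfolding spectral_period_eq euler_product_eq[OF s] by (simp only: ac_simps)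
    then show ?thesis unfolding dd period_eq[OF s] by simp
  qed
  obtain c where c: "\<forall>w. c < Re w \<longrightarrow> period_converges r M \<rho> \<eta> dh \<psi> w" using conv by (elim exE)
  have "d \<noteq> 0" using dd by (metis mult_zero_left zero_neq_one)
  then show "regularized_value (automorphic_period r M \<rho> \<eta> dh \<psi>)
      = d * regularized_value (spectral_period k r N \<eta> \<rho> \<pi> dh Fr \<phi>)"
    by (rule regularized_value_cmult) (rule eq, rule c[rule_format])
qed

end

end

section \<open>Toric duality\<close>

theorem theorem4p1:
  fixes k :: "'f::field set"
    and r :: nat
    and \<sigma> :: "(nat \<Rightarrow> real) set"
    and \<rho>\<^sub>1 \<rho>\<^sub>2 :: "nat \<Rightarrow> int"
    and \<omega> :: "('f \<Rightarrow> 'f) \<Rightarrow> 'f"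
    and m :: "('f \<Rightarrow> int) \<Rightarrow> int"
    and \<pi> :: "'f adele"
    and Fr :: "('f \<Rightarrow> int) \<Rightarrow> 'f alg_closure \<Rightarrow> 'f alg_closure"
  defines "M \<equiv> lattice_points r (dual_cone r \<sigma>)"
    and "N \<equiv> lattice_points r \<sigma>"
    and "\<epsilon> \<equiv> lattice_pairing r \<rho>\<^sub>1 \<rho>\<^sub>2"
    and "dh \<equiv> half_different \<pi> m"
  defines "P \<equiv> automorphic_period r M \<rho>\<^sub>1 \<rho>\<^sub>2 dh"
    and "P' \<equiv> automorphic_period r N \<rho>\<^sub>2 \<rho>\<^sub>1 dh"
    and "L \<equiv> spectral_period k r M \<rho>\<^sub>1 \<rho>\<^sub>2 \<pi> dh Fr"
    and "L' \<equiv> spectral_period k r N \<rho>\<^sub>2 \<rho>\<^sub>1 \<pi> dh Fr"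
    and "d \<equiv> complex_of_real (discriminant k powr ((real r - real_of_int \<epsilon>) / 4))"
  assumes "rational_polyhedral_cone r \<sigma>"
    and "strongly_convex \<sigma>"
    and "full_dimensional r \<sigma>"
    and "dual_gradings r \<sigma> \<rho>\<^sub>1 \<rho>\<^sub>2"
    and "function_field k"
    and "spin_section \<omega> m"
    and "uniformizers \<pi>"
    and "\<forall>v\<in>places. geometric_frobenius k v (Fr v)"
  shows
    "(\<forall>\<psi> \<phi>. unitary_character r \<psi> \<longrightarrow> L_parameter k r \<pi> Fr \<psi> \<phi> \<longrightarrow>
        discrete (fixed_locus k r N \<phi>) \<longrightarrow>
          (\<exists>c. \<forall>w. c < Re w \<longrightarrow> period_converges r M \<rho>\<^sub>1 \<rho>\<^sub>2 dh \<psi> w) \<and>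
          (\<forall>w. period_converges r M \<rho>\<^sub>1 \<rho>\<^sub>2 dh \<psi> w \<longrightarrow> P \<psi> w = d * L' \<phi> w) \<and>
          regularized_value (P \<psi>) = d * regularized_value (L' \<phi>))
     \<and>
     (\<forall>\<mu> \<phi>. unitary_character r \<mu> \<longrightarrow> L_parameter k r \<pi> Fr \<mu> \<phi> \<longrightarrow>
        discrete (fixed_locus k r M \<phi>) \<longrightarrow>
          (\<exists>c. \<forall>w. c < Re w \<longrightarrow> period_converges r N \<rho>\<^sub>2 \<rho>\<^sub>1 dh \<mu> w) \<and>
          (\<forall>w. period_converges r N \<rho>\<^sub>2 \<rho>\<^sub>1 dh \<mu> w \<longrightarrow> P' \<mu> w = d * L \<phi> w) \<and>
          regularized_value (P' \<mu>) = d * regularized_value (L \<phi>))"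
proof -
  note M_def = assms(1) and N_def = assms(2) and \<epsilon>_def = assms(3) and dh_def = assms(4)
    and P_def = assms(5) and P'_def = assms(6) and L_def = assms(7) and L'_def = assms(8) and d_def = assms(9)
  have gff: "global_function_field k" using assms(14) by (rule function_field_global)
  then interpret it: idele_torus k r by (rule idele_torus.intro)
  obtain S where S: "finite S" "S \<subseteq> lattice_vecs r"
    and sigma: "\<sigma> = {x. \<exists>c. (\<forall>u\<in>S. 0 \<le> c u) \<and> x = (\<lambda>i. \<Sum>u\<in>S. c u * real_of_int (u i))}"
    using assms(10) unfolding rational_polyhedral_cone_def by blast
  interpret cone: polyhedral_cone r \<sigma> S by (rule polyhedral_cone.intro[OF S sigma])
  have gr: "\<rho>\<^sub>1 \<in> lattice_vecs r" "conical r M \<rho>\<^sub>1" "conical r N \<rho>\<^sub>2"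
    using assms(13) unfolding dual_gradings_def M_def N_def by blast+
  \<comment> \<open>The period of the variety of \<open>M\<close> sums over divisors with values in
    \<open>N\<close>, with \<open>\<rho>\<^sub>2\<close> as degree. Exchanging the tori exchanges
    \<open>M\<close> with \<open>N\<close>, so the coordinate bound is then needed on the dual cone,
    with \<open>\<rho>\<^sub>1\<close> as degree.\<close>
  obtain A where A: "dual_monoids r M N \<rho>\<^sub>2 A"
    using cone.dual_N[OF gr(3)[unfolded N_def]] unfolding M_def N_def by (elim exE)
  obtain B where B: "dual_monoids r N M \<rho>\<^sub>1 B"
    using cone.dual_M[OF gr(2)[unfolded M_def] gr(1) assms(12)] unfolding M_def N_def by (elim exE)
  have fin: "finite {v \<in> places. m v \<noteq> 0}" using assms(15) by (simp add: spin_section_def)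
  have Fr: "\<And>v. v \<in> places \<Longrightarrow> geometric_frobenius k v (Fr v)" using assms(17) by blast
  \<comment> \<open>In the second half the two cocharacters enter in the opposite order, and the
    symmetry of the pairing identifies the discrepancies.\<close>
  have d': "d = complex_of_real (discriminant k powr ((real r - real_of_int (lattice_pairing r \<rho>\<^sub>2 \<rho>\<^sub>1)) / 4))"
    unfolding d_def \<epsilon>_def lattice_pairing_commute[of r \<rho>\<^sub>1 \<rho>\<^sub>2] ..
  show ?thesis
  proof (intro conjI[of "\<forall>\<psi> \<phi>. _ \<psi> \<phi>" "\<forall>\<psi> \<phi>. _ \<psi> \<phi>"] allI impI)
    fix \<psi> \<phi> assume h: "unitary_character r \<psi>" "L_parameter k r \<pi> Fr \<psi> \<phi>"
    have th: "theta_series k r M N \<rho>\<^sub>2 A \<pi> m \<psi>"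
      by (intro theta_series.intro theta_series_axioms.intro it.idele_torus_axioms A assms(16) fin h(1))
    note W = theta_series.weak_numerical_duality[OF th h(2) Fr, where \<rho> = \<rho>\<^sub>1,
      folded dh_def \<epsilon>_def, folded d_def P_def L'_def]
    show "(\<exists>c. \<forall>w. c < Re w \<longrightarrow> period_converges r M \<rho>\<^sub>1 \<rho>\<^sub>2 dh \<psi> w) \<and>
        (\<forall>w. period_converges r M \<rho>\<^sub>1 \<rho>\<^sub>2 dh \<psi> w \<longrightarrow> P \<psi> w = d * L' \<phi> w) \<and>
        regularized_value (P \<psi>) = d * regularized_value (L' \<phi>)"
      using W by blast
  next
    fix \<mu> \<phi> assume h: "unitary_character r \<mu>" "L_parameter k r \<pi> Fr \<mu> \<phi>"
    have th: "theta_series k r N M \<rho>\<^sub>1 B \<pi> m \<mu>"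
      by (intro theta_series.intro theta_series_axioms.intro it.idele_torus_axioms B assms(16) fin h(1))
    note W = theta_series.weak_numerical_duality[OF th h(2) Fr, where \<rho> = \<rho>\<^sub>2,
      folded dh_def, folded d' P'_def L_def]
    show "(\<exists>c. \<forall>w. c < Re w \<longrightarrow> period_converges r N \<rho>\<^sub>2 \<rho>\<^sub>1 dh \<mu> w) \<and>
        (\<forall>w. period_converges r N \<rho>\<^sub>2 \<rho>\<^sub>1 dh \<mu> w \<longrightarrow> P' \<mu> w = d * L \<phi> w) \<and>
        regularized_value (P' \<mu>) = d * regularized_value (L \<phi>)"
      using W by blast
  qed
qed

end
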